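(* Let $\epsilon>0$ be a real number and, for an integer $L$, let $\mathcal G^c(L)$ be the set of closed geodesics $\gamma$ of the pair of pants $P=\mathbb D/\Gamma$ with combinatorial length $L(\gamma)=L$, and $$\mathcal A_\epsilon(L)=\Big\{\gamma\in\mathcal G^c(L)\ :\ i(\gamma;\gamma)\ge\big(\tfrac14-\epsilon\big)L^2\Big\}.$$ Then for $L$ large enough $$\frac{4\times 3^{6\epsilon L}}{L}\le \#\mathcal A_\epsilon(L)\le \frac{2^L}{L}\Big[2^2\big(\tfrac32\big)^{6\sqrt\epsilon\,L}-3\sqrt{\epsilon}\,L\Big],$$ and, if $\epsilon<\frac1{36}$, $$\lim_{L\to+\infty}\frac{\#\mathcal A_\epsilon(L)}{\#\mathcal G^c(L)}=0 .$$
   Context: Setting. $\mathbb D$ is the Poincaré disk with its hyperbolic metric, $a,b$ are hyperbolic isometries of $\mathbb D$, and $\bar e$ denotes the inverse of $e$. There are four pairwise disjoint closed half-disks $D(a),D(\bar a),D(b),D(\bar b)$ of $\mathbb D$, bounded by circles orthogonal to $\mathbb S^1=\partial\mathbb D$, with $a(D(\bar a))=\mathbb D\setminus \mathring D(a)$ and $b(D(\bar b))=\mathbb D\setminus\mathring D(b)$, and the corresponding arcs $A(e)$ of $\partial\mathbb D$ occur anticlockwise in the cyclic order $A(a),A(\bar b),A(b),A(\bar a)$. The group $\Gamma=\langle a,b\rangle$ is a (free) Schottky group, $P=\mathbb D/\Gamma$ is a pair of pants, and $\mathcal D=\bigcap_{e\in\{a,\bar a,b,\bar b\}}(\mathbb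 D\setminus\mathring D(e))$ is a fundamental domain. Coding. An infinite reduced word $f_1f_2\cdots$ in the letters $a,\bar a,b,\bar b$ denotes the limit point $\lim_m f_1\cdots f_m(o)\in\partial\mathbb D$. Oriented closed geodesics of $P$ (multiples allowed) correspond bijectively to nonempty cyclically reduced words $e_1\cdots e_L$ up to cyclic permutation; $L=L(\gamma)$ is the combinatorial length. The lifts of $\gamma$ meeting $\mathcal D$ are the geodesics $\gamma_i$ ($1\le i\le L$, indices mod $L$) with positive endpoint the periodic word $e_ie_{i+1}\cdots$ and negative endpoint the periodic word $\bar e_{i-1}\bar e_{i-2}\cdots$. Self-intersection number. If the word of $\gamma$ is not a proper power, $i(\gamma;\gamma)$ is the number of equivalence classes of intersecting unordered pairs $\{\gamma_i,\gamma_j\}$, $i\ne j$, where two pairs are equivalent if some element of $\Gamma$ maps one pair onto the other. If $\gamma=\gamma_0^m$, then $i(\gamma;\gamma)=m^2\,i(\gamma_0;\gamma_0)$.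
   Formalization: The lower bound is stated only for ε < 1/6; for ε ≥ 1/6 it is false for large L, since it is then at least 4·3^L/L while #G^c(L) is asymptotic to 3^L/L. The upper bound and the limit are as stated. *)

theory Defs
  imports "HOL-Analysis.Analysis"
begin

abbreviation disc :: "complex set" where
  "disc \<equiv> ball 0 1"

(* Distance of the metric 2|dz| / (1 - |z|^2). *)
definition hdist :: "complex \<Rightarrow> complex \<Rightarrow> real" where
  "hdist z w = arcosh (1 + 2 * (cmod (z - w))\<^sup>2 / ((1 - (cmod z)\<^sup>2) * (1 - (cmod w)\<^sup>2)))"

(* Isometries are regarded as maps of the closed disc; their values outside cball 0 1
   are irrelevant. Holomorphic: orientation preserving. The last two clauses are the
   hyperbolic type: exactly two fixed points, both at infinity. *)
definition hyperbolic_isometry :: "(complex \<Rightarrow> complex) \<Rightarrow> bool" where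
  "hyperbolic_isometry f \<longleftrightarrow>
     bij_betw f disc disc \<and>
     (\<forall>z\<in>disc. \<forall>w\<in>disc. hdist (f z) (f w) = hdist z w) \<and>
     f holomorphic_on disc \<and>
     continuous_on (cball 0 1) f \<and>
     (\<forall>z\<in>disc. f z \<noteq> z) \<and>
     card {z \<in> cball 0 1. f z = z} = 2"

(* A closed half-disk of the Poincare disk, as a subset of the open disc. The condition
   |c|^2 = 1 + r^2 says that the circle meets the unit circle orthogonally. Either side of
   such a circle is allowed, and diameters count as circles through infinity, so that the
   notion is invariant under isometries. *)
definition half_disk :: "complex set \<Rightarrow> bool" where
  "half_disk H \<longleftrightarrow>
     (\<exists>c r. 0 < r \<and> (cmod c)\<^sup>2 = 1 + r\<^sup>2 \<and> (H = disc \<inter> cball c r \<or> H = disc - ball c r)) \<or>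
     (\<exists>u. cmod u = 1 \<and> H = {z \<in> disc. 0 \<le> Re (cnj u * z)})"

definition boundary_arc :: "complex set \<Rightarrow> complex set" where
  "boundary_arc H = closure H \<inter> sphere 0 1"

(* The strict inequalities make the four arcs pairwise disjoint, endpoints included. *)
definition anticlockwise :: "complex set \<Rightarrow> complex set \<Rightarrow> complex set \<Rightarrow> complex set \<Rightarrow> bool" where
  "anticlockwise P Q R S \<longleftrightarrow>
     (\<forall>p\<in>P. \<forall>q\<in>Q. \<forall>r\<in>R. \<forall>s\<in>S. \<exists>t1 t2 t3 t4.
        t1 < t2 \<and> t2 < t3 \<and> t3 < t4 \<and> t4 < t1 + 2 * pi \<and>
        p = cis t1 \<and> q = cis t2 \<and> r = cis t3 \<and> s = cis t4)"

datatype letter = Pos_a | Neg_a | Pos_b | Neg_b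

fun bar :: "letter \<Rightarrow> letter" where
  "bar Pos_a = Neg_a"
| "bar Neg_a = Pos_a"
| "bar Pos_b = Neg_b"
| "bar Neg_b = Pos_b"

definition schottky_pants ::
  "(complex \<Rightarrow> complex) \<Rightarrow> (complex \<Rightarrow> complex) \<Rightarrow> (letter \<Rightarrow> complex set) \<Rightarrow> bool" where
  "schottky_pants a b D \<longleftrightarrow>
     hyperbolic_isometry a \<and> hyperbolic_isometry b \<and>
     (\<forall>e. half_disk (D e)) \<and>
     (\<forall>e f. e \<noteq> f \<longrightarrow> D e \<inter> D f = {}) \<and>
     a ` D Neg_a = disc - interior (D Pos_a) \<and>
     b ` D Neg_b = disc - interior (D Pos_b) \<and>
     anticlockwise (boundary_arc (D Pos_a)) (boundary_arc (D Neg_b))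
       (boundary_arc (D Pos_b)) (boundary_arc (D Neg_a))"

fun letter_map :: "(complex \<Rightarrow> complex) \<Rightarrow> (complex \<Rightarrow> complex) \<Rightarrow> letter \<Rightarrow> complex \<Rightarrow> complex" where
  "letter_map a b Pos_a = a"
| "letter_map a b Neg_a = inv_into (cball 0 1) a"
| "letter_map a b Pos_b = b"
| "letter_map a b Neg_b = inv_into (cball 0 1) b"

fun word_map ::
  "(complex \<Rightarrow> complex) \<Rightarrow> (complex \<Rightarrow> complex) \<Rightarrow> letter list \<Rightarrow> complex \<Rightarrow> complex" where
  "word_map a b [] = id"
| "word_map a b (e # w) = letter_map a b e \<circ> word_map a b w"

definition Gam :: "(complex \<Rightarrow> complex) \<Rightarrow> (complex \<Rightarrow> complex) \<Rightarrow> (complex \<Rightarrow> complex) set" where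
  "Gam a b = range (word_map a b)"

(* Points of the quotient surface are Gam-orbits of points of disc. *)
definition proj :: "(complex \<Rightarrow> complex) \<Rightarrow> (complex \<Rightarrow> complex) \<Rightarrow> complex \<Rightarrow> complex set" where
  "proj a b z = {g z | g. g \<in> Gam a b}"

definition unit_speed_geodesic :: "(real \<Rightarrow> complex) \<Rightarrow> bool" where
  "unit_speed_geodesic c \<longleftrightarrow> range c \<subseteq> disc \<and> (\<forall>s t. hdist (c s) (c t) = \<bar>s - t\<bar>)"

type_synonym closed_curve = "((real \<Rightarrow> complex set) \<times> real) set"

(* An oriented closed curve on the surface is a parametrised curve together with a period,
   up to the choice of the initial point. The period need not be minimal: it tells
   a closed geodesic from its multiples. *)
definition closed_curve ::
  "(complex \<Rightarrow> complex) \<Rightarrow> (complex \<Rightarrow> complex) \<Rightarrow> (real \<Rightarrow> complex) \<Rightarrow> real \<Rightarrow> closed_curve" where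
  "closed_curve a b c T = {(\<lambda>t. proj a b (c (t + s)), T) | s. True}"

definition closed_geodesics ::
  "(complex \<Rightarrow> complex) \<Rightarrow> (complex \<Rightarrow> complex) \<Rightarrow> closed_curve set" where
  "closed_geodesics a b =
     {closed_curve a b c T | c T.
        unit_speed_geodesic c \<and> 0 < T \<and> (\<forall>t. proj a b (c (t + T)) = proj a b (c t))}"

definition cyclically_reduced :: "letter list \<Rightarrow> bool" where
  "cyclically_reduced w \<longleftrightarrow>
     w \<noteq> [] \<and> (\<forall>i<length w. w ! ((i + 1) mod length w) \<noteq> bar (w ! i))"

(* The closed geodesic coded by a word: the projection of the axis of the isometry spelled
   by the word, oriented by its translation direction and with one translation as period. *)
definition codes ::
  "(complex \<Rightarrow> complex) \<Rightarrow> (complex \<Rightarrow> complex) \<Rightarrow> letter list \<Rightarrow> closed_curve \<Rightarrow> bool" where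
  "codes a b w \<gamma> \<longleftrightarrow>
     cyclically_reduced w \<and>
     (\<exists>c T. unit_speed_geodesic c \<and> 0 < T \<and> (\<forall>t. word_map a b w (c t) = c (t + T)) \<and>
        \<gamma> = closed_curve a b c T)"

(* Determined up to cyclic permutation. *)
definition geodesic_word ::
  "(complex \<Rightarrow> complex) \<Rightarrow> (complex \<Rightarrow> complex) \<Rightarrow> closed_curve \<Rightarrow> letter list" where
  "geodesic_word a b \<gamma> = (SOME w. codes a b w \<gamma>)"

definition comb_length ::
  "(complex \<Rightarrow> complex) \<Rightarrow> (complex \<Rightarrow> complex) \<Rightarrow> closed_curve \<Rightarrow> nat" where
  "comb_length a b \<gamma> = length (geodesic_word a b \<gamma>)"

definition limit_point ::
  "(complex \<Rightarrow> complex) \<Rightarrow> (complex \<Rightarrow> complex) \<Rightarrow> (nat \<Rightarrow> letter) \<Rightarrow> complex" where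
  "limit_point a b f = lim (\<lambda>m. word_map a b (map f [0..<m]) 0)"

(* The lift (negative endpoint, positive endpoint), the indices of the word starting at 0. *)
definition lift ::
  "(complex \<Rightarrow> complex) \<Rightarrow> (complex \<Rightarrow> complex) \<Rightarrow> letter list \<Rightarrow> nat \<Rightarrow> complex \<times> complex" where
  "lift a b w i =
     (limit_point a b (\<lambda>k. bar (w ! nat ((int i - 1 - int k) mod int (length w)))),
      limit_point a b (\<lambda>k. w ! ((i + k) mod length w)))"

fun geodesic_line :: "complex \<times> complex \<Rightarrow> complex set" where
  "geodesic_line (\<xi>, \<eta>) =
     {c t | c t. unit_speed_geodesic c \<and> (c \<longlongrightarrow> \<xi>) at_bot \<and> (c \<longlongrightarrow> \<eta>) at_top}"

definition intersecting_pairs ::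
  "(complex \<Rightarrow> complex) \<Rightarrow> (complex \<Rightarrow> complex) \<Rightarrow> letter list \<Rightarrow> (complex \<times> complex) set set" where
  "intersecting_pairs a b w =
     {{lift a b w i, lift a b w j} | i j.
        i < length w \<and> j < length w \<and> i \<noteq> j \<and>
        geodesic_line (lift a b w i) \<inter> geodesic_line (lift a b w j) \<noteq> {}}"

definition pair_equiv ::
  "(complex \<Rightarrow> complex) \<Rightarrow> (complex \<Rightarrow> complex) \<Rightarrow> letter list \<Rightarrow>
   ((complex \<times> complex) set \<times> (complex \<times> complex) set) set" where
  "pair_equiv a b w =
     {(X, Y). X \<in> intersecting_pairs a b w \<and> Y \<in> intersecting_pairs a b w \<and>
        (\<exists>g \<in> Gam a b. Y = map_prod g g ` X)}"

definition primitive_self_int ::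
  "(complex \<Rightarrow> complex) \<Rightarrow> (complex \<Rightarrow> complex) \<Rightarrow> letter list \<Rightarrow> nat" where
  "primitive_self_int a b w = card (intersecting_pairs a b w // pair_equiv a b w)"

definition primitive_word :: "letter list \<Rightarrow> bool" where
  "primitive_word w \<longleftrightarrow> w \<noteq> [] \<and> \<not> (\<exists>v m. 2 \<le> m \<and> w = concat (replicate m v))"

(* Every nonempty word is v^m for a unique primitive word v and a unique m. *)
definition word_self_int ::
  "(complex \<Rightarrow> complex) \<Rightarrow> (complex \<Rightarrow> complex) \<Rightarrow> letter list \<Rightarrow> nat" where
  "word_self_int a b w =
     (THE n. \<exists>v m. primitive_word v \<and> w = concat (replicate m v) \<and>
        n = m\<^sup>2 * primitive_self_int a b v)"

definition self_int ::
  "(complex \<Rightarrow> complex) \<Rightarrow> (complex \<Rightarrow> complex) \<Rightarrow> closed_curve \<Rightarrow> nat" where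
  "self_int a b \<gamma> = word_self_int a b (geodesic_word a b \<gamma>)"

definition Gc :: "(complex \<Rightarrow> complex) \<Rightarrow> (complex \<Rightarrow> complex) \<Rightarrow> nat \<Rightarrow> closed_curve set" where
  "Gc a b L = {\<gamma> \<in> closed_geodesics a b. comb_length a b \<gamma> = L}"

definition Aeps ::
  "(complex \<Rightarrow> complex) \<Rightarrow> (complex \<Rightarrow> complex) \<Rightarrow> real \<Rightarrow> nat \<Rightarrow> closed_curve set" where
  "Aeps a b \<epsilon> L = {\<gamma> \<in> Gc a b L. real (self_int a b \<gamma>) \<ge> (1 / 4 - \<epsilon>) * (real L)\<^sup>2}"

end

theory Submission
  imports Defs "HOL-Complex_Analysis.Conformal_Mappings" "HOL-Real_Asymp.Real_Asymp"
    "HOL-Combinatorics.Multiset_Permutations"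
begin

text \<open>
  Whether two lifts intersect is read off the cyclic order of their endpoints, hence off the first
  letters in which the words differ. Since every class of intersecting pairs is represented where the
  two lifts diverge, the self-intersection number counts pairs of positions of the word.
  If \<open>k\<close> of the \<open>L\<close> turns are not between opposite sides of the fundamental domain, then counting turns
  according to the three perfect matchings of the four sides gives \<open>8 i + k\<^sup>2 \<le> 2 L\<^sup>2\<close>. So words in
  \<open>Aeps\<close> have \<open>k \<le> 3 sqrt \<epsilon> L\<close>, and the weight \<open>2\<close> to the power \<open>- k\<close> summed over the reduced words
  bounds their number by \<open>2\<close> times \<open>2\<close> to the power \<open>L + 3 sqrt \<epsilon> L\<close>.
  Conversely, take the alternating word in \<open>a\<close> and the inverse of \<open>b\<close>, of length about \<open>(1 - x) L\<close>,
  followed by equally many copies of all reduced words of a large fixed length in any order. Its self-intersection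
  number is about \<open>(1 / 2 - x / 6)\<^sup>2 L\<^sup>2\<close>, which exceeds \<open>(1 / 4 - \<epsilon>) L\<^sup>2\<close> for \<open>x\<close> slightly above
  \<open>6 \<epsilon>\<close>, and there are about \<open>3\<close> to the power \<open>x L\<close> such orders.
\<close>

section \<open>Isometries of the disc\<close>

text \<open>The self-intersection number counts orbits of pairs, whereas only positions of a word
  can be counted. The bridge is that a group element carrying one lift through the fundamental
  domain to another can only walk along it (\<open>rigid\<close>), so a class of crossings is a
  segment of a tree whose ends are visible locally in the word. The constant 6 in the lower bound
  arises as follows. For the constructed words, the square root of the guaranteed self-intersection
  number is asymptotically linear in the lengths: a letter of the alternating part contributes 1/2,
  a letter of the block part 1/3. A block letter thus costs 1/6. At x = 6 \<epsilon> the square (1/2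
  - x/6)^2 exceeds 1/4 - \<epsilon> by the square of \<epsilon>, so x may be taken slightly larger,
  and this surplus in the exponent pays for all polynomial losses in the count. Rearranging a fixed
  multiset of blocks, instead of choosing blocks freely, gives all the words the same lower bounds
  on subword counts; since the block length stays fixed as L grows, this loses only polynomial
  factors.\<close>

definition mob :: "complex \<Rightarrow> complex \<Rightarrow> complex \<Rightarrow> complex" where
  "mob \<alpha> \<beta> z = (\<alpha> * z + \<beta>) / (cnj \<beta> * z + cnj \<alpha>)"

text \<open>SU(1,1) up to a real factor: the inequality replaces determinant 1 and spares
  normalisations. Agreement is asked on the closed disc only, because the letter maps, among them
  \<open>inv_into (cball 0 1) a\<close>, are arbitrary elsewhere.\<close>

definition disc_isom :: "(complex \<Rightarrow> complex) \<Rightarrow> bool" where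
  "disc_isom f \<longleftrightarrow> (\<exists>\<alpha> \<beta>. cmod \<beta> < cmod \<alpha> \<and> (\<forall>z\<in>cball 0 1. f z = mob \<alpha> \<beta> z))"

lemma mob_denom_nonzero:
  assumes "cmod \<beta> < cmod \<alpha>" "cmod z \<le> 1"
  shows "cnj \<beta> * z + cnj \<alpha> \<noteq> 0"
proof
  assume "cnj \<beta> * z + cnj \<alpha> = 0"
  then have "cmod \<alpha> = cmod (cnj \<beta> * z)"
    by (metis add_eq_0_iff complex_mod_cnj norm_minus_cancel)
  also have "\<dots> \<le> cmod \<beta> * 1"
    using assms by (simp add: norm_mult mult_left_le)
  finally show False using assms by simp
qed

lemma mob_diff:
  assumes "cmod \<beta> < cmod \<alpha>" "cmod x \<le> 1" "cmod y \<le> 1"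
  shows "mob \<alpha> \<beta> x - mob \<alpha> \<beta> y =
    of_real ((cmod \<alpha>)\<^sup>2 - (cmod \<beta>)\<^sup>2) * (x - y) / ((cnj \<beta> * x + cnj \<alpha>) * (cnj \<beta> * y + cnj \<alpha>))"
proof -
  have "complex_of_real ((cmod \<alpha>)\<^sup>2 - (cmod \<beta>)\<^sup>2) = \<alpha> * cnj \<alpha> - \<beta> * cnj \<beta>"
    by (simp only: of_real_diff complex_norm_square)
  moreover have "mob \<alpha> \<beta> x - mob \<alpha> \<beta> y =
    (\<alpha> * cnj \<alpha> - \<beta> * cnj \<beta>) * (x - y) / ((cnj \<beta> * x + cnj \<alpha>) * (cnj \<beta> * y + cnj \<alpha>))"
    using mob_denom_nonzero[OF assms(1,2)] mob_denom_nonzero[OF assms(1,3)]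
    unfolding mob_def by (simp add: diff_frac_eq) (simp add: algebra_simps)
  ultimately show ?thesis by simp
qed

text \<open>Together with \<open>mob_diff\<close> this shows that numerator and denominator in
  \<open>hdist\<close> are scaled by the same factor, whence the invariance of the distance.\<close>

lemma mob_one_minus_norm:
  assumes "cmod \<beta> < cmod \<alpha>" "cmod x \<le> 1"
  shows "1 - (cmod (mob \<alpha> \<beta> x))\<^sup>2 =
    ((cmod \<alpha>)\<^sup>2 - (cmod \<beta>)\<^sup>2) * (1 - (cmod x)\<^sup>2) / (cmod (cnj \<beta> * x + cnj \<alpha>))\<^sup>2"
proof -
  have "(cmod (cnj \<beta> * x + cnj \<alpha>))\<^sup>2 - (cmod (\<alpha> * x + \<beta>))\<^sup>2
      = ((cmod \<alpha>)\<^sup>2 - (cmod \<beta>)\<^sup>2) * (1 - (cmod x)\<^sup>2)"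
    unfolding cmod_power2 by (simp add: power2_eq_square algebra_simps)
  then show ?thesis
    using mob_denom_nonzero[OF assms]
    by (simp add: mob_def norm_divide power_divide divide_simps)
qed

lemma norm_diff_power2_pos:
  assumes "cmod \<beta> < cmod \<alpha>" shows "0 < (cmod \<alpha>)\<^sup>2 - (cmod \<beta>)\<^sup>2"
  using assms by (simp add: power_strict_mono)

lemma disc_isom_in_disc:
  assumes "disc_isom f" "z \<in> disc" shows "f z \<in> disc"
proof -
  obtain \<alpha> \<beta> where *: "cmod \<beta> < cmod \<alpha>" "\<forall>z\<in>cball 0 1. f z = mob \<alpha> \<beta> z"
    using assms unfolding disc_isom_def by blast
  have z: "cmod z < 1" using assms by simp
  then have "0 < 1 - (cmod z)\<^sup>2"
    by (simp add: power_less_one_iff abs_square_less_1)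
  then have "0 < 1 - (cmod (mob \<alpha> \<beta> z))\<^sup>2"
    using mob_one_minus_norm[OF *(1), of z] norm_diff_power2_pos[OF *(1)]
      mob_denom_nonzero[OF *(1), of z] z by (simp add: zero_less_mult_iff)
  then have "cmod (mob \<alpha> \<beta> z) < 1"
    using abs_square_less_1[of "cmod (mob \<alpha> \<beta> z)"] by simp
  then show ?thesis using * z by simp
qed

lemma disc_isom_in_sphere:
  assumes "disc_isom f" "cmod z = 1" shows "cmod (f z) = 1"
proof -
  obtain \<alpha> \<beta> where *: "cmod \<beta> < cmod \<alpha>" "\<forall>z\<in>cball 0 1. f z = mob \<alpha> \<beta> z"
    using assms unfolding disc_isom_def by blast
  have "1 - (cmod (mob \<alpha> \<beta> z))\<^sup>2 = 0"
    using mob_one_minus_norm[OF *(1), of z] assms by simp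
  then have "cmod (mob \<alpha> \<beta> z) = 1" using power2_eq_1_iff[of "cmod (mob \<alpha> \<beta> z)"]
    by (metis diff_eq_diff_eq diff_zero cancel_comm_monoid_add_class.diff_cancel norm_ge_zero norm_one norm_minus_cancel real_norm_def abs_of_nonneg abs_minus_cancel abs_one)
  then show ?thesis using * assms by simp
qed

lemma disc_isom_in_cball:
  assumes "disc_isom f" "z \<in> cball 0 1" shows "f z \<in> cball 0 1"
  using disc_isom_in_disc[OF assms(1), of z] disc_isom_in_sphere[OF assms(1), of z] assms(2)
  by force

lemma disc_isom_continuous:
  assumes "disc_isom f" shows "continuous_on (cball 0 1) f"
proof -
  obtain \<alpha> \<beta> where *: "cmod \<beta> < cmod \<alpha>" "\<forall>z\<in>cball 0 1. f z = mob \<alpha> \<beta> z"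
    using assms unfolding disc_isom_def by blast
  have "continuous_on (cball 0 1) (mob \<alpha> \<beta>)"
    unfolding mob_def by (intro continuous_intros) (use mob_denom_nonzero[OF *(1)] in auto)
  then show ?thesis using * continuous_on_cong[of "cball 0 1" "cball 0 1" f "mob \<alpha> \<beta>"] by simp
qed

lemma one_minus_norm_pos: "z \<in> disc \<Longrightarrow> 0 < 1 - (cmod z)\<^sup>2"
  by (simp add: abs_square_less_1)

lemma disc_isom_hdist:
  assumes "disc_isom f" "z \<in> disc" "w \<in> disc" shows "hdist (f z) (f w) = hdist z w"
proof -
  obtain \<alpha> \<beta> where *: "cmod \<beta> < cmod \<alpha>" "\<forall>z\<in>cball 0 1. f z = mob \<alpha> \<beta> z"
    using assms unfolding disc_isom_def by blast
  have zw: "cmod z \<le> 1" "cmod w \<le> 1" using assms by auto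
  define d where "d = (cmod \<alpha>)\<^sup>2 - (cmod \<beta>)\<^sup>2"
  define p where "p = cmod (cnj \<beta> * z + cnj \<alpha>)"
  define q where "q = cmod (cnj \<beta> * w + cnj \<alpha>)"
  have pos: "d > 0" "p \<noteq> 0" "q \<noteq> 0"
    using norm_diff_power2_pos[OF *(1)] mob_denom_nonzero[OF *(1)] zw by (auto simp: d_def p_def q_def)
  have "(cmod (mob \<alpha> \<beta> z - mob \<alpha> \<beta> w))\<^sup>2 = (d * cmod (z - w) / (p * q))\<^sup>2"
    unfolding mob_diff[OF *(1) zw] norm_divide norm_mult norm_of_real using pos
    by (simp add: d_def p_def q_def)
  moreover have "1 - (cmod (mob \<alpha> \<beta> z))\<^sup>2 = d * (1 - (cmod z)\<^sup>2) / p\<^sup>2"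
     "1 - (cmod (mob \<alpha> \<beta> w))\<^sup>2 = d * (1 - (cmod w)\<^sup>2) / q\<^sup>2"
    using mob_one_minus_norm[OF *(1)] zw by (simp_all add: d_def p_def q_def)
  ultimately have "hdist (mob \<alpha> \<beta> z) (mob \<alpha> \<beta> w) = hdist z w"
    unfolding hdist_def using pos by (simp add: power_mult_distrib power_divide power2_eq_square)
  then show ?thesis using * zw by simp
qed

lemma mob_compose:
  assumes "cmod \<beta> < cmod \<alpha>" "cmod \<beta>' < cmod \<alpha>'" "cmod z \<le> 1"
  shows "mob \<alpha>' \<beta>' (mob \<alpha> \<beta> z) = mob (\<alpha>' * \<alpha> + \<beta>' * cnj \<beta>) (\<alpha>' * \<beta> + \<beta>' * cnj \<alpha>) z"
proof -
  have nz: "cnj \<beta> * z + cnj \<alpha> \<noteq> 0" using mob_denom_nonzero assms by blast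
  have eq: "x * (p / d) + y = (x * p + y * d) / d" if "d \<noteq> 0" for x y p d :: complex
    using that by (simp add: add_divide_distrib)
  have "mob \<alpha>' \<beta>' (mob \<alpha> \<beta> z) =
     ((\<alpha>' * (\<alpha> * z + \<beta>) + \<beta>' * (cnj \<beta> * z + cnj \<alpha>)) / (cnj \<beta> * z + cnj \<alpha>)) /
     ((cnj \<beta>' * (\<alpha> * z + \<beta>) + cnj \<alpha>' * (cnj \<beta> * z + cnj \<alpha>)) / (cnj \<beta> * z + cnj \<alpha>))"
    unfolding mob_def eq[OF nz] ..
  also have "\<dots> = (\<alpha>' * (\<alpha> * z + \<beta>) + \<beta>' * (cnj \<beta> * z + cnj \<alpha>)) /
     (cnj \<beta>' * (\<alpha> * z + \<beta>) + cnj \<alpha>' * (cnj \<beta> * z + cnj \<alpha>))"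
    using nz by simp
  finally show ?thesis unfolding mob_def by (simp add: algebra_simps)
qed

lemma disc_isom_compose:
  assumes "disc_isom f" "disc_isom g" shows "disc_isom (g \<circ> f)"
proof -
  obtain \<alpha> \<beta> where 1: "cmod \<beta> < cmod \<alpha>" "\<forall>z\<in>cball 0 1. f z = mob \<alpha> \<beta> z"
    using assms(1) unfolding disc_isom_def by blast
  obtain \<alpha>' \<beta>' where 2: "cmod \<beta>' < cmod \<alpha>'" "\<forall>z\<in>cball 0 1. g z = mob \<alpha>' \<beta>' z"
    using assms(2) unfolding disc_isom_def by blast
  let ?A = "\<alpha>' * \<alpha> + \<beta>' * cnj \<beta>" and ?B = "\<alpha>' * \<beta> + \<beta>' * cnj \<alpha>"
  have "(cmod ?A)\<^sup>2 - (cmod ?B)\<^sup>2 = ((cmod \<alpha>)\<^sup>2 - (cmod \<beta>)\<^sup>2) * ((cmod \<alpha>')\<^sup>2 - (cmod \<beta>')\<^sup>2)"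
    unfolding cmod_power2 by (simp add: power2_eq_square algebra_simps)
  then have "(cmod ?B)\<^sup>2 < (cmod ?A)\<^sup>2"
    using norm_diff_power2_pos[OF 1(1)] norm_diff_power2_pos[OF 2(1)]
    by (smt (verit) mult_pos_pos)
  then have "cmod ?B < cmod ?A" by (rule power_less_imp_less_base) simp
  moreover have "\<forall>z\<in>cball 0 1. (g \<circ> f) z = mob ?A ?B z"
    using mob_compose[OF 1(1) 2(1)] disc_isom_in_cball[OF assms(1)] 1 2 by auto
  ultimately show ?thesis unfolding disc_isom_def by blast
qed

lemma disc_isom_id: "disc_isom id"
  unfolding disc_isom_def by (rule exI[of _ 1], rule exI[of _ 0]) (simp add: mob_def)

lemma disc_isom_rotation: "cmod u = 1 \<Longrightarrow> disc_isom (\<lambda>z. u * z)"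
proof -
  assume u: "cmod u = 1"
  \<comment> \<open>Rotation by \<open>u\<close> is given by the diagonal matrix with entries
    \<open>v\<close> and \<open>cnj v\<close>, hence the square root.\<close>
  define v where "v = csqrt u"
  have v: "v\<^sup>2 = u" "cmod v = 1" using u by (auto simp: v_def)
  then have vv: "v * cnj v = 1" by (simp add: complex_norm_square[symmetric])
  then have "cnj v \<noteq> 0" by auto
  moreover have "v * z = u * z * cnj v" for z
  proof -
    have "u * z * cnj v = v * z * (v * cnj v)" using v(1) by (simp add: power2_eq_square mult_ac)
    then show ?thesis by (simp only: vv mult_1_right)
  qed
  ultimately have "v * z / cnj v = u * z" for z by (simp add: nonzero_divide_eq_eq)
  then show ?thesis unfolding disc_isom_def
    by (intro exI[of _ v] exI[of _ 0]) (simp add: mob_def v)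
qed

lemma disc_isom_inverse:
  assumes "disc_isom f"
  obtains g where "disc_isom g" "\<And>z. z \<in> cball 0 1 \<Longrightarrow> g (f z) = z" "\<And>z. z \<in> cball 0 1 \<Longrightarrow> f (g z) = z"
proof -
  obtain \<alpha> \<beta> where 1: "cmod \<beta> < cmod \<alpha>" "\<forall>z\<in>cball 0 1. f z = mob \<alpha> \<beta> z"
    using assms(1) unfolding disc_isom_def by blast
  let ?g = "mob (cnj \<alpha>) (- \<beta>)"
  have lt: "cmod (- \<beta>) < cmod (cnj \<alpha>)" using 1 by simp
  have g: "disc_isom ?g" unfolding disc_isom_def using lt by blast
  have ne: "cnj \<alpha> * \<alpha> - \<beta> * cnj \<beta> \<noteq> 0"
  proof
    assume "cnj \<alpha> * \<alpha> - \<beta> * cnj \<beta> = 0"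
    then have "\<alpha> * cnj \<alpha> = \<beta> * cnj \<beta>" by (simp add: mult.commute)
    then have "(cmod \<alpha>)\<^sup>2 = (cmod \<beta>)\<^sup>2" unfolding complex_norm_square[symmetric] of_real_eq_iff .
    then show False using norm_diff_power2_pos[OF 1(1)] by simp
  qed
  have "?g (f z) = z" if "z \<in> cball 0 1" for z
    using mob_compose[OF 1(1) lt, of z] that 1 ne by (simp add: mob_def mult.commute)
  moreover have "f (?g z) = z" if "z \<in> cball 0 1" for z
    using mob_compose[OF lt 1(1), of z] that 1 ne disc_isom_in_cball[OF g that]
    by (simp add: mob_def mult.commute)
  ultimately show ?thesis using that g by blast
qed

lemma disc_isom_inj: "disc_isom f \<Longrightarrow> inj_on f (cball 0 1)"
  by (metis disc_isom_inverse inj_on_inverseI)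

lemma disc_isom_cong: "disc_isom f \<Longrightarrow> (\<And>z. z \<in> cball 0 1 \<Longrightarrow> f z = g z) \<Longrightarrow> disc_isom g"
  unfolding disc_isom_def by metis

lemma disc_isom_to_zero:
  assumes "p \<in> disc" obtains f where "disc_isom f" "f p = 0"
proof -
  have "disc_isom (mob 1 (-p))" unfolding disc_isom_def using assms
    by (intro exI[of _ 1] exI[of _ "-p"]) auto
  moreover have "mob 1 (-p) p = 0" by (simp add: mob_def)
  ultimately show ?thesis using that by blast
qed

lemma disc_isom_from_zero:
  assumes "p \<in> disc" obtains f where "disc_isom f" "f 0 = p"
proof -
  obtain g where g: "disc_isom g" "g p = 0" using disc_isom_to_zero[OF assms] .
  obtain f where f: "disc_isom f" "\<And>z. z \<in> cball 0 1 \<Longrightarrow> f (g z) = z"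
    using disc_isom_inverse[OF g(1)] by metis
  show ?thesis using that[OF f(1)] f(2)[of p] g(2) assms by simp
qed

lemma hdist_zero_norm: "z \<in> disc \<Longrightarrow> cosh (hdist 0 z) = (1 + (cmod z)\<^sup>2) / (1 - (cmod z)\<^sup>2)"
proof -
  assume z: "z \<in> disc"
  then have "0 < 1 - (cmod z)\<^sup>2" by (rule one_minus_norm_pos)
  then show ?thesis unfolding hdist_def by (subst cosh_arcosh_real) (auto simp: field_simps)
qed

lemma cosh_hdist:
  assumes "z \<in> disc" "w \<in> disc"
  shows "cosh (hdist z w) = 1 + 2 * (cmod (z - w))\<^sup>2 / ((1 - (cmod z)\<^sup>2) * (1 - (cmod w)\<^sup>2))"
  using one_minus_norm_pos[OF assms(1)] one_minus_norm_pos[OF assms(2)]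
  unfolding hdist_def by (subst cosh_arcosh_real) auto

lemma hdist_nonneg:
  assumes "z \<in> disc" "w \<in> disc" shows "0 \<le> hdist z w"
  using one_minus_norm_pos[OF assms(1)] one_minus_norm_pos[OF assms(2)]
  unfolding hdist_def by (subst arcosh_nonneg_real) auto

lemma hdist_zero_eq_norm:
  assumes "z \<in> disc" "w \<in> disc" "hdist 0 z = hdist 0 w" shows "cmod z = cmod w"
proof -
  have "(1 + (cmod z)\<^sup>2) / (1 - (cmod z)\<^sup>2) = (1 + (cmod w)\<^sup>2) / (1 - (cmod w)\<^sup>2)"
    using hdist_zero_norm assms by metis
  then have "(cmod z)\<^sup>2 = (cmod w)\<^sup>2"
    using one_minus_norm_pos[OF assms(1)] one_minus_norm_pos[OF assms(2)]
    by (simp add: divide_simps) (simp add: algebra_simps)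
  then show ?thesis by simp
qed

text \<open>Once \<open>f 0\<close> is moved back to the origin, the map preserves distances to 0
  and therefore norms, so the equality case of the Schwarz lemma makes it a rotation. Continuity
  carries the formula to the unit circle.\<close>

lemma hyperbolic_isometry_disc_isom:
  assumes "hyperbolic_isometry f" shows "disc_isom f"
proof -
  have bij: "bij_betw f disc disc" and iso: "\<And>z w. z \<in> disc \<Longrightarrow> w \<in> disc \<Longrightarrow> hdist (f z) (f w) = hdist z w"
    and hol: "f holomorphic_on disc" and cont: "continuous_on (cball 0 1) f"
    using assms unfolding hyperbolic_isometry_def by auto
  have f0: "f 0 \<in> disc" using bij by (simp add: bij_betw_def)
       (metis image_eqI mem_ball_0 norm_zero zero_less_one)
  obtain h where h: "disc_isom h" "h (f 0) = 0" using disc_isom_to_zero[OF f0] .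
  obtain h' where h': "disc_isom h'" "\<And>z. z \<in> cball 0 1 \<Longrightarrow> h' (h z) = z"
    using disc_isom_inverse[OF h(1)] by metis
  obtain \<alpha> \<beta> where 1: "cmod \<beta> < cmod \<alpha>" "\<forall>z\<in>cball 0 1. h z = mob \<alpha> \<beta> z"
    using h(1) unfolding disc_isom_def by blast
  have fd: "f z \<in> disc" if "z \<in> disc" for z using that bij by (auto simp: bij_betw_def)
  let ?g = "\<lambda>z. mob \<alpha> \<beta> (f z)"
  have gh: "?g z = h (f z)" if "z \<in> disc" for z using 1 fd[OF that] by simp
  have "?g holomorphic_on disc"
    unfolding mob_def using hol fd mob_denom_nonzero[OF 1(1)]
    by (intro holomorphic_intros) (auto simp: less_imp_le)
  moreover have "?g 0 = 0" using gh[of 0] h by simp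
  moreover have gd: "?g z \<in> disc" if "z \<in> disc" for z
    using gh[OF that] disc_isom_in_disc[OF h(1) fd[OF that]] by simp
  moreover have nrm: "cmod (?g z) = cmod z" if "z \<in> disc" for z
  proof (rule hdist_zero_eq_norm[OF gd[OF that] that])
    have "hdist 0 (?g z) = hdist (h (f 0)) (h (f z))" using gh that h by simp
    also have "\<dots> = hdist 0 z" using disc_isom_hdist[OF h(1) fd fd, of 0 z] iso[of 0 z] that by simp
    finally show "hdist 0 (?g z) = hdist 0 z" .
  qed
  moreover have half: "\<exists>z. cmod z < 1 \<and> z \<noteq> 0 \<and> cmod (?g z) = cmod z"
    using nrm[of "1/2"] by (intro exI[of _ "1/2"]) simp
  ultimately obtain u where u: "\<And>z. cmod z < 1 \<Longrightarrow> ?g z = u * z" "cmod u = 1"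
    using Schwarz_Lemma(3)[of ?g 0] half by force
  let ?F = "h' \<circ> (\<lambda>z. u * z)"
  have F: "disc_isom ?F" by (intro disc_isom_compose disc_isom_rotation h' u)
  have eq: "?F z = f z" if "z \<in> disc" for z
    using u(1)[of z] gh[OF that] h'(2)[of "f z"] fd[OF that] that by auto
  have "?F z = f z" if "z \<in> cball 0 1" for z
  proof -
    have "continuous_on (closure disc) (\<lambda>z. ?F z - f z)"
      using continuous_on_diff[OF disc_isom_continuous[OF F] cont] by simp
    then have "?F z - f z = 0"
      by (rule continuous_constant_on_closure) (use eq that in auto)
    then show ?thesis by simp
  qed
  then show ?thesis using disc_isom_cong[OF F] by blast
qed

section \<open>Geodesics and their endpoints\<close>

lemma ex_real_tanh:
  assumes "\<bar>y :: real\<bar> < 1" obtains x where "tanh x = y"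
proof -
  have "\<forall>\<^sub>F x in at_top. y < tanh (x::real)"
    using tanh_real_at_top assms by (intro order_tendstoD(1)) auto
  then obtain p where "y < tanh p" by (auto simp: eventually_at_top_linorder)
  moreover have "\<forall>\<^sub>F x in at_bot. tanh (x::real) < y"
    using tanh_real_at_bot assms by (intro order_tendstoD(2)) auto
  then obtain n where "tanh n < y" by (auto simp: eventually_at_bot_linorder)
  moreover from calculation have "n \<le> p" using tanh_real_le_iff[of p n] by linarith
  moreover have "continuous_on {n..p} (tanh :: real \<Rightarrow> real)"
    by (intro continuous_intros) (auto simp: cosh_real_nonzero)
  ultimately show ?thesis using IVT'[of tanh n y p] that by force
qed

text \<open>The parameter is halved because the metric carries the factor 2: a point r > 0 of the
  real diameter lies at distance 2 artanh r from the origin.\<close>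

lemma hdist_real_tanh: "hdist (of_real (tanh (s / 2))) (of_real (tanh (t / 2))) = \<bar>s - t\<bar>"
proof -
  let ?x = "s / 2" and ?y = "t / 2"
  have c: "cosh ?x > 0" "cosh ?y > 0" by (rule cosh_real_pos)+
  have 1: "1 - (tanh x)\<^sup>2 = 1 / (cosh x)\<^sup>2" for x :: real
    using cosh_real_pos[of x] hyperbolic_pythagoras[of x]
    by (simp add: tanh_def power_divide divide_simps)
  have "tanh x - tanh y = sinh (x - y) / (cosh x * cosh y)" for x y :: real
    using cosh_real_pos[of x] cosh_real_pos[of y] by (simp add: tanh_def sinh_diff field_simps)
  note 2 = this[of ?x ?y]
  have "1 + 2 * (tanh ?x - tanh ?y)\<^sup>2 / ((1 - (tanh ?x)\<^sup>2) * (1 - (tanh ?y)\<^sup>2))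
     = 1 + 2 * (sinh (?x - ?y))\<^sup>2"
    unfolding 1 2 using c by (simp add: power_divide power_mult_distrib)
  also have "\<dots> = cosh (2 * (?x - ?y))"
    using cosh_square_eq[of "?x - ?y"] by (simp only: cosh_double)
  also have "2 * (?x - ?y) = s - t" by (simp add: algebra_simps)
  also have "cosh (s - t) = cosh \<bar>s - t\<bar>" by simp
  finally have "arcosh (1 + 2 * (tanh ?x - tanh ?y)\<^sup>2 / ((1 - (tanh ?x)\<^sup>2) * (1 - (tanh ?y)\<^sup>2))) = \<bar>s - t\<bar>"
    using arcosh_cosh_real[of "\<bar>s - t\<bar>"] by (simp only: abs_ge_zero)
  moreover have "cmod (of_real (tanh ?x) - of_real (tanh ?y)) = \<bar>tanh ?x - tanh ?y\<bar>"
    by (metis norm_of_real of_real_diff)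
  ultimately show ?thesis unfolding hdist_def by simp
qed

lemma continuous_on_tanh_half: "continuous_on UNIV (\<lambda>t. complex_of_real (tanh (t / 2)))"
  by (intro continuous_intros) (auto simp: cosh_real_nonzero)

lemma real_tanh_in_disc: "complex_of_real (tanh x) \<in> disc"
  using tanh_real_bounds[of x] by (simp add: abs_less_iff)

lemma unit_speed_geodesic_in_disc: "unit_speed_geodesic c \<Longrightarrow> c t \<in> disc"
  unfolding unit_speed_geodesic_def by blast

lemma unit_speed_geodesic_isom:
  assumes "disc_isom f" "unit_speed_geodesic c" shows "unit_speed_geodesic (f \<circ> c)"
  using assms disc_isom_in_disc[OF assms(1)] disc_isom_hdist[OF assms(1)]
  unfolding unit_speed_geodesic_def by (auto simp: image_subset_iff)

lemma unit_speed_geodesic_tanh: "unit_speed_geodesic (\<lambda>t. of_real (tanh (t / 2)))"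
  unfolding unit_speed_geodesic_def using hdist_real_tanh real_tanh_in_disc by auto

lemma unit_speed_geodesic_shift: "unit_speed_geodesic c \<Longrightarrow> unit_speed_geodesic (\<lambda>t. c (t + s))"
  unfolding unit_speed_geodesic_def by auto

lemma hdist_eq_imp_norm_diff_eq:
  assumes "z \<in> disc" "w \<in> disc" "z' \<in> disc" "w' \<in> disc"
    "hdist z w = hdist z' w'" "cmod z = cmod z'" "cmod w = cmod w'"
  shows "cmod (z - w) = cmod (z' - w')"
proof -
  have "(cmod (z - w))\<^sup>2 = (cmod (z' - w'))\<^sup>2"
    using cosh_hdist[OF assms(1,2)] cosh_hdist[OF assms(3,4)] assms(5-7)
     one_minus_norm_pos[OF assms(3)] one_minus_norm_pos[OF assms(4)] by simp
  then show ?thesis by simp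
qed

text \<open>Distances to 0 fix the norms, and mutual distances then fix the inner products. These
  are the inner products of points on one line, and equality in the Cauchy-Schwarz inequality puts
  all points on the line of \<open>v\<close>.\<close>

lemma unit_speed_geodesic_through_zero:
  assumes c: "unit_speed_geodesic c" "c 0 = 0"
  obtains v where "cmod v = 1" "\<And>t. c t = v * of_real (tanh (t / 2))"
proof -
  define \<tau> where "\<tau> t = tanh (t / 2)" for t :: real
  have cd: "c t \<in> disc" for t by (rule unit_speed_geodesic_in_disc[OF c(1)])
  have ch: "hdist (c s) (c t) = \<bar>s - t\<bar>" for s t using c unfolding unit_speed_geodesic_def by auto
  have \<tau>h: "hdist (of_real (\<tau> s)) (of_real (\<tau> t)) = \<bar>s - t\<bar>" for s t
    unfolding \<tau>_def by (rule hdist_real_tanh)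
  have \<tau>d: "of_real (\<tau> t) \<in> disc" for t unfolding \<tau>_def by (rule real_tanh_in_disc)
  have n: "cmod (c t) = cmod (of_real (\<tau> t))" for t
    using hdist_zero_eq_norm[OF cd \<tau>d, of t t] ch[of 0 t] \<tau>h[of 0 t] c(2) by (simp add: \<tau>_def)
  have d: "cmod (c s - c t) = cmod (of_real (\<tau> s) - of_real (\<tau> t))" for s t
    by (rule hdist_eq_imp_norm_diff_eq[OF cd cd \<tau>d \<tau>d]) (simp_all add: ch \<tau>h n)
  have n2: "(cmod (c t))\<^sup>2 = (\<tau> t)\<^sup>2" for t by (simp add: n)
  have inner: "c s \<bullet> c t = \<tau> s * \<tau> t" for s t
  proof -
    have "(cmod (c s - c t))\<^sup>2 = (\<tau> s - \<tau> t)\<^sup>2"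
      unfolding d of_real_diff[symmetric] norm_of_real by simp
    moreover have "(cmod (c s - c t))\<^sup>2 = (cmod (c s))\<^sup>2 + (cmod (c t))\<^sup>2 - 2 * (c s \<bullet> c t)"
      by (simp add: power2_norm_eq_inner algebra_simps inner_commute)
    ultimately have "(\<tau> s - \<tau> t)\<^sup>2 = (\<tau> s)\<^sup>2 + (\<tau> t)\<^sup>2 - 2 * (c s \<bullet> c t)" unfolding n2 by simp
    then show ?thesis by (simp add: power2_diff)
  qed
  have p: "\<tau> 1 > 0" by (simp add: \<tau>_def)
  define v where "v = (1 / \<tau> 1) *\<^sub>R c 1"
  have "cmod v = 1" using p n[of 1] by (simp add: v_def)
  moreover have "c t = v * of_real (\<tau> t)" for t
  proof -
    have "v \<bullet> c t = \<tau> t"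
      using inner[of 1 t] p by (simp add: v_def)
    moreover have "(cmod (c t - \<tau> t *\<^sub>R v))\<^sup>2 = (cmod (c t))\<^sup>2 + (\<tau> t)\<^sup>2 * (cmod v)\<^sup>2 - 2 * \<tau> t * (v \<bullet> c t)"
      unfolding power2_norm_eq_inner by (simp add: algebra_simps inner_commute power2_eq_square)
    ultimately have "(cmod (c t - \<tau> t *\<^sub>R v))\<^sup>2 = 0"
      using \<open>cmod v = 1\<close> by (simp only: n2) (simp add: power2_eq_square)
    then show ?thesis by (simp add: scaleR_conv_of_real mult.commute)
  qed
  ultimately show ?thesis using that unfolding \<tau>_def by blast
qed

lemma unit_speed_geodesic_isom_tanh:
  assumes "unit_speed_geodesic c"
  obtains f where "disc_isom f" "\<And>t. c t = f (of_real (tanh (t / 2)))"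
proof -
  have cd: "c t \<in> disc" for t by (rule unit_speed_geodesic_in_disc[OF assms])
  obtain g where g: "disc_isom g" "g (c 0) = 0" using disc_isom_to_zero[OF cd] .
  obtain h where h: "disc_isom h" "\<And>z. z \<in> cball 0 1 \<Longrightarrow> h (g z) = z" using disc_isom_inverse[OF g(1)] by metis
  obtain v where v: "cmod v = 1" "\<And>t. (g \<circ> c) t = v * of_real (tanh (t / 2))"
    using unit_speed_geodesic_through_zero[OF unit_speed_geodesic_isom[OF g(1) assms]] g(2) by auto
  show ?thesis
  proof (rule that[of "h \<circ> (\<lambda>z. v * z)"])
    show "disc_isom (h \<circ> (*) v)" by (intro disc_isom_compose disc_isom_rotation v h)
    fix t
    have "(h \<circ> (*) v) (of_real (tanh (t / 2))) = h (g (c t))"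
      using v(2)[of t] by simp
    also have "\<dots> = c t" using h(2)[of "c t"] cd[of t] by simp
    finally show "c t = (h \<circ> (*) v) (of_real (tanh (t / 2)))" by simp
  qed
qed

lemma disc_isom_tendsto:
  assumes "disc_isom f" "(c \<longlongrightarrow> x) F" "\<forall>\<^sub>F t in F. c t \<in> disc" "x \<in> cball 0 1"
  shows "((\<lambda>t. f (c t)) \<longlongrightarrow> f x) F"
proof -
  have "continuous_on (cball 0 1) f" by (rule disc_isom_continuous[OF assms(1)])
  then show ?thesis
    by (rule continuous_on_tendsto_compose[OF _ assms(2,4)])
      (use assms(3) in \<open>auto elim!: eventually_mono\<close>)
qed

lemma isom_tanh_tendsto:
  assumes "disc_isom f"
  shows "((\<lambda>t. f (of_real (tanh (t / 2)))) \<longlongrightarrow> f 1) at_top"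
    "((\<lambda>t. f (of_real (tanh (t / 2)))) \<longlongrightarrow> f (-1)) at_bot"
proof -
  have t: "((\<lambda>t. complex_of_real (tanh (t / 2))) \<longlongrightarrow> of_real 1) at_top"
  proof (rule tendsto_of_real)
    show "((\<lambda>t. tanh (t / 2)) \<longlongrightarrow> (1::real)) at_top"
      by (rule filterlim_compose[OF tanh_real_at_top]) real_asymp
  qed
  have b: "((\<lambda>t. complex_of_real (tanh (t / 2))) \<longlongrightarrow> of_real (-1)) at_bot"
  proof (rule tendsto_of_real)
    show "((\<lambda>t. tanh (t / 2)) \<longlongrightarrow> (-1::real)) at_bot"
      by (rule filterlim_compose[OF tanh_real_at_bot]) real_asymp
  qed
  show "((\<lambda>t. f (of_real (tanh (t / 2)))) \<longlongrightarrow> f 1) at_top"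
    using disc_isom_tendsto[OF assms t] real_tanh_in_disc by simp
  show "((\<lambda>t. f (of_real (tanh (t / 2)))) \<longlongrightarrow> f (-1)) at_bot"
    using disc_isom_tendsto[OF assms b] real_tanh_in_disc by simp
qed

lemma disc_isom_fix_zero:
  assumes "disc_isom f" "f 0 = 0"
  obtains u where "cmod u = 1" "\<And>z. z \<in> cball 0 1 \<Longrightarrow> f z = u * z"
proof -
  obtain \<alpha> \<beta> where 1: "cmod \<beta> < cmod \<alpha>" "\<forall>z\<in>cball 0 1. f z = mob \<alpha> \<beta> z"
    using assms(1) unfolding disc_isom_def by blast
  have a: "\<alpha> \<noteq> 0" using 1 by auto
  have "mob \<alpha> \<beta> 0 = 0" using assms(2) 1 by simp
  then have "\<beta> = 0" using a by (simp add: mob_def)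
  then show ?thesis using that[of "\<alpha> / cnj \<alpha>"] 1 a by (simp add: mob_def norm_divide)
qed

text \<open>Serves \<open>same_curve_rotate\<close>, where two lifts of one closed curve are first
  matched by a group element at two times only.\<close>

lemma geodesics_agree:
  assumes "unit_speed_geodesic c" "unit_speed_geodesic c'" "r \<noteq> s" "c r = c' r" "c s = c' s"
  shows "c = c'"
proof -
  obtain f where f: "disc_isom f" "\<And>t. c (t + r) = f (of_real (tanh (t / 2)))"
    using unit_speed_geodesic_isom_tanh[OF unit_speed_geodesic_shift[OF assms(1)], of r] by metis
  obtain f' where f': "disc_isom f'" "\<And>t. c' (t + r) = f' (of_real (tanh (t / 2)))"
    using unit_speed_geodesic_isom_tanh[OF unit_speed_geodesic_shift[OF assms(2)], of r] by metis
  obtain h where h: "disc_isom h" "\<And>z. z \<in> cball 0 1 \<Longrightarrow> h (f z) = z" "\<And>z. z \<in> cball 0 1 \<Longrightarrow> f (h z) = z"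
    using disc_isom_inverse[OF f(1)] by metis
  have tc: "of_real (tanh x) \<in> cball (0::complex) 1" for x :: real using real_tanh_in_disc[of x] by auto
  have "f' 0 = f 0" using f(2)[of 0] f'(2)[of 0] assms(4) by simp
  then have "(h \<circ> f') 0 = 0" using h(2)[of 0] by simp
  then obtain u where u: "cmod u = 1" "\<And>z. z \<in> cball 0 1 \<Longrightarrow> (h \<circ> f') z = u * z"
    using disc_isom_fix_zero[OF disc_isom_compose[OF f'(1) h(1)]] by blast
  define x where "x = complex_of_real (tanh ((s - r) / 2))"
  have x: "x \<in> cball 0 1" "x \<noteq> 0" using tc assms(3) by (auto simp: x_def)
  have "f' x = f x" using f(2)[of "s-r"] f'(2)[of "s - r"] assms(5) by (simp add: x_def)
  then have "u * x = x" using u(2)[OF x(1)] h(2)[OF x(1)] by simp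
  then have "u = 1" using x by simp
  then have eq: "f' z = f z" if "z \<in> cball 0 1" for z
    using u(2)[OF that] h(3)[OF disc_isom_in_cball[OF f'(1) that]] by simp
  show ?thesis
  proof
    fix t
    show "c t = c' t" using f(2)[of "t - r"] f'(2)[of "t - r"] eq[OF tc] by simp
  qed
qed

text \<open>An isometry fixing 1 and -1 has a real matrix, so on the real diameter it is (A x + B) /
  (B x + A). By the addition formula of tanh this is a translation of the parameter.\<close>

lemma geodesic_same_endpoints:
  assumes f: "disc_isom f" and f': "disc_isom f'" and e: "f 1 = f' 1" "f (-1) = f' (-1)"
  obtains s where "\<And>t. f' (of_real (tanh (t / 2))) = f (of_real (tanh ((t + s) / 2)))"
proof -
  obtain h where h: "disc_isom h" "\<And>z. z \<in> cball 0 1 \<Longrightarrow> h (f z) = z" "\<And>z. z \<in> cball 0 1 \<Longrightarrow> f (h z) = z"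
    using disc_isom_inverse[OF f(1)] by metis
  have tc: "of_real (tanh x) \<in> cball (0::complex) 1" for x :: real using real_tanh_in_disc[of x] by auto
  have k: "disc_isom (h \<circ> f')" by (rule disc_isom_compose[OF f' h(1)])
  then obtain \<alpha> \<beta> where 1: "cmod \<beta> < cmod \<alpha>" "\<forall>z\<in>cball 0 1. (h \<circ> f') z = mob \<alpha> \<beta> z"
    unfolding disc_isom_def by blast
  have "mob \<alpha> \<beta> 1 = 1" "mob \<alpha> \<beta> (-1) = -1" using 1(2) e h(2)[of 1] h(2)[of "-1"] by auto
  then have "\<alpha> + \<beta> = cnj \<beta> + cnj \<alpha>" "- \<alpha> + \<beta> = - (- cnj \<beta> + cnj \<alpha>)"
    using mob_denom_nonzero[OF 1(1), of 1] mob_denom_nonzero[OF 1(1), of "-1"]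
    by (simp_all add: mob_def divide_eq_eq)
  then have "Im \<alpha> = 0" "Im \<beta> = 0" by (auto simp: complex_eq_iff)
  then obtain A B where AB: "\<alpha> = of_real A" "\<beta> = of_real B"
    by (metis complex_is_Real_iff Reals_cases)
  have lt: "\<bar>B\<bar> < \<bar>A\<bar>" using 1(1) AB by simp
  then have A0: "A \<noteq> 0" by auto
  have "\<bar>B / A\<bar> < 1" using lt by (simp add: abs_divide)
  obtain x where "tanh x = B / A" using ex_real_tanh[OF \<open>\<bar>B / A\<bar> < 1\<close>] .
  define s where "s = 2 * x"
  have ts: "tanh (s / 2) = B / A" using \<open>tanh x = B / A\<close> by (simp add: s_def)
  show ?thesis
  proof (rule that[of s])
    fix t :: real
    let ?x = "tanh (t / 2)"
    have nz: "1 + (B / A) * ?x \<noteq> 0"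
    proof -
      have "\<bar>(B / A) * ?x\<bar> < 1"
        using mult_strict_mono'[of "\<bar>B / A\<bar>" 1 "\<bar>?x\<bar>" 1] \<open>\<bar>B / A\<bar> < 1\<close> tanh_real_bounds[of "t/2"]
        unfolding abs_mult by (simp add: abs_less_iff)
      then show ?thesis by linarith
    qed
    have "tanh ((t + s) / 2) = tanh (t / 2 + s / 2)" by (simp add: add_divide_distrib)
    also have "\<dots> = (?x + tanh (s / 2)) / (1 + ?x * tanh (s / 2))"
      by (rule tanh_add) (simp_all add: cosh_real_nonzero)
    also have "\<dots> = (?x + B / A) / (1 + ?x * (B / A))" by (simp only: ts)
    also have "\<dots> = (A * ?x + B) / (B * ?x + A)"
      using A0 nz by (simp add: divide_simps) (simp add: algebra_simps)
    finally have "mob \<alpha> \<beta> (of_real ?x) = of_real (tanh ((t + s) / 2))"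
      by (simp add: mob_def AB)
    then have "h (f' (of_real ?x)) = of_real (tanh ((t + s) / 2))"
      using 1(2) tc[of "t/2"] by simp
    then show "f' (of_real ?x) = f (of_real (tanh ((t + s) / 2)))"
      using h(3)[OF disc_isom_in_cball[OF f' tc[of "t/2"]]] by simp
  qed
qed

text \<open>On the unit circle, positive exactly for the anticlockwise triples of distinct points.\<close>

definition orient :: "complex \<Rightarrow> complex \<Rightarrow> complex \<Rightarrow> real" where
  "orient x y z = Im (cnj x * y + cnj y * z + cnj z * x)"

text \<open>Conjugation is inversion on the unit circle, which turns the signed area into a product
  of differences; under Moebius maps such products change by explicit factors.\<close>

lemma orient_eq:
  assumes "cmod x = 1" "cmod y = 1" "cmod z = 1"
  shows "(x - y) * (y - z) * (z - x) = - 2 * \<i> * of_real (orient x y z) * (x * y * z)"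
proof -
  have c: "x * cnj x = 1" "y * cnj y = 1" "z * cnj z = 1"
    using assms by (simp_all add: complex_norm_square[symmetric])
  define s where "s = cnj x * y + cnj y * z + cnj z * x"
  have "2 * \<i> * of_real (orient x y z) = s - cnj s"
    by (simp add: s_def orient_def complex_eq_iff)
  then have "2 * \<i> * of_real (orient x y z) * (x * y * z)
    = (cnj x * y + cnj y * z + cnj z * x - x * cnj y - y * cnj z - z * cnj x) * (x * y * z)"
    by (simp add: s_def)
  also have "\<dots> = (x * cnj x) * y * y * z + (y * cnj y) * z * z * x + (z * cnj z) * x * x * y
      - (y * cnj y) * x * x * z - (z * cnj z) * y * y * x - (x * cnj x) * z * z * y"
    by (simp add: algebra_simps)
  also have "\<dots> = - ((x - y) * (y - z) * (z - x))"
    unfolding c by (simp add: algebra_simps)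
  finally show ?thesis by (simp add: minus_equation_iff)
qed

lemma orient_disc_isom:
  assumes f: "disc_isom f" and x: "cmod x = 1" "cmod y = 1" "cmod z = 1"
  obtains k where "k > 0" "orient (f x) (f y) (f z) = k * orient x y z"
proof -
  obtain \<alpha> \<beta> where 1: "cmod \<beta> < cmod \<alpha>" "\<forall>z\<in>cball 0 1. f z = mob \<alpha> \<beta> z"
    using f(1) unfolding disc_isom_def by blast
  define d where "d z = cnj \<beta> * z + cnj \<alpha>" for z
  define \<Delta> where "\<Delta> = (cmod \<alpha>)\<^sup>2 - (cmod \<beta>)\<^sup>2"
  have \<Delta>: "\<Delta> > 0" unfolding \<Delta>_def by (rule norm_diff_power2_pos[OF 1(1)])
  have d0: "d z \<noteq> 0" if "cmod z = 1" for z using mob_denom_nonzero[OF 1(1), of z] that by (simp add: d_def)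
  have fz: "f z = z * cnj (d z) / d z" if "cmod z = 1" for z
  proof -
    have "z * cnj z = 1" using that by (simp add: complex_norm_square[symmetric])
    then have "z * cnj (d z) = \<alpha> * z + \<beta>" by (simp add: d_def algebra_simps)
    then show ?thesis using 1 that by (simp add: mob_def d_def)
  qed
  have df: "f x - f y = of_real \<Delta> * (x - y) / (d x * d y)" if "cmod x = 1" "cmod y = 1" for x y
    using mob_diff[OF 1(1), of x y] 1(2) that by (simp add: d_def \<Delta>_def)
  have n: "d z * cnj (d z) = of_real ((cmod (d z))\<^sup>2)" for z by (simp only: complex_norm_square)
  have fn: "cmod (f z) = 1" if "cmod z = 1" for z using disc_isom_in_sphere[OF f that] .
  define P where "P = (cmod (d x) * cmod (d y) * cmod (d z))\<^sup>2"
  have P: "P > 0" using d0 x by (simp add: P_def)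
  have PE: "of_real P = d x * cnj (d x) * (d y * cnj (d y)) * (d z * cnj (d z))"
    unfolding n by (simp add: P_def power_mult_distrib)
  have "(f x - f y) * (f y - f z) * (f z - f x) = of_real (\<Delta>^3) * ((x - y) * (y - z) * (z - x)) / (d x * d y * d z)\<^sup>2"
    unfolding df[OF x(1,2)] df[OF x(2,3)] df[OF x(3,1)] by (simp add: power2_eq_square power3_eq_cube mult_ac)
  also have "\<dots> = - 2 * \<i> * of_real (\<Delta>^3 * orient x y z) * (x * y * z) / (d x * d y * d z)\<^sup>2"
    unfolding orient_eq[OF x] by simp
  finally have "- 2 * \<i> * of_real (orient (f x) (f y) (f z)) * (f x * f y * f z) =
      - 2 * \<i> * of_real (\<Delta>^3 * orient x y z) * (x * y * z) / (d x * d y * d z)\<^sup>2"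
    unfolding orient_eq[OF fn[OF x(1)] fn[OF x(2)] fn[OF x(3)]] .
  then have "(- 2 * \<i>) * (of_real (orient (f x) (f y) (f z)) * (f x * f y * f z)) =
      (- 2 * \<i>) * (of_real (\<Delta>^3 * orient x y z) * (x * y * z) / (d x * d y * d z)\<^sup>2)"
    by (simp only: mult.assoc times_divide_eq_right)
  then have "of_real (orient (f x) (f y) (f z)) * (f x * f y * f z) =
      of_real (\<Delta>^3 * orient x y z) * (x * y * z) / (d x * d y * d z)\<^sup>2"
    unfolding mult_cancel_left by simp
  then have "of_real (orient (f x) (f y) (f z)) * (x * y * z * (cnj (d x) * cnj (d y) * cnj (d z)) / (d x * d y * d z)) =
      of_real (\<Delta>^3 * orient x y z) * (x * y * z) / (d x * d y * d z)\<^sup>2"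
    using fz[OF x(1)] fz[OF x(2)] fz[OF x(3)] by (simp add: mult_ac)
  then have "of_real (orient (f x) (f y) (f z)) * (cnj (d x) * cnj (d y) * cnj (d z)) * (d x * d y * d z) = of_real (\<Delta>^3 * orient x y z)"
    using d0[OF x(1)] d0[OF x(2)] d0[OF x(3)] x by (auto simp: divide_simps power2_eq_square mult_ac)
  then have "of_real (orient (f x) (f y) (f z) * P) = (of_real (\<Delta>^3 * orient x y z) :: complex)"
    unfolding of_real_mult PE by (simp add: mult_ac)
  then have "orient (f x) (f y) (f z) * P = \<Delta>^3 * orient x y z" unfolding of_real_eq_iff .
  then have "orient (f x) (f y) (f z) = (\<Delta>^3 / P) * orient x y z" using P by (simp add: field_simps)
  then show ?thesis using that[of "\<Delta>^3 / P"] P \<Delta> by simp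
qed

lemma orient_disc_isom_sgn:
  assumes "disc_isom f" "cmod x = 1" "cmod y = 1" "cmod z = 1"
  shows "sgn (orient (f x) (f y) (f z)) = sgn (orient x y z)"
proof -
  obtain k where "k > 0" "orient (f x) (f y) (f z) = k * orient x y z"
    using orient_disc_isom[OF assms] .
  then show ?thesis by (simp add: sgn_mult)
qed

text \<open>The endpoints of the second chord lie on opposite sides of the line through the
  endpoints of the first. The strict sign excludes common endpoints.\<close>

definition separates :: "complex \<times> complex \<Rightarrow> complex \<times> complex \<Rightarrow> bool" where
  "separates p q \<longleftrightarrow> orient (fst p) (fst q) (snd p) * orient (fst p) (snd q) (snd p) < 0"

lemma separates_isom:
  assumes f: "disc_isom f" and "cmod x = 1" "cmod y = 1" "cmod x' = 1" "cmod y' = 1"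
  shows "separates (f x, f y) (f x', f y') \<longleftrightarrow> separates (x, y) (x', y')"
proof -
  have "sgn (orient (f x) (f x') (f y) * orient (f x) (f y') (f y)) = sgn (orient x x' y * orient x y' y)"
    using assms by (simp add: sgn_mult orient_disc_isom_sgn)
  then show ?thesis unfolding separates_def fst_conv snd_conv
    by (simp only: sgn_less[of "orient (f x) (f x') (f y) * orient (f x) (f y') (f y)", symmetric] sgn_less[of "orient x x' y * orient x y' y", symmetric])
qed

lemma ex_isom_endpoints:
  assumes "cmod \<xi> = 1" "cmod \<eta> = 1" "\<xi> \<noteq> \<eta>"
  obtains f where "disc_isom f" "f (-1) = \<xi>" "f 1 = \<eta>"
proof -
  \<comment> \<open>The matrix with \<alpha> + \<beta> = S and \<alpha> - \<beta> = E sends 1 to S /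
    cnj S, which is the square of S, and -1 to minus the square of E.\<close>
  define S where "S = csqrt \<eta>"
  define E0 where "E0 = csqrt (- \<xi>)"
  have S: "S\<^sup>2 = \<eta>" "cmod S = 1" using assms by (auto simp: S_def)
  have E0: "E0\<^sup>2 = - \<xi>" "cmod E0 = 1" using assms by (auto simp: E0_def)
  have ne: "Re (S * cnj E0) \<noteq> 0"
  proof
    assume r: "Re (S * cnj E0) = 0"
    have "cmod (S * cnj E0) = 1" using S E0 by (simp add: norm_mult)
    then have "(Im (S * cnj E0))\<^sup>2 = 1" using cmod_power2[of "S * cnj E0"] r by simp
    then have "(S * cnj E0)\<^sup>2 = -1" using r by (simp add: complex_eq_iff power2_eq_square)
    then have "S\<^sup>2 * (cnj E0 * E0)\<^sup>2 = - (E0\<^sup>2)" by (simp add: power_mult_distrib mult.assoc[symmetric])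
    moreover have "cnj E0 * E0 = 1" using E0(2) by (simp add: complex_norm_square[symmetric] mult.commute)
    ultimately show False using S E0 assms by simp
  qed
  \<comment> \<open>Changing the sign of E keeps its square and exchanges \<alpha> and \<beta>, so
    the sign decides which of the two has the larger norm.\<close>
  define E where "E = (if Re (S * cnj E0) > 0 then E0 else - E0)"
  have E: "E\<^sup>2 = - \<xi>" "cmod E = 1" "Re (S * cnj E) > 0" using E0 ne by (auto simp: E_def)
  let ?\<alpha> = "(S + E) / 2" and ?\<beta> = "(S - E) / 2"
  have "(cmod ?\<alpha>)\<^sup>2 - (cmod ?\<beta>)\<^sup>2 = Re (S * cnj E)"
    unfolding cmod_power2 by (simp add: power2_eq_square field_simps)
  then have "(cmod ?\<beta>)\<^sup>2 < (cmod ?\<alpha>)\<^sup>2" using E(3) by linarith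
  then have lt: "cmod ?\<beta> < cmod ?\<alpha>" by (rule power_less_imp_less_base) simp
  have iso: "disc_isom (mob ?\<alpha> ?\<beta>)" unfolding disc_isom_def using lt by blast
  have cS: "cnj S * S = 1" "cnj E * E = 1" using S E by (simp_all add: complex_norm_square[symmetric] mult.commute)
  have nz: "cnj S \<noteq> 0" "cnj E \<noteq> 0" using S E by auto
  have "mob ?\<alpha> ?\<beta> 1 = S / cnj S" by (simp add: mob_def add_divide_distrib[symmetric])
  also have "\<dots> = S\<^sup>2" using nz cS by (simp add: divide_eq_eq power2_eq_square mult.assoc) (simp add: mult.commute)
  finally have 1: "mob ?\<alpha> ?\<beta> 1 = \<eta>" using S by simp
  have "?\<alpha> * (-1) + ?\<beta> = - E" "cnj ?\<beta> * (-1) + cnj ?\<alpha> = cnj E" by (simp_all add: field_simps)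
  then have "mob ?\<alpha> ?\<beta> (-1) = - E / cnj E" unfolding mob_def by simp
  also have "\<dots> = - (E\<^sup>2)" using nz cS by (simp add: divide_eq_eq power2_eq_square mult.assoc) (simp add: mult.commute)
  finally have 2: "mob ?\<alpha> ?\<beta> (-1) = \<xi>" using E by simp
  show ?thesis using that[OF iso 2 1] .
qed

lemma mem_geodesic_line:
  "z \<in> geodesic_line (\<xi>, \<eta>) \<longleftrightarrow> (\<exists>f t. disc_isom f \<and> f (-1) = \<xi> \<and> f 1 = \<eta> \<and> z = f (of_real (tanh (t / 2))))"
  (is "?l \<longleftrightarrow> ?r")
proof
  assume ?l
  then obtain c t where c: "z = c t" "unit_speed_geodesic c" "(c \<longlongrightarrow> \<xi>) at_bot" "(c \<longlongrightarrow> \<eta>) at_top" by auto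
  obtain f where f: "disc_isom f" "\<And>t. c t = f (of_real (tanh (t / 2)))"
    using unit_speed_geodesic_isom_tanh[OF c(2)] by metis
  have "f 1 = \<eta>" using tendsto_unique[OF _ isom_tanh_tendsto(1)[OF f(1)]] c(4) f(2)[symmetric] by auto
  moreover have "f (-1) = \<xi>" using tendsto_unique[OF _ isom_tanh_tendsto(2)[OF f(1)]] c(3) f(2)[symmetric] by auto
  ultimately show ?r using f c by blast
next
  assume ?r
  then obtain f t where f: "disc_isom f" "f (-1) = \<xi>" "f 1 = \<eta>" "z = f (of_real (tanh (t / 2)))" by blast
  let ?c = "\<lambda>t. f (of_real (tanh (t / 2)))"
  have "unit_speed_geodesic ?c" using unit_speed_geodesic_isom[OF f(1) unit_speed_geodesic_tanh] by (simp add: o_def)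
  then show ?l using isom_tanh_tendsto[OF f(1)] f by auto
qed

text \<open>A common point can be moved to the origin, where both lines are diameters and the sign
  is explicit. Conversely, straighten the first line to the real diameter: the second then joins
  points on both sides, and the intermediate value theorem for the imaginary part finds a common
  point.\<close>

lemma geodesic_lines_meet_iff:
  assumes n: "cmod \<xi> = 1" "cmod \<eta> = 1" "cmod \<xi>' = 1" "cmod \<eta>' = 1"
    and d: "\<xi> \<noteq> \<eta>" "\<xi>' \<noteq> \<eta>'" "\<xi> \<noteq> \<xi>'" "\<xi> \<noteq> \<eta>'"
  shows "geodesic_line (\<xi>, \<eta>) \<inter> geodesic_line (\<xi>', \<eta>') \<noteq> {} \<longleftrightarrow> separates (\<xi>, \<eta>) (\<xi>', \<eta>')"
proof
  assume "geodesic_line (\<xi>, \<eta>) \<inter> geodesic_line (\<xi>', \<eta>') \<noteq> {}"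
  then obtain z where z: "z \<in> geodesic_line (\<xi>, \<eta>)" "z \<in> geodesic_line (\<xi>', \<eta>')" by blast
  have centre: "\<exists>g. disc_isom g \<and> g 0 = z \<and> g (-1) = \<xi> \<and> g 1 = \<eta>" if z: "z \<in> geodesic_line (\<xi>, \<eta>)" for \<xi> \<eta>
  proof -
    obtain f s where f: "disc_isom f" "f (-1) = \<xi>" "f 1 = \<eta>" "z = f (of_real (tanh (s / 2)))"
      using z unfolding mem_geodesic_line by blast
    let ?c = "\<lambda>t. f (of_real (tanh (t / 2)))"
    have "unit_speed_geodesic ?c" using unit_speed_geodesic_isom[OF f(1) unit_speed_geodesic_tanh] by (simp add: o_def)
    then obtain g where g: "disc_isom g" "\<And>t. ?c (t + s) = g (of_real (tanh (t / 2)))"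
      by (rule unit_speed_geodesic_isom_tanh[OF unit_speed_geodesic_shift[where s=s]]) (rule that)
    have "((\<lambda>t. ?c (t + s)) \<longlongrightarrow> f 1) at_top"
      by (rule filterlim_compose[OF isom_tanh_tendsto(1)[OF f(1)]]) real_asymp
    then have "g 1 = \<eta>" using tendsto_unique[OF _ isom_tanh_tendsto(1)[OF g(1)]] f g(2) by auto
    moreover have "((\<lambda>t. ?c (t + s)) \<longlongrightarrow> f (-1)) at_bot"
      by (rule filterlim_compose[OF isom_tanh_tendsto(2)[OF f(1)]]) real_asymp
    then have "g (-1) = \<xi>" using tendsto_unique[OF _ isom_tanh_tendsto(2)[OF g(1)]] f g(2) by auto
    moreover have "g 0 = z" using g(2)[of 0] f by simp
    ultimately show ?thesis using g by blast
  qed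
  obtain g where g: "disc_isom g" "g 0 = z" "g (-1) = \<xi>" "g 1 = \<eta>" using centre[OF z(1)] by blast
  obtain g' where g': "disc_isom g'" "g' 0 = z" "g' (-1) = \<xi>'" "g' 1 = \<eta>'" using centre[OF z(2)] by blast
  obtain h where h: "disc_isom h" "\<And>z. z \<in> cball 0 1 \<Longrightarrow> h (g z) = z" "\<And>z. z \<in> cball 0 1 \<Longrightarrow> g (h z) = z"
    using disc_isom_inverse[OF g(1)] by metis
  have "(h \<circ> g') 0 = 0" using h(2)[of 0] g g' by simp
  then obtain u where u: "cmod u = 1" "\<And>z. z \<in> cball 0 1 \<Longrightarrow> (h \<circ> g') z = u * z"
    using disc_isom_fix_zero[OF disc_isom_compose[OF g'(1) h(1)]] by blast
  have hg': "g' z = g (u * z)" if "z \<in> cball 0 1" for z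
    using u(2)[OF that] h(3)[OF disc_isom_in_cball[OF g'(1) that]] by simp
  have e: "\<xi>' = g (- u)" "\<eta>' = g u" using hg'[of "-1"] hg'[of 1] g' by auto
  have "Im u \<noteq> 0"
  proof
    assume "Im u = 0"
    then have "u = 1 \<or> u = -1" using u(1) cmod_eq_Re[of u] by (auto simp: complex_eq_iff abs_if split: if_splits)
    then show False using e g d by auto
  qed
  then have "separates (-1, 1) (-u, u)"
    unfolding separates_def orient_def by (auto simp: zero_less_mult_iff)
  then show "separates (\<xi>, \<eta>) (\<xi>', \<eta>')" using separates_isom[OF g(1), of "-1" 1 "-u" u] g e u by simp
next
  assume sep: "separates (\<xi>, \<eta>) (\<xi>', \<eta>')"
  obtain g where g: "disc_isom g" "g (-1) = \<xi>" "g 1 = \<eta>" using ex_isom_endpoints[OF n(1,2) d(1)] .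
  obtain g' where g': "disc_isom g'" "g' (-1) = \<xi>'" "g' 1 = \<eta>'" using ex_isom_endpoints[OF n(3,4) d(2)] .
  obtain h where h: "disc_isom h" "\<And>z. z \<in> cball 0 1 \<Longrightarrow> h (g z) = z" "\<And>z. z \<in> cball 0 1 \<Longrightarrow> g (h z) = z"
    using disc_isom_inverse[OF g(1)] by metis
  define x where "x = h \<xi>'" define y where "y = h \<eta>'"
  have xy: "cmod x = 1" "cmod y = 1" "g x = \<xi>'" "g y = \<eta>'"
    using n disc_isom_in_sphere[OF h(1)] h(3) by (auto simp: x_def y_def)
  have "separates (-1, 1) (x, y)" using sep separates_isom[OF g(1), of "-1" 1 x y] g xy by simp
  then have s: "Im x * Im y < 0" unfolding separates_def orient_def by (simp add: algebra_simps)
  let ?q = "\<lambda>t. (h \<circ> g') (of_real (tanh (t / 2)))"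
  have k: "disc_isom (h \<circ> g')" by (rule disc_isom_compose[OF g'(1) h(1)])
  have lim: "((\<lambda>t. Im (?q t)) \<longlongrightarrow> Im y) at_top" "((\<lambda>t. Im (?q t)) \<longlongrightarrow> Im x) at_bot"
    using isom_tanh_tendsto[OF k] g' by (auto intro!: tendsto_Im simp: x_def y_def)
  have "continuous_on UNIV ?q"
    by (rule continuous_on_compose2[OF disc_isom_continuous[OF k] continuous_on_tanh_half]) (use real_tanh_in_disc in \<open>auto simp: less_imp_le\<close>)
  then have cont: "continuous_on UNIV (\<lambda>t. Im (?q t))" by (intro continuous_intros)
  have conn: "connected (range (\<lambda>t. Im (?q t)))" by (rule connected_continuous_image[OF cont]) simp
  have "\<exists>t. Im (?q t) = 0"
  proof (cases "Im x < 0")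
    case True
    then have "Im y > 0" using s by (simp add: mult_less_0_iff)
    then have "\<forall>\<^sub>F t in at_top. Im (?q t) > 0" using lim(1) by (rule order_tendstoD(1)[rotated])
    then obtain t1 where "Im (?q t1) > 0" by (auto simp: eventually_at_top_linorder)
    moreover have "\<forall>\<^sub>F t in at_bot. Im (?q t) < 0" using lim(2) True by (rule order_tendstoD(2))
    then obtain t2 where "Im (?q t2) < 0" by (auto simp: eventually_at_bot_linorder)
    ultimately have "0 \<in> range (\<lambda>t. Im (?q t))" using connectedD_interval[OF conn, of "Im (?q t2)" "Im (?q t1)" 0] by simp
    then show ?thesis by force
  next
    case False
    then have xp: "Im x > 0" and "Im y < 0" using s by (auto simp: mult_less_0_iff)
    then have "\<forall>\<^sub>F t in at_top. Im (?q t) < 0" using lim(1) by (intro order_tendstoD(2)) auto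
    then obtain t1 where "Im (?q t1) < 0" by (auto simp: eventually_at_top_linorder)
    moreover have "\<forall>\<^sub>F t in at_bot. Im (?q t) > 0" using lim(2) xp by (rule order_tendstoD(1))
    then obtain t2 where "Im (?q t2) > 0" by (auto simp: eventually_at_bot_linorder)
    ultimately have "0 \<in> range (\<lambda>t. Im (?q t))" using connectedD_interval[OF conn, of "Im (?q t1)" "Im (?q t2)" 0] by simp
    then show ?thesis by force
  qed
  then obtain t where t: "Im (?q t) = 0" by blast
  have qd: "?q t \<in> disc" by (rule disc_isom_in_disc[OF k real_tanh_in_disc])
  obtain r where r: "?q t = of_real r" using t by (metis complex_is_Real_iff Reals_cases)
  have "\<bar>r\<bar> < 1" using qd r by simp
  then obtain p where "tanh p = r" using ex_real_tanh by blast
  then have p: "?q t = of_real (tanh ((2 * p) / 2))" using r by simp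
  have "g' (of_real (tanh (t / 2))) = g (?q t)"
    using h(3)[OF disc_isom_in_cball[OF g'(1)], of "of_real (tanh (t / 2))"] real_tanh_in_disc[of "t/2"] by (auto simp: less_imp_le)
  then have "g' (of_real (tanh (t / 2))) = g (of_real (tanh ((2 * p) / 2)))" using p by simp
  then have "g' (of_real (tanh (t / 2))) \<in> geodesic_line (\<xi>, \<eta>)" unfolding mem_geodesic_line using g by blast
  moreover have "g' (of_real (tanh (t / 2))) \<in> geodesic_line (\<xi>', \<eta>')" unfolding mem_geodesic_line using g' by blast
  ultimately show "geodesic_line (\<xi>, \<eta>) \<inter> geodesic_line (\<xi>', \<eta>') \<noteq> {}" by blast
qed

section \<open>Half-disks and ping-pong\<close>

lemma ex_unit_speed_geodesic_between:
  assumes "p \<in> disc" "q \<in> disc"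
  obtains c where "unit_speed_geodesic c" "c 0 = p" "c (hdist p q) = q"
proof -
  obtain f where f: "disc_isom f" "f 0 = p" using disc_isom_from_zero[OF assms(1)] .
  obtain h where h: "disc_isom h" "\<And>z. z \<in> cball 0 1 \<Longrightarrow> f (h z) = z"
    using disc_isom_inverse[OF f(1)] by metis
  have hq: "h q \<in> disc" using disc_isom_in_disc[OF h(1) assms(2)] .
  then obtain x where x: "tanh x = cmod (h q)" using ex_real_tanh[of "cmod (h q)"] by auto
  have x0: "x \<ge> 0" using x by (metis norm_ge_zero tanh_real_nonneg_iff)
  obtain v where v: "cmod v = 1" "h q = v * of_real (cmod (h q))"
  proof (cases "h q = 0")
    case True then show ?thesis using that[of 1] by simp
  next
    case False then show ?thesis by (intro that[of "sgn (h q)"]) (simp_all add: sgn_eq norm_divide)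
  qed
  define c where "c t = f (v * of_real (tanh (t / 2)))" for t
  have fv: "disc_isom (f \<circ> (*) v)" by (intro disc_isom_compose disc_isom_rotation v f)
  have c: "unit_speed_geodesic c"
    using unit_speed_geodesic_isom[OF fv unit_speed_geodesic_tanh] by (simp add: o_def c_def[abs_def])
  have c0: "c 0 = p" by (simp add: c_def f)
  have "c (2 * x) = f (h q)" using v x by (simp add: c_def)
  then have cq: "c (2 * x) = q" using h(2)[of q] assms by simp
  have "hdist p q = 2 * x" using c c0 cq x0 unfolding unit_speed_geodesic_def by force
  then show ?thesis using that c c0 cq by simp
qed

lemma half_disk_subset: "half_disk H \<Longrightarrow> H \<subseteq> disc"
  unfolding half_disk_def by auto

lemma half_disk_closed:
  assumes "half_disk H" "z \<in> closure H" "z \<in> disc" shows "z \<in> H"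
proof -
  obtain C where C: "closed C" "H = disc \<inter> C"
  proof -
    consider c r where "H = disc \<inter> cball c r" | c r where "H = disc - ball c r" | u where "H = {z \<in> disc. 0 \<le> Re (cnj u * z)}"
      using assms(1) unfolding half_disk_def by blast
    then show ?thesis
    proof cases
      case 1 then show ?thesis using that by blast
    next
      case 2 then show ?thesis using that[of "- ball c r"] by (auto simp: Diff_eq)
    next
      case 3
      have "closed {z. 0 \<le> Re (cnj u * z)}" by (intro closed_Collect_le continuous_intros)
      then show ?thesis by (rule that) (use 3 in auto)
    qed
  qed
  then have "closure H \<subseteq> C" by (simp add: closure_minimal)
  then show ?thesis using assms C by auto
qed

lemma sphere_point_in_closure:
  assumes "cmod u = 1" "\<And>s. 0 < s \<Longrightarrow> s < 1 \<Longrightarrow> of_real s * u \<in> H"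
  shows "u \<in> closure H"
proof (rule Lim_in_closed_set[where F = "at_left (1::real)" and f = "\<lambda>s. of_real s * u"])
  show "((\<lambda>s. complex_of_real s * u) \<longlongrightarrow> u) (at_left 1)" by (rule tendsto_eq_intros refl | simp)+
  show "\<forall>\<^sub>F s in at_left 1. complex_of_real s * u \<in> closure H"
    by (rule eventually_mono[OF eventually_at_left_real[of 0 "1::real", OF zero_less_one]])
      (use assms(2) closure_subset in auto)
qed auto

text \<open>The condition \<open>anticlockwise\<close> quantifies over points of the arcs, so it
  would be vacuous if one of them were empty.\<close>

lemma half_disk_boundary_arc_nonempty:
  assumes "half_disk H" shows "boundary_arc H \<noteq> {}"
proof -
  have in_disc: "of_real s * u \<in> disc" if "cmod u = 1" "0 < s" "s < 1" for s u using that by (simp add: norm_mult)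
  consider c r where "0 < r" "(cmod c)\<^sup>2 = 1 + r\<^sup>2" "H = disc \<inter> cball c r" | c r where "0 < r" "(cmod c)\<^sup>2 = 1 + r\<^sup>2" "H = disc - ball c r"
    | u where "cmod u = 1" "H = {z \<in> disc. 0 \<le> Re (cnj u * z)}"
    using assms(1) unfolding half_disk_def by blast
  then have "\<exists>u. cmod u = 1 \<and> u \<in> closure H"
  proof cases
    case 1
    have c1: "cmod c > 1" by (rule power_less_imp_less_base[of _ 2]) (use 1 in simp_all)
    then have c0: "c \<noteq> 0" by force
    let ?u = "c / of_real (cmod c)"
    have u: "cmod ?u = 1" using c0 by (simp add: norm_divide)
    have "?u \<in> closure H"
    proof (rule Lim_in_closed_set[where F = "at_left (1::real)" and f = "\<lambda>s. of_real s * ?u"])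
      show "((\<lambda>s. complex_of_real s * ?u) \<longlongrightarrow> ?u) (at_left 1)" by (rule tendsto_eq_intros refl | simp)+
      have "cmod c - 1 < r"
      proof (rule power_less_imp_less_base)
        show "(cmod c - 1)\<^sup>2 < r\<^sup>2" using 1 c1 by (simp add: power2_diff)
      qed (use 1 in simp)
      then have "\<forall>\<^sub>F s in at_left (1::real). s > cmod c - r"
        using eventually_at_left_real[of "cmod c - r" "1::real"] by (simp add: eventually_mono)
      then show "\<forall>\<^sub>F s in at_left 1. complex_of_real s * ?u \<in> closure H"
        using eventually_at_left_real[of 0 "1::real", OF zero_less_one]
      proof eventually_elim
        case (elim s)
        have "c - of_real s * ?u = of_real (cmod c - s) * ?u" using c1 by (auto simp: algebra_simps)
        then have "cmod (c - of_real s * ?u) = \<bar>cmod c - s\<bar> * cmod ?u" by (metis norm_mult norm_of_real)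
        also have "\<dots> = cmod c - s" unfolding u using elim c1 by simp
        finally have "of_real s * ?u \<in> cball c r" using elim by (simp add: dist_norm)
        moreover have "of_real s * ?u \<in> disc" using in_disc[OF u, of s] elim by simp
        ultimately have "of_real s * ?u \<in> H" unfolding 1(3) by (rule IntI[rotated])
        then show ?case using closure_subset[of H] by (rule rev_subsetD)
      qed
    qed auto
    then show ?thesis using u by blast
  next
    case 2
    have c1: "cmod c > r" by (rule power_less_imp_less_base[of _ 2]) (use 2 in simp_all)
    then have c0: "c \<noteq> 0" using 2 by auto
    let ?u = "- (c / of_real (cmod c))"
    have u: "cmod ?u = 1" using c0 by (simp add: norm_divide)
    have "of_real s * ?u \<in> H" if s: "0 < s" "s < 1" for s
    proof -
      have "c - of_real s * ?u = of_real (cmod c + s) * (c / of_real (cmod c))" using c0 by (auto simp: field_simps)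
      then have "cmod (c - of_real s * ?u) = \<bar>cmod c + s\<bar> * cmod (c / of_real (cmod c))" by (metis norm_mult norm_of_real)
      also have "\<dots> = cmod c + s" using u s by simp
      finally have "of_real s * ?u \<notin> ball c r" using s c1 by (simp add: dist_norm)
      then show ?thesis using 2 in_disc[OF u, of s] s by blast
    qed
    then show ?thesis using u sphere_point_in_closure[OF u] by blast
  next
    case 3
    have "of_real s * u \<in> H" if s: "0 < s" "s < 1" for s
    proof -
      have "cnj u * (of_real s * u) = of_real s * (u * cnj u)" by (simp add: mult_ac)
      also have "\<dots> = of_real s" using 3(1) by (simp add: complex_norm_square[symmetric])
      finally have e: "cnj u * (of_real s * u) = of_real s" .
      show ?thesis unfolding 3(2) mem_Collect_eq e using in_disc[OF 3(1) s] s by simp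
    qed
    then show ?thesis using 3 sphere_point_in_closure by blast
  qed
  then show ?thesis by (auto simp: boundary_arc_def)
qed

section \<open>Cyclic order of points of the four arcs\<close>

lemma orient_cis:
  "orient (cis x) (cis y) (cis z) = 4 * sin ((y - x) / 2) * sin ((z - y) / 2) * sin ((z - x) / 2)"
proof -
  have 1: "orient (cis x) (cis y) (cis z) = sin (y - x) + sin (z - y) + sin (x - z)"
    by (simp add: orient_def sin_diff algebra_simps)
  define p q where pq: "p = (y - x) / 2" "q = (z - y) / 2"
  have e: "(z - x) / 2 = p + q" "y - x = 2 * p" "z - y = 2 * q" "x - z = - (2 * (p + q))"
    by (auto simp: pq field_simps)
  have 2: "sin (2 * p) + sin (2 * q) - sin (2 * (p + q)) = 4 * sin p * sin q * sin (p + q)"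
  proof -
    have "sin (2 * p) + sin (2 * q) - sin (2 * (p + q)) = 2 * sin p * cos p + 2 * sin q * cos q
      - 2 * (sin p * cos q + cos p * sin q) * (cos p * cos q - sin p * sin q)"
      by (simp only: sin_double sin_add cos_add)
    also have "\<dots> = 2 * sin p * cos p * (1 - (cos q)\<^sup>2) + 2 * sin q * cos q * (1 - (cos p)\<^sup>2)
        + 2 * (sin p * cos q + cos p * sin q) * (sin p * sin q)"
      by (simp add: algebra_simps power2_eq_square)
    also have "\<dots> = 2 * sin p * cos p * (sin q)\<^sup>2 + 2 * sin q * cos q * (sin p)\<^sup>2
        + 2 * (sin p * cos q + cos p * sin q) * (sin p * sin q)"
      by (simp only: sin_squared_eq)
    also have "\<dots> = 4 * sin p * sin q * sin (p + q)"
      by (simp add: sin_add algebra_simps power2_eq_square)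
    finally show ?thesis .
  qed
  show ?thesis unfolding 1 pq[symmetric] e sin_minus using 2 by simp
qed

lemma orient_cis_pos:
  assumes "x < y" "y < z" "z < x + 2 * pi" shows "orient (cis x) (cis y) (cis z) > 0"
  unfolding orient_cis using assms by (intro mult_pos_pos sin_gt_zero) auto

text \<open>Anticlockwise order of the four arcs; \<open>cyc3\<close> is the corresponding sign of \<open>orient\<close>.\<close>

fun pos :: "letter \<Rightarrow> nat" where
  "pos Pos_a = 0" | "pos Neg_b = 1" | "pos Pos_b = 2" | "pos Neg_a = 3"

lemma UNIV_letter: "(UNIV :: letter set) = {Pos_a, Neg_a, Pos_b, Neg_b}"
  using letter.exhaust by auto

instance letter :: finite
  by standard (simp add: UNIV_letter)

definition cyc3 :: "letter \<Rightarrow> letter \<Rightarrow> letter \<Rightarrow> real" where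
  "cyc3 e f g = (if e = f \<or> f = g \<or> e = g then 0
     else if pos e < pos f \<and> pos f < pos g \<or> pos f < pos g \<and> pos g < pos e \<or> pos g < pos e \<and> pos e < pos f
     then 1 else -1)"

lemma bar_bar [simp]: "bar (bar e) = e" by (cases e) auto
lemma bar_neq [simp]: "bar e \<noteq> e" "e \<noteq> bar e" by (cases e; simp)+
lemma bar_eq_iff [simp]: "bar e = bar f \<longleftrightarrow> e = f" by (metis bar_bar)
definition reduced :: "(nat \<Rightarrow> letter) \<Rightarrow> bool" where
  "reduced f \<longleftrightarrow> (\<forall>n. f (Suc n) \<noteq> bar (f n))"

definition reduced_list :: "letter list \<Rightarrow> bool" where
  "reduced_list w \<longleftrightarrow> successively (\<lambda>e f. f \<noteq> bar e) w"

lemma word_map_append: "word_map a b (u @ v) = word_map a b u \<circ> word_map a b v"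
  by (induction u) (auto simp: o_assoc)

locale schottky =
  fixes a b :: "complex \<Rightarrow> complex" and D :: "letter \<Rightarrow> complex set"
  assumes schottky: "schottky_pants a b D"
begin

abbreviation "lm \<equiv> letter_map a b"
abbreviation "wm \<equiv> word_map a b"
abbreviation "lp \<equiv> limit_point a b"

lemma half_disk_D: "half_disk (D e)" and D_disjoint: "e \<noteq> f \<Longrightarrow> D e \<inter> D f = {}"
  using schottky unfolding schottky_pants_def by auto

lemma D_subset: "D e \<subseteq> disc" by (rule half_disk_subset[OF half_disk_D])

lemma disc_isom_a: "disc_isom a" "disc_isom b"
  using schottky hyperbolic_isometry_disc_isom unfolding schottky_pants_def by auto

lemma inv_into_isom:
  assumes "disc_isom f"
  shows "disc_isom (inv_into (cball 0 1) f)" "z \<in> cball 0 1 \<Longrightarrow> inv_into (cball 0 1) f (f z) = z"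
    "z \<in> cball 0 1 \<Longrightarrow> f (inv_into (cball 0 1) f z) = z"
proof -
  obtain g where g: "disc_isom g" "\<And>z. z \<in> cball 0 1 \<Longrightarrow> g (f z) = z" "\<And>z. z \<in> cball 0 1 \<Longrightarrow> f (g z) = z"
    using disc_isom_inverse[OF assms] by metis
  have eq: "inv_into (cball 0 1) f z = g z" if "z \<in> cball 0 1" for z
    by (rule inv_into_f_eq[OF disc_isom_inj[OF assms] disc_isom_in_cball[OF g(1) that] g(3)[OF that]])
  show "disc_isom (inv_into (cball 0 1) f)" by (rule disc_isom_cong[OF g(1)]) (simp add: eq)
  show "z \<in> cball 0 1 \<Longrightarrow> inv_into (cball 0 1) f (f z) = z" using inv_into_f_f disc_isom_inj[OF assms] by metis
  show "z \<in> cball 0 1 \<Longrightarrow> f (inv_into (cball 0 1) f z) = z" using eq g by simp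
qed

lemma lm_isom: "disc_isom (lm e)"
  by (cases e) (auto simp: disc_isom_a inv_into_isom)

lemma lm_bar: "z \<in> cball 0 1 \<Longrightarrow> lm (bar e) (lm e z) = z"
  by (cases e) (auto simp: inv_into_isom disc_isom_a)

lemma lm_bar': "z \<in> cball 0 1 \<Longrightarrow> lm e (lm (bar e) z) = z"
  using lm_bar[of z "bar e"] by simp

lemma lm_eq_iff: "z \<in> cball 0 1 \<Longrightarrow> w \<in> cball 0 1 \<Longrightarrow> lm e z = lm e w \<longleftrightarrow> z = w"
  using disc_isom_inj[OF lm_isom, of e] by (auto dest: inj_onD)

lemma D_cball: "z \<in> D e \<Longrightarrow> z \<in> cball 0 1"
  using D_subset[of e] by force

lemma wm_isom: "disc_isom (wm w)"
  by (induction w) (unfold word_map.simps, intro disc_isom_id, intro disc_isom_compose lm_isom)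

lemma lm_image_D: "lm Pos_a ` D Neg_a = disc - interior (D Pos_a)" "lm Pos_b ` D Neg_b = disc - interior (D Pos_b)"
  using schottky unfolding schottky_pants_def by auto

lemma lm_pos_image_D:
  assumes "e = Pos_a \<or> e = Pos_b" shows "lm e ` D (bar e) = disc - interior (D e)"
  using lm_image_D assms by auto

text \<open>The ping-pong step. The Schottky relation is given for the two generators only; for
  their inverses it has to be read backwards.\<close>

lemma lm_outside_D:
  assumes z: "z \<in> disc" "z \<notin> D (bar e)" shows "lm e z \<in> D e"
proof (cases "e = Pos_a \<or> e = Pos_b")
  case True
  have "lm e z \<notin> lm e ` D (bar e)"
  proof
    assume "lm e z \<in> lm e ` D (bar e)"
    then obtain y where y: "y \<in> D (bar e)" "lm e z = lm e y" by blast
    then have "z = y" using lm_eq_iff[of z y e] z D_cball by auto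
    then show False using y z by simp
  qed
  then have "lm e z \<in> interior (D e)" unfolding lm_pos_image_D[OF True] using disc_isom_in_disc[OF lm_isom z(1)] by blast
  then show ?thesis using interior_subset by blast
next
  case False
  then have e: "bar e = Pos_a \<or> bar e = Pos_b" by (cases e) auto
  have "z \<in> lm (bar e) ` D (bar (bar e))" unfolding lm_pos_image_D[OF e] using z interior_subset by blast
  then obtain y where y: "y \<in> D e" "z = lm (bar e) y" by auto
  then have "lm e z = y" using lm_bar'[of y e] D_subset[of e] by force
  then show ?thesis using y by simp
qed

text \<open>For an inverse letter the relation does not mention the boundary of \<open>D e\<close>.
  There the points of the disc mapped outside \<open>D (bar e)\<close> form an open set contained in
  \<open>D e\<close>, so no boundary point can be among them.\<close>

lemma lm_boundary_D:
  assumes q: "q \<in> D e" "q \<notin> interior (D e)" shows "lm (bar e) q \<in> D (bar e)"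
proof (cases "e = Pos_a \<or> e = Pos_b")
  case True
  have "q \<in> lm e ` D (bar e)" unfolding lm_pos_image_D[OF True] using q D_subset by blast
  then obtain y where y: "y \<in> D (bar e)" "q = lm e y" by auto
  then have "lm (bar e) q = y" using lm_bar[of y e] D_subset[of "bar e"] by force
  then show ?thesis using y by simp
next
  case False
  then have e: "bar e = Pos_a \<or> bar e = Pos_b" by (cases e) auto
  show ?thesis
  proof (rule ccontr)
    assume n: "lm (bar e) q \<notin> D (bar e)"
    let ?U = "{z \<in> disc. lm (bar e) z \<notin> D (bar e)}"
    have "?U = disc \<inter> lm (bar e) -` (- closure (D (bar e)))"
      using half_disk_closed[OF half_disk_D, of _ "bar e"] closure_subset[of "D (bar e)"] disc_isom_in_disc[OF lm_isom, of _ "bar e"] by blast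
    moreover have "continuous_on disc (lm (bar e))"
      by (rule continuous_on_subset[OF disc_isom_continuous[OF lm_isom]]) auto
    ultimately have "open ?U"
      using continuous_open_preimage[of disc "lm (bar e)" "- closure (D (bar e))"] by (simp add: open_Compl)
    moreover have "?U \<subseteq> D e"
    proof
      fix z assume z: "z \<in> ?U"
      then have "lm (bar e) z \<in> lm (bar e) ` D (bar (bar e))"
        unfolding lm_pos_image_D[OF e] using disc_isom_in_disc[OF lm_isom, of z "bar e"] interior_subset by blast
      then obtain y where y: "y \<in> D e" "lm (bar e) z = lm (bar e) y" by auto
      then have "z = y" using lm_eq_iff[of z y "bar e"] z D_cball by auto
      then show "z \<in> D e" using y by simp
    qed
    moreover have "q \<in> ?U" using n q D_subset by blast
    ultimately show False using q interior_maximal by blast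
  qed
qed

lemma lm_maps_D: "x \<noteq> bar e \<Longrightarrow> z \<in> D x \<Longrightarrow> lm e z \<in> D e"
  using lm_outside_D[of z e] D_disjoint[of x "bar e"] D_subset by blast

lemma D_nonempty: "D e \<noteq> {}"
  using half_disk_boundary_arc_nonempty[OF half_disk_D, of e] by (auto simp: boundary_arc_def)

text \<open>The disc is connected, so it is not a disjoint union of four nonempty relatively closed
  sets. The origin cannot serve as base point, as it may lie in one of the half-disks.\<close>

lemma ex_basepoint: obtains p where "p \<in> disc" "\<And>e. p \<notin> D e"
proof -
  have cl: "closedin (top_of_set disc) (D e)" for e
    unfolding closedin_closed using half_disk_closed[OF half_disk_D, of _ e] D_subset[of e] closure_subset[of "D e"]
    by (intro exI[of _ "closure (D e)"]) auto
  have "\<not> disc \<subseteq> (\<Union>e. D e)"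
  proof
    assume sub: "disc \<subseteq> (\<Union>e. D e)"
    have conn: "connected disc" by (simp add: convex_connected)
    have "disc \<subseteq> D Pos_a \<union> (D Neg_a \<union> D Pos_b \<union> D Neg_b)" using sub unfolding UNIV_letter by auto
    moreover have "closedin (top_of_set disc) (D Neg_a \<union> D Pos_b \<union> D Neg_b)" using cl by (intro closedin_Un)
    moreover have "D Pos_a \<inter> (D Neg_a \<union> D Pos_b \<union> D Neg_b) = {}" using D_disjoint by blast
    ultimately show False using conn cl[of Pos_a] D_nonempty[of Pos_a] D_nonempty[of Neg_a]
      unfolding connected_closedin by blast
  qed
  then show ?thesis using that by blast
qed

lemma boundary_points_ordered:
  assumes P: "\<And>e. P e \<in> boundary_arc (D e)"
  obtains t1 t2 t3 t4 where "t1 < t2" "t2 < t3" "t3 < t4" "t4 < t1 + 2 * pi"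
    "P Pos_a = cis t1" "P Neg_b = cis t2" "P Pos_b = cis t3" "P Neg_a = cis t4"
  using schottky P unfolding schottky_pants_def anticlockwise_def by metis

lemma orient_boundary:
  assumes P: "\<And>e. P e \<in> boundary_arc (D e)"
  shows "sgn (orient (P e) (P f) (P g)) = cyc3 e f g"
proof -
  obtain t1 t2 t3 t4 where t: "t1 < t2" "t2 < t3" "t3 < t4" "t4 < t1 + 2 * pi"
    "P Pos_a = cis t1" "P Neg_b = cis t2" "P Pos_b = cis t3" "P Neg_a = cis t4"
    using boundary_points_ordered[OF P] by metis
  have same: "orient x x y = 0" "orient x y x = 0" "orient y x x = 0" for x y
    by (auto simp: orient_def algebra_simps)
  have o: "orient (P Pos_a) (P Neg_b) (P Pos_b) > 0" "orient (P Pos_a) (P Neg_b) (P Neg_a) > 0"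
    "orient (P Pos_a) (P Pos_b) (P Neg_a) > 0" "orient (P Neg_b) (P Pos_b) (P Neg_a) > 0"
    using t by (auto intro!: orient_cis_pos)
  have r: "orient y z x = orient x y z" "orient z x y = orient x y z" "orient y x z = - orient x y z"
    "orient x z y = - orient x y z" "orient z y x = - orient x y z" for x y z
    by (auto simp: orient_def algebra_simps)
  note o1 = o(1) r[where x="P Pos_a" and y="P Neg_b" and z="P Pos_b"]
  note o2 = o(2) r[where x="P Pos_a" and y="P Neg_b" and z="P Neg_a"]
  note o3 = o(3) r[where x="P Pos_a" and y="P Pos_b" and z="P Neg_a"]
  note o4 = o(4) r[where x="P Neg_b" and y="P Pos_b" and z="P Neg_a"]
  show ?thesis
    by (cases e; cases f; cases g; simp add: cyc3_def same o1 o2 o3 o4)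
qed

text \<open>A common point could represent both arcs at once; with a point of a third arc its
  orientation would vanish, against the strict cyclic order.\<close>

lemma boundary_arcs_disjoint:
  assumes "e \<noteq> f" shows "boundary_arc (D e) \<inter> boundary_arc (D f) = {}"
proof (rule ccontr)
  assume "\<not> ?thesis"
  then obtain p where p: "p \<in> boundary_arc (D e)" "p \<in> boundary_arc (D f)" by blast
  have "\<forall>e. \<exists>p. p \<in> boundary_arc (D e)" using half_disk_boundary_arc_nonempty[OF half_disk_D] by blast
  then obtain P where P: "\<And>e. P e \<in> boundary_arc (D e)" by metis
  obtain g where g: "g \<noteq> e" "g \<noteq> f" using bar_neq by (metis letter.distinct)
  let ?P = "P(e := p, f := p)"
  have "?P h \<in> boundary_arc (D h)" for h using P p by auto
  from orient_boundary[of ?P e f g, OF this] have "cyc3 e f g = sgn (orient p p (P g))"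
    using g assms by simp
  moreover have "orient p p (P g) = 0" by (simp add: orient_def algebra_simps)
  moreover have "cyc3 e f g \<noteq> 0" using g assms by (simp add: cyc3_def)
  ultimately show False by simp
qed

text \<open>The closures are compact and disjoint, even on the unit circle, which gives a Euclidean
  gap; the hyperbolic distance dominates it. This gap is gained once per letter in
  \<open>hdist_word_growth\<close>.\<close>

lemma ex_gap:
  obtains \<delta> where "\<delta> > 0" "\<And>e f z w. e \<noteq> f \<Longrightarrow> z \<in> D e \<Longrightarrow> w \<in> D f \<Longrightarrow> \<delta> \<le> hdist z w"
proof -
  have "\<exists>\<eta>>0. \<forall>z\<in>D e. \<forall>w\<in>D f. \<eta> \<le> dist z w" if "e \<noteq> f" for e f
  proof -
    have sub: "closure (D e) \<subseteq> cball 0 1" for e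
      using closure_mono[OF D_subset] by simp
    have "compact (closure (D e))" using bounded_subset[OF _ sub] compact_closure
      by (metis bounded_subset bounded_cball closure_closed closed_closure compact_eq_bounded_closed sub)
    moreover have "closure (D e) \<inter> closure (D f) = {}"
    proof (rule ccontr)
      assume "\<not> ?thesis"
      then obtain z where z: "z \<in> closure (D e)" "z \<in> closure (D f)" by blast
      then have "cmod z \<le> 1" using sub[of e] by auto
      show False
      proof (cases "cmod z < 1")
        case True
        then have "z \<in> D e" "z \<in> D f" using half_disk_closed[OF half_disk_D] z by auto
        then show False using D_disjoint[OF that] by blast
      next
        case False
        then have "z \<in> boundary_arc (D e) \<inter> boundary_arc (D f)" using z \<open>cmod z \<le> 1\<close> by (simp add: boundary_arc_def)
        then show False using boundary_arcs_disjoint[OF that] by blast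
      qed
    qed
    ultimately obtain d where "0 < d" "\<forall>x\<in>closure (D e). \<forall>y\<in>closure (D f). d \<le> dist x y"
      using separate_compact_closed[of "closure (D e)" "closure (D f)"] by auto
    then show ?thesis using closure_subset by (intro exI[of _ d]) blast
  qed
  then obtain \<eta> where \<eta>: "\<And>e f. e \<noteq> f \<Longrightarrow> \<eta> e f > 0" "\<And>e f z w. e \<noteq> f \<Longrightarrow> z \<in> D e \<Longrightarrow> w \<in> D f \<Longrightarrow> \<eta> e f \<le> dist z w"
    by metis
  have fin: "finite {(e :: letter, f). e \<noteq> f}"  by simp
  define d where "d = Min ((\<lambda>(e, f). \<eta> e f) ` {(e, f). e \<noteq> f})"
  have ne: "{(e :: letter, f). e \<noteq> f} \<noteq> {}" using bar_neq by blast
  have "d > 0" unfolding d_def by (subst Min_gr_iff) (use fin ne \<eta>(1) in auto)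
  moreover have "d \<le> \<eta> e f" if "e \<noteq> f" for e f
    unfolding d_def by (rule Min_le) (use fin that in force)+
  ultimately have d: "d > 0" "\<And>e f. e \<noteq> f \<Longrightarrow> d \<le> \<eta> e f" by blast+
  show ?thesis
  \<comment> \<open>The denominators in \<open>hdist\<close> are at most 1; dropping them leaves
    this value.\<close>
  proof (rule that[of "arcosh (1 + 2 * d\<^sup>2)"])
    show "arcosh (1 + 2 * d\<^sup>2) > 0" using d(1) by simp
    fix e f z w assume ef: "e \<noteq> f" "z \<in> D e" "w \<in> D f"
    have zw: "z \<in> disc" "w \<in> disc" using ef D_subset by blast+
    have dl: "d \<le> cmod (z - w)" using d(2)[OF ef(1)] \<eta>(2)[OF ef] by (simp add: dist_norm)
    let ?p = "1 - (cmod z)\<^sup>2" and ?q = "1 - (cmod w)\<^sup>2"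
    have pq: "?p > 0" "?p \<le> 1" "?q > 0" "?q \<le> 1" using one_minus_norm_pos zw by auto
    then have m: "0 < ?p * ?q" "?p * ?q \<le> 1" by (auto intro: mult_le_one)
    have "d\<^sup>2 \<le> (cmod (z - w))\<^sup>2" using dl d(1) by (simp add: power_mono)
    also have "\<dots> \<le> (cmod (z - w))\<^sup>2 / (?p * ?q)" using m by (simp add: le_divide_eq mult_left_le)
    finally have "1 + 2 * d\<^sup>2 \<le> cosh (hdist z w)" unfolding cosh_hdist[OF zw] by simp
    then have "cosh (arcosh (1 + 2 * d\<^sup>2)) \<le> cosh (hdist z w)" by simp
    then show "arcosh (1 + 2 * d\<^sup>2) \<le> hdist z w"
      using cosh_real_nonneg_le_iff[of "arcosh (1 + 2 * d\<^sup>2)" "hdist z w"] hdist_nonneg[OF zw] by simp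
  qed
qed

section \<open>Linear growth of the hyperbolic distance along reduced words\<close>

lemma wm_maps_D:
  assumes "reduced_list (gs @ [e])" "z \<in> D e" shows "wm gs z \<in> D (hd (gs @ [e]))"
  using assms
proof (induction gs)
  case (Cons x gs)
  then have "reduced_list (gs @ [e])" and "hd (gs @ [e]) \<noteq> bar x"
    by (auto simp: reduced_list_def successively_Cons)
  then show ?case using Cons lm_maps_D[of "hd (gs @ [e])" x] by simp
qed simp

text \<open>The geodesic from \<open>p\<close> to the end point has to cross the boundary of the
  image of the last half-disk. The induction hypothesis bounds the part before this crossing, the
  gap \<delta> the part after it.\<close>

lemma hdist_word_growth:
  assumes p: "p \<in> disc" "\<And>e. p \<notin> D e"
    and gap: "\<And>e f z w. e \<noteq> f \<Longrightarrow> z \<in> D e \<Longrightarrow> w \<in> D f \<Longrightarrow> \<delta> \<le> hdist z w"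
    and "reduced_list (fs @ [x])" "z \<in> D x"
  shows "real (length fs) * \<delta> \<le> hdist p (wm fs z)"
  using assms(4,5)
proof (induction fs arbitrary: x z rule: rev_induct)
  case Nil
  then show ?case using hdist_nonneg[OF p(1), of z] D_subset[of x] by auto
next
  case (snoc e gs)
  have red: "reduced_list (gs @ [e])" and x: "x \<noteq> bar e"
    using snoc.prems(1) by (auto simp: reduced_list_def successively_append_iff)
  define y where "y = lm e z"
  have zd: "z \<in> disc" using snoc.prems D_subset by blast
  have y: "y \<in> D e" unfolding y_def using lm_maps_D[OF x snoc.prems(2)] .
  have yd: "y \<in> disc" using y D_subset by blast
  let ?w = "wm gs y"
  have wd: "?w \<in> disc" using disc_isom_in_disc[OF wm_isom yd] .
  obtain c where c: "unit_speed_geodesic c" "c 0 = p" "c (hdist p ?w) = ?w"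
    using ex_unit_speed_geodesic_between[OF p(1) wd] .
  define T where "T = hdist p ?w"
  have T: "T \<ge> 0" unfolding T_def by (rule hdist_nonneg[OF p(1) wd])
  obtain G where G: "disc_isom G" "\<And>z. z \<in> cball 0 1 \<Longrightarrow> G (wm gs z) = z" "\<And>z. z \<in> cball 0 1 \<Longrightarrow> wm gs (G z) = z"
    using disc_isom_inverse[OF wm_isom, of gs] by metis
  obtain f where f: "disc_isom f" "\<And>t. c t = f (of_real (tanh (t / 2)))"
    using unit_speed_geodesic_isom_tanh[OF c(1)] by metis
  have cd: "c t \<in> disc" for t using unit_speed_geodesic_in_disc[OF c(1)] .
  have "continuous_on UNIV c" unfolding f(2)[abs_def]
    by (rule continuous_on_compose2[OF disc_isom_continuous[OF f(1)] continuous_on_tanh_half]) (use real_tanh_in_disc in \<open>auto simp: less_imp_le\<close>)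
  then have "continuous_on UNIV (\<lambda>t. G (c t))"
    by (rule continuous_on_compose2[OF disc_isom_continuous[OF G(1)]]) (use cd in \<open>auto simp: less_imp_le\<close>)
  then have "connected ((\<lambda>t. G (c t)) ` {0..T})"
    by (intro connected_continuous_image) (auto intro: continuous_on_subset)
  moreover have "y \<in> (\<lambda>t. G (c t)) ` {0..T}"
    using T c(3) G(2)[of y] yd by (intro image_eqI[of _ _ T]) (auto simp: T_def)
  moreover have "G p \<in> (\<lambda>t. G (c t)) ` {0..T}" using T c(2) by (intro image_eqI[of _ _ 0]) auto
  \<comment> \<open>The word \<open>gs\<close> sends \<open>D e\<close> into a half-disk, and
    \<open>p\<close> lies in none. Hence the pulled-back path starts outside \<open>D e\<close> and
    ends inside.\<close>
  moreover have "G p \<notin> D e"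
  proof
    assume "G p \<in> D e"
    then have "wm gs (G p) \<in> D (hd (gs @ [e]))" by (rule wm_maps_D[OF red])
    then show False using p G(3)[of p] by simp
  qed
  ultimately obtain q where q: "q \<in> (\<lambda>t. G (c t)) ` {0..T}" "q \<in> frontier (D e)"
    using y connected_Int_frontier[of "(\<lambda>t. G (c t)) ` {0..T}" "D e"] by blast
  then obtain s where s: "0 \<le> s" "s \<le> T" "q = G (c s)" by auto
  have qd: "q \<in> disc" using s disc_isom_in_disc[OF G(1) cd] by simp
  have qD: "q \<in> D e" "q \<notin> interior (D e)"
    using q(2) half_disk_closed[OF half_disk_D, of q e] qd by (auto simp: frontier_def)
  have wq: "wm gs q = c s" using s(3) G(3)[of "c s"] cd[of s] by simp
  have "real (length gs) * \<delta> \<le> hdist p (c s)" using snoc.IH[OF red qD(1)] wq by simp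
  also have "hdist p (c s) = s" using c s unfolding unit_speed_geodesic_def by (metis abs_of_nonneg abs_minus_commute diff_zero)
  finally have 1: "real (length gs) * \<delta> \<le> s" .
  \<comment> \<open>After one more letter the remaining piece joins a point of
    \<open>D (bar e)\<close> to a point of \<open>D x\<close>, two different half-disks since the
    word is reduced.\<close>
  have "lm (bar e) q \<in> D (bar e)" using lm_boundary_D[OF qD] .
  then have "\<delta> \<le> hdist (lm (bar e) q) z" using gap[of "bar e" x] x snoc.prems(2) by auto
  also have "\<dots> = hdist (lm e (lm (bar e) q)) (lm e z)"
    using disc_isom_hdist[OF lm_isom disc_isom_in_disc[OF lm_isom qd] zd] by simp
  also have "\<dots> = hdist q y" using lm_bar'[of q e] qd by (simp add: y_def)
  also have "\<dots> = hdist (c s) ?w" using disc_isom_hdist[OF wm_isom qd yd, of gs] wq by simp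
  also have "\<dots> = T - s" using c s unfolding unit_speed_geodesic_def T_def by (metis T_def abs_of_nonneg abs_minus_commute diff_ge_0_iff_ge)
  finally have "real (length (gs @ [e])) * \<delta> \<le> T" using 1 by (simp add: algebra_simps)
  then show ?case by (simp add: T_def word_map_append y_def)
qed

end

section \<open>Limit points\<close>

lemma reduced_shift: "reduced f \<Longrightarrow> reduced (\<lambda>k. f (m + k))"
  unfolding reduced_def by (metis add_Suc_right)

lemma reduced_Suc: "reduced f \<Longrightarrow> reduced (\<lambda>k. f (Suc k))"
  unfolding reduced_def by blast

lemma reduced_list_map_upt: "reduced f \<Longrightarrow> reduced_list (map f [0..<m])"
proof (induction m arbitrary: f)
  case (Suc m)
  have "reduced_list (map (\<lambda>i. f (Suc i)) [0..<m])" using Suc.IH[OF reduced_Suc[OF Suc.prems]] .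
  moreover have "map (\<lambda>i. f (Suc i)) [0..<m] \<noteq> [] \<Longrightarrow> hd (map (\<lambda>i. f (Suc i)) [0..<m]) = f (Suc 0)"
    by (cases m) (simp_all add: map_upt_Suc del: upt_Suc)
  moreover have "f (Suc 0) \<noteq> bar (f 0)" using Suc.prems unfolding reduced_def by blast
  ultimately show ?case unfolding map_upt_Suc reduced_list_def successively_Cons by metis
qed (simp add: reduced_list_def)

lemma cosh_ge_half_exp: "exp (d :: real) / 2 \<le> cosh d"
  by (simp add: cosh_def scaleR_conv_of_real)

text \<open>The constant: the product of cosh with both factors is at most 1 + 2 * 4 = 9, and cosh
  is at least half of exp.\<close>

lemma one_minus_norm_le_exp:
  assumes "p \<in> disc" "u \<in> disc"
  shows "1 - (cmod u)\<^sup>2 \<le> 18 / (1 - (cmod p)\<^sup>2) * exp (- hdist p u)"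
proof -
  let ?A = "1 - (cmod p)\<^sup>2" and ?B = "1 - (cmod u)\<^sup>2"
  have pos: "?A > 0" "?B > 0" using one_minus_norm_pos assms by auto
  have "cmod (p - u) \<le> 2" using norm_triangle_ineq4[of p u] assms by simp
  then have "(cmod (p - u))\<^sup>2 \<le> 2\<^sup>2" by (intro power_mono) auto
  moreover have "?A * ?B \<le> 1" using pos by (intro mult_le_one) auto
  moreover have "cosh (hdist p u) * (?A * ?B) = ?A * ?B + 2 * (cmod (p - u))\<^sup>2"
  proof -
    have "(1 + x / P) * P = P + x" if "P \<noteq> 0" for x P :: real using that by (simp add: distrib_right)
    from this[of "?A * ?B"] show ?thesis unfolding cosh_hdist[OF assms] using pos by simp
  qed
  ultimately have "cosh (hdist p u) * (?A * ?B) \<le> 9" by simp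
  moreover have "exp (hdist p u) / 2 * (?A * ?B) \<le> cosh (hdist p u) * (?A * ?B)"
    using pos cosh_ge_half_exp by (intro mult_right_mono) auto
  ultimately have "exp (hdist p u) * ?A * ?B \<le> 18" by simp
  then show ?thesis using pos by (simp add: exp_minus field_simps)
qed

text \<open>The hyperbolic distance stays the same, so images near the unit circle must be close in
  the Euclidean sense.\<close>

lemma isom_diff_bound:
  assumes "disc_isom g" "u \<in> disc" "v \<in> disc"
  shows "(cmod (g u - g v))\<^sup>2 \<le> cosh (hdist u v) * ((1 - (cmod (g u))\<^sup>2) * (1 - (cmod (g v))\<^sup>2))"
proof -
  have d: "g u \<in> disc" "g v \<in> disc" using disc_isom_in_disc assms by auto
  have p: "(1 - (cmod (g u))\<^sup>2) * (1 - (cmod (g v))\<^sup>2) > 0" using one_minus_norm_pos d by simp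
  have "2 * (cmod (g u - g v))\<^sup>2 / ((1 - (cmod (g u))\<^sup>2) * (1 - (cmod (g v))\<^sup>2)) \<le> cosh (hdist u v)"
    using cosh_hdist[OF d] disc_isom_hdist[OF assms] by simp
  then have "2 * (cmod (g u - g v))\<^sup>2 \<le> cosh (hdist u v) * ((1 - (cmod (g u))\<^sup>2) * (1 - (cmod (g v))\<^sup>2))"
    using p by (simp add: divide_le_eq)
  then show ?thesis using zero_le_power2[of "cmod (g u - g v)"] by linarith
qed

lemma closed_curve_shift: "closed_curve a b (\<lambda>t. c (t + s)) T = closed_curve a b c T"
proof -
  have "(\<exists>r. f = (\<lambda>t. proj a b (c (t + r + s)))) \<longleftrightarrow> (\<exists>r. f = (\<lambda>t. proj a b (c (t + r))))" for f
    by (metis (no_types, opaque_lifting) add.assoc diff_add_cancel)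
  then show ?thesis unfolding closed_curve_def by auto
qed

context schottky
begin

text \<open>Linear growth makes the orbit of a base point outside all half-disks approach the circle
  geometrically, and its Euclidean steps become summable. Any other start, in particular the origin
  used in \<open>limit_point\<close>, stays at bounded hyperbolic distance from that orbit and has
  the same limit.\<close>

lemma orbit_converges:
  assumes f: "reduced f"
  shows "\<exists>\<xi>. cmod \<xi> = 1 \<and> (\<forall>z\<in>disc. (\<lambda>m. wm (map f [0..<m]) z) \<longlonglongrightarrow> \<xi>)"
proof -
  obtain p where p: "p \<in> disc" "\<And>e. p \<notin> D e" using ex_basepoint by metis
  obtain \<delta> where \<delta>: "\<delta> > 0" "\<And>e f z w. e \<noteq> f \<Longrightarrow> z \<in> D e \<Longrightarrow> w \<in> D f \<Longrightarrow> \<delta> \<le> hdist z w"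
    using ex_gap by metis
  define z where "z m = wm (map f [0..<m]) p" for m
  have zd: "z m \<in> disc" for m unfolding z_def by (rule disc_isom_in_disc[OF wm_isom p(1)])
  \<comment> \<open>The index is shifted because the last letter of the prefix is spent on moving
    \<open>p\<close> into a half-disk.\<close>
  have growth: "real m * \<delta> \<le> hdist p (z (Suc m))" for m
  proof -
    have "reduced_list (map f [0..<m] @ [f m])" using reduced_list_map_upt[OF f, of "Suc m"] by simp
    from hdist_word_growth[OF p \<delta>(2) this lm_outside_D[OF p(1) p(2)]] show ?thesis
      by (simp add: z_def word_map_append)
  qed
  define r where "r = exp (- \<delta>)"
  have r: "0 < r" "r < 1" using \<delta> by (auto simp: r_def)
  have A0: "1 - (cmod p)\<^sup>2 > 0" by (rule one_minus_norm_pos[OF p(1)])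
  define C where "C = 18 / (1 - (cmod p)\<^sup>2)"
  have C: "C > 0" using A0 by (simp add: C_def)
  have decay: "1 - (cmod (z (Suc m)))\<^sup>2 \<le> C * r ^ m" for m
  proof -
    have "1 - (cmod (z (Suc m)))\<^sup>2 \<le> C * exp (- hdist p (z (Suc m)))"
      unfolding C_def by (rule one_minus_norm_le_exp[OF p(1) zd])
    also have "\<dots> \<le> C * exp (- (real m * \<delta>))" using growth[of m] C by simp
    also have "exp (- (real m * \<delta>)) = r ^ m" unfolding r_def by (simp add: exp_of_nat_mult[symmetric])
    finally show ?thesis .
  qed
  define K where "K = (\<Sum>e\<in>UNIV. cosh (hdist p (lm e p)))"
  have K: "cosh (hdist p (lm e p)) \<le> K" for e
    unfolding K_def by (rule member_le_sum) (simp_all add: less_imp_le)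
  have K0: "K \<ge> 0" using K[of Pos_a] cosh_real_pos[of "hdist p (lm Pos_a p)"] by linarith
  have step: "cmod (z (Suc (Suc m)) - z (Suc m)) \<le> sqrt K * C * r ^ m" for m
  proof -
    let ?g = "wm (map f [0..<Suc m])"
    have zz: "z (Suc (Suc m)) = ?g (lm (f (Suc m)) p)" by (simp add: z_def word_map_append)
    have "(cmod (z (Suc m) - z (Suc (Suc m))))\<^sup>2 \<le> cosh (hdist p (lm (f (Suc m)) p)) * ((1 - (cmod (z (Suc m)))\<^sup>2) * (1 - (cmod (z (Suc (Suc m))))\<^sup>2))"
      using isom_diff_bound[OF wm_isom p(1) disc_isom_in_disc[OF lm_isom p(1)], of "map f [0..<Suc m]" "f (Suc m)"]
      unfolding zz by (simp only: z_def)
    also have "\<dots> \<le> K * ((C * r ^ m) * (C * r ^ m))"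
    proof (intro mult_mono K decay)
      have "C * r ^ Suc m \<le> C * r ^ m" using r C by (simp add: mult_left_le_one_le)
      then show "1 - (cmod (z (Suc (Suc m))))\<^sup>2 \<le> C * r ^ m" using decay[of "Suc m"] by linarith
    qed (use K0 C r one_minus_norm_pos[OF zd] in \<open>auto simp: less_imp_le\<close>)
    also have "\<dots> = (sqrt K * C * r ^ m)\<^sup>2" using K0 by (simp add: power_mult_distrib power2_eq_square)
    finally have "cmod (z (Suc m) - z (Suc (Suc m))) \<le> sqrt K * C * r ^ m"
      by (rule power2_le_imp_le) (use K0 C r in simp)
    then show ?thesis by (simp add: norm_minus_commute)
  qed
  have "summable (\<lambda>m. sqrt K * C * r ^ m)" using r by (intro summable_mult summable_geometric) auto
  then have "summable (\<lambda>m. z (Suc (Suc m)) - z (Suc m))"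
    by (rule summable_comparison_test'[where N = 0]) (use step in simp)
  then have "convergent (\<lambda>n. \<Sum>m<n. z (Suc (Suc m)) - z (Suc m))" by (simp add: summable_iff_convergent)
  then have "convergent (\<lambda>n. z (Suc n) - z (Suc 0))"
    using sum_lessThan_telescope[of "\<lambda>m. z (Suc m)"] by simp
  then obtain l where "(\<lambda>n. z (Suc n) - z (Suc 0)) \<longlonglongrightarrow> l" by (auto simp: convergent_def)
  from tendsto_add[OF this tendsto_const[of "z (Suc 0)"]]
  have "(\<lambda>n. z (Suc n)) \<longlonglongrightarrow> l + z (Suc 0)" by simp
  then obtain \<xi> where \<xi>: "(\<lambda>n. z (Suc n)) \<longlonglongrightarrow> \<xi>" by blast
  have rm: "(\<lambda>m. r ^ m) \<longlonglongrightarrow> 0" using r by (intro LIMSEQ_power_zero) auto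
  have limC: "(\<lambda>m. C * r ^ m) \<longlonglongrightarrow> 0" using tendsto_mult_left[OF rm, of C] by simp
  have lim0: "(\<lambda>m. 1 - (cmod (z (Suc m)))\<^sup>2) \<longlonglongrightarrow> 0"
  proof (rule tendsto_sandwich[OF _ _ tendsto_const limC])
    show "\<forall>\<^sub>F m in sequentially. 0 \<le> 1 - (cmod (z (Suc m)))\<^sup>2"
      using one_minus_norm_pos[OF zd] by (intro always_eventually allI less_imp_le)
    show "\<forall>\<^sub>F m in sequentially. 1 - (cmod (z (Suc m)))\<^sup>2 \<le> C * r ^ m"
      using decay by (intro always_eventually allI)
  qed
  have "(\<lambda>m. 1 - (cmod (z (Suc m)))\<^sup>2) \<longlonglongrightarrow> 1 - (cmod \<xi>)\<^sup>2" by (intro tendsto_intros \<xi>)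
  then have "1 - (cmod \<xi>)\<^sup>2 = 0" using lim0 LIMSEQ_unique by blast
  then have "cmod \<xi> = 1" by (simp add: power2_eq_1_iff) (smt (verit) norm_ge_zero)
  moreover have "(\<lambda>m. wm (map f [0..<m]) y) \<longlonglongrightarrow> \<xi>" if y: "y \<in> disc" for y
  proof -
    define w where "w m = wm (map f [0..<m]) y" for m
    have b: "(cmod (w (Suc m) - z (Suc m)))\<^sup>2 \<le> cosh (hdist y p) * (1 - (cmod (z (Suc m)))\<^sup>2)" for m
    proof -
      have "(cmod (w (Suc m) - z (Suc m)))\<^sup>2 \<le> cosh (hdist y p) * ((1 - (cmod (w (Suc m)))\<^sup>2) * (1 - (cmod (z (Suc m)))\<^sup>2))"
        unfolding w_def z_def by (rule isom_diff_bound[OF wm_isom y p(1)])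
      also have "\<dots> \<le> cosh (hdist y p) * (1 * (1 - (cmod (z (Suc m)))\<^sup>2))"
        by (intro mult_left_mono mult_right_mono) (use one_minus_norm_pos[OF zd] in \<open>auto simp: less_imp_le\<close>)
      finally show ?thesis by simp
    qed
    have "(\<lambda>m. (cmod (w (Suc m) - z (Suc m)))\<^sup>2) \<longlonglongrightarrow> 0"
    proof (rule tendsto_sandwich[OF _ _ tendsto_const])
      show "(\<lambda>m. cosh (hdist y p) * (1 - (cmod (z (Suc m)))\<^sup>2)) \<longlonglongrightarrow> 0"
        using tendsto_mult_left[OF lim0, of "cosh (hdist y p)"] by simp
      show "\<forall>\<^sub>F m in sequentially. (cmod (w (Suc m) - z (Suc m)))\<^sup>2 \<le> cosh (hdist y p) * (1 - (cmod (z (Suc m)))\<^sup>2)"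
        using b by (intro always_eventually allI)
    qed simp
    then have "(\<lambda>m. w (Suc m) - z (Suc m)) \<longlonglongrightarrow> 0"
      using tendsto_real_sqrt[of _ 0] by (fastforce simp: tendsto_norm_zero_iff)
    from tendsto_add[OF this \<xi>] have "(\<lambda>m. w (Suc m)) \<longlonglongrightarrow> \<xi>" by simp
    then show ?thesis unfolding w_def by (rule LIMSEQ_imp_Suc)
  qed
  ultimately show ?thesis by blast
qed

lemma lp_tendsto:
  assumes "reduced f" "z \<in> disc" shows "(\<lambda>m. wm (map f [0..<m]) z) \<longlonglongrightarrow> lp f"
proof -
  obtain \<xi> where \<xi>: "\<And>z. z \<in> disc \<Longrightarrow> (\<lambda>m. wm (map f [0..<m]) z) \<longlonglongrightarrow> \<xi>"
    using orbit_converges[OF assms(1)] by blast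
  have "lp f = \<xi>" unfolding limit_point_def by (rule limI[OF \<xi>]) simp
  then show ?thesis using \<xi>[OF assms(2)] by simp
qed

lemma lp_norm: assumes "reduced f" shows "cmod (lp f) = 1"
proof -
  obtain \<xi> where \<xi>: "cmod \<xi> = 1" "\<And>z. z \<in> disc \<Longrightarrow> (\<lambda>m. wm (map f [0..<m]) z) \<longlonglongrightarrow> \<xi>"
    using orbit_converges[OF assms(1)] by blast
  have "lp f = \<xi>" unfolding limit_point_def by (rule limI[OF \<xi>(2)]) simp
  then show ?thesis using \<xi> by simp
qed

lemma lp_cball: "reduced f \<Longrightarrow> lp f \<in> cball 0 1"
  using lp_norm by simp

lemma lp_arc: assumes "reduced f" shows "lp f \<in> boundary_arc (D (f 0))"
proof -
  obtain p where p: "p \<in> disc" "\<And>e. p \<notin> D e" using ex_basepoint by metis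
  have "wm (map f [0..<Suc m]) p \<in> D (f 0)" for m
  proof -
    have "reduced_list (map f [0..<m] @ [f m])" using reduced_list_map_upt[OF assms, of "Suc m"] by simp
    moreover have "hd (map f [0..<m] @ [f m]) = f 0"
      by (cases m) (simp_all add: map_upt_Suc del: upt_Suc)
    ultimately show ?thesis using wm_maps_D[OF _ lm_outside_D[OF p(1) p(2)], of "map f [0..<m]" "f m"]
      by (simp add: word_map_append)
  qed
  moreover have "(\<lambda>m. wm (map f [0..<Suc m]) p) \<longlonglongrightarrow> lp f"
    using LIMSEQ_Suc[OF lp_tendsto[OF assms p(1)]] .
  ultimately have "lp f \<in> closure (D (f 0))"
    using closure_subset by (intro Lim_in_closed_set[OF closed_closure _ _ \<open>_ \<longlonglongrightarrow> _\<close>]) (auto intro!: always_eventually)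
  then show ?thesis using lp_norm[OF assms] by (simp add: boundary_arc_def)
qed

lemma lp_step:
  assumes "reduced f" shows "lp f = lm (f 0) (lp (\<lambda>k. f (Suc k)))"
proof -
  have "(\<lambda>m. lm (f 0) (wm (map (\<lambda>k. f (Suc k)) [0..<m]) 0)) \<longlonglongrightarrow> lm (f 0) (lp (\<lambda>k. f (Suc k)))"
    by (rule disc_isom_tendsto[OF lm_isom lp_tendsto[OF reduced_Suc[OF assms]]])
      (use disc_isom_in_disc[OF wm_isom] lp_cball[OF reduced_Suc[OF assms]] in auto)
  moreover have "lm (f 0) (wm (map (\<lambda>k. f (Suc k)) [0..<m]) 0) = wm (map f [0..<Suc m]) 0" for m
    unfolding map_upt_Suc by simp
  ultimately have "(\<lambda>m. wm (map f [0..<Suc m]) 0) \<longlonglongrightarrow> lm (f 0) (lp (\<lambda>k. f (Suc k)))" by simp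
  moreover have "(\<lambda>m. wm (map f [0..<Suc m]) 0) \<longlonglongrightarrow> lp f"
    using LIMSEQ_Suc[OF lp_tendsto[OF assms, of 0]] by simp
  ultimately show ?thesis using LIMSEQ_unique by blast
qed

lemma lp_cons:
  assumes "reduced f" "f 0 \<noteq> bar e" shows "lm e (lp f) = lp (case_nat e f)"
proof -
  have "reduced (case_nat e f)" using assms unfolding reduced_def by (auto split: nat.split)
  from lp_step[OF this] show ?thesis by simp
qed

lemma lp_tail:
  assumes "reduced f" shows "lm (bar (f 0)) (lp f) = lp (\<lambda>k. f (Suc k))"
  using lp_step[OF assms] lm_bar[OF lp_cball[OF reduced_Suc[OF assms]], of "f 0"] by simp

lemma lp_unfold:
  assumes "reduced f" shows "lp f = wm (map f [0..<m]) (lp (\<lambda>k. f (m + k)))"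
  using assms
proof (induction m arbitrary: f)
  case (Suc m)
  show ?case using lp_step[OF Suc.prems] Suc.IH[OF reduced_Suc[OF Suc.prems]] unfolding map_upt_Suc by simp
qed simp

lemma lp_neq_first:
  assumes "reduced f" "reduced g" "f 0 \<noteq> g 0" shows "lp f \<noteq> lp g"
  using boundary_arcs_disjoint[OF assms(3)] lp_arc[OF assms(1)] lp_arc[OF assms(2)] by auto

text \<open>Different first letters give points of disjoint arcs; equal first letters can be
  stripped by the group.\<close>

lemma lp_inj:
  assumes "reduced f" "reduced g" "lp f = lp g" shows "f = g"
proof
  fix n show "f n = g n"
    using assms
  proof (induction n arbitrary: f g)
    case 0 then show ?case using lp_neq_first by blast
  next
    case (Suc n)
    have "f 0 = g 0" using lp_neq_first Suc.prems by blast
    then have "lp (\<lambda>k. f (Suc k)) = lp (\<lambda>k. g (Suc k))"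
      using lp_tail[OF Suc.prems(1)] lp_tail[OF Suc.prems(2)] Suc.prems(3) by simp
    from Suc.IH[OF reduced_Suc reduced_Suc this] Suc.prems show ?case by simp
  qed
qed

lemma orient_lp:
  assumes "reduced f" "reduced g" "reduced h" "f 0 \<noteq> g 0" "g 0 \<noteq> h 0" "f 0 \<noteq> h 0"
  shows "sgn (orient (lp f) (lp g) (lp h)) = cyc3 (f 0) (g 0) (h 0)"
proof -
  have "\<forall>e. \<exists>p. p \<in> boundary_arc (D e)" using half_disk_boundary_arc_nonempty[OF half_disk_D] by blast
  then obtain P where P: "\<And>e. P e \<in> boundary_arc (D e)" by metis
  let ?P = "P(f 0 := lp f, g 0 := lp g, h 0 := lp h)"
  have "?P e \<in> boundary_arc (D e)" for e using P lp_arc assms by simp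
  from orient_boundary[of ?P "f 0" "g 0" "h 0", OF this] show ?thesis using assms by simp
qed

text \<open>Applying a letter to an infinite reduced word changes only an initial segment of it.\<close>

lemma wm_lp_tail:
  assumes "reduced f"
  shows "\<exists>g k l. reduced g \<and> wm u (lp f) = lp g \<and> (\<forall>n. g (k + n) = f (l + n))"
proof (induction u)
  case Nil
  then show ?case using assms by (intro exI[of _ f] exI[of _ 0]) simp
next
  case (Cons e u)
  then obtain g k l where g: "reduced g" "wm u (lp f) = lp g" "\<And>n. g (k + n) = f (l + n)" by blast
  show ?case
  proof (cases "g 0 = bar e")
    case True
    have "lm e (lp g) = lp (\<lambda>n. g (Suc n))" using lp_tail[OF g(1)] True by simp
    moreover have "g (Suc (k + n)) = f (Suc l + n)" for n using g(3)[of "Suc n"] by simp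
    ultimately show ?thesis using g reduced_Suc[OF g(1)]
      by (intro exI[of _ "\<lambda>n. g (Suc n)"] exI[of _ k] exI[of _ "Suc l"]) simp
  next
    case False
    have "reduced (case_nat e g)" using g(1) False unfolding reduced_def by (auto split: nat.split)
    then show ?thesis using lp_cons[OF g(1) False] g
      by (intro exI[of _ "case_nat e g"] exI[of _ "Suc k"] exI[of _ l]) simp
  qed
qed

lemma wm_inverse: "z \<in> cball 0 1 \<Longrightarrow> wm (rev (map bar u)) (wm u z) = z"
proof (induction u)
  case (Cons e u)
  then show ?case using lm_bar[OF disc_isom_in_cball[OF wm_isom Cons.prems], of e u] by (simp add: word_map_append)
qed simp

lemma wm_inverse': "z \<in> cball 0 1 \<Longrightarrow> wm u (wm (rev (map bar u)) z) = z"
  using wm_inverse[of z "rev (map bar u)"] by (simp add: rev_map o_def)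

lemma proj_wm:
  assumes "z \<in> disc" shows "proj a b (wm u z) = proj a b z"
proof -
  have "wm v (wm u z) \<in> proj a b z" for v
    unfolding proj_def Gam_def by (auto simp: word_map_append intro!: exI[of _ "wm (v @ u)"])
  moreover have "wm v z \<in> proj a b (wm u z)" for v
    unfolding proj_def Gam_def using wm_inverse[of z u] assms
    by (auto simp: word_map_append intro!: exI[of _ "wm (v @ rev (map bar u))"])
  ultimately show ?thesis unfolding proj_def Gam_def by blast
qed

end

section \<open>Axes and codes\<close>

text \<open>The biinfinite periodic word. Integer positions make its past available and turn
  rotations of the word into translations.\<close>

definition per :: "letter list \<Rightarrow> int \<Rightarrow> letter" where
  "per w i = w ! nat (i mod int (length w))"

definition fwd :: "(int \<Rightarrow> letter) \<Rightarrow> int \<Rightarrow> nat \<Rightarrow> letter" where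
  "fwd g i k = g (i + int k)"

definition bwd :: "(int \<Rightarrow> letter) \<Rightarrow> int \<Rightarrow> nat \<Rightarrow> letter" where
  "bwd g i k = bar (g (i - 1 - int k))"

definition bireduced :: "(int \<Rightarrow> letter) \<Rightarrow> bool" where
  "bireduced g \<longleftrightarrow> (\<forall>i. g (i + 1) \<noteq> bar (g i))"

lemma reduced_fwd: "bireduced g \<Longrightarrow> reduced (fwd g i)"
  unfolding bireduced_def reduced_def fwd_def by (metis add.assoc of_nat_Suc add.commute)

lemma reduced_bwd: "bireduced g \<Longrightarrow> reduced (bwd g i)"
proof -
  assume g: "bireduced g"
  have "g (i - 1 - int n) \<noteq> bar (g (i - 1 - int (Suc n)))" for n
  proof -
    have "i - 1 - int (Suc n) + 1 = i - 1 - int n" by simp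
    then show ?thesis using g unfolding bireduced_def by metis
  qed
  then show ?thesis unfolding reduced_def bwd_def by (metis bar_bar)
qed

lemma fwd_neq_bwd: "bireduced g \<Longrightarrow> fwd g i 0 \<noteq> bwd g i 0"
  unfolding bireduced_def fwd_def bwd_def by (metis add.commute add_0 diff_add_cancel diff_zero of_nat_0)

lemma per_add_length: "per w (i + int (length w)) = per w i"
  by (simp add: per_def)

lemma per_mod: "i mod int (length w) = j mod int (length w) \<Longrightarrow> per w i = per w j"
  by (simp add: per_def)

lemma per_nth: "k < length w \<Longrightarrow> per w (int k) = w ! k"
  by (simp add: per_def)

lemma per_nat_mod: "per w (int k) = w ! (k mod length w)"
  by (simp add: per_def zmod_int[symmetric])

lemma bireduced_per:
  assumes "cyclically_reduced w" shows "bireduced (per w)"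
  unfolding bireduced_def
proof
  fix i :: int
  let ?L = "length w"
  have L: "?L > 0" using assms by (simp add: cyclically_reduced_def)
  define k where "k = nat (i mod int ?L)"
  have k: "int k = i mod int ?L" "k < ?L" using L by (auto simp: k_def nat_less_iff)
  have "per w (i + 1) = per w (int (k + 1))" by (rule per_mod) (simp add: k mod_simps add.commute)
  then have "per w (i + 1) = w ! ((k + 1) mod ?L)" by (simp only: per_nat_mod)
  moreover have "per w i = w ! k" by (simp add: per_def k_def)
  ultimately show "per w (i + 1) \<noteq> bar (per w i)"
    using assms k(2) unfolding cyclically_reduced_def by auto
qed

lemma map_fwd_per: "map (fwd (per w) 0) [0..<length w] = w"
  by (rule nth_equalityI) (auto simp: fwd_def per_nth)

lemma fwd_add_length: "fwd (per w) i (k + length w) = fwd (per w) i k"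
  using per_add_length[of w "i + int k"] by (simp add: fwd_def algebra_simps)

lemma cyclically_reduced_inverse:
  assumes "cyclically_reduced w" shows "cyclically_reduced (rev (map bar w))"
proof -
  let ?L = "length w"
  have L: "?L > 0" using assms by (simp add: cyclically_reduced_def)
  have "rev (map bar w) ! ((i + 1) mod ?L) \<noteq> bar (rev (map bar w) ! i)" if i: "i < ?L" for i
  proof (cases "i + 1 = ?L")
    case True
    have "w ! ((?L - 1 + 1) mod ?L) \<noteq> bar (w ! (?L - 1))"
      using assms L unfolding cyclically_reduced_def by (metis diff_less zero_less_one)
    then have "w ! 0 \<noteq> bar (w ! (?L - 1))" using L by simp
    then show ?thesis using True L i by (simp add: rev_nth)
  next
    case False
    define j where "j = ?L - Suc (Suc i)"
    have j: "j < ?L" "j + 1 < ?L" "Suc j = ?L - Suc i" using False i by (auto simp: j_def)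
    have "w ! ((j + 1) mod ?L) \<noteq> bar (w ! j)" using assms j unfolding cyclically_reduced_def by blast
    then have "w ! (?L - Suc i) \<noteq> bar (w ! j)" using j by simp
    then show ?thesis using False i by (simp add: rev_nth j_def)
  qed
  then show ?thesis using L by (simp add: cyclically_reduced_def)
qed

lemma bwd_per_inverse:
  assumes "w \<noteq> []" shows "bwd (per w) 0 = fwd (per (rev (map bar w))) 0"
proof
  fix k
  let ?L = "length w"
  have L: "?L > 0" using assms by simp
  have m: "k mod ?L < ?L" using L by simp
  have "per w (0 - 1 - int k) = per w (int (?L - Suc (k mod ?L)))"
  proof (rule per_mod)
    have "int (?L - Suc (k mod ?L)) = int ?L - 1 - int k mod int ?L" using m by (simp add: of_nat_diff zmod_int)
    then show "(0 - 1 - int k) mod int ?L = int (?L - Suc (k mod ?L)) mod int ?L"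
    proof -
      have e: "int ?L - 1 - int k = (0 - 1 - int k) + int ?L" by simp
      show ?thesis by (simp only: \<open>int (?L - Suc (k mod ?L)) = _\<close> mod_diff_right_eq e mod_add_self2)
    qed
  qed
  also have "\<dots> = w ! (?L - Suc (k mod ?L))" using L by (intro per_nth) simp
  finally show "bwd (per w) 0 k = fwd (per (rev (map bar w))) 0 k"
    using m by (simp add: bwd_def fwd_def per_nat_mod rev_nth)
qed

lemma lift_eq:
  "lift a b w i = (limit_point a b (bwd (per w) (int i)), limit_point a b (fwd (per w) (int i)))"
proof -
  have "(\<lambda>k. w ! ((i + k) mod length w)) = fwd (per w) (int i)"
    by (rule ext) (simp add: fwd_def per_nat_mod[symmetric])
  moreover have "(\<lambda>k. bar (w ! nat ((int i - 1 - int k) mod int (length w)))) = bwd (per w) (int i)"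
    by (rule ext) (simp add: bwd_def per_def)
  ultimately show ?thesis unfolding lift_def by simp
qed

context schottky
begin

lemma wm_power:
  "wm (map (fwd (per w) 0) [0..<n * length w]) z = (wm w ^^ n) z"
proof (induction n)
  case (Suc n)
  have "map (fwd (per w) 0) [0..<Suc n * length w] = w @ map (fwd (per w) 0) [0..<n * length w]"
  proof -
    have "[0..<Suc n * length w] = [0..<length w] @ map (\<lambda>k. k + length w) [0..<n * length w]"
      by (simp add: map_add_upt upt_add_eq_append[symmetric] add.commute)
    then show ?thesis by (simp add: map_fwd_per fwd_add_length o_def del: mult_Suc)
  qed
  then show ?case using Suc by (simp add: word_map_append del: mult_Suc)
qed simp

lemma power_tendsto:
  assumes "cyclically_reduced w" "z \<in> disc"
  shows "(\<lambda>n. (wm w ^^ n) z) \<longlonglongrightarrow> lp (fwd (per w) 0)"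
proof -
  have L: "length w > 0" using assms by (simp add: cyclically_reduced_def)
  have "strict_mono (\<lambda>n. n * length w)" using L by (simp add: strict_mono_def)
  from LIMSEQ_subseq_LIMSEQ[OF lp_tendsto[OF reduced_fwd[OF bireduced_per[OF assms(1)]] assms(2), of 0] this]
  show ?thesis by (simp add: o_def wm_power)
qed

lemma power_inverse_tendsto:
  assumes "cyclically_reduced w" "z \<in> disc"
  shows "(\<lambda>n. (wm (rev (map bar w)) ^^ n) z) \<longlonglongrightarrow> lp (bwd (per w) 0)"
  using power_tendsto[OF cyclically_reduced_inverse[OF assms(1)] assms(2)] bwd_per_inverse[of w] assms(1)
  by (simp add: cyclically_reduced_def)

definition axis :: "letter list \<Rightarrow> (real \<Rightarrow> complex) \<Rightarrow> real \<Rightarrow> bool" where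
  "axis w c T \<longleftrightarrow> unit_speed_geodesic c \<and> 0 < T \<and> (\<forall>t. wm w (c t) = c (t + T))"

lemma codes_iff: "codes a b w \<gamma> \<longleftrightarrow> cyclically_reduced w \<and> (\<exists>c T. axis w c T \<and> \<gamma> = closed_curve a b c T)"
  unfolding codes_def axis_def by blast

lemma axis_in_disc: "axis w c T \<Longrightarrow> c t \<in> disc"
  unfolding axis_def using unit_speed_geodesic_in_disc by blast

lemma axis_power: "axis w c T \<Longrightarrow> (wm w ^^ n) (c t) = c (t + real n * T)"
  by (induction n) (auto simp: axis_def algebra_simps)

lemma axis_inverse:
  assumes "axis w c T" shows "wm (rev (map bar w)) (c t) = c (t - T)"
proof -
  have "wm w (c (t - T)) = c t" using assms unfolding axis_def by (metis diff_add_cancel)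
  then show ?thesis using wm_inverse[of "c (t - T)" w] axis_in_disc[OF assms, of "t - T"] by (auto simp: less_imp_le)
qed

lemma axis_inverse_power: "axis w c T \<Longrightarrow> (wm (rev (map bar w)) ^^ n) (c t) = c (t - real n * T)"
  by (induction n) (auto simp: axis_inverse algebra_simps)

lemma axis_endpoints:
  assumes w: "cyclically_reduced w" and c: "axis w c T"
  obtains f where "disc_isom f" "\<And>t. c t = f (of_real (tanh (t / 2)))"
    "f 1 = lp (fwd (per w) 0)" "f (-1) = lp (bwd (per w) 0)"
proof -
  have T: "T > 0" "unit_speed_geodesic c" using c unfolding axis_def by auto
  obtain f where f: "disc_isom f" "\<And>t. c t = f (of_real (tanh (t / 2)))"
    using unit_speed_geodesic_isom_tanh[OF T(2)] by metis
  have up: "filterlim (\<lambda>n. 0 + real n * T) at_top sequentially" using T by real_asymp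
  have down: "filterlim (\<lambda>n. 0 - real n * T) at_bot sequentially" using T by real_asymp
  have "(\<lambda>n. c (0 + real n * T)) \<longlonglongrightarrow> f 1"
    unfolding f(2) by (rule filterlim_compose[OF isom_tanh_tendsto(1)[OF f(1)] up])
  moreover have "(\<lambda>n. c (0 + real n * T)) \<longlonglongrightarrow> lp (fwd (per w) 0)"
    unfolding axis_power[OF c, symmetric] by (rule power_tendsto[OF w axis_in_disc[OF c]])
  ultimately have 1: "f 1 = lp (fwd (per w) 0)" using LIMSEQ_unique by blast
  have "(\<lambda>n. c (0 - real n * T)) \<longlonglongrightarrow> f (-1)"
    unfolding f(2) by (rule filterlim_compose[OF isom_tanh_tendsto(2)[OF f(1)] down])
  moreover have "(\<lambda>n. c (0 - real n * T)) \<longlonglongrightarrow> lp (bwd (per w) 0)"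
    unfolding axis_inverse_power[OF c, symmetric] by (rule power_inverse_tendsto[OF w axis_in_disc[OF c]])
  ultimately have 2: "f (-1) = lp (bwd (per w) 0)" using LIMSEQ_unique by blast
  show ?thesis using that f 1 2 by blast
qed

section \<open>Existence and uniqueness of axes\<close>

lemma geodesic_inj: "unit_speed_geodesic c \<Longrightarrow> c s = c t \<Longrightarrow> s = t"
  unfolding unit_speed_geodesic_def using hdist_def by (metis abs_eq_0 diff_eq_diff_eq diff_self eq_iff_diff_eq_0)

text \<open>Both geodesics join the same two limit points, so they differ by a shift of the
  parameter, and comparing the translations along them gives equal periods.\<close>

lemma axis_unique:
  assumes w: "cyclically_reduced w" and c: "axis w c T" "axis w c' T'"
  shows "T' = T \<and> closed_curve a b c' T' = closed_curve a b c T"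
proof -
  obtain f where f: "disc_isom f" "\<And>t. c t = f (of_real (tanh (t / 2)))"
    "f 1 = lp (fwd (per w) 0)" "f (-1) = lp (bwd (per w) 0)" using axis_endpoints[OF w c(1)] by metis
  obtain f' where f': "disc_isom f'" "\<And>t. c' t = f' (of_real (tanh (t / 2)))"
    "f' 1 = lp (fwd (per w) 0)" "f' (-1) = lp (bwd (per w) 0)" using axis_endpoints[OF w c(2)] by metis
  obtain s where s: "\<And>t. f' (of_real (tanh (t / 2))) = f (of_real (tanh ((t + s) / 2)))"
    using geodesic_same_endpoints[OF f(1) f'(1)] f f' by metis
  then have cc: "c' t = c (t + s)" for t unfolding f(2) f'(2) by blast
  have "c (0 + T' + s) = wm w (c' 0)" using c(2) cc unfolding axis_def by metis
  also have "\<dots> = c (0 + s + T)" using c(1) cc unfolding axis_def by metis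
  finally have "T' = T" using geodesic_inj c(1) unfolding axis_def by fastforce
  moreover have "c' = (\<lambda>t. c (t + s))" using cc by blast
  ultimately show ?thesis using closed_curve_shift by metis
qed

lemma codes_unique: "codes a b w \<gamma> \<Longrightarrow> codes a b w \<gamma>' \<Longrightarrow> \<gamma> = \<gamma>'"
  unfolding codes_iff using axis_unique by metis

text \<open>Both periodic limit points are fixed by the isometry, which therefore maps the geodesic
  between them to a shift of itself.\<close>

lemma ex_axis:
  assumes w: "cyclically_reduced w" shows "\<exists>c T. axis w c T"
proof -
  let ?f = "fwd (per w) 0" and ?h = "bwd (per w) 0"
  have L: "length w > 0" using w by (simp add: cyclically_reduced_def)
  note bireduced_g = bireduced_per[OF w]
  note rf = reduced_fwd[OF bireduced_g, of 0] and rh = reduced_bwd[OF bireduced_g, of 0]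
  have ne: "lp ?h \<noteq> lp ?f" using lp_neq_first[OF rh rf] fwd_neq_bwd[OF bireduced_g, of 0] by metis
  have "(\<lambda>k. ?f (length w + k)) = ?f" by (rule ext) (metis add.commute fwd_add_length)
  then have Wf: "wm w (lp ?f) = lp ?f" using lp_unfold[OF rf, of "length w"] by (simp add: map_fwd_per)
  let ?w' = "rev (map bar w)"
  have h': "?h = fwd (per ?w') 0" using bwd_per_inverse L by blast
  have len': "length ?w' = length w" by simp
  have "(\<lambda>k. fwd (per ?w') 0 (length w + k)) = fwd (per ?w') 0"
    by (rule ext) (metis add.commute fwd_add_length len')
  moreover have "map (fwd (per ?w') 0) [0..<length w] = ?w'" using map_fwd_per[of ?w'] len' by simp
  ultimately have "lp ?h = wm ?w' (lp ?h)"
    using lp_unfold[OF rh, of "length w"] unfolding h' by simp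
  then have Wh: "wm w (lp ?h) = lp ?h" using wm_inverse'[OF lp_cball[OF rh], of w] by simp
  obtain f where f: "disc_isom f" "f (-1) = lp ?h" "f 1 = lp ?f"
    using ex_isom_endpoints[OF lp_norm[OF rh] lp_norm[OF rf] ne] .
  define c where "c t = f (of_real (tanh (t / 2)))" for t
  have c: "unit_speed_geodesic c"
    using unit_speed_geodesic_isom[OF f(1) unit_speed_geodesic_tanh] by (simp add: o_def c_def[abs_def])
  have "disc_isom (wm w \<circ> f)" by (rule disc_isom_compose[OF f(1) wm_isom])
  then obtain s where "\<And>t. (wm w \<circ> f) (of_real (tanh (t / 2))) = f (of_real (tanh ((t + s) / 2)))"
    using geodesic_same_endpoints[OF f(1), of "wm w \<circ> f"] f Wf Wh by (metis comp_apply)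
  then have s: "wm w (c t) = c (t + s)" for t by (simp add: c_def)
  have pw: "(wm w ^^ n) (c 0) = c (real n * s)" for n
    by (induction n) (simp_all add: s algebra_simps)
  have lim: "(\<lambda>n. c (real n * s)) \<longlonglongrightarrow> lp ?f"
    using power_tendsto[OF w unit_speed_geodesic_in_disc[OF c], of 0] unfolding pw .
  \<comment> \<open>The powers converge to the positive endpoint, which excludes rest and motion in
    the negative direction.\<close>
  have "s > 0"
  proof (rule ccontr)
    assume "\<not> s > 0"
    then consider "s = 0" | "s < 0" by linarith
    then show False
    proof cases
      case 1
      then have "lp ?f = c 0" using lim by (simp add: LIMSEQ_const_iff)
      then show False using lp_norm[OF rf] unit_speed_geodesic_in_disc[OF c, of 0] by simp
    next
      case 2
      then have "filterlim (\<lambda>n. real n * s) at_bot sequentially" by real_asymp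
      then have "(\<lambda>n. c (real n * s)) \<longlonglongrightarrow> f (-1)"
        unfolding c_def by (rule filterlim_compose[OF isom_tanh_tendsto(2)[OF f(1)]])
      then show False using lim LIMSEQ_unique f ne by metis
    qed
  qed
  then show ?thesis using c s unfolding axis_def by blast
qed

lemma codes_exists: "cyclically_reduced w \<Longrightarrow> \<exists>\<gamma>. codes a b w \<gamma>"
  unfolding codes_iff using ex_axis by blast

lemma codes_closed_geodesic: "codes a b w \<gamma> \<Longrightarrow> \<gamma> \<in> closed_geodesics a b"
  unfolding codes_iff closed_geodesics_def mem_Collect_eq
  using axis_in_disc proj_wm unfolding axis_def by metis

section \<open>A closed geodesic determines its word up to rotation\<close>

lemma cyclically_reduced_rotate1:
  assumes "cyclically_reduced w" shows "cyclically_reduced (rotate1 w)"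
proof -
  have "rotate1 w ! ((i + 1) mod length w) \<noteq> bar (rotate1 w ! i)" if "i < length w" for i
    using that assms[unfolded cyclically_reduced_def]
    by (simp add: nth_rotate1 mod_Suc_eq) (metis Suc_lessD mod_less_divisor length_greater_0_conv mod_Suc_eq)
  then show ?thesis using assms by (simp add: cyclically_reduced_def)
qed

lemma codes_rotate1:
  assumes "codes a b w \<gamma>" shows "codes a b (rotate1 w) \<gamma>"
proof -
  obtain c T where w: "cyclically_reduced w" and c: "axis w c T" and \<gamma>: "\<gamma> = closed_curve a b c T" using assms codes_iff by blast
  obtain e v where ev: "w = e # v" using w by (cases w) (auto simp: cyclically_reduced_def)
  let ?c = "\<lambda>t. lm (bar e) (c t)"
  have cd: "c t \<in> disc" for t by (rule axis_in_disc[OF c])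
  have u: "unit_speed_geodesic ?c" using unit_speed_geodesic_isom[OF lm_isom, of c "bar e"] c unfolding axis_def o_def by blast
  have "wm (rotate1 w) (?c t) = ?c (t + T)" for t
  proof -
    have 1: "lm e (?c t) = c t" using lm_bar'[of "c t" e] cd[of t] by auto
    have "lm e (wm v (c t)) = c (t + T)" using c ev unfolding axis_def by simp
    moreover have "wm v (c t) \<in> disc" using disc_isom_in_disc[OF wm_isom cd] .
    ultimately have "?c (t + T) = wm v (c t)" using lm_bar[of "wm v (c t)" e] by auto
    then show ?thesis using 1 by (simp add: ev word_map_append)
  qed
  then have "axis (rotate1 w) ?c T" using u c unfolding axis_def by blast
  moreover have "proj a b (?c t) = proj a b (c t)" for t using proj_wm[OF cd, of "[bar e]" t] by simp
  then have "\<gamma> = closed_curve a b ?c T" unfolding \<gamma> closed_curve_def by simp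
  ultimately show ?thesis unfolding codes_iff using cyclically_reduced_rotate1[OF w] by blast
qed

lemma codes_rotate: "codes a b w \<gamma> \<Longrightarrow> codes a b (rotate k w) \<gamma>"
  by (induction k) (simp_all add: codes_rotate1 rotate_Suc)

text \<open>Countability is what singles out one group element in
  \<open>same_curve_rotate\<close>.\<close>

lemma countable_Gam: "countable (Gam a b)"
  unfolding Gam_def by (rule countable_image) (rule countableI_type)

lemma fwd_rotate: "w \<noteq> [] \<Longrightarrow> fwd (per (rotate k w)) 0 n = fwd (per w) 0 (k + n)"
  by (simp add: fwd_def per_nat_mod nth_rotate mod_add_right_eq)
     (metis (no_types, opaque_lifting) mod_add_right_eq of_nat_add per_nat_mod)

text \<open>Equal curves have lifts matched by a single group element, which changes only an initial
  part of the endpoint word; hence the two periodic words have a common tail. A word and its powers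
  share all tails, so the equality of lengths has to come from the period stored in the closed
  curve.\<close>

lemma same_curve_rotate:
  assumes "codes a b w \<gamma>" "codes a b w' \<gamma>" shows "\<exists>k. w' = rotate k w"
proof -
  obtain c0 T where w: "cyclically_reduced w" and c0: "axis w c0 T" and \<gamma>: "\<gamma> = closed_curve a b c0 T"
    using assms(1) codes_iff by blast
  obtain c' T' where w': "cyclically_reduced w'" and c': "axis w' c' T'" and \<gamma>': "\<gamma> = closed_curve a b c' T'"
    using assms(2) codes_iff by blast
  have "(\<lambda>t. proj a b (c' (t + 0)), T') \<in> closed_curve a b c' T'" unfolding closed_curve_def by blast
  then have "(\<lambda>t. proj a b (c' t), T') \<in> closed_curve a b c0 T" using \<gamma> \<gamma>' by simp
  then obtain s where TT: "T' = T" and s: "\<And>t. proj a b (c' t) = proj a b (c0 (t + s))"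
    unfolding closed_curve_def by (auto dest: fun_cong)
  define c where "c t = c0 (t + s)" for t
  have c: "axis w c T" using c0 unit_speed_geodesic_shift[of c0 s] unfolding axis_def c_def by (auto simp: algebra_simps)
  have "\<exists>g\<in>Gam a b. c' t = g (c t)" for t
  proof -
    have "c' t \<in> proj a b (c' t)" unfolding proj_def Gam_def by (auto intro!: exI[of _ "wm []"] rangeI)
    then have "c' t \<in> proj a b (c t)" using s by (simp add: c_def)
    then show ?thesis unfolding proj_def by auto
  qed
  \<comment> \<open>There are uncountably many times but countably many group elements, so one
    element works at uncountably many times and then, by \<open>geodesics_agree\<close>, at all
    times.\<close>
  then have "UNIV = (\<Union>g\<in>Gam a b. {t. c' t = g (c t)})" by blast
  moreover have "uncountable (UNIV :: real set)" by (rule uncountable_UNIV_real)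
  ultimately have "\<exists>g\<in>Gam a b. uncountable {t. c' t = g (c t)}" using countable_Gam by (metis (no_types, lifting) countable_UN)
  then obtain u where u: "uncountable {t. c' t = wm u (c t)}" unfolding Gam_def by blast
  then obtain r where r: "c' r = wm u (c r)" by (metis (mono_tags, lifting) Collect_empty_eq countable_empty)
  have "\<not> {t. c' t = wm u (c t)} \<subseteq> {r}" using u countable_subset by blast
  then obtain r' where r': "c' r' = wm u (c r')" "r \<noteq> r'" by blast
  have uc: "unit_speed_geodesic (wm u \<circ> c)" using unit_speed_geodesic_isom[OF wm_isom] c unfolding axis_def by blast
  have eq: "c' = wm u \<circ> c"
    using geodesics_agree[OF _ uc r'(2)] c' r r' unfolding axis_def by simp
  obtain f where f: "disc_isom f" "\<And>t. c t = f (of_real (tanh (t / 2)))"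
    "f 1 = lp (fwd (per w) 0)" "f (-1) = lp (bwd (per w) 0)" using axis_endpoints[OF w c] by metis
  obtain f' where f': "disc_isom f'" "\<And>t. c' t = f' (of_real (tanh (t / 2)))"
    "f' 1 = lp (fwd (per w') 0)" "f' (-1) = lp (bwd (per w') 0)" using axis_endpoints[OF w' c'] by metis
  have "(c' \<longlongrightarrow> f' 1) at_top" unfolding f'(2)[abs_def] by (rule isom_tanh_tendsto(1)[OF f'(1)])
  moreover have "(c' \<longlongrightarrow> wm u (f 1)) at_top"
    unfolding eq o_def f(2) using isom_tanh_tendsto(1)[OF disc_isom_compose[OF f(1) wm_isom], of u] by simp
  ultimately have "f' 1 = wm u (f 1)" by (rule tendsto_unique[rotated]) simp
  then have lp': "lp (fwd (per w') 0) = wm u (lp (fwd (per w) 0))" using f f' by simp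
  note rf = reduced_fwd[OF bireduced_per[OF w], of 0] and rf' = reduced_fwd[OF bireduced_per[OF w'], of 0]
  obtain g k l where g: "reduced g" "wm u (lp (fwd (per w) 0)) = lp g" "\<And>n. g (k + n) = fwd (per w) 0 (l + n)"
    using wm_lp_tail[OF rf, of u] by blast
  have "g = fwd (per w') 0" using lp_inj[OF g(1) rf'] g(2) lp' by simp
  then have tail: "fwd (per w') 0 (k + n) = fwd (per w) 0 (l + n)" for n using g(3) by simp
  have wne: "w \<noteq> []" "w' \<noteq> []" using w w' by (auto simp: cyclically_reduced_def)
  \<comment> \<open>Rotation removes the initial parts in which the two expansions differ.\<close>
  define W where "W = rotate l w"
  define W' where "W' = rotate k w'"
  have Wc: "codes a b W \<gamma>" "codes a b W' \<gamma>" using codes_rotate assms by (auto simp: W_def W'_def)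
  have WW: "fwd (per W) 0 = fwd (per W') 0"
    using tail fwd_rotate wne by (auto simp: W_def W'_def)
  obtain d S where Wr: "cyclically_reduced W" and d: "axis W d S" using Wc codes_iff by blast
  obtain d' S' where Wr': "cyclically_reduced W'" and d': "axis W' d' S'" using Wc codes_iff by blast
  have SS: "S = T \<and> S' = T"
  proof -
    have "snd ` closed_curve a b c T = {T}" for c T unfolding closed_curve_def by force
    moreover have "\<gamma> = closed_curve a b d S" "\<gamma> = closed_curve a b d' S'"
      using codes_unique Wc Wr Wr' d d' codes_iff by blast+
    ultimately show ?thesis using \<gamma> by (metis singleton_inject)
  qed
  have T: "T > 0" using c unfolding axis_def by blast
  \<comment> \<open>Both sides spell the same prefix, of length \<open>length W * length W'\<close>,
    of the common expansion. Since both words translate by the same period, comparing the distances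
    travelled will give equal lengths.\<close>
  have pow: "(wm W ^^ length W') z = (wm W' ^^ length W) z" for z
    using wm_power[of W "length W'" z] wm_power[of W' "length W" z] WW by (simp add: mult.commute)
  obtain F where F: "disc_isom F" "\<And>t. d t = F (of_real (tanh (t / 2)))"
    "F 1 = lp (fwd (per W) 0)" "F (-1) = lp (bwd (per W) 0)" using axis_endpoints[OF Wr d] by metis
  have lenW: "length W > 0" "length W' > 0" using wne by (auto simp: W_def W'_def)
  have bw: "bwd (per W) 0 = bwd (per W') 0"
  proof
    fix n
    \<comment> \<open>A multiple of both lengths, large enough to move the negative position to a
      nonnegative one, where the forward expansions are known to agree.\<close>
    define N where "N = (n + 1) * (length W * length W')"
    have "length W * length W' \<ge> 1" using lenW by (simp add: Suc_le_eq)
    then have N: "N \<ge> n + 1" using mult_le_mono2[of 1 "length W * length W'" "n + 1"] by (simp add: N_def)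
    have m1: "per W (int (N - 1 - n)) = per W (0 - 1 - int n)"
      by (rule per_mod) (use N in \<open>simp add: of_nat_diff N_def mod_eq_dvd_iff algebra_simps\<close>)
    have m2: "per W' (int (N - 1 - n)) = per W' (0 - 1 - int n)"
      by (rule per_mod) (use N in \<open>simp add: of_nat_diff N_def mod_eq_dvd_iff algebra_simps\<close>)
    have "per W (int (N - 1 - n)) = per W' (int (N - 1 - n))" using fun_cong[OF WW, of "N - 1 - n"] by (simp add: fwd_def)
    then show "bwd (per W) 0 n = bwd (per W') 0 n" using m1 m2 by (simp add: bwd_def)
  qed
  obtain F' where F': "disc_isom F'" "\<And>t. d' t = F' (of_real (tanh (t / 2)))"
    "F' 1 = lp (fwd (per W') 0)" "F' (-1) = lp (bwd (per W') 0)" using axis_endpoints[OF Wr' d'] by metis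
  obtain q where "\<And>t. F' (of_real (tanh (t / 2))) = F (of_real (tanh ((t + q) / 2)))"
    using geodesic_same_endpoints[OF F(1) F'(1)] F F' WW bw by metis
  then have dd: "d' t = d (t + q)" for t unfolding F(2) F'(2) by blast
  have "d (0 + q + real (length W') * S) = (wm W ^^ length W') (d (0 + q))" using axis_power[OF d] by metis
  also have "\<dots> = (wm W' ^^ length W) (d' 0)" using pow dd by metis
  also have "\<dots> = d (0 + real (length W) * S' + q)" using axis_power[OF d'] dd by metis
  finally have "0 + q + real (length W') * S = 0 + real (length W) * S' + q"
    using geodesic_inj d unfolding axis_def by blast
  then have "length W' = length W" using SS T by simp
  then have "W = W'" using map_fwd_per WW by metis
  then have "rotate l w = rotate k w'" by (simp add: W_def W'_def)
  moreover have "rotate ((length w' - k mod length w') + k) w' = w'"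
  proof (rule rotate_id)
    have "k mod length w' \<le> length w'" using wne by (simp add: less_imp_le)
    then have "length w' - k mod length w' + k = length w' * Suc (k div length w')"
      using mult_div_mod_eq[of "length w'" k] unfolding mult_Suc_right by linarith
    then show "(length w' - k mod length w' + k) mod length w' = 0" by (simp only: mod_mult_self1_is_0)
  qed
  ultimately have "w' = rotate (length w' - k mod length w') (rotate l w)" by (simp add: rotate_rotate)
  then show ?thesis by (auto simp: rotate_rotate)
qed

end

section \<open>Classes of intersecting lifts\<close>

text \<open>The two pieces exchanged by the rotation commute, and commuting words are powers of a
  common word.\<close>

lemma rotation_invariant_not_primitive:
  assumes "0 < d" "d < length w" "rotate d w = w" shows "\<not> primitive_word w"
proof -
  have "rotate d w = drop d w @ take d w" using assms by (simp add: rotate_drop_take)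
  then have "take d w @ drop d w = drop d w @ take d w" using assms by simp
  then obtain m n zs where z: "concat (replicate m zs) = take d w" "concat (replicate n zs) = drop d w"
    using comm_append_are_replicate by metis
  have "take d w \<noteq> []" "drop d w \<noteq> []" using assms by auto
  then have "m \<noteq> 0" "n \<noteq> 0" using z by (metis concat.simps(1) replicate_0)+
  then have "2 \<le> m + n" by simp
  moreover have "w = concat (replicate (m + n) zs)" using z by (metis append_take_drop_id concat_append replicate_add)
  ultimately show ?thesis unfolding primitive_word_def by blast
qed

lemma eventually_periodic_per:
  assumes "\<And>n::nat. per w (i + int n) = per w (j + int n)" "w \<noteq> []"
  shows "per w (i + x) = per w (j + x)"
proof -
  let ?L = "length w"
  define n where "n = nat (x mod int ?L)"
  have n: "int n = x mod int ?L" using assms(2) by (simp add: n_def)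
  have "per w (y + x) = per w (y + int n)" for y by (rule per_mod) (simp add: n mod_simps)
  then show ?thesis using assms(1)[of n] by metis
qed

lemma primitive_period:
  assumes "primitive_word w" "\<And>n::nat. per w (i + int n) = per w (j + int n)"
  shows "i mod int (length w) = j mod int (length w)"
proof (rule ccontr)
  assume ne: "\<not> ?thesis"
  let ?L = "length w"
  have w: "w \<noteq> []" using assms(1) by (simp add: primitive_word_def)
  have p: "per w (i + x) = per w (j + x)" for x by (rule eventually_periodic_per[OF assms(2) w])
  define d where "d = nat ((j - i) mod int ?L)"
  have d: "int d = (j - i) mod int ?L" "d < ?L" using w by (auto simp: d_def nat_less_iff)
  have "d \<noteq> 0"
  proof
    assume "d = 0" then have "(j - i) mod int ?L = 0" using d by simp
    then have "j mod int ?L = i mod int ?L" by (metis mod_0_imp_dvd mod_eq_dvd_iff)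
    then show False using ne by simp
  qed
  moreover have "rotate d w = w"
  proof (rule nth_equalityI)
    fix k assume k: "k < length (rotate d w)"
    have "rotate d w ! k = per w (int (d + k))" using k by (simp add: nth_rotate per_nat_mod del: of_nat_add)
    also have "\<dots> = per w (j + (int k - i))" by (rule per_mod) (simp add: d mod_simps algebra_simps)
    also have "\<dots> = per w (i + (int k - i))" using p by metis
    also have "\<dots> = w ! k" using k per_nth[of k w] by simp
    finally show "rotate d w ! k = w ! k" .
  qed simp
  ultimately show False using rotation_invariant_not_primitive[of d w] d assms(1) by simp
qed

text \<open>The two indices meet in the middle, where a letter would be its own inverse or be
  followed by its inverse. Consequently no segment of the word is its own inverse.\<close>

lemma bireduced_not_palindromic:
  assumes g: "bireduced g" and "i < j"
  shows "\<exists>k::nat. int k < j - i \<and> g (i + int k) \<noteq> bar (g (j - 1 - int k))"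
proof -
  define k where "k = nat ((j - 1 - i) div 2)"
  have k: "int k = (j - 1 - i) div 2" using assms(2) by (simp add: k_def)
  have lt: "int k < j - i" using k assms(2) by linarith
  have "g (i + int k) \<noteq> bar (g (j - 1 - int k))"
  proof (cases "even (j - 1 - i)")
    case True
    then have "i + int k = j - 1 - int k" using k by (auto elim!: evenE)
    then show ?thesis by (metis bar_neq(2))
  next
    case False
    then obtain q where q: "j - 1 - i = 2 * q + 1" by (elim oddE)
    then have "int k = q" using k by simp
    then have "j - 1 - int k = i + int k + 1" using q by simp
    then show ?thesis using g unfolding bireduced_def by (metis bar_bar)
  qed
  then show ?thesis using lt by blast
qed

text \<open>A strand \<open>(i, \<sigma>)\<close> is the lift that enters the fundamental domain at position \<open>i\<close> of the
  biinfinite word, traversed forwards or backwards according to \<open>\<sigma>\<close>.\<close>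

definition ray :: "(int \<Rightarrow> letter) \<Rightarrow> int \<times> bool \<Rightarrow> nat \<Rightarrow> letter" where
  "ray g s = (if snd s then fwd g (fst s) else bwd g (fst s))"

definition flip :: "int \<times> bool \<Rightarrow> int \<times> bool" where
  "flip s = (fst s, \<not> snd s)"

definition step :: "nat \<Rightarrow> int \<times> bool \<Rightarrow> int \<times> bool" where
  "step n s = (if snd s then fst s + int n else fst s - int n, snd s)"

text \<open>The two sides through which the lift at position \<open>i\<close> crosses the boundary of the fundamental domain.\<close>

definition turn :: "(int \<Rightarrow> letter) \<Rightarrow> int \<Rightarrow> letter set" where
  "turn g i = {g i, bar (g (i - 1))}"

lemma step_0 [simp]: "step 0 s = s" by (simp add: step_def prod_eq_iff)
lemma step_step: "step m (step n s) = step (n + m) s" by (auto simp: step_def)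
lemma flip_flip [simp]: "flip (flip s) = s" by (simp add: flip_def)
lemma fst_flip [simp]: "fst (flip s) = fst s" by (simp add: flip_def)

lemma ray_step: "ray g (step n s) k = ray g s (n + k)"
  by (simp add: ray_def step_def fwd_def bwd_def algebra_simps)

lemma ray_flip_step: "ray g (flip (step (Suc 0) s)) = case_nat (bar (ray g s 0)) (ray g (flip s))"
  by (rule ext) (auto simp: ray_def step_def flip_def fwd_def bwd_def algebra_simps split: nat.split)

lemma ray_flip_step_0: "ray g (flip (step (Suc n) s)) 0 = bar (ray g s n)"
proof -
  have "step (Suc n) s = step (Suc 0) (step n s)" by (simp add: step_step)
  then show ?thesis using ray_flip_step[of g "step n s"] by (simp add: ray_step)
qed

lemma reduced_ray: "bireduced g \<Longrightarrow> reduced (ray g s)"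
  by (simp add: ray_def reduced_fwd reduced_bwd)

lemma ray_neq_flip: "bireduced g \<Longrightarrow> ray g s 0 \<noteq> ray g (flip s) 0"
  using fwd_neq_bwd[of g "fst s"] by (auto simp: ray_def flip_def)

lemma ray_Suc_neq: "bireduced g \<Longrightarrow> ray g s (Suc n) \<noteq> bar (ray g s n)"
  using reduced_ray[of g s] unfolding reduced_def by blast

lemma turn_strand: "turn g (fst s) = {ray g s 0, ray g (flip s) 0}"
  by (auto simp: turn_def ray_def flip_def fwd_def bwd_def)

lemma turn_shared_direction:
  assumes "d \<in> turn g i" obtains s where "fst s = i" "ray g s 0 = d"
proof -
  have "ray g (i, True) 0 = d \<or> ray g (i, False) 0 = d" using assms turn_strand[of g "(i, True)"] by (auto simp: flip_def)
  then show ?thesis using that by fastforce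
qed

lemma first_difference:
  assumes "f \<noteq> (h :: nat \<Rightarrow> 'a)" "f 0 = h 0"
  obtains n where "\<forall>k<Suc n. f k = h k" "f (Suc n) \<noteq> h (Suc n)"
proof -
  let ?P = "\<lambda>m. f m \<noteq> h m"
  have ex: "\<exists>m. ?P m" using assms(1) by blast
  define m where "m = (LEAST m. ?P m)"
  have m: "?P m" "\<And>k. k < m \<Longrightarrow> f k = h k"
    unfolding m_def using LeastI_ex[OF ex] not_less_Least by blast+
  then obtain n where "m = Suc n" using assms(2) by (cases m) auto
  then show ?thesis using that m by blast
qed

context schottky
begin

definition ends :: "(int \<Rightarrow> letter) \<Rightarrow> int \<times> bool \<Rightarrow> complex \<times> complex" where
  "ends g s = (lp (ray g (flip s)), lp (ray g s))"

lemma ends_step_1: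
  assumes "bireduced g"
  shows "ends g (step (Suc 0) s) = map_prod (lm (bar (ray g s 0))) (lm (bar (ray g s 0))) (ends g s)"
proof -
  have "ray g (step (Suc 0) s) = (\<lambda>k. ray g s (Suc k))" by (rule ext) (simp add: ray_step)
  moreover have "ray g (flip s) 0 \<noteq> bar (bar (ray g s 0))" using ray_neq_flip[OF assms, of s] by simp
  ultimately show ?thesis
    using lp_tail[OF reduced_ray[OF assms], of s] lp_cons[OF reduced_ray[OF assms], of "flip s" "bar (ray g s 0)"]
    by (simp add: ends_def ray_flip_step)
qed

lemma ends_step:
  assumes "bireduced g"
  shows "ends g (step n s) = map_prod (wm (rev (map bar (map (ray g s) [0..<n])))) (wm (rev (map bar (map (ray g s) [0..<n])))) (ends g s)"
proof (induction n)
  case 0 show ?case by (simp add: prod.map_id0[unfolded id_def] map_prod_def split: prod.split)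
next
  case (Suc n)
  have "ends g (step (Suc n) s) = ends g (step (Suc 0) (step n s))" by (simp add: step_step)
  also have "\<dots> = map_prod (lm (bar (ray g s n))) (lm (bar (ray g s n))) (ends g (step n s))"
    using ends_step_1[OF assms, of "step n s"] by (simp add: ray_step)
  finally show ?case unfolding Suc by (simp add: prod.map_comp[symmetric, unfolded o_def] map_prod_def split: prod.split)
qed

lemma ends_norm: "bireduced g \<Longrightarrow> cmod (fst (ends g s)) = 1" "bireduced g \<Longrightarrow> cmod (snd (ends g s)) = 1"
  by (simp_all add: ends_def lp_norm reduced_ray)

lemma separates_map_wm:
  assumes "bireduced g"
  shows "separates (map_prod (wm u) (wm u) (ends g s)) (map_prod (wm u) (wm u) (ends g t)) \<longleftrightarrow> separates (ends g s) (ends g t)"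
  using separates_isom[OF wm_isom, of "fst (ends g s)" "snd (ends g s)" "fst (ends g t)" "snd (ends g t)" u]
    ends_norm[OF assms] by (simp add: map_prod_def case_prod_beta)

lemma separates_flip:
  "separates (ends g (flip s)) q \<longleftrightarrow> separates (ends g s) q"
  "separates p (ends g (flip s)) \<longleftrightarrow> separates p (ends g s)"
  by (auto simp: separates_def ends_def orient_def algebra_simps)

lemma separates_step:
  assumes "bireduced g" "\<forall>k<n. ray g s k = ray g t k"
  shows "separates (ends g (step n s)) (ends g (step n t)) \<longleftrightarrow> separates (ends g s) (ends g t)"
proof -
  have "map (ray g s) [0..<n] = map (ray g t) [0..<n]" using assms(2) by simp
  then show ?thesis unfolding ends_step[OF assms(1)] using separates_map_wm[OF assms(1)] by metis
qed

text \<open>One orientation is read at the start of the common segment, the other at its end, after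
  translation along the segment. In each place the three endpoints concerned have distinct first
  letters, so the cyclic order of the arcs decides.\<close>

lemma separates_diverging_iff:
  assumes g: "bireduced g" and "ray g (flip s) 0 \<noteq> ray g (flip t) 0"
    and "\<forall>k<Suc n. ray g s k = ray g t k" "ray g s (Suc n) \<noteq> ray g t (Suc n)"
  shows "separates (ends g s) (ends g t) \<longleftrightarrow>
    cyc3 (ray g (flip s) 0) (ray g (flip t) 0) (ray g s 0) * cyc3 (bar (ray g s n)) (ray g t (Suc n)) (ray g s (Suc n)) < 0"
proof -
  let ?G = "wm (rev (map bar (map (ray g s) [0..<Suc n])))"
  note r = reduced_ray[OF g]
  have "map (ray g s) [0..<Suc n] = map (ray g t) [0..<Suc n]" using assms(3) by simp
  then have es: "ends g (step (Suc n) s) = map_prod ?G ?G (ends g s)" and et: "ends g (step (Suc n) t) = map_prod ?G ?G (ends g t)"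
    using ends_step[OF g, of "Suc n"] by metis+
  have "sgn (orient (lp (ray g (flip s))) (lp (ray g (flip t))) (lp (ray g s))) = cyc3 (ray g (flip s) 0) (ray g (flip t) 0) (ray g s 0)"
    by (rule orient_lp[OF r r r]) (use assms ray_neq_flip[OF g] in \<open>metis zero_less_Suc\<close>)+
  moreover have "sgn (orient (lp (ray g (flip s))) (lp (ray g t)) (lp (ray g s))) =
     sgn (orient (?G (lp (ray g (flip s)))) (?G (lp (ray g t))) (?G (lp (ray g s))))"
    by (rule orient_disc_isom_sgn[OF wm_isom, symmetric]) (simp_all add: lp_norm r)
  moreover have "\<dots> = sgn (orient (lp (ray g (flip (step (Suc n) s)))) (lp (ray g (step (Suc n) t))) (lp (ray g (step (Suc n) s))))"
    using es et by (simp add: ends_def)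
  moreover have "\<dots> = cyc3 (bar (ray g s n)) (ray g t (Suc n)) (ray g s (Suc n))"
  proof -
    have "ray g (step (Suc n) s) 0 = ray g s (Suc n)" "ray g (step (Suc n) t) 0 = ray g t (Suc n)" by (simp_all add: ray_step)
    moreover have "bar (ray g s n) \<noteq> ray g t (Suc n)" "bar (ray g s n) \<noteq> ray g s (Suc n)"
      using ray_Suc_neq[OF g] assms(3) by (metis lessI)+
    ultimately show ?thesis
      using orient_lp[OF r r r, of "flip (step (Suc n) s)" "step (Suc n) t" "step (Suc n) s"] assms(4)
      by (simp add: ray_flip_step_0)
  qed
  ultimately have "sgn (orient (lp (ray g (flip s))) (lp (ray g (flip t))) (lp (ray g s)) * orient (lp (ray g (flip s))) (lp (ray g t)) (lp (ray g s)))
    = cyc3 (ray g (flip s) 0) (ray g (flip t) 0) (ray g s 0) * cyc3 (bar (ray g s n)) (ray g t (Suc n)) (ray g s (Suc n))"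
    by (simp add: sgn_mult)
  then show ?thesis unfolding separates_def ends_def fst_conv snd_conv by (metis sgn_less)
qed

text \<open>The lifts cross exactly if their sides alternate around the fundamental domain. In the
  cyclic order of the arcs the opposite sides are \<open>Pos_a\<close>, \<open>Pos_b\<close> and
  \<open>Neg_b\<close>, \<open>Neg_a\<close>.\<close>

lemma separates_four_directions_iff:
  assumes g: "bireduced g" and "turn g (fst s) \<inter> turn g (fst t) = {}"
  shows "separates (ends g s) (ends g t) \<longleftrightarrow>
    turn g (fst s) = {Pos_a, Pos_b} \<and> turn g (fst t) = {Neg_a, Neg_b} \<or> turn g (fst s) = {Neg_a, Neg_b} \<and> turn g (fst t) = {Pos_a, Pos_b}"
proof -
  note r = reduced_ray[OF g]
  define x y x' y' where xy: "x = ray g (flip s) 0" "y = ray g s 0" "x' = ray g (flip t) 0" "y' = ray g t 0"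
  have ne: "x \<noteq> y" "x' \<noteq> y'" using ray_neq_flip[OF g] by (metis xy)+
  have dis: "x \<noteq> x'" "x \<noteq> y'" "y \<noteq> x'" "y \<noteq> y'" using assms(2) unfolding turn_strand xy by auto
  have "sgn (orient (lp (ray g (flip s))) (lp (ray g (flip t))) (lp (ray g s))) = cyc3 x x' y"
     "sgn (orient (lp (ray g (flip s))) (lp (ray g t)) (lp (ray g s))) = cyc3 x y' y"
    using orient_lp[OF r r r] ne dis unfolding xy by metis+
  then have "sgn (orient (lp (ray g (flip s))) (lp (ray g (flip t))) (lp (ray g s)) * orient (lp (ray g (flip s))) (lp (ray g t)) (lp (ray g s)))
    = cyc3 x x' y * cyc3 x y' y" by (simp add: sgn_mult)
  then have "separates (ends g s) (ends g t) \<longleftrightarrow> cyc3 x x' y * cyc3 x y' y < 0"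
    unfolding separates_def ends_def fst_conv snd_conv by (metis sgn_less)
  also have "\<dots> \<longleftrightarrow> {y, x} = {Pos_a, Pos_b} \<and> {y', x'} = {Neg_a, Neg_b} \<or> {y, x} = {Neg_a, Neg_b} \<and> {y', x'} = {Pos_a, Pos_b}"
    using ne dis by (cases x; cases y; cases x'; cases y'; simp add: cyc3_def doubleton_eq_iff)
  finally show ?thesis unfolding turn_strand xy .
qed

lemma wm_eq_iff: "z \<in> cball 0 1 \<Longrightarrow> y \<in> cball 0 1 \<Longrightarrow> wm u z = wm u y \<longleftrightarrow> z = y"
  using disc_isom_inj[OF wm_isom, of u] by (auto dest: inj_onD)

lemma wm_reduce:
  "\<exists>v. reduced_list v \<and> (\<forall>z\<in>cball 0 1. wm u z = wm v z)"
proof (induction u)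
  case Nil then show ?case by (intro exI[of _ "[]"]) (simp add: reduced_list_def)
next
  case (Cons e u)
  then obtain v where v: "reduced_list v" "\<And>z. z \<in> cball 0 1 \<Longrightarrow> wm u z = wm v z" by blast
  show ?case
  proof (cases "v \<noteq> [] \<and> hd v = bar e")
    case True
    then obtain v' where v': "v = bar e # v'" by (cases v) auto
    have "reduced_list v'" using v(1) v' by (cases v') (auto simp: reduced_list_def)
    moreover have "wm (e # u) z = wm v' z" if "z \<in> cball 0 1" for z
      using v(2)[OF that] v' lm_bar'[OF disc_isom_in_cball[OF wm_isom that], of e v'] by simp
    ultimately show ?thesis by blast
  next
    case False
    then have "reduced_list (e # v)" using v(1) by (cases v) (auto simp: reduced_list_def)
    then show ?thesis using v(2) by (intro exI[of _ "e # v"]) simp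
  qed
qed

text \<open>Used in \<open>rigid\<close> for both endpoints of a lift at once: without cancellation
  both images would begin with the same letter.\<close>

lemma wm_lp_no_cancel:
  assumes "reduced f" "reduced_list (v @ [e])" "f 0 \<noteq> bar e"
  shows "\<exists>h. reduced h \<and> wm (v @ [e]) (lp f) = lp h \<and> h 0 = hd (v @ [e])"
  using assms(2)
proof (induction v)
  case Nil
  have "reduced (case_nat e f)" using assms unfolding reduced_def by (auto split: nat.split)
  then show ?case using lp_cons[OF assms(1,3)] by (intro exI[of _ "case_nat e f"]) simp
next
  case (Cons x v)
  then have "reduced_list (v @ [e])" and hd: "hd (v @ [e]) \<noteq> bar x" by (auto simp: reduced_list_def successively_Cons)
  then obtain h where h: "reduced h" "wm (v @ [e]) (lp f) = lp h" "h 0 = hd (v @ [e])" using Cons by blast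
  have "reduced (case_nat x h)" using h hd unfolding reduced_def by (auto split: nat.split)
  then show ?case using lp_cons[OF h(1), of x] h hd by (intro exI[of _ "case_nat x h"]) simp
qed

end

locale primitive_geodesic = schottky +
  fixes w :: "letter list"
  assumes cyc_red: "cyclically_reduced w" and prim: "primitive_word w"
begin

abbreviation "g \<equiv> per w"
abbreviation "L \<equiv> length w"

lemma bireduced_g: "bireduced g" by (rule bireduced_per[OF cyc_red])
lemma w_ne: "w \<noteq> []" using cyc_red by (simp add: cyclically_reduced_def)

definition lf :: "int \<Rightarrow> complex \<times> complex" where "lf i = ends g (i, True)"

lemma lift_lf: "lift a b w i = lf (int i)"
  by (simp add: lift_eq lf_def ends_def ray_def flip_def)

lemma fwd_cong_mod: "i mod int L = j mod int L \<Longrightarrow> fwd g i = fwd g j"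
  by (rule ext) (auto simp: fwd_def intro!: per_mod mod_add_cong)

lemma bwd_cong_mod: "i mod int L = j mod int L \<Longrightarrow> bwd g i = bwd g j"
  by (rule ext) (auto simp: bwd_def intro!: per_mod mod_diff_cong)

text \<open>Otherwise a lift would be translated to its own reverse. Periodicity allows the second
  index to be moved to the right of the first, and the segment between them would be its own
  inverse.\<close>

lemma fwd_neq_bwd_all: "fwd g i \<noteq> bwd g j"
proof
  assume e: "fwd g i = bwd g j"
  define j' where "j' = j mod int L + int L * (1 + \<bar>i\<bar>)"
  have "j' mod int L = j mod int L" by (simp add: j'_def)
  then have e': "fwd g i = bwd g j'" using e bwd_cong_mod by metis
  have L1: "int L \<ge> 1" using w_ne by (simp add: Suc_le_eq)
  have "i < 1 * (1 + \<bar>i\<bar>)" by simp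
  also have "\<dots> \<le> int L * (1 + \<bar>i\<bar>)" using L1 by (intro mult_right_mono) auto
  also have "\<dots> \<le> j'" using w_ne by (simp add: j'_def)
  finally have "i < j'" .
  from bireduced_not_palindromic[OF bireduced_g this] obtain k where "g (i + int k) \<noteq> bar (g (j' - 1 - int k))" by blast
  then show False using fun_cong[OF e', of k] by (simp add: fwd_def bwd_def)
qed

lemma fwd_eq_iff: "fwd g i = fwd g j \<longleftrightarrow> i mod int L = j mod int L"
  using primitive_period[OF prim, of i j] fwd_cong_mod fun_cong[of "fwd g i" "fwd g j"] unfolding fwd_def by metis

lemma bwd_eq_iff: "bwd g i = bwd g j \<longleftrightarrow> i mod int L = j mod int L"
proof
  assume e: "bwd g i = bwd g j"
  have "per w (i + int n) = per w (j + int n)" for n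
  proof -
    \<comment> \<open>With this \<open>m\<close>, position x - 1 - m is congruent to x + n modulo
      \<open>L\<close>, which turns information on the past into information on the future.\<close>
    define m where "m = L * (n + 1) - (n + 1)"
    have le: "n + 1 \<le> L * (n + 1)" using w_ne by (cases w) simp_all
    have m: "int m = int L * (int n + 1) - (int n + 1)"
    proof -
      have "m + (n + 1) = L * (n + 1)" using le by (simp only: m_def le_add_diff_inverse2)
      then have "int (m + (n + 1)) = int (L * (n + 1))" by (simp only:)
      then show ?thesis by (simp only: of_nat_add of_nat_mult of_nat_1)
    qed
    have "per w (x + int n) = per w (x - 1 - int m)" for x
      by (rule per_mod) (simp add: m mod_eq_dvd_iff algebra_simps)
    moreover have "per w (i - 1 - int m) = per w (j - 1 - int m)" using fun_cong[OF e, of m] by (simp add: bwd_def)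
    ultimately show ?thesis by metis
  qed
  then show "i mod int L = j mod int L" by (rule primitive_period[OF prim])
qed (rule bwd_cong_mod)

lemma lf_eq_iff: "lf i = lf j \<longleftrightarrow> i mod int L = j mod int L"
proof
  assume "lf i = lf j"
  then have "lp (fwd g i) = lp (fwd g j)" by (simp add: lf_def ends_def ray_def)
  then have "fwd g i = fwd g j" using lp_inj reduced_fwd[OF bireduced_g] by blast
  then show "i mod int L = j mod int L" by (simp add: fwd_eq_iff)
next
  assume "i mod int L = j mod int L"
  then have "fwd g i = fwd g j" "bwd g i = bwd g j" by (simp_all add: fwd_eq_iff bwd_eq_iff)
  then show "lf i = lf j" by (simp add: lf_def ends_def ray_def flip_def)
qed

lemma lf_mod: "lf (i mod int L) = lf i" by (simp add: lf_eq_iff)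

lemma turn_cong: "lf i = lf j \<Longrightarrow> turn g i = turn g j"
proof -
  assume "lf i = lf j"
  then have "i mod int L = j mod int L" by (simp add: lf_eq_iff)
  then have "fwd g i 0 = fwd g j 0" "bwd g i 0 = bwd g j 0" using fwd_cong_mod bwd_cong_mod by metis+
  then show ?thesis by (simp add: turn_def fwd_def bwd_def)
qed

lemma ray_inj:
  assumes "lf (fst s) \<noteq> lf (fst t)" shows "ray g s \<noteq> ray g t"
  using assms fwd_neq_bwd_all[of "fst s" "fst t"] fwd_neq_bwd_all[of "fst t" "fst s"] unfolding lf_eq_iff ray_def
  by (auto simp: fwd_eq_iff bwd_eq_iff)

text \<open>Crossing does not depend on orientation, so each lift may be traversed in the direction
  that makes the common segment run forwards.\<close>

lemma separates_strands: "separates (ends g s) (ends g t) \<longleftrightarrow> separates (lf (fst s)) (lf (fst t))"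
proof -
  have "ends g s = lf (fst s) \<or> ends g s = ends g (flip (fst s, True))" for s
    by (cases s; cases "snd s") (auto simp: lf_def flip_def)
  then have "\<And>q. separates (ends g s) q \<longleftrightarrow> separates (lf (fst s)) q" "\<And>p. separates p (ends g s) \<longleftrightarrow> separates p (lf (fst s))" for s
    using separates_flip unfolding lf_def by metis+
  then show ?thesis by blast
qed

lemma lines_meet_iff:
  assumes "lf i \<noteq> lf j"
  shows "geodesic_line (lf i) \<inter> geodesic_line (lf j) \<noteq> {} \<longleftrightarrow> separates (lf i) (lf j)"
proof -
  have fb: "lp (bwd g i) \<noteq> lp (fwd g i)" for i using lp_inj[OF reduced_bwd[OF bireduced_g] reduced_fwd[OF bireduced_g]] fwd_neq_bwd_all by metis
  have "lp (bwd g i) \<noteq> lp (bwd g j)" using lp_inj[OF reduced_bwd[OF bireduced_g] reduced_bwd[OF bireduced_g]] assms unfolding lf_eq_iff bwd_eq_iff[symmetric] by metis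
  moreover have "lp (bwd g i) \<noteq> lp (fwd g j)" using lp_inj[OF reduced_bwd[OF bireduced_g] reduced_fwd[OF bireduced_g]] fwd_neq_bwd_all by metis
  ultimately show ?thesis unfolding lf_def ends_def ray_def flip_def
    using geodesic_lines_meet_iff[OF lp_norm[OF reduced_bwd[OF bireduced_g]] lp_norm[OF reduced_fwd[OF bireduced_g]] lp_norm[OF reduced_bwd[OF bireduced_g]] lp_norm[OF reduced_fwd[OF bireduced_g]] fb fb]
    by simp
qed

definition crossing_pairs :: "(complex \<times> complex) set set" where
  "crossing_pairs = {{lf i, lf j} | i j. lf i \<noteq> lf j \<and> separates (lf i) (lf j)}"

lemma intersecting_pairs_eq: "intersecting_pairs a b w = crossing_pairs"
proof (intro set_eqI iffI)
  fix X assume "X \<in> intersecting_pairs a b w"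
  then obtain i j where ij: "X = {lf (int i), lf (int j)}" "i < L" "j < L" "i \<noteq> j"
     "geodesic_line (lf (int i)) \<inter> geodesic_line (lf (int j)) \<noteq> {}"
    unfolding intersecting_pairs_def lift_lf by blast
  moreover have "lf (int i) \<noteq> lf (int j)" using ij by (simp add: lf_eq_iff zmod_int[symmetric])
  ultimately show "X \<in> crossing_pairs" unfolding crossing_pairs_def using lines_meet_iff by blast
next
  fix X assume "X \<in> crossing_pairs"
  then obtain i j where ij: "X = {lf i, lf j}" "lf i \<noteq> lf j" "separates (lf i) (lf j)" unfolding crossing_pairs_def by blast
  define i' where "i' = nat (i mod int L)" define j' where "j' = nat (j mod int L)"
  have L0: "int L > 0" using w_ne by simp
  have e: "lf (int i') = lf i" "lf (int j') = lf j" "i' < L" "j' < L"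
    using L0 lf_mod by (auto simp: i'_def j'_def nat_less_iff)
  moreover have "i' \<noteq> j'" using e ij by metis
  ultimately show "X \<in> intersecting_pairs a b w" unfolding intersecting_pairs_def lift_lf mem_Collect_eq
    using lines_meet_iff[OF ij(2)] ij by metis
qed

text \<open>Two crossing lifts share a segment of the tree of fundamental domains. If it is a single vertex,
  their class contains one element, which lies in \<open>four_way_pairs\<close>; otherwise exactly the
  two ends of the segment represent the class in \<open>end_pairs\<close>, while at inner vertices both
  directions agree.\<close>

definition four_way_pairs :: "(complex \<times> complex) set set" where
  "four_way_pairs = {{lf i, lf j} | i j. turn g i \<inter> turn g j = {} \<and> separates (lf i) (lf j)}"

definition end_pairs :: "(complex \<times> complex) set set" where
  "end_pairs = {{lf i, lf j} | i j. card (turn g i \<inter> turn g j) = 1 \<and> separates (lf i) (lf j)}"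

lemma turn_two: "card (turn g i) = 2"
  using ray_neq_flip[OF bireduced_g, of "(i, True)"] turn_strand[of g "(i, True)"] by simp

lemma four_way_pairs_subset: "four_way_pairs \<subseteq> crossing_pairs" and end_pairs_subset: "end_pairs \<subseteq> crossing_pairs"
proof -
  have "lf i \<noteq> lf j" if "turn g i \<inter> turn g j = {} \<or> card (turn g i \<inter> turn g j) = 1" for i j
    using that turn_cong[of i j] turn_two[of i] by auto
  then show "four_way_pairs \<subseteq> crossing_pairs" "end_pairs \<subseteq> crossing_pairs" unfolding four_way_pairs_def end_pairs_def crossing_pairs_def by blast+
qed

lemma finite_lf: "finite (range lf)"
proof (rule finite_subset)
  show "range lf \<subseteq> lf ` {0..<int L}" using w_ne lf_mod by (force intro!: image_eqI[of _ lf "_ mod int L"])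
qed simp

lemma finite_crossing_pairs: "finite crossing_pairs"
  by (rule finite_subset[of _ "Pow (range lf)"]) (auto simp: crossing_pairs_def finite_lf)

definition moved :: "letter list \<Rightarrow> (complex \<times> complex) set \<Rightarrow> (complex \<times> complex) set" where
  "moved u X = map_prod (wm u) (wm u) ` X"

lemma pair_equiv_iff: "(X, Y) \<in> pair_equiv a b w \<longleftrightarrow> X \<in> crossing_pairs \<and> Y \<in> crossing_pairs \<and> (\<exists>u. Y = moved u X)"
  unfolding pair_equiv_def intersecting_pairs_eq Gam_def moved_def by auto

lemma lf_cball: "fst (lf i) \<in> cball 0 1" "snd (lf i) \<in> cball 0 1"
  using ends_norm[OF bireduced_g, of "(i, True)"] by (simp_all add: lf_def)

lemma moved_append: "moved u (moved v X) = moved (u @ v) X"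
  unfolding moved_def by (simp add: image_image map_prod_def word_map_append case_prod_beta)

lemma moved_cong: "X \<in> crossing_pairs \<Longrightarrow> (\<And>z. z \<in> cball 0 1 \<Longrightarrow> wm u z = wm v z) \<Longrightarrow> moved u X = moved v X"
  unfolding moved_def crossing_pairs_def using lf_cball by (auto simp: map_prod_def case_prod_beta)

lemma equiv_pair_equiv: "equiv crossing_pairs (pair_equiv a b w)"
proof (rule equivI)
  show "pair_equiv a b w \<subseteq> crossing_pairs \<times> crossing_pairs" using pair_equiv_iff by auto
  have id: "moved [] X = X" for X unfolding moved_def by (simp add: map_prod_def)
  show "refl_on crossing_pairs (pair_equiv a b w)" by (rule refl_onI) (metis id pair_equiv_iff)
  show "sym (pair_equiv a b w)"
  proof (rule symI)
    fix X Y assume "(X, Y) \<in> pair_equiv a b w"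
    then obtain u where u: "X \<in> crossing_pairs" "Y \<in> crossing_pairs" "Y = moved u X" using pair_equiv_iff by blast
    have "moved (rev (map bar u)) Y = moved [] X" unfolding u(3) moved_append
      by (rule moved_cong[OF u(1)]) (simp add: word_map_append wm_inverse)
    then show "(Y, X) \<in> pair_equiv a b w" using u id pair_equiv_iff by metis
  qed
  show "trans (pair_equiv a b w)" by (rule transI) (metis moved_append pair_equiv_iff)
qed

lemma lf_step: "lf (fst (step n s)) = map_prod (wm (rev (map bar (map (ray g s) [0..<n])))) (wm (rev (map bar (map (ray g s) [0..<n])))) (lf (fst s))"
proof (cases "snd s")
  case True
  then have "s = (fst s, True)" "step n s = (fst (step n s), True)" by (auto simp: step_def prod_eq_iff)
  then show ?thesis using ends_step[OF bireduced_g, of n s] unfolding lf_def by metis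
next
  case False
  then have "s = flip (fst s, True)" "step n s = flip (fst (step n s), True)" by (auto simp: step_def flip_def prod_eq_iff)
  then have "ends g s = prod.swap (lf (fst s))" "ends g (step n s) = prod.swap (lf (fst (step n s)))"
    unfolding lf_def ends_def by (metis flip_flip swap_simp)+
  then show ?thesis using ends_step[OF bireduced_g, of n s] by (cases "lf (fst s)"; cases "lf (fst (step n s))") auto
qed

lemma step_equiv:
  assumes "separates (lf (fst s)) (lf (fst t))" "lf (fst s) \<noteq> lf (fst t)" "\<forall>k<n. ray g s k = ray g t k"
  shows "({lf (fst s), lf (fst t)}, {lf (fst (step n s)), lf (fst (step n t))}) \<in> pair_equiv a b w"
    "separates (lf (fst (step n s))) (lf (fst (step n t)))"
proof -
  let ?u = "rev (map bar (map (ray g s) [0..<n]))"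
  have u: "map (ray g s) [0..<n] = map (ray g t) [0..<n]" using assms(3) by simp
  have Y: "{lf (fst (step n s)), lf (fst (step n t))} = moved ?u {lf (fst s), lf (fst t)}"
    unfolding moved_def lf_step[of n s] lf_step[of n t] u by simp
  show sep: "separates (lf (fst (step n s))) (lf (fst (step n t)))"
    using separates_step[OF bireduced_g assms(3)] assms(1) unfolding separates_strands by blast
  have "lf (fst (step n s)) \<noteq> lf (fst (step n t))"
    using assms(2) unfolding lf_eq_iff
  proof -
    have "ray g (step n s) = ray g (step n t) \<Longrightarrow> ray g s = ray g t"
    proof (rule ext)
      fix k assume e: "ray g (step n s) = ray g (step n t)"
      show "ray g s k = ray g t k"
      proof (cases "k < n")
        case False then show ?thesis using fun_cong[OF e, of "k - n"] by (simp add: ray_step)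
      qed (use assms(3) in blast)
    qed
    then have "ray g (step n s) \<noteq> ray g (step n t)" using ray_inj[OF assms(2)] by blast
    moreover have "snd s = snd t \<or> snd s \<noteq> snd t" by blast
    moreover have "map_prod (wm ?u) (wm ?u) (lf (fst s)) \<noteq> map_prod (wm ?u) (wm ?u) (lf (fst t))"
    proof
      assume "map_prod (wm ?u) (wm ?u) (lf (fst s)) = map_prod (wm ?u) (wm ?u) (lf (fst t))"
      then have "fst (lf (fst s)) = fst (lf (fst t))" "snd (lf (fst s)) = snd (lf (fst t))"
        using wm_eq_iff[OF lf_cball(1) lf_cball(1)] wm_eq_iff[OF lf_cball(2) lf_cball(2)]
        by (simp_all only: map_prod_def case_prod_beta prod.inject)
      then show False using assms(2) by (simp add: prod_eq_iff)
    qed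
    ultimately show "fst (step n s) mod int L \<noteq> fst (step n t) mod int L"
      unfolding lf_eq_iff[symmetric] lf_step[of n s] lf_step[of n t] u by simp
  qed
  then show "({lf (fst s), lf (fst t)}, {lf (fst (step n s)), lf (fst (step n t))}) \<in> pair_equiv a b w"
    unfolding pair_equiv_iff using assms sep Y unfolding crossing_pairs_def by blast
qed

lemma shared_one_iff:
  assumes "ray g s 0 = ray g t 0"
  shows "card (turn g (fst s) \<inter> turn g (fst t)) = 1 \<longleftrightarrow> ray g (flip s) 0 \<noteq> ray g (flip t) 0"
proof (cases "ray g (flip s) 0 = ray g (flip t) 0")
  case True
  then show ?thesis using assms turn_two[of "fst t"] unfolding turn_strand by simp
next
  case False
  then have "turn g (fst s) \<inter> turn g (fst t) = {ray g s 0}"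
    using assms ray_neq_flip[OF bireduced_g, of s] ray_neq_flip[OF bireduced_g, of t] unfolding turn_strand by auto
  then show ?thesis using False by simp
qed

text \<open>Distinct lifts have distinct rays, so walking along the common direction must reach a
  place of divergence. Looked at backwards, the lifts share exactly one direction there.\<close>

lemma walk_to_end:
  assumes "separates (lf (fst s)) (lf (fst t))" "lf (fst s) \<noteq> lf (fst t)" "ray g s 0 = ray g t 0"
  obtains n where "\<forall>k<Suc n. ray g s k = ray g t k" "ray g s (Suc n) \<noteq> ray g t (Suc n)"
    "{lf (fst (step (Suc n) s)), lf (fst (step (Suc n) t))} \<in> end_pairs"
proof -
  obtain n where n: "\<forall>k<Suc n. ray g s k = ray g t k" "ray g s (Suc n) \<noteq> ray g t (Suc n)"
    using first_difference[OF ray_inj[OF assms(2)] assms(3)] by metis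
  let ?s = "flip (step (Suc n) s)" and ?t = "flip (step (Suc n) t)"
  have "ray g ?s 0 = ray g ?t 0" using n(1) by (simp add: ray_flip_step_0)
  moreover have "ray g (flip ?s) 0 \<noteq> ray g (flip ?t) 0" using n(2) by (simp add: ray_step)
  ultimately have "card (turn g (fst ?s) \<inter> turn g (fst ?t)) = 1" using shared_one_iff by blast
  then have "{lf (fst (step (Suc n) s)), lf (fst (step (Suc n) t))} \<in> end_pairs"
    unfolding end_pairs_def using step_equiv(2)[OF assms(1,2) n(1)] by auto
  then show ?thesis using that n by blast
qed

text \<open>The backward directions differ at the start and agree at the far end, which excludes
  equality unless the strands run in opposite senses and exchange their lifts. In that case the
  segment would be its own inverse.\<close>

lemma ends_distinct:
  assumes out: "ray g s 0 = ray g t 0" and bk: "ray g (flip s) 0 \<noteq> ray g (flip t) 0"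
    and n: "\<forall>k<Suc n. ray g s k = ray g t k" "ray g s (Suc n) \<noteq> ray g t (Suc n)"
  shows "{lf (fst (step (Suc n) s)), lf (fst (step (Suc n) t))} \<noteq> {lf (fst s), lf (fst t)}"
proof
  assume "{lf (fst (step (Suc n) s)), lf (fst (step (Suc n) t))} = {lf (fst s), lf (fst t)}"
  then consider (same) "lf (fst (step (Suc n) s)) = lf (fst s)" "lf (fst (step (Suc n) t)) = lf (fst t)"
    | (swap) "lf (fst (step (Suc n) s)) = lf (fst t)" "lf (fst (step (Suc n) t)) = lf (fst s)"
    by (auto simp: doubleton_eq_iff)
  then show False
  proof cases
    case same
    have bk': "ray g (flip (step (Suc n) s)) 0 = ray g (flip (step (Suc n) t)) 0" using n(1) by (simp add: ray_flip_step_0)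
    have "ray g (flip (step (Suc n) s)) = ray g (flip s)" if "lf (fst (step (Suc n) s)) = lf (fst s)" for s
      using that unfolding lf_eq_iff
      by (cases "snd s") (simp_all add: ray_def flip_def step_def fwd_eq_iff bwd_eq_iff del: of_nat_Suc)
    then show False using same bk bk' by simp
  next
    case swap
    show False
    proof (cases "snd s = snd t")
      case True
      have e: "ray g (flip (step (Suc n) s)) = ray g (flip t)" if "lf (fst (step (Suc n) s)) = lf (fst t)" "snd s = snd t" for s t
        using that unfolding lf_eq_iff
        by (cases "snd s") (simp_all add: ray_def flip_def step_def fwd_eq_iff bwd_eq_iff del: of_nat_Suc)
      have "ray g (flip t) 0 = ray g (flip s) 0"
        using e[OF swap(1) True] e[OF swap(2) True[symmetric]] n(1) by (metis lessI ray_flip_step_0)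
      then show False using bk by simp
    next
      case False
      have key: False if "snd s" "\<not> snd t" "\<forall>k<Suc n. ray g s k = ray g t k" "lf (fst (step (Suc n) s)) = lf (fst t)" for s t
      proof -
        define i where "i = fst s"
        have "bwd g (fst t) = bwd g (i + int (Suc n))" using that(1,4) unfolding lf_eq_iff bwd_eq_iff by (simp add: step_def i_def)
        then have eq: "\<forall>k<Suc n. fwd g i k = bwd g (i + int (Suc n)) k" using that unfolding ray_def i_def by simp
        obtain k where "int k < i + int (Suc n) - i" "g (i + int k) \<noteq> bar (g (i + int (Suc n) - 1 - int k))"
          using bireduced_not_palindromic[OF bireduced_g, of i "i + int (Suc n)"] by auto
        then show False using eq by (simp add: fwd_def bwd_def)
      qed
      show False
      proof (cases "snd s")
        case True then show False using key[of s t] False n swap by blast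
      next
        case f: False then show False using key[of t s] False n swap by metis
      qed
    qed
  qed
qed

text \<open>If the lifts share a direction, walk along it to one end of the common segment, then
  turn round and walk to the other end.\<close>

lemma class_upper:
  assumes "X \<in> crossing_pairs"
  shows "(\<exists>Y\<in>four_way_pairs. (X, Y) \<in> pair_equiv a b w) \<or> (\<exists>Y\<in>end_pairs. \<exists>Z\<in>end_pairs. Y \<noteq> Z \<and> (X, Y) \<in> pair_equiv a b w \<and> (X, Z) \<in> pair_equiv a b w)"
proof -
  obtain i j where X: "X = {lf i, lf j}" "lf i \<noteq> lf j" "separates (lf i) (lf j)" using assms unfolding crossing_pairs_def by blast
  show ?thesis
  proof (cases "turn g i \<inter> turn g j = {}")
    case True
    then have "X \<in> four_way_pairs" unfolding four_way_pairs_def using X by blast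
    moreover have "(X, X) \<in> pair_equiv a b w" using equiv_pair_equiv assms by (meson equivE refl_onD)
    ultimately show ?thesis by blast
  next
    case False
    then obtain d where "d \<in> turn g i" "d \<in> turn g j" by blast
    then obtain s t where st: "fst s = i" "fst t = j" "ray g s 0 = ray g t 0" by (metis turn_shared_direction)
    have X': "separates (lf (fst s)) (lf (fst t))" "lf (fst s) \<noteq> lf (fst t)" using X st by auto
    obtain n where n: "\<forall>k<Suc n. ray g s k = ray g t k" "ray g s (Suc n) \<noteq> ray g t (Suc n)"
       "{lf (fst (step (Suc n) s)), lf (fst (step (Suc n) t))} \<in> end_pairs"
      using walk_to_end[OF X' st(3)] .
    let ?s = "flip (step (Suc n) s)" and ?t = "flip (step (Suc n) t)"
    let ?Y = "{lf (fst ?s), lf (fst ?t)}"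
    have XY: "(X, ?Y) \<in> pair_equiv a b w" using step_equiv(1)[OF X' n(1)] X st by simp
    have o: "ray g ?s 0 = ray g ?t 0" using n(1) by (simp add: ray_flip_step_0)
    have bk: "ray g (flip ?s) 0 \<noteq> ray g (flip ?t) 0" using n(2) by (simp add: ray_step)
    have sep: "separates (lf (fst ?s)) (lf (fst ?t))" using step_equiv(2)[OF X' n(1)] by simp
    have "ray g (flip ?s) \<noteq> ray g (flip ?t)" using bk by metis
    have ne: "lf (fst ?s) \<noteq> lf (fst ?t)"
    proof
      assume "lf (fst ?s) = lf (fst ?t)"
      then have "turn g (fst ?s) = turn g (fst ?t)" by (rule turn_cong)
      then have "card (turn g (fst ?s) \<inter> turn g (fst ?t)) = 2" using turn_two by simp
      then show False using shared_one_iff[OF o] bk by simp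
    qed
    obtain m where m: "\<forall>k<Suc m. ray g ?s k = ray g ?t k" "ray g ?s (Suc m) \<noteq> ray g ?t (Suc m)"
       "{lf (fst (step (Suc m) ?s)), lf (fst (step (Suc m) ?t))} \<in> end_pairs"
      using walk_to_end[OF sep ne o] .
    let ?Z = "{lf (fst (step (Suc m) ?s)), lf (fst (step (Suc m) ?t))}"
    have "(?Y, ?Z) \<in> pair_equiv a b w" using step_equiv(1)[OF sep ne m(1)] .
    then have XZ: "(X, ?Z) \<in> pair_equiv a b w" using XY equiv_pair_equiv by (meson equivE transD)
    have ne': "?Y \<noteq> ?Z" using ends_distinct[OF o bk m(1,2)] by (rule not_sym)
    have "?Y \<in> end_pairs" using n(3) by simp
    then show ?thesis using XY XZ ne' m(3) by (intro disjI2 bexI[of _ ?Y] bexI[of _ ?Z] conjI)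
  qed
qed

text \<open>If the last letter of \<open>u\<close> did not undo a step along the lift, nothing would
  cancel and both endpoints of the image would begin with the first letter of \<open>u\<close>. The
  endpoints of a lift through the fundamental domain have different first letters, so every letter
  of \<open>u\<close> has to follow the lift; being reduced, \<open>u\<close> never turns
  back.\<close>

lemma rigid:
  assumes "reduced_list u" "u \<noteq> []" "map_prod (wm u) (wm u) (lf i) = lf i'"
  shows "\<exists>s. fst s = i \<and> u = rev (map bar (map (ray g s) [0..<length u])) \<and> lf i' = lf (fst (step (length u) s))"
  using assms
proof (induction u arbitrary: i rule: rev_induct)
  case (snoc e v)
  show ?case
  proof (cases "bar e \<in> turn g i")
    case False
    then have "fwd g i 0 \<noteq> bar e" "bwd g i 0 \<noteq> bar e" unfolding turn_def fwd_def bwd_def by auto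
    then obtain h h' where h: "reduced h" "wm (v @ [e]) (lp (fwd g i)) = lp h" "h 0 = hd (v @ [e])"
       "reduced h'" "wm (v @ [e]) (lp (bwd g i)) = lp h'" "h' 0 = hd (v @ [e])"
      using wm_lp_no_cancel[OF reduced_fwd[OF bireduced_g] snoc.prems(1)] wm_lp_no_cancel[OF reduced_bwd[OF bireduced_g] snoc.prems(1)] by metis
    have "lp h = lp (fwd g i')" "lp h' = lp (bwd g i')"
      using snoc.prems(3) h by (auto simp: lf_def ends_def ray_def flip_def simp del: word_map.simps)
    then have "h = fwd g i'" "h' = bwd g i'" using lp_inj h reduced_fwd[OF bireduced_g] reduced_bwd[OF bireduced_g] by blast+
    then show ?thesis using h fwd_neq_bwd[OF bireduced_g, of i'] by simp
  next
    case True
    then obtain s where s: "fst s = i" "ray g s 0 = bar e" using turn_shared_direction by metis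
    define s1 where "s1 = step (Suc 0) s"
    have l1: "lf (fst s1) = map_prod (lm e) (lm e) (lf i)" using lf_step[of "Suc 0" s] s by (simp add: s1_def)
    have "map_prod (wm v) (wm v) (lf (fst s1)) = lf i'"
      using snoc.prems(3) unfolding l1 by (cases "lf i") (simp add: word_map_append)
    show ?thesis
    proof (cases "v = []")
      case True
      then show ?thesis using s \<open>map_prod (wm v) (wm v) (lf (fst s1)) = lf i'\<close>
        by (intro exI[of _ s]) (cases "lf (fst s1)", simp add: s1_def)
    next
      case False
      have rv: "reduced_list v" and ev: "e \<noteq> bar (last v)"
        using snoc.prems(1) False by (auto simp: reduced_list_def successively_append_iff)
      obtain s2 where s2: "fst s2 = fst s1" "v = rev (map bar (map (ray g s2) [0..<length v]))" "lf i' = lf (fst (step (length v) s2))"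
        using snoc.IH[OF rv False \<open>map_prod (wm v) (wm v) (lf (fst s1)) = lf i'\<close>] by blast
      obtain m where m: "length v = Suc m" using False by (cases v) auto
      have "v = rev (map bar (map (ray g s2) [0..<Suc m]))" using s2(2) m by metis
      then have "last v = bar (ray g s2 0)" unfolding map_upt_Suc by simp
      then have "ray g s2 0 \<noteq> e" using ev by auto
      moreover have "ray g (flip s1) 0 = e" using s by (simp add: s1_def ray_flip_step_0)
      moreover have "s2 = s1 \<or> s2 = flip s1" using s2(1) by (cases s1; cases s2) (auto simp: flip_def)
      ultimately have "s2 = s1" by auto
      have "map (ray g s) [0..<Suc (length v)] = bar e # map (ray g s1) [0..<length v]"
        unfolding map_upt_Suc s using s by (simp add: s1_def ray_step)
      then have "v @ [e] = rev (map bar (map (ray g s) [0..<length (v @ [e])]))"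
        using s2(2) \<open>s2 = s1\<close> by simp
      moreover have "step (length v) s1 = step (length (v @ [e])) s" by (simp add: s1_def step_step)
      ultimately show ?thesis using s s2 \<open>s2 = s1\<close> by metis
    qed
  qed
qed simp

text \<open>By \<open>rigid\<close> the reduced word of the group element is spelled along both
  lifts, so they agree for that many letters.\<close>

lemma pair_equivE:
  assumes "(X, Y) \<in> pair_equiv a b w"
  obtains "X = Y" | s t n where "X = {lf (fst s), lf (fst t)}" "Y = {lf (fst (step (Suc n) s)), lf (fst (step (Suc n) t))}"
    "\<forall>k<Suc n. ray g s k = ray g t k" "lf (fst s) \<noteq> lf (fst t)"
proof -
  obtain u0 where u0: "X \<in> crossing_pairs" "Y \<in> crossing_pairs" "Y = moved u0 X" using assms pair_equiv_iff by blast
  obtain u where u: "reduced_list u" "\<And>z. z \<in> cball 0 1 \<Longrightarrow> wm u0 z = wm u z" using wm_reduce by metis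
  have Y: "Y = moved u X" using u0 moved_cong[OF u0(1) u(2)] by simp
  obtain i j where X: "X = {lf i, lf j}" "lf i \<noteq> lf j" using u0(1) unfolding crossing_pairs_def by blast
  have YM: "Y = {map_prod (wm u) (wm u) (lf i), map_prod (wm u) (wm u) (lf j)}" unfolding Y moved_def X by simp
  obtain p q where "Y = {lf p, lf q}" using u0(2) unfolding crossing_pairs_def by blast
  then obtain i' j' where ij': "map_prod (wm u) (wm u) (lf i) = lf i'" "map_prod (wm u) (wm u) (lf j) = lf j'"
    using YM by (metis doubleton_eq_iff)
  show ?thesis
  proof (cases "u = []")
    case True
    then have "X = Y" unfolding Y moved_def by (simp add: map_prod_def)
    then show ?thesis using that by blast
  next
    case False
    then obtain n where n: "length u = Suc n" by (cases u) auto
    obtain s where s: "fst s = i" "u = rev (map bar (map (ray g s) [0..<Suc n]))" "lf i' = lf (fst (step (Suc n) s))"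
      using rigid[OF u(1) False ij'(1)] unfolding n by blast
    obtain t where t: "fst t = j" "u = rev (map bar (map (ray g t) [0..<Suc n]))" "lf j' = lf (fst (step (Suc n) t))"
      using rigid[OF u(1) False ij'(2)] unfolding n by blast
    have "map bar (map (ray g s) [0..<Suc n]) = map bar (map (ray g t) [0..<Suc n])" using s(2) t(2) by (metis rev_rev_ident)
    then have "\<forall>k<Suc n. ray g s k = ray g t k" by (simp del: upt_Suc add: map_eq_conv)
    then show ?thesis using that(2)[of s t n] X YM ij' s t by simp
  qed
qed

lemma four_way_pairs_D: "{lf i, lf j} \<in> four_way_pairs \<Longrightarrow> turn g i \<inter> turn g j = {}"
  unfolding four_way_pairs_def by (auto simp: doubleton_eq_iff dest!: turn_cong)

lemma end_pairs_D: "{lf i, lf j} \<in> end_pairs \<Longrightarrow> card (turn g i \<inter> turn g j) = 1"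
  unfolding end_pairs_def by (auto simp: doubleton_eq_iff Int_commute dest!: turn_cong)

lemma class_four_way_pairs:
  assumes "X \<in> four_way_pairs" "(X, Y) \<in> pair_equiv a b w" shows "Y = X"
  using assms(2)
proof (cases rule: pair_equivE)
  case (2 s t n)
  then have "turn g (fst s) \<inter> turn g (fst t) = {}" using assms(1) four_way_pairs_D by blast
  then show ?thesis using 2(3) unfolding turn_strand by auto
qed simp

text \<open>A group element moves both lifts along their single shared direction. It produces
  another end pair only if it stops exactly where they diverge: before that they share both
  directions, and it cannot go further.\<close>

lemma class_end_pairs:
  assumes "X \<in> end_pairs" shows "card {Y \<in> end_pairs. (X, Y) \<in> pair_equiv a b w} \<le> 2"
proof -
  obtain i j where X: "X = {lf i, lf j}" "card (turn g i \<inter> turn g j) = 1" using assms unfolding end_pairs_def by blast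
  have ne: "lf i \<noteq> lf j" using X(2) turn_cong[of i j] turn_two by auto
  obtain d where d: "turn g i \<inter> turn g j = {d}" using X(2) card_1_singletonE by metis
  then have "d \<in> turn g i" "d \<in> turn g j" by auto
  then obtain s t where st: "fst s = i" "fst t = j" "ray g s 0 = d" "ray g t 0 = d" by (metis turn_shared_direction)
  obtain n where n: "\<forall>k<Suc n. ray g s k = ray g t k" "ray g s (Suc n) \<noteq> ray g t (Suc n)"
    using first_difference[OF ray_inj, of s t] st ne by metis
  let ?Y = "{lf (fst (step (Suc n) s)), lf (fst (step (Suc n) t))}"
  have key: "Y = ?Y" if Y: "Y \<in> end_pairs" and s': "Y = {lf (fst (step (Suc m) s')), lf (fst (step (Suc m) t'))}"
      "lf (fst s') = lf i" "lf (fst t') = lf j" "\<forall>k<Suc m. ray g s' k = ray g t' k" for Y s' t' m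
  proof -
    have mods: "fst s' mod int L = fst s mod int L" "fst t' mod int L = fst t mod int L" using s' st by (auto simp: lf_eq_iff)
    have "ray g s' 0 \<in> turn g (fst s')" "ray g t' 0 \<in> turn g (fst t')" using turn_strand by blast+
    then have "ray g s' 0 \<in> turn g i \<inter> turn g j" using s' turn_cong by (metis IntI zero_less_Suc)
    then have d': "ray g s' 0 = d" "ray g t' 0 = d" using d s' by auto
    have same: "snd x' = snd x" if "fst x' mod int L = fst x mod int L" "ray g x' 0 = ray g x 0" for x x'
    proof (rule ccontr)
      assume "snd x' \<noteq> snd x"
      then have "ray g x' = ray g (flip x)" using that(1) by (auto simp: ray_def flip_def fwd_eq_iff bwd_eq_iff)
      then show False using that(2) ray_neq_flip[OF bireduced_g, of x] by simp
    qed
    have sn: "snd s' = snd s" "snd t' = snd t" using same mods d' st by metis+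
    have rr: "ray g s' = ray g s" "ray g t' = ray g t" using sn mods by (auto simp: ray_def fwd_eq_iff bwd_eq_iff)
    have lstep: "lf (fst (step k x')) = lf (fst (step k x))" if "fst x' mod int L = fst x mod int L" "snd x' = snd x" for k x x'
      using that unfolding lf_eq_iff by (auto simp: step_def intro: mod_add_cong mod_diff_cong)
    have Y2: "Y = {lf (fst (step (Suc m) s)), lf (fst (step (Suc m) t))}" using s'(1) lstep mods sn by metis
    then have "card (turn g (fst (step (Suc m) s)) \<inter> turn g (fst (step (Suc m) t))) = 1" using Y end_pairs_D by blast
    moreover have "ray g (flip (step (Suc m) s)) 0 = ray g (flip (step (Suc m) t)) 0" using s'(4) rr by (simp add: ray_flip_step_0)
    ultimately have "ray g (flip (flip (step (Suc m) s))) 0 \<noteq> ray g (flip (flip (step (Suc m) t))) 0"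
      using shared_one_iff[of "flip (step (Suc m) s)" "flip (step (Suc m) t)"] by simp
    then have "ray g s (Suc m) \<noteq> ray g t (Suc m)" by (simp add: ray_step)
    moreover have "\<forall>k<Suc m. ray g s k = ray g t k" using s'(4) rr by simp
    ultimately have "m = n" using n by (metis Suc_mono linorder_neqE_nat)
    then show ?thesis using Y2 by simp
  qed
  have "{Y \<in> end_pairs. (X, Y) \<in> pair_equiv a b w} \<subseteq> {X, ?Y}"
  proof
    fix Y assume "Y \<in> {Y \<in> end_pairs. (X, Y) \<in> pair_equiv a b w}"
    then have Y: "Y \<in> end_pairs" "(X, Y) \<in> pair_equiv a b w" by auto
    from Y(2) show "Y \<in> {X, ?Y}"
    proof (cases rule: pair_equivE)
      case (2 s' t' m)
      from 2(1) X(1) consider "lf (fst s') = lf i" "lf (fst t') = lf j" | "lf (fst s') = lf j" "lf (fst t') = lf i"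
        by (auto simp: doubleton_eq_iff)
      then show ?thesis
      proof cases
        case 1 then show ?thesis using key[OF Y(1) 2(2) 1 2(3)] by blast
      next
        case c2: 2
        have "Y = {lf (fst (step (Suc m) t')), lf (fst (step (Suc m) s'))}" using 2(2) by (simp add: insert_commute)
        moreover have "\<forall>k<Suc m. ray g t' k = ray g s' k" using 2(3) by simp
        ultimately have "Y = ?Y" using c2 by (intro key[OF Y(1)])
        then show ?thesis by blast
      qed
    qed simp
  qed
  then have "card {Y \<in> end_pairs. (X, Y) \<in> pair_equiv a b w} \<le> card {X, ?Y}" by (rule card_mono[rotated]) simp
  also have "\<dots> \<le> 2" by (simp add: card_insert_if)
  finally show ?thesis .
qed

lemma end_pairs_not_four_way_pairs_class:
  assumes "X \<in> end_pairs" "(X, Y) \<in> pair_equiv a b w" shows "Y \<notin> four_way_pairs"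
proof
  assume "Y \<in> four_way_pairs"
  moreover have "(Y, X) \<in> pair_equiv a b w" using assms(2) equiv_pair_equiv by (meson equivE symD)
  ultimately have "X = Y" using class_four_way_pairs by blast
  then have "X \<in> four_way_pairs" using \<open>Y \<in> four_way_pairs\<close> by simp
  then show False using assms(1) unfolding end_pairs_def using four_way_pairs_D by force
qed

theorem primitive_self_int_eq: "2 * primitive_self_int a b w = 2 * card four_way_pairs + card end_pairs"
proof -
  let ?R = "pair_equiv a b w" and ?Q = "crossing_pairs // pair_equiv a b w"
  have fQ: "finite ?Q" using finite_quotient[OF finite_crossing_pairs equiv_type[OF equiv_pair_equiv]] .
  have fin: "finite q" if "q \<in> ?Q" for q using finite_equiv_class[OF finite_crossing_pairs equiv_type[OF equiv_pair_equiv] that] .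
  have Un: "\<Union> ?Q = crossing_pairs" by (rule Union_quotient[OF equiv_pair_equiv])
  have dj: "pairwise disjnt ?Q" using quotient_disj[OF equiv_pair_equiv] by (auto simp: pairwise_def disjnt_def)
  have split: "card S = (\<Sum>q\<in>?Q. card (q \<inter> S))" if "S \<subseteq> crossing_pairs" for S
  proof -
    have "S = (\<Union>q\<in>?Q. q \<inter> S)" using Un that by blast
    moreover have "card (\<Union>q\<in>?Q. q \<inter> S) = (\<Sum>q\<in>?Q. card (q \<inter> S))"
      by (rule card_UN_disjoint) (use fQ fin dj in \<open>auto simp: pairwise_def disjnt_def\<close>)
    ultimately show ?thesis by simp
  qed
  have "2 * card (q \<inter> four_way_pairs) + card (q \<inter> end_pairs) = 2" if q: "q \<in> ?Q" for q
  proof -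
    have cls: "q = ?R `` {X}" if "X \<in> q" for X
    proof -
      obtain Z where Z: "q = ?R `` {Z}" using q by (rule quotientE)
      then have "(Z, X) \<in> ?R" using that by simp
      then show ?thesis using equiv_class_eq[OF equiv_pair_equiv] Z by simp
    qed
    show ?thesis
    proof (cases "q \<inter> four_way_pairs = {}")
      case False
      then obtain X where X: "X \<in> q" "X \<in> four_way_pairs" by blast
      have "q = {X}" using cls[OF X(1)] class_four_way_pairs[OF X(2)] X(1) by auto
      moreover have "X \<notin> end_pairs" using X(2) end_pairs_not_four_way_pairs_class[of X X] equiv_pair_equiv end_pairs_subset by (meson equivE refl_onD subsetD)
      ultimately show ?thesis using X by simp
    next
      case True
      have "q \<noteq> {}" using q by (rule in_quotient_imp_non_empty[OF equiv_pair_equiv])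
      then obtain X where X: "X \<in> q" "X \<in> crossing_pairs" using Un q by blast
      have qX: "q = ?R `` {X}" by (rule cls[OF X(1)])
      have mem: "V \<in> q" if "(X, V) \<in> ?R" for V using that unfolding qX by simp
      have no0: "\<not> (\<exists>Y\<in>four_way_pairs. (X, Y) \<in> ?R)" using True mem by (auto simp: disjoint_iff)
      then obtain Y where Y: "Y \<in> end_pairs" "(X, Y) \<in> ?R" "\<exists>Z\<in>end_pairs. Y \<noteq> Z \<and> (X, Z) \<in> ?R"
        using class_upper[OF X(2)] by (elim disjE) auto
      then obtain Z where Z: "Z \<in> end_pairs" "Y \<noteq> Z" "(X, Z) \<in> ?R" by auto
      note YZ = Y(1) Z(1,2) mem[OF Y(2)] mem[OF Z(3)]
      have "card {Y, Z} \<le> card (q \<inter> end_pairs)" by (rule card_mono) (use YZ fin[OF q] in auto)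
      moreover have "q \<inter> end_pairs = {V \<in> end_pairs. (Y, V) \<in> ?R}" using cls[OF YZ(4)] by auto
      then have "card (q \<inter> end_pairs) \<le> 2" using class_end_pairs[OF YZ(1)] by simp
      ultimately show ?thesis using True YZ(3) by simp
    qed
  qed
  then have "2 * card ?Q = (\<Sum>q\<in>?Q. 2 * card (q \<inter> four_way_pairs) + card (q \<inter> end_pairs))" by simp
  also have "\<dots> = 2 * card four_way_pairs + card end_pairs"
    unfolding split[OF four_way_pairs_subset] split[OF end_pairs_subset] by (simp add: sum.distrib sum_distrib_left)
  finally show ?thesis unfolding primitive_self_int_def intersecting_pairs_eq .
qed

end

section \<open>Counting classes of intersecting lifts\<close>

text \<open>The side \<open>mid e\<close> is the one opposite to \<open>bar e\<close>: after \<open>e\<close>, the geodesic goes straight on.\<close>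

fun mid :: "letter \<Rightarrow> letter" where
  "mid Pos_a = Neg_b" | "mid Neg_b = Pos_a" | "mid Neg_a = Pos_b" | "mid Pos_b = Neg_a"

lemma mid_mid [simp]: "mid (mid e) = e" by (cases e) auto

definition nonmid :: "letter list \<Rightarrow> nat" where
  "nonmid w = card {i. i < length w \<and> per w (int i) \<noteq> mid (per w (int i - 1))}"

definition strands :: "letter list \<Rightarrow> (int \<times> bool) set" where
  "strands w = {0..<int (length w)} \<times> UNIV"

definition occurrences :: "letter list \<Rightarrow> letter list \<Rightarrow> (int \<times> bool) set" where
  "occurrences w p = {s \<in> strands w. \<forall>k<length p. ray (per w) s k = p ! k}"

definition cnt :: "letter list \<Rightarrow> letter list \<Rightarrow> nat" where
  "cnt w p = card (occurrences w p)"

text \<open>The sign condition of \<open>separates_diverging_iff\<close> for two strands that share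
  \<open>v\<close>, are preceded on it by \<open>x\<close> and \<open>x'\<close>, and are followed
  by \<open>y\<close> and \<open>y'\<close>.\<close>

definition crossing_ends :: "letter \<Rightarrow> letter \<Rightarrow> letter list \<Rightarrow> letter \<Rightarrow> letter \<Rightarrow> bool" where
  "crossing_ends x x' v y y' \<longleftrightarrow> cyc3 (bar x) (bar x') (hd v) * cyc3 (bar (last v)) y' y < 0"

definition reduced_words :: "nat \<Rightarrow> letter list set" where
  "reduced_words n = {w. reduced_list w \<and> length w = n}"

text \<open>For \<open>f = cnt w\<close> this is the number of ordered pairs of strands that cross
  along a common segment of \<open>n\<close> letters. Leaving \<open>f\<close> open gives the
  quadratic scaling for powers of a word and allows lower bounds for the counts to be
  inserted.\<close>

definition crossing_sum :: "(letter list \<Rightarrow> real) \<Rightarrow> nat \<Rightarrow> real" where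
  "crossing_sum f n = (\<Sum>v\<in>reduced_words n. \<Sum>x\<in>UNIV. \<Sum>x'\<in>UNIV. \<Sum>y\<in>UNIV. \<Sum>y'\<in>UNIV.
     (if crossing_ends x x' v y y' then f (x # v @ [y]) * f (x' # v @ [y']) else 0))"

lemma finite_strands [simp]: "finite (strands w)" by (simp add: strands_def)

lemma finite_occurrences [simp]: "finite (occurrences w p)" by (simp add: occurrences_def)

lemma finite_reduced_words [simp]: "finite (reduced_words n)"
  by (rule finite_subset[OF _ finite_lists_length_eq[OF finite_class.finite_UNIV, of n]]) (auto simp: reduced_words_def)

lemma card_le_of_fibres:
  assumes "finite A" "finite B" "\<And>x. x \<in> A \<Longrightarrow> h x \<in> B" "\<And>y. y \<in> B \<Longrightarrow> card {x \<in> A. h x = y} \<le> c"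
  shows "card A \<le> c * card B"
proof -
  have "card A = card (\<Union>y\<in>B. {x \<in> A. h x = y})" using assms(3) by (intro arg_cong[where f = card]) auto
  also have "\<dots> \<le> (\<Sum>y\<in>B. card {x \<in> A. h x = y})" by (rule card_UN_le[OF assms(2)])
  also have "\<dots> \<le> (\<Sum>y\<in>B. c)" by (rule sum_mono) (rule assms(4))
  finally show ?thesis by (simp add: mult.commute)
qed

context primitive_geodesic
begin

definition mids :: "letter set \<Rightarrow> nat set" where
  "mids T = {i. i < L \<and> turn g (int i) = T}"

lemma lf_nat_inj: "i < L \<Longrightarrow> j < L \<Longrightarrow> lf (int i) = lf (int j) \<longleftrightarrow> i = j"
  by (simp add: lf_eq_iff zmod_int[symmetric])

lemma ex_nat_rep: obtains k where "k < L" "lf (int k) = lf i" "turn g (int k) = turn g i"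
proof -
  have L0: "int L > 0" using w_ne by simp
  define k where "k = nat (i mod int L)"
  have "k < L" "lf (int k) = lf i" using L0 lf_mod by (auto simp: k_def nat_less_iff)
  then show ?thesis using that turn_cong by blast
qed

lemma card_four_way_pairs: "card four_way_pairs = card (mids {Pos_a, Pos_b}) * card (mids {Neg_a, Neg_b})"
proof -
  let ?A = "mids {Pos_a, Pos_b} \<times> mids {Neg_a, Neg_b}"
  have sep: "separates (lf i) (lf j) \<longleftrightarrow>
    turn g i = {Pos_a, Pos_b} \<and> turn g j = {Neg_a, Neg_b} \<or> turn g i = {Neg_a, Neg_b} \<and> turn g j = {Pos_a, Pos_b}"
    if "turn g i \<inter> turn g j = {}" for i j
    using separates_four_directions_iff[OF bireduced_g, of "(i, True)" "(j, True)"] that unfolding lf_def by simp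
  have ne: "{Pos_a, Pos_b} \<noteq> {Neg_a, Neg_b}" by (simp add: doubleton_eq_iff)
  have "four_way_pairs = (\<lambda>(i, j). {lf (int i), lf (int j)}) ` ?A"
  proof (intro set_eqI iffI)
    fix X assume "X \<in> four_way_pairs"
    then obtain i j where ij: "X = {lf i, lf j}" "turn g i \<inter> turn g j = {}" "separates (lf i) (lf j)" unfolding four_way_pairs_def by blast
    obtain k where k: "k < L" "lf (int k) = lf i" "turn g (int k) = turn g i" using ex_nat_rep .
    obtain l where l: "l < L" "lf (int l) = lf j" "turn g (int l) = turn g j" using ex_nat_rep .
    from sep[OF ij(2)] ij(3) show "X \<in> (\<lambda>(i, j). {lf (int i), lf (int j)}) ` ?A"
    proof (elim iffD1[elim_format] disjE)
      assume "turn g i = {Pos_a, Pos_b} \<and> turn g j = {Neg_a, Neg_b}"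
      then have "(k, l) \<in> ?A" using k l by (simp add: mids_def)
      then show ?thesis using ij k l by (intro image_eqI[of _ _ "(k, l)"]) auto
    next
      assume "turn g i = {Neg_a, Neg_b} \<and> turn g j = {Pos_a, Pos_b}"
      then have "(l, k) \<in> ?A" using k l by (simp add: mids_def)
      then show ?thesis using ij k l by (intro image_eqI[of _ _ "(l, k)"]) auto
    qed
  next
    fix X assume "X \<in> (\<lambda>(i, j). {lf (int i), lf (int j)}) ` ?A"
    then obtain i j where ij: "X = {lf (int i), lf (int j)}" "turn g (int i) = {Pos_a, Pos_b}" "turn g (int j) = {Neg_a, Neg_b}"
      by (auto simp: mids_def)
    then have "turn g (int i) \<inter> turn g (int j) = {}" by simp
    then show "X \<in> four_way_pairs" unfolding four_way_pairs_def using sep ij by blast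
  qed
  moreover have "inj_on (\<lambda>(i, j). {lf (int i), lf (int j)}) ?A"
  proof (rule inj_onI, clarify)
    fix i j i' j' assume m: "i \<in> mids {Pos_a, Pos_b}" "j \<in> mids {Neg_a, Neg_b}" "i' \<in> mids {Pos_a, Pos_b}" "j' \<in> mids {Neg_a, Neg_b}"
      and e: "{lf (int i), lf (int j)} = {lf (int i'), lf (int j')}"
    have "lf (int i) \<noteq> lf (int j')" using m ne turn_cong[of "int i" "int j'"] by (auto simp: mids_def)
    then have "lf (int i) = lf (int i')" "lf (int j) = lf (int j')" using e by (auto simp: doubleton_eq_iff)
    then show "i = i' \<and> j = j'" using m lf_nat_inj by (auto simp: mids_def)
  qed
  ultimately show ?thesis by (simp add: card_image card_cartesian_product)
qed

lemma turn_mid_iff: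
  "g i = mid (g (i - 1)) \<longleftrightarrow> turn g i = {Pos_a, Pos_b} \<or> turn g i = {Neg_a, Neg_b}"
  unfolding turn_def by (cases "g i"; cases "g (i - 1)") (simp_all add: doubleton_eq_iff)

lemma card_mids: "card (mids {Pos_a, Pos_b}) + card (mids {Neg_a, Neg_b}) + nonmid w = L"
proof -
  let ?N = "{i. i < length w \<and> per w (int i) \<noteq> mid (per w (int i - 1))}"
  have ne: "{Pos_a, Pos_b} \<noteq> {Neg_a, Neg_b}" by (simp add: doubleton_eq_iff)
  have "{..<L} = mids {Pos_a, Pos_b} \<union> mids {Neg_a, Neg_b} \<union> ?N"
    unfolding mids_def using turn_mid_iff by auto
  then have "L = card (mids {Pos_a, Pos_b} \<union> mids {Neg_a, Neg_b} \<union> ?N)" by (metis card_lessThan)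
  also have "\<dots> = card (mids {Pos_a, Pos_b} \<union> mids {Neg_a, Neg_b}) + card ?N"
    by (rule card_Un_disjoint) (use turn_mid_iff in \<open>auto simp: mids_def\<close>)
  also have "card (mids {Pos_a, Pos_b} \<union> mids {Neg_a, Neg_b}) = card (mids {Pos_a, Pos_b}) + card (mids {Neg_a, Neg_b})"
    by (rule card_Un_disjoint) (use ne in \<open>auto simp: mids_def\<close>)
  finally show ?thesis by (simp add: nonmid_def)
qed

text \<open>Two turns share exactly one direction only if they belong to different perfect matchings
  of the four directions.\<close>

lemma card_end_pairs_upper:
  obtains p q where "p + q = nonmid w" "card end_pairs \<le> (L - nonmid w) * nonmid w + p * q"
proof -
  define M1 where "M1 = mids {Pos_a, Pos_b} \<union> mids {Neg_a, Neg_b}"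
  define M2 where "M2 = mids {Pos_a, Neg_b} \<union> mids {Neg_a, Pos_b}"
  define M3 where "M3 = mids {Pos_a, Neg_a} \<union> mids {Pos_b, Neg_b}"
  have fin: "finite (mids T)" for T by (simp add: mids_def)
  have F: "finite M1" "finite M2" "finite M3" by (auto simp: M1_def M2_def M3_def fin)
  have turns: "turn g i \<in> {{Pos_a, Pos_b}, {Neg_a, Neg_b}, {Pos_a, Neg_b}, {Neg_a, Pos_b}, {Pos_a, Neg_a}, {Pos_b, Neg_b}}" for i
    using turn_two[of i] unfolding turn_def by (cases "g i"; cases "g (i - 1)") (simp_all add: doubleton_eq_iff)
  have cov: "i < L \<Longrightarrow> i \<in> M1 \<union> M2 \<union> M3" for i
    using turns[of "int i"] by (auto simp: M1_def M2_def M3_def mids_def)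
  have N: "nonmid w = card (M2 \<union> M3)"
  proof -
    have "{i. i < length w \<and> per w (int i) \<noteq> mid (per w (int i - 1))} = M2 \<union> M3"
    proof -
      have "g i \<noteq> mid (g (i - 1)) \<longleftrightarrow> turn g i = {Pos_a, Neg_b} \<or> turn g i = {Neg_a, Pos_b} \<or> turn g i = {Pos_a, Neg_a} \<or> turn g i = {Pos_b, Neg_b}" for i
        using turn_two[of i] unfolding turn_def by (cases "g i"; cases "g (i - 1)") (simp_all add: doubleton_eq_iff)
      then show ?thesis unfolding M2_def M3_def mids_def by blast
    qed
    then show ?thesis by (simp add: nonmid_def)
  qed
  also have "\<dots> = card M2 + card M3"
    by (rule card_Un_disjoint) (use F in \<open>auto simp: M2_def M3_def mids_def doubleton_eq_iff\<close>)
  finally have N: "nonmid w = card M2 + card M3" .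
  have "card M1 = card (mids {Pos_a, Pos_b}) + card (mids {Neg_a, Neg_b})" unfolding M1_def
    by (rule card_Un_disjoint) (auto simp: mids_def doubleton_eq_iff)
  then have M1: "card M1 = L - nonmid w" using card_mids by linarith
  let ?S = "M1 \<times> M2 \<union> M1 \<times> M3 \<union> M2 \<times> M3"
  have "end_pairs \<subseteq> (\<lambda>(i, j). {lf (int i), lf (int j)}) ` ?S"
  proof
    fix X assume "X \<in> end_pairs"
    then obtain i j where ij: "X = {lf i, lf j}" "card (turn g i \<inter> turn g j) = 1" unfolding end_pairs_def by blast
    obtain k where k: "k < L" "lf (int k) = lf i" "turn g (int k) = turn g i" using ex_nat_rep .
    obtain l where l: "l < L" "lf (int l) = lf j" "turn g (int l) = turn g j" using ex_nat_rep .
    have c: "card (turn g (int k) \<inter> turn g (int l)) = 1" using ij k l by simp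
    have no1: "\<not> (k \<in> M1 \<and> l \<in> M1)"
    proof
      assume "k \<in> M1 \<and> l \<in> M1"
      then have "turn g (int k) \<in> {{Pos_a, Pos_b}, {Neg_a, Neg_b}}" "turn g (int l) \<in> {{Pos_a, Pos_b}, {Neg_a, Neg_b}}"
        unfolding M1_def mids_def by blast+
      then show False using c by (elim insertE emptyE) simp_all
    qed
    have no2: "\<not> (k \<in> M2 \<and> l \<in> M2)"
    proof
      assume "k \<in> M2 \<and> l \<in> M2"
      then have "turn g (int k) \<in> {{Pos_a, Neg_b}, {Neg_a, Pos_b}}" "turn g (int l) \<in> {{Pos_a, Neg_b}, {Neg_a, Pos_b}}"
        unfolding M2_def mids_def by blast+
      then show False using c by (elim insertE emptyE) simp_all
    qed
    have no3: "\<not> (k \<in> M3 \<and> l \<in> M3)"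
    proof
      assume "k \<in> M3 \<and> l \<in> M3"
      then have "turn g (int k) \<in> {{Pos_a, Neg_a}, {Pos_b, Neg_b}}" "turn g (int l) \<in> {{Pos_a, Neg_a}, {Pos_b, Neg_b}}"
        unfolding M3_def mids_def by blast+
      then show False using c by (elim insertE emptyE) simp_all
    qed
    have "(k, l) \<in> ?S \<or> (l, k) \<in> ?S" using cov[OF k(1)] cov[OF l(1)] no1 no2 no3 by blast
    then show "X \<in> (\<lambda>(i, j). {lf (int i), lf (int j)}) ` ?S"
    proof
      assume "(k, l) \<in> ?S" then show ?thesis using ij k l by (intro image_eqI[of _ _ "(k, l)"]) auto
    next
      assume "(l, k) \<in> ?S" then show ?thesis using ij k l by (intro image_eqI[of _ _ "(l, k)"]) auto
    qed
  qed
  then have "card end_pairs \<le> card ((\<lambda>(i, j). {lf (int i), lf (int j)}) ` ?S)" using F by (intro card_mono) auto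
  also have "\<dots> \<le> card ?S" using F by (intro card_image_le) auto
  also have "\<dots> \<le> card (M1 \<times> M2) + card (M1 \<times> M3) + card (M2 \<times> M3)"
    by (meson add_le_mono1 card_Un_le le_trans)
  also have "\<dots> = (L - nonmid w) * nonmid w + card M2 * card M3"
    by (simp only: card_cartesian_product M1 N add_mult_distrib2)
  finally show ?thesis using that[of "card M2" "card M3"] N by simp
qed

text \<open>Let A and B count the two kinds of opposite turns, p and q the turns of the other two
  matchings. Twice the number is at most 2 A B + (A + B) (p + q) + p q; now bound A B and p q by a
  quarter of the squares of A + B and p + q.\<close>

lemma primitive_self_int_upper: "8 * primitive_self_int a b w + (nonmid w)\<^sup>2 \<le> 2 * L\<^sup>2"
proof -
  define A where "A = card (mids {Pos_a, Pos_b})"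
  define B where "B = card (mids {Neg_a, Neg_b})"
  obtain p q where pq: "p + q = nonmid w" "card end_pairs \<le> (L - nonmid w) * nonmid w + p * q" using card_end_pairs_upper .
  have s: "A + B + (p + q) = L" using card_mids pq by (simp add: A_def B_def)
  have "2 * primitive_self_int a b w \<le> 2 * (A * B) + (A + B) * (p + q) + p * q"
  proof -
    have "L - nonmid w = A + B" using card_mids by (simp add: A_def B_def)
    then show ?thesis using primitive_self_int_eq pq card_four_way_pairs by (simp add: A_def B_def)
  qed
  then have "int (2 * primitive_self_int a b w) \<le> int (2 * (A * B) + (A + B) * (p + q) + p * q)" by (rule zle_int[THEN iffD2])
  moreover have "4 * (int A * int B) \<le> (int A + int B)\<^sup>2" "4 * (int p * int q) \<le> (int p + int q)\<^sup>2"
  proof -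
    have "4 * (x * y) \<le> (x + y)\<^sup>2" for x y :: int
      using zero_le_power2[of "x - y"] by (simp add: power2_eq_square algebra_simps)
    then show "4 * (int A * int B) \<le> (int A + int B)\<^sup>2" "4 * (int p * int q) \<le> (int p + int q)\<^sup>2" by blast+
  qed
  moreover have "2 * (int L)\<^sup>2 = 2 * (int A + int B)\<^sup>2 + 4 * ((int A + int B) * (int p + int q)) + 2 * (int p + int q)\<^sup>2"
    unfolding s[symmetric] by (simp add: power2_eq_square algebra_simps)
  ultimately have "int (8 * primitive_self_int a b w + (nonmid w)\<^sup>2) \<le> int (2 * L\<^sup>2)"
    unfolding pq(1)[symmetric] by (simp add: of_nat_add of_nat_mult of_nat_power)
  then show ?thesis by (simp only: zle_int)
qed

text \<open>The lift leaves only the direction open, and the next letter decides it because the two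
  directions of a turn differ. This bounds the fibres when strands are replaced by lifts.\<close>

lemma strand_det:
  assumes "s \<in> strands w" "t \<in> strands w" "lf (fst (step (Suc 0) s)) = lf (fst (step (Suc 0) t))" "ray g s 1 = ray g t 1"
  shows "s = t"
proof -
  have sn: "snd s = snd t"
  proof (rule ccontr)
    assume ne: "snd s \<noteq> snd t"
    have "snd (step (Suc 0) s) = snd s" "snd (step (Suc 0) t) = snd t" by (simp_all add: step_def)
    then have "ray g (step (Suc 0) s) = ray g (flip (step (Suc 0) t))"
      using assms(3) ne unfolding lf_eq_iff ray_def flip_def fwd_eq_iff[symmetric]
      by (auto simp: fwd_eq_iff bwd_eq_iff)
    then have "ray g s 1 = bar (ray g t 0)" by (metis One_nat_def ray_flip_step_0 ray_step add.right_neutral)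
    then show False using assms(4) ray_Suc_neq[OF bireduced_g, of t 0] by simp
  qed
  have cancel: "(x + c) mod m = (y + c) mod m \<Longrightarrow> x mod m = y mod m" for x y c m :: int
    by (simp add: mod_eq_dvd_iff)
  have "fst s mod int L = fst t mod int L"
  proof (cases "snd s")
    case True
    then show ?thesis using assms(3) sn cancel[of "fst s" 1 "int L" "fst t"] unfolding lf_eq_iff by (simp add: step_def)
  next
    case False
    then show ?thesis using assms(3) sn cancel[of "fst s" "-1" "int L" "fst t"] unfolding lf_eq_iff by (simp add: step_def)
  qed
  then have "fst s = fst t" using assms(1,2) by (simp add: strands_def mem_Times_iff)
  then show ?thesis using sn by (simp add: prod_eq_iff)
qed

text \<open>A turn with sides \<open>d\<close> and \<open>bar e\<close> means that \<open>d\<close>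
  follows \<open>e\<close> in one of the two reading directions. The strands in
  \<open>occurrences\<close> start one position earlier, hence the step by one.\<close>

lemma card_mids_cnt:
  "card (mids {Pos_a, Pos_b}) = cnt w [Neg_b, Pos_a]" "card (mids {Neg_a, Neg_b}) = cnt w [Pos_b, Neg_a]"
proof -
  have key: "card (mids {d, bar e}) = cnt w [e, d]" if "d \<noteq> bar e" for d e
  proof -
    define h where "h s = nat (fst (step (Suc 0) s) mod int L)" for s
    have L0: "int L > 0" using w_ne by simp
    have hk: "h s < L" "lf (int (h s)) = lf (fst (step (Suc 0) s))" for s
      using L0 lf_mod by (auto simp: h_def nat_less_iff)
    have ht: "turn g (int (h s)) = {ray g s 1, bar (ray g s 0)}" for s
      using turn_cong[OF hk(2)[of s]] turn_strand[of g "step (Suc 0) s"] by (simp add: ray_step ray_flip_step_0)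
    have occ: "s \<in> occurrences w [e, d] \<longleftrightarrow> s \<in> strands w \<and> ray g s 0 = e \<and> ray g s 1 = d" for s
      by (auto simp: occurrences_def less_Suc_eq)
    have "bij_betw h (occurrences w [e, d]) (mids {d, bar e})"
      unfolding bij_betw_def
    proof
      show "inj_on h (occurrences w [e, d])"
      proof (rule inj_onI)
        fix s t assume st: "s \<in> occurrences w [e, d]" "t \<in> occurrences w [e, d]" "h s = h t"
        have "lf (fst (step (Suc 0) s)) = lf (fst (step (Suc 0) t))" using hk(2) st(3) by metis
        then show "s = t" using st by (intro strand_det) (auto simp: occ)
      qed
      show "h ` occurrences w [e, d] = mids {d, bar e}"
      proof (intro set_eqI iffI)
        fix k assume "k \<in> h ` occurrences w [e, d]"
        then show "k \<in> mids {d, bar e}" using hk(1) ht by (auto simp: mids_def occ)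
      next
        fix k assume k: "k \<in> mids {d, bar e}"
        then obtain s where s: "fst s = int k" "ray g s 0 = d" using turn_shared_direction[of d g "int k"] by (auto simp: mids_def)
        have "turn g (int k) = {d, bar e}" using k by (simp add: mids_def)
        then have bk: "ray g (flip s) 0 = bar e" using turn_strand[of g s] s ray_neq_flip[OF bireduced_g, of s] by (auto simp: doubleton_eq_iff)
        define t0 where "t0 = (if snd s then fst s - 1 else fst s + 1, snd s)"
        define t where "t = (fst t0 mod int L, snd s)"
        have st0: "step (Suc 0) t0 = s" by (auto simp: step_def t0_def prod_eq_iff)
        have rt: "ray g t = ray g t0" by (simp add: ray_def t_def t0_def fwd_eq_iff bwd_eq_iff)
        have "ray g t0 1 = d" using s ray_step[of g "Suc 0" t0 0] st0 by simp
        moreover have "bar (ray g t0 0) = bar e" using bk ray_flip_step_0[of g 0 t0] st0 by simp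
        moreover have "t \<in> strands w" using L0 by (simp add: strands_def t_def)
        ultimately have "t \<in> occurrences w [e, d]" using rt by (simp add: occ)
        moreover have "h t = k"
        proof -
          have "fst (step (Suc 0) t) mod int L = fst (step (Suc 0) t0) mod int L"
            by (simp add: step_def t_def t0_def mod_simps)
          then show ?thesis unfolding h_def st0 using s k by (simp add: mids_def zmod_int[symmetric])
        qed
        ultimately show "k \<in> h ` occurrences w [e, d]" by blast
      qed
    qed
    then show ?thesis unfolding cnt_def by (simp add: bij_betw_same_card)
  qed
  show "card (mids {Pos_a, Pos_b}) = cnt w [Neg_b, Pos_a]" using key[of Pos_a Neg_b] by simp
  show "card (mids {Neg_a, Neg_b}) = cnt w [Pos_b, Neg_a]" using key[of Neg_a Pos_b] by simp
qed

text \<open>Index 0 is the letter before the common segment, indices 1 to \<open>n\<close> are the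
  segment, and \<open>Suc n\<close> is the letter after it.\<close>

definition crossing_strands :: "nat \<Rightarrow> ((int \<times> bool) \<times> (int \<times> bool)) set" where
  "crossing_strands n = {(s, t). s \<in> strands w \<and> t \<in> strands w \<and> ray g s 0 \<noteq> ray g t 0 \<and>
     (\<forall>k\<in>{1..n}. ray g s k = ray g t k) \<and> ray g s (Suc n) \<noteq> ray g t (Suc n) \<and>
     cyc3 (bar (ray g s 0)) (bar (ray g t 0)) (ray g s 1) * cyc3 (bar (ray g s n)) (ray g t (Suc n)) (ray g s (Suc n)) < 0}"

lemma reduced_list_ray: "reduced_list (map (ray g s) [m..<n])"
proof -
  have "reduced (\<lambda>k. ray g s (m + k))" by (rule reduced_shift[OF reduced_ray[OF bireduced_g]])
  from reduced_list_map_upt[OF this, of "n - m"] show ?thesis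
  proof -
    assume "reduced_list (map (\<lambda>k. ray g s (m + k)) [0..<n - m])"
    moreover have "map (\<lambda>k. ray g s (m + k)) [0..<n - m] = map (ray g s) [m..<n]" by (rule nth_equalityI) auto
    ultimately show ?thesis by simp
  qed
qed

lemma crossing_strands_eq:
  assumes "n \<ge> 1"
  shows "crossing_strands n = (\<Union>(v, x, x', y, y')\<in>{(v, x, x', y, y'). v \<in> reduced_words n \<and> crossing_ends x x' v y y'}.
    occurrences w (x # v @ [y]) \<times> occurrences w (x' # v @ [y']))" (is "_ = ?R")
proof -
  have occ: "s \<in> occurrences w (x # v @ [y]) \<longleftrightarrow> s \<in> strands w \<and> ray g s 0 = x \<and> map (ray g s) [1..<Suc n] = v \<and> ray g s (Suc n) = y"
    if "length v = n" for s x v y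
  proof -
    have "(\<forall>k<length (x # v @ [y]). ray g s k = (x # v @ [y]) ! k) \<longleftrightarrow> map (ray g s) [0..<Suc (Suc n)] = x # v @ [y]"
      using that by (auto simp: list_eq_iff_nth_eq simp del: upt_Suc)
    also have "map (ray g s) [0..<Suc (Suc n)] = ray g s 0 # map (ray g s) [1..<Suc n] @ [ray g s (Suc n)]"
    proof -
      have "[0..<Suc (Suc n)] = 0 # [1..<Suc n] @ [Suc n]" using assms by (simp add: upt_conv_Cons)
      then show ?thesis by (simp del: upt_Suc)
    qed
    also have "\<dots> = x # v @ [y] \<longleftrightarrow> ray g s 0 = x \<and> map (ray g s) [1..<Suc n] = v \<and> ray g s (Suc n) = y"
      using that by auto
    finally show ?thesis unfolding occurrences_def by blast
  qed
  have "hd (map (ray g s) [1..<Suc n]) = ray g s 1" for s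
    using assms upt_conv_Cons[of 1 "Suc n"] by (simp del: upt_Suc)
  moreover have "last (map (ray g s) [1..<Suc n]) = ray g s n" for s using assms by simp
  ultimately have hl: "hd (map (ray g s) [1..<Suc n]) = ray g s 1" "last (map (ray g s) [1..<Suc n]) = ray g s n" for s
    by blast+
  show ?thesis
  proof (intro set_eqI iffI)
    fix z assume "z \<in> crossing_strands n"
    then obtain s t where z: "z = (s, t)" "s \<in> strands w" "t \<in> strands w" "ray g s 0 \<noteq> ray g t 0"
     "\<forall>k\<in>{1..n}. ray g s k = ray g t k" "ray g s (Suc n) \<noteq> ray g t (Suc n)"
     "cyc3 (bar (ray g s 0)) (bar (ray g t 0)) (ray g s 1) * cyc3 (bar (ray g s n)) (ray g t (Suc n)) (ray g s (Suc n)) < 0"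
      unfolding crossing_strands_def by blast
    define v where "v = map (ray g s) [1..<Suc n]"
    have "v = map (ray g t) [1..<Suc n]" using z(5) by (auto simp: v_def simp del: upt_Suc)
    moreover have "length v = n" by (simp add: v_def)
    ultimately have "z \<in> occurrences w (ray g s 0 # v @ [ray g s (Suc n)]) \<times> occurrences w (ray g t 0 # v @ [ray g t (Suc n)])"
      using z occ v_def by simp
    moreover have "v \<in> reduced_words n" using reduced_list_ray[of s 1 "Suc n"] by (simp add: reduced_words_def v_def del: upt_Suc)
    moreover have "crossing_ends (ray g s 0) (ray g t 0) v (ray g s (Suc n)) (ray g t (Suc n))"
      unfolding crossing_ends_def v_def hl using z(7) .
    ultimately show "z \<in> ?R" by blast
  next
    fix z assume "z \<in> ?R"
    then obtain v x x' y y' s t where z: "z = (s, t)" "length v = n" "crossing_ends x x' v y y'"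
       "s \<in> occurrences w (x # v @ [y])" "t \<in> occurrences w (x' # v @ [y'])" by (auto simp: reduced_words_def)
    have s: "s \<in> strands w" "ray g s 0 = x" "map (ray g s) [1..<Suc n] = v" "ray g s (Suc n) = y"
      and t: "t \<in> strands w" "ray g t 0 = x'" "map (ray g t) [1..<Suc n] = v" "ray g t (Suc n) = y'"
      using z occ by blast+
    have c: "cyc3 (bar x) (bar x') (ray g s 1) * cyc3 (bar (ray g s n)) y' y < 0"
      using z(3) hl s(3) unfolding crossing_ends_def by metis
    then have "x \<noteq> x'" "y \<noteq> y'" by (auto simp: cyc3_def)
    moreover have "\<forall>k\<in>{1..n}. ray g s k = ray g t k"
    proof -
      have "map (ray g s) [1..<Suc n] = map (ray g t) [1..<Suc n]" using s t by simp
      then show ?thesis by (auto simp del: upt_Suc)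
    qed
    ultimately show "z \<in> crossing_strands n" unfolding crossing_strands_def z(1) using s t c by simp
  qed
qed

lemma card_crossing_strands:
  assumes "n \<ge> 1"
  shows "real (card (crossing_strands n)) = crossing_sum (\<lambda>p. real (cnt w p)) n"
proof -
  let ?I = "{(v, x, x', y, y'). v \<in> reduced_words n \<and> crossing_ends x x' v y y'}"
  let ?B = "reduced_words n \<times> (UNIV :: letter set) \<times> (UNIV :: letter set) \<times> (UNIV :: letter set) \<times> (UNIV :: letter set)"
  have fB: "finite ?B" by simp
  have fI: "finite ?I" by (rule finite_subset[OF _ fB]) auto
  have "card (crossing_strands n) = (\<Sum>(v, x, x', y, y')\<in>?I. cnt w (x # v @ [y]) * cnt w (x' # v @ [y']))"
    unfolding crossing_strands_eq[OF assms]
  proof (subst card_UN_disjoint)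
    show "\<forall>i\<in>?I. \<forall>j\<in>?I. i \<noteq> j \<longrightarrow> (case i of (v, x, x', y, y') \<Rightarrow> occurrences w (x # v @ [y]) \<times> occurrences w (x' # v @ [y'])) \<inter>
        (case j of (v, x, x', y, y') \<Rightarrow> occurrences w (x # v @ [y]) \<times> occurrences w (x' # v @ [y'])) = {}"
    proof (intro ballI impI)
      have un: "p = p'" if "s \<in> occurrences w p" "s \<in> occurrences w p'" "length p = length p'" for s p p'
        using that by (intro nth_equalityI) (auto simp: occurrences_def)
      fix i j assume ij: "i \<in> ?I" "j \<in> ?I" "i \<noteq> j"
      obtain v x x' y y' where i: "i = (v, x, x', y, y')" by (cases i)
      obtain u z z' q q' where j: "j = (u, z, z', q, q')" by (cases j)
      have len: "length v = n" "length u = n" using ij i j by (auto simp: reduced_words_def)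
      show "(case i of (v, x, x', y, y') \<Rightarrow> occurrences w (x # v @ [y]) \<times> occurrences w (x' # v @ [y'])) \<inter>
        (case j of (v, x, x', y, y') \<Rightarrow> occurrences w (x # v @ [y]) \<times> occurrences w (x' # v @ [y'])) = {}"
      proof (rule ccontr)
        assume "\<not> ?thesis"
        then obtain s t where st: "s \<in> occurrences w (x # v @ [y])" "s \<in> occurrences w (z # u @ [q])"
          "t \<in> occurrences w (x' # v @ [y'])" "t \<in> occurrences w (z' # u @ [q'])" unfolding i j by auto
        have "x # v @ [y] = z # u @ [q]" using un[OF st(1,2)] len by simp
        moreover have "x' # v @ [y'] = z' # u @ [q']" using un[OF st(3,4)] len by simp
        ultimately
        show False using ij(3) i j by simp
      qed
    qed
  qed (use fI in \<open>auto simp: cnt_def card_cartesian_product case_prod_beta\<close>)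
  also have "real \<dots> = (\<Sum>(v, x, x', y, y')\<in>?I. real (cnt w (x # v @ [y])) * real (cnt w (x' # v @ [y'])))"
    by (simp add: case_prod_beta)
  also have "\<dots> = (\<Sum>(v, x, x', y, y')\<in>?B. if crossing_ends x x' v y y' then real (cnt w (x # v @ [y])) * real (cnt w (x' # v @ [y'])) else 0)"
    by (rule sum.mono_neutral_cong_left[OF fB]) (auto split: if_splits)
  also have "\<dots> = crossing_sum (\<lambda>p. real (cnt w p)) n"
    unfolding crossing_sum_def by (simp add: sum.cartesian_product case_prod_beta)
  finally show ?thesis .
qed

text \<open>One step leads from a crossing pair of strands to an end pair. By
  \<open>strand_det\<close> only \<open>(s, t)\<close> and \<open>(t, s)\<close> lead to the same
  one, hence the factor 2.\<close>

lemma card_end_pairs_lower: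
  assumes "N \<subseteq> {1..}" "finite N"
  shows "(\<Sum>n\<in>N. card (crossing_strands n)) \<le> 2 * card end_pairs"
proof -
  let ?U = "\<Union>n\<in>N. crossing_strands n"
  define h where "h z = {lf (fst (step (Suc 0) (fst z))), lf (fst (step (Suc 0) (snd z)))}" for z
  have fc: "finite (crossing_strands n)" for n
    by (rule finite_subset[of _ "strands w \<times> strands w"]) (auto simp: crossing_strands_def)
  have fU: "finite ?U" using assms fc by blast
  have "crossing_strands m \<inter> crossing_strands n = {}" if "m \<noteq> n" "m \<in> N" "n \<in> N" for m n
  proof -
    have *: "crossing_strands m \<inter> crossing_strands n = {}" if "m < n" "m \<ge> 1" for m n
      using that unfolding crossing_strands_def by fastforce
    from that consider "m < n" | "n < m" by linarith
    then show ?thesis using *[of m n] *[of n m] that assms by cases auto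
  qed
  then have "(\<Sum>n\<in>N. card (crossing_strands n)) = card ?U"
    by (intro card_UN_disjoint[symmetric]) (use assms fc in auto)
  also have "\<dots> \<le> 2 * card end_pairs"
  proof (rule card_le_of_fibres[OF fU])
    show "finite end_pairs" using finite_crossing_pairs end_pairs_subset finite_subset by blast
    have facts: "ray g (step (Suc 0) s) 0 = ray g (step (Suc 0) t) 0 \<and>
        ray g (flip (step (Suc 0) s)) 0 \<noteq> ray g (flip (step (Suc 0) t)) 0 \<and> separates (lf (fst (step (Suc 0) s))) (lf (fst (step (Suc 0) t)))"
      if st: "(s, t) \<in> ?U" for s t
    proof -
      obtain n where n: "n \<in> N" "(s, t) \<in> crossing_strands n" using st by blast
      then obtain m where m: "n = Suc m" using assms by (cases n) auto
      have c: "ray g s 0 \<noteq> ray g t 0" "\<forall>k\<in>{1..n}. ray g s k = ray g t k" "ray g s (Suc n) \<noteq> ray g t (Suc n)"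
        "cyc3 (bar (ray g s 0)) (bar (ray g t 0)) (ray g s 1) * cyc3 (bar (ray g s n)) (ray g t (Suc n)) (ray g s (Suc n)) < 0"
        using n(2) unfolding crossing_strands_def by auto
      have agree: "\<forall>k<Suc m. ray g (step (Suc 0) s) k = ray g (step (Suc 0) t) k" using c(2) m by (simp add: ray_step)
      have bk: "ray g (flip (step (Suc 0) s)) 0 \<noteq> ray g (flip (step (Suc 0) t)) 0" using c(1) by (simp add: ray_flip_step_0)
      have "ray g (step (Suc 0) s) (Suc m) \<noteq> ray g (step (Suc 0) t) (Suc m)" using c(3) m by (simp add: ray_step)
      from separates_diverging_iff[OF bireduced_g bk agree this] c(4) m
      have "separates (ends g (step (Suc 0) s)) (ends g (step (Suc 0) t))" by (simp add: ray_step ray_flip_step_0)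
      then show ?thesis using agree bk unfolding separates_strands by simp
    qed
    fix z assume "z \<in> ?U"
    then have f: "ray g (step (Suc 0) (fst z)) 0 = ray g (step (Suc 0) (snd z)) 0"
       "ray g (flip (step (Suc 0) (fst z))) 0 \<noteq> ray g (flip (step (Suc 0) (snd z))) 0"
       "separates (lf (fst (step (Suc 0) (fst z)))) (lf (fst (step (Suc 0) (snd z))))"
      using facts[of "fst z" "snd z"] by auto
    then show "h z \<in> end_pairs" unfolding h_def end_pairs_def using shared_one_iff[OF f(1)] by blast
  next
    fix X assume "X \<in> end_pairs"
    show "card {z \<in> ?U. h z = X} \<le> 2"
    proof (cases "{z \<in> ?U. h z = X} = {}")
      case False
      then obtain z0 where z0: "z0 \<in> ?U" "h z0 = X" by blast
      obtain s t where "z0 = (s, t)" by (cases z0)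
      then have st: "(s, t) \<in> ?U" "h (s, t) = X" using z0 by blast+
      have data: "s \<in> strands w \<and> t \<in> strands w \<and> ray g s 1 = ray g t 1 \<and> ray g s 0 \<noteq> ray g t 0" if "(s, t) \<in> ?U" for s t
        using that assms unfolding crossing_strands_def by force
      have shared: "turn g (fst (step (Suc 0) s)) \<inter> turn g (fst (step (Suc 0) t)) = {ray g s 1}" if "(s, t) \<in> ?U" for s t
        using data[OF that] ray_Suc_neq[OF bireduced_g, of s 0] ray_Suc_neq[OF bireduced_g, of t 0]
        unfolding turn_strand by (auto simp: ray_step ray_flip_step_0)
      have "{z \<in> ?U. h z = X} \<subseteq> {(s, t), (t, s)}"
      proof
        fix z assume zX: "z \<in> {z \<in> ?U. h z = X}"
        obtain s' t' where "z = (s', t')" by (cases z)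
        then have z: "z = (s', t')" "(s', t') \<in> ?U" "h (s', t') = X" using zX by blast+
        have e: "{lf (fst (step (Suc 0) s')), lf (fst (step (Suc 0) t'))} = {lf (fst (step (Suc 0) s)), lf (fst (step (Suc 0) t))}"
          using z(3) st(2) by (simp add: h_def)
        then have alt: "lf (fst (step (Suc 0) s')) = lf (fst (step (Suc 0) s)) \<and> lf (fst (step (Suc 0) t')) = lf (fst (step (Suc 0) t))
          \<or> lf (fst (step (Suc 0) s')) = lf (fst (step (Suc 0) t)) \<and> lf (fst (step (Suc 0) t')) = lf (fst (step (Suc 0) s))"
          by (auto simp: doubleton_eq_iff)
        then have "turn g (fst (step (Suc 0) s')) \<inter> turn g (fst (step (Suc 0) t')) = turn g (fst (step (Suc 0) s)) \<inter> turn g (fst (step (Suc 0) t))"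
          using turn_cong by (metis Int_commute)
        then have "ray g s' 1 = ray g s 1" unfolding shared[OF z(2)] shared[OF st(1)] by simp
        then have r: "ray g s' 1 = ray g s 1" "ray g t' 1 = ray g t 1" "ray g s 1 = ray g t 1"
          using data[OF z(2)] data[OF st(1)] by auto
        have m: "s \<in> strands w" "t \<in> strands w" "s' \<in> strands w" "t' \<in> strands w" using data[OF z(2)] data[OF st(1)] by auto
        from alt show "z \<in> {(s, t), (t, s)}"
        proof
          assume "lf (fst (step (Suc 0) s')) = lf (fst (step (Suc 0) s)) \<and> lf (fst (step (Suc 0) t')) = lf (fst (step (Suc 0) t))"
          then have "s' = s" "t' = t" using strand_det m r by metis+
          then show ?thesis using z by simp
        next
          assume "lf (fst (step (Suc 0) s')) = lf (fst (step (Suc 0) t)) \<and> lf (fst (step (Suc 0) t')) = lf (fst (step (Suc 0) s))"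
          then have "s' = t" "t' = s" using strand_det m r by metis+
          then show ?thesis using z by simp
        qed
      qed
      then have "card {z \<in> ?U. h z = X} \<le> card {(s, t), (t, s)}" by (rule card_mono[rotated]) simp
      also have "\<dots> \<le> 2" using card_insert_le_m1[of 2 "{(t, s)}" "(s, t)"] by simp
      finally show ?thesis .
    next
      case True
      show ?thesis unfolding True by simp
    qed
  qed
  finally show ?thesis .
qed

end

section \<open>Rotations and powers of words\<close>

lemma sum_periodic_shift:
  fixes f :: "nat \<Rightarrow> nat"
  assumes "\<And>i. f (i + l) = f i" shows "(\<Sum>i<l. f (i + k)) = (\<Sum>i<l. f i)"
proof (induction k)
  case (Suc k)
  have "f k + (\<Sum>i<l. f (Suc i + k)) = (\<Sum>i<l. f (i + k)) + f (l + k)"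
    using sum.lessThan_Suc_shift[of "\<lambda>i. f (i + k)" l] by simp
  then show ?case using Suc assms[of k] by (simp add: add.commute)
qed simp

lemma sum_periodic_mult:
  fixes f :: "nat \<Rightarrow> nat"
  assumes "\<And>i. f (i + l) = f i" shows "(\<Sum>i<m * l. f i) = m * (\<Sum>i<l. f i)"
proof (induction m)
  case (Suc m)
  have "(\<Sum>i<l + m * l. f i) = (\<Sum>i<l. f i) + (\<Sum>i<m * l. f (i + l))"
    by (simp add: sum.nat_group lessThan_atLeast0 sum.atLeastLessThan_concat[symmetric, of 0 l "l + m * l"] sum.shift_bounds_nat_ivl[of f 0 l "m * l", symmetric] add.commute)
  then show ?case using Suc assms by simp
qed simp

lemma cnt_sum:
  "cnt w p = (\<Sum>i<length w. of_bool (\<forall>k<length p. ray (per w) (int i, True) k = p ! k) + of_bool (\<forall>k<length p. ray (per w) (int i, False) k = p ! k))"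
proof -
  define A where "A \<sigma> = {i. i < length w \<and> (\<forall>k<length p. ray (per w) (int i, \<sigma>) k = p ! k)}" for \<sigma>
  have cA: "card (A \<sigma>) = (\<Sum>i<length w. of_bool (\<forall>k<length p. ray (per w) (int i, \<sigma>) k = p ! k))" for \<sigma>
    by (simp add: A_def sum.If_cases of_bool_def lessThan_def Int_def)
  have "occurrences w p = (\<Union>\<sigma>\<in>UNIV. (\<lambda>i. (int i, \<sigma>)) ` A \<sigma>)"
  proof (intro set_eqI iffI)
    fix s assume s: "s \<in> occurrences w p"
    then have "s = (int (nat (fst s)), snd s)" "nat (fst s) \<in> A (snd s)"
      by (auto simp: occurrences_def strands_def A_def nat_less_iff)
    then show "s \<in> (\<Union>\<sigma>\<in>UNIV. (\<lambda>i. (int i, \<sigma>)) ` A \<sigma>)" by blast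
  qed (auto simp: occurrences_def strands_def A_def)
  also have "card \<dots> = (\<Sum>\<sigma>\<in>UNIV. card ((\<lambda>i. (int i, \<sigma>)) ` A \<sigma>))"
    by (rule card_UN_disjoint) (auto simp: A_def)
  also have "\<dots> = (\<Sum>\<sigma>\<in>UNIV. card (A \<sigma>))" by (intro sum.cong refl card_image) (auto simp: inj_on_def)
  also have "\<dots> = card (A True) + card (A False)" by (simp add: UNIV_bool)
  finally show ?thesis unfolding cnt_def by (simp only: cA sum.distrib)
qed

lemma ray_per_period: "ray (per w) (int (i + length w), \<sigma>) = ray (per w) (int i, \<sigma>)"
  by (rule ext) (auto simp: ray_def fwd_def bwd_def intro!: per_mod arg_cong[where f = bar] simp: mod_eq_dvd_iff)

lemma per_rotate: "w \<noteq> [] \<Longrightarrow> per (rotate k w) i = per w (i + int k)"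
proof -
  assume w: "w \<noteq> []"
  define n where "n = nat (i mod int (length w))"
  have n: "int n = i mod int (length w)" "n < length w" using w by (auto simp: n_def nat_less_iff)
  have "per (rotate k w) i = rotate k w ! n" by (simp add: per_def n_def)
  also have "\<dots> = per w (int (k + n))" using n by (simp add: nth_rotate per_nat_mod del: of_nat_add)
  also have "\<dots> = per w (i + int k)" by (rule per_mod) (simp add: n mod_simps add.commute)
  finally show ?thesis .
qed

lemma cnt_rotate: "w \<noteq> [] \<Longrightarrow> cnt (rotate k w) p = cnt w p"
proof -
  assume w: "w \<noteq> []"
  have r: "ray (per (rotate k w)) (int i, \<sigma>) = ray (per w) (int (i + k), \<sigma>)" for i \<sigma>
    by (rule ext) (simp add: ray_def fwd_def bwd_def per_rotate[OF w] algebra_simps)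
  show ?thesis unfolding cnt_sum r length_rotate
    by (rule sum_periodic_shift) (simp only: ray_per_period)
qed

lemma length_concat_replicate: "length (concat (replicate m v)) = m * length v"
  by (induction m) simp_all

lemma nth_concat_replicate: "k < m * length v \<Longrightarrow> concat (replicate m v) ! k = v ! (k mod length v)"
proof (induction m arbitrary: k)
  case (Suc m)
  show ?case
  proof (cases "k < length v")
    case False
    then have "concat (replicate m v) ! (k - length v) = v ! ((k - length v) mod length v)" using Suc by (intro Suc.IH) auto
    then show ?thesis using False by (simp add: nth_append le_mod_geq)
  qed (simp add: nth_append)
qed simp

lemma per_power:
  assumes "v \<noteq> []" "m > 0" shows "per (concat (replicate m v)) = per v"
proof
  fix i :: int
  define n where "n = nat (i mod int (m * length v))"
  have pos: "int (m * length v) > 0" using assms by simp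
  have n: "int n = i mod int (m * length v)" "n < m * length v" using pos by (auto simp: n_def nat_less_iff)
  have "per (concat (replicate m v)) i = concat (replicate m v) ! n" by (simp add: per_def n_def length_concat_replicate)
  also have "\<dots> = per v (int n)" unfolding per_nat_mod by (rule nth_concat_replicate[OF n(2)])
  also have "\<dots> = per v i" by (rule per_mod) (simp add: n mod_mod_cancel)
  finally show "per (concat (replicate m v)) i = per v i" .
qed

lemma cnt_power:
  assumes "v \<noteq> []" "m > 0" shows "cnt (concat (replicate m v)) p = m * cnt v p"
  unfolding cnt_sum per_power[OF assms] length_concat_replicate
  by (rule sum_periodic_mult) (simp only: ray_per_period)

lemma nonmid_power:
  assumes "v \<noteq> []" "m > 0" shows "nonmid (concat (replicate m v)) = m * nonmid v"
proof -
  have s: "nonmid w = (\<Sum>i<length w. of_bool (per w (int i) \<noteq> mid (per w (int i - 1))))" for w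
    by (simp add: nonmid_def sum.If_cases of_bool_def lessThan_def Int_def)
  have p: "per v (int (i + length v)) = per v (int i)" "per v (int (i + length v) - 1) = per v (int i - 1)" for i
    by (rule per_mod, simp add: mod_eq_dvd_iff)+
  show ?thesis unfolding s per_power[OF assms] length_concat_replicate
    by (rule sum_periodic_mult) (simp only: p)
qed

lemma ex_primitive_root:
  assumes "w \<noteq> []" shows "\<exists>v m. primitive_word v \<and> 0 < m \<and> w = concat (replicate m v)"
  using assms
proof (induction "length w" arbitrary: w rule: less_induct)
  case less
  show ?case
  proof (cases "primitive_word w")
    case True then show ?thesis by (intro exI[of _ w] exI[of _ 1]) simp
  next
    case False
    then obtain u k where u: "2 \<le> k" "w = concat (replicate k u)" using less.prems unfolding primitive_word_def by blast
    have une: "u \<noteq> []" using u less.prems by auto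
    have "length u < length w" using u une by (simp add: length_concat_replicate)
    then obtain v m where v: "primitive_word v" "0 < m" "u = concat (replicate m v)" using less.hyps une by blast
    have "concat (replicate k (concat (replicate m v))) = concat (replicate (k * m) v)"
      by (induction k) (simp_all add: replicate_add)
    then show ?thesis using u v by (intro exI[of _ v] exI[of _ "k * m"]) auto
  qed
qed

lemma primitive_root_unique:
  assumes "primitive_word v" "primitive_word v'" "0 < m" "0 < m'" "concat (replicate m v) = concat (replicate m' v')"
  shows "v = v' \<and> m = m'"
proof -
  have ne: "v \<noteq> []" "v' \<noteq> []" using assms by (auto simp: primitive_word_def)
  have p: "per v = per v'" using per_power ne assms by metis
  have "length v dvd length v'" if "primitive_word v" "per v = per v'" for v v'
  proof -
    have "per v (0 + int n) = per v (int (length v') + int n)" for n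
      unfolding that(2) using per_add_length[of v' "int n"] by (simp add: add.commute)
    from primitive_period[OF that(1) this] show ?thesis
      by (metis mod_0 dvd_eq_mod_eq_0 int_dvd_int_iff)
  qed
  then have "length v = length v'" using assms p by (metis dvd_antisym)
  then have "v = v'" using map_fwd_per p by metis
  moreover have "m * length v = m' * length v'" using assms(5) length_concat_replicate by metis
  ultimately show ?thesis using ne by simp
qed

lemma word_self_int_power:
  assumes "primitive_word v" "0 < m"
  shows "word_self_int a b (concat (replicate m v)) = m\<^sup>2 * primitive_self_int a b v"
  unfolding word_self_int_def
proof (rule the_equality)
  fix n assume "\<exists>v' m'. primitive_word v' \<and> concat (replicate m v) = concat (replicate m' v') \<and> n = m'\<^sup>2 * primitive_self_int a b v'"
  then obtain v' m' where v': "primitive_word v'" "concat (replicate m v) = concat (replicate m' v')" "n = m'\<^sup>2 * primitive_self_int a b v'" by blast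
  have "concat (replicate m v) \<noteq> []" using assms by (auto simp: primitive_word_def)
  then have "m' > 0" using v' by (cases m') auto
  then show "n = m\<^sup>2 * primitive_self_int a b v" using primitive_root_unique[OF assms(1) v'(1) assms(2) _ v'(2)] v' by simp
qed (use assms in blast)

lemma cyclically_reduced_iff: "cyclically_reduced w \<longleftrightarrow> w \<noteq> [] \<and> bireduced (per w)"
proof
  assume w: "w \<noteq> [] \<and> bireduced (per w)"
  have "w ! ((i + 1) mod length w) \<noteq> bar (w ! i)" if "i < length w" for i
    using w that per_nat_mod[of w "i + 1"] per_nth[of i w] unfolding bireduced_def by (metis of_nat_1 of_nat_add)
  then show "cyclically_reduced w" using w by (simp add: cyclically_reduced_def)
qed (use bireduced_per in \<open>auto simp: cyclically_reduced_def\<close>)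

lemma crossing_sum_scale: "crossing_sum (\<lambda>p. c * f p) n = c\<^sup>2 * crossing_sum f n"
proof -
  have "(if P then c * x * (c * y) else 0) = c\<^sup>2 * (if P then x * y else 0)" for P and x y :: real
    by (simp add: power2_eq_square)
  then show ?thesis unfolding crossing_sum_def by (simp add: sum_distrib_left)
qed

context schottky
begin

text \<open>All three terms are quadratic in the exponent, so the bound for the primitive root
  scales.\<close>

lemma word_self_int_upper:
  assumes "cyclically_reduced w" shows "8 * word_self_int a b w + (nonmid w)\<^sup>2 \<le> 2 * (length w)\<^sup>2"
proof -
  have "w \<noteq> []" using assms by (simp add: cyclically_reduced_def)
  then obtain v m where v: "primitive_word v" "0 < m" "w = concat (replicate m v)" using ex_primitive_root by blast
  have ne: "v \<noteq> []" using v by (auto simp: primitive_word_def)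
  have "cyclically_reduced v" using assms ne per_power[OF ne v(2)] unfolding cyclically_reduced_iff v(3) by simp
  then interpret primitive_geodesic a b D v using v by unfold_locales
  have "m\<^sup>2 * (8 * primitive_self_int a b v + (nonmid v)\<^sup>2) \<le> m\<^sup>2 * (2 * (length v)\<^sup>2)"
    using primitive_self_int_upper by (rule mult_le_mono2)
  then show ?thesis unfolding v(3) word_self_int_power[OF v(1,2)] nonmid_power[OF ne v(2)] length_concat_replicate
    by (simp add: algebra_simps power_mult_distrib)
qed

text \<open>Truncation at \<open>N\<close> leaves only finitely many subword counts to be
  controlled; in the application it costs no more than the factor 1 - (1/3)^N.\<close>

lemma word_self_int_lower:
  assumes "cyclically_reduced w"
  shows "4 * (real (cnt w [Neg_b, Pos_a]) * real (cnt w [Pos_b, Neg_a])) + (\<Sum>n=1..N. crossing_sum (\<lambda>p. real (cnt w p)) n)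
     \<le> 4 * real (word_self_int a b w)"
proof -
  have "w \<noteq> []" using assms by (simp add: cyclically_reduced_def)
  then obtain v m where v: "primitive_word v" "0 < m" "w = concat (replicate m v)" using ex_primitive_root by blast
  have ne: "v \<noteq> []" using v by (auto simp: primitive_word_def)
  have "cyclically_reduced v" using assms ne per_power[OF ne v(2)] unfolding cyclically_reduced_iff v(3) by simp
  then interpret primitive_geodesic a b D v using v by unfold_locales
  have "4 * card four_way_pairs + (\<Sum>n\<in>{1..N}. card (crossing_strands n)) \<le> 4 * primitive_self_int a b v"
    using card_end_pairs_lower[of "{1..N}"] primitive_self_int_eq by auto
  then have "real (4 * card four_way_pairs + (\<Sum>n\<in>{1..N}. card (crossing_strands n))) \<le> real (4 * primitive_self_int a b v)"
    by (simp only: of_nat_le_iff)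
  then have "4 * (real (cnt v [Neg_b, Pos_a]) * real (cnt v [Pos_b, Neg_a])) + (\<Sum>n=1..N. crossing_sum (\<lambda>p. real (cnt v p)) n)
     \<le> 4 * real (primitive_self_int a b v)"
    by (simp add: card_four_way_pairs card_mids_cnt card_crossing_strands)
  then have "(real m)\<^sup>2 * (4 * (real (cnt v [Neg_b, Pos_a]) * real (cnt v [Pos_b, Neg_a])) + (\<Sum>n=1..N. crossing_sum (\<lambda>p. real (cnt v p)) n))
     \<le> (real m)\<^sup>2 * (4 * real (primitive_self_int a b v))" by (rule mult_left_mono) simp
  then show ?thesis unfolding v(3) word_self_int_power[OF v(1,2)] cnt_power[OF ne v(2)] of_nat_mult crossing_sum_scale
    by (simp add: algebra_simps sum_distrib_left power2_eq_square)
qed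

end

section \<open>Words with many occurrences of every reduced word\<close>

text \<open>Occurrences inside the linear word, none across its ends, so that they are superadditive
  under concatenation.\<close>

fun occ :: "letter list \<Rightarrow> letter list \<Rightarrow> nat" where
  "occ p [] = 0"
| "occ p (x # w) = of_bool (take (length p) (x # w) = p) + occ p w"

definition inv_word :: "letter list \<Rightarrow> letter list" where
  "inv_word p = rev (map bar p)"

lemma occ_append: "occ p u + occ p v \<le> occ p (u @ v)"
proof (induction u)
  case (Cons x u)
  have "take (length p) (x # u @ v) = p" if "take (length p) (x # u) = p"
  proof -
    have "length p \<le> length (x # u)" using that by (metis length_take min.cobounded1 min_def)
    then have "take (length p) ((x # u) @ v) = take (length p) (x # u)" by (subst take_append) simp
    then show ?thesis using that by simp
  qed
  then show ?case using Cons by auto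
qed simp

lemma occ_eq_card:
  assumes "p \<noteq> []" shows "occ p w = card {i. i < length w \<and> take (length p) (drop i w) = p}"
proof (induction w)
  case (Cons x w)
  have "{i. i < length (x # w) \<and> take (length p) (drop i (x # w)) = p} =
     {i. i = 0 \<and> take (length p) (x # w) = p} \<union> Suc ` {i. i < length w \<and> take (length p) (drop i w) = p}"
    by (auto simp: image_iff less_Suc_eq_0_disj)
  also have "card \<dots> = card {i::nat. i = 0 \<and> take (length p) (x # w) = p} + card (Suc ` {i. i < length w \<and> take (length p) (drop i w) = p})"
    by (rule card_Un_disjoint) auto
  also have "\<dots> = occ p (x # w)" by (simp add: card_image Cons)
  finally show ?case by simp
qed simp

text \<open>An occurrence of the inverse word at position i is an occurrence of \<open>p\<close>
  read backwards from position i + \<open>length p\<close>; this position is reduced modulo the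
  length, since it may be the end of the word.\<close>

lemma cnt_ge_occ:
  assumes "p \<noteq> []" shows "occ p w + occ (inv_word p) w \<le> cnt w p"
proof -
  let ?L = "length w" and ?l = "length p"
  have pl: "?l > 0" using assms by simp
  define A where "A = {i. i < ?L \<and> take ?l (drop i w) = p}"
  define B where "B = {i. i < ?L \<and> take ?l (drop i w) = inv_word p}"
  have il: "length (inv_word p) = ?l" by (simp add: inv_word_def)
  have len: "i + ?l \<le> ?L" if "take ?l (drop i w) = q" "length q = ?l" "i < ?L" for i q
  proof -
    have "min (?L - i) ?l = ?l" using that by (metis length_drop length_take min.commute)
    then show ?thesis using that(3) pl by (simp add: min_def split: if_splits)
  qed
  have nth: "w ! (i + k) = q ! k" if "take ?l (drop i w) = q" "length q = ?l" "i < ?L" "k < ?l" for i q k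
    using that len[OF that(1-3)] by (metis add.commute le_add1 nth_drop nth_take le_trans less_imp_le)
  have "(\<lambda>i. (int i, True)) ` A \<union> (\<lambda>i. (int ((i + ?l) mod ?L), False)) ` B \<subseteq> occurrences w p"
  proof (intro Un_least subsetI)
    fix s assume "s \<in> (\<lambda>i. (int i, True)) ` A"
    then obtain i where i: "s = (int i, True)" "i < ?L" "take ?l (drop i w) = p" by (auto simp: A_def)
    have "ray (per w) s k = p ! k" if "k < ?l" for k
    proof -
      have "i + k < ?L" using len[OF i(3) refl i(2)] that by simp
      then show ?thesis using nth[OF i(3) refl i(2) that] per_nth[of "i + k" w] by (simp add: i ray_def fwd_def)
    qed
    then show "s \<in> occurrences w p" using i by (simp add: occurrences_def strands_def)
  next
    fix s assume "s \<in> (\<lambda>i. (int ((i + ?l) mod ?L), False)) ` B"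
    then obtain i where i: "s = (int ((i + ?l) mod ?L), False)" "i < ?L" "take ?l (drop i w) = inv_word p" by (auto simp: B_def)
    have "ray (per w) s k = p ! k" if "k < ?l" for k
    proof -
      have le: "i + ?l \<le> ?L" using len[OF i(3) il i(2)] .
      have "per w (int ((i + ?l) mod ?L) - 1 - int k) = per w (int (i + (?l - Suc k)))"
        by (rule per_mod) (use that in \<open>simp add: zmod_int mod_simps of_nat_diff algebra_simps\<close>)
      also have "\<dots> = w ! (i + (?l - Suc k))" using le that by (intro per_nth) simp
      also have "\<dots> = inv_word p ! (?l - Suc k)" by (rule nth[OF i(3) il i(2)]) (use that in simp)
      also have "\<dots> = bar (p ! k)" using that by (simp add: inv_word_def rev_nth)
      finally show ?thesis by (simp add: i ray_def bwd_def)
    qed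
    moreover have "?L > 0" by (rule le_less_trans[OF le0 i(2)])
    ultimately show "s \<in> occurrences w p" using i by (simp add: occurrences_def strands_def)
  qed
  then have "card ((\<lambda>i. (int i, True)) ` A \<union> (\<lambda>i. (int ((i + ?l) mod ?L), False)) ` B) \<le> cnt w p"
    unfolding cnt_def by (rule card_mono[OF finite_occurrences])
  moreover have "card ((\<lambda>i. (int i, True)) ` A \<union> (\<lambda>i. (int ((i + ?l) mod ?L), False)) ` B) =
      card ((\<lambda>i. (int i, True)) ` A) + card ((\<lambda>i. (int ((i + ?l) mod ?L), False)) ` B)"
    by (rule card_Un_disjoint) (auto simp: A_def B_def)
  moreover have "card ((\<lambda>i. (int i, True)) ` A) = card A" by (rule card_image) (simp add: inj_on_def)
  moreover have "card ((\<lambda>i. (int ((i + ?l) mod ?L), False)) ` B) = card B"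
  proof (rule card_image, rule inj_onI)
    fix i j assume ij: "i \<in> B" "j \<in> B" "(int ((i + ?l) mod ?L), False) = (int ((j + ?l) mod ?L), False)"
    then have e: "(i + ?l) mod ?L = (j + ?l) mod ?L" by simp
    have b: "i + ?l \<le> ?L" "j + ?l \<le> ?L" using ij len[OF _ il] by (auto simp: B_def)
    have m: "(n mod ?L = 0 \<longleftrightarrow> n = ?L) \<and> (n \<noteq> ?L \<longrightarrow> n mod ?L = n)" if "0 < n" "n \<le> ?L" for n
      using that by (cases "n = ?L") auto
    show "i = j" using e m[of "i + ?l"] m[of "j + ?l"] b pl
      by (metis add_gr_0 add_right_cancel)
  qed
  ultimately show ?thesis using occ_eq_card[OF assms, of w] occ_eq_card[of "inv_word p" w] assms il
    by (simp add: A_def B_def inv_word_def)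
qed

lemma card_UNIV_minus_letter: "card (UNIV - {e :: letter}) = 3"
  by (cases e; simp add: UNIV_letter insert_Diff_if)

lemma reduced_words_Cons:
  assumes "n \<ge> 1"
  shows "reduced_words (Suc n) = (\<lambda>(B, x). x # B) ` (SIGMA B : reduced_words n. UNIV - {bar (hd B)})"
proof (intro set_eqI iffI)
  fix w assume "w \<in> reduced_words (Suc n)"
  then obtain x B where w: "w = x # B" "reduced_list (x # B)" "length B = n" by (cases w) (auto simp: reduced_words_def)
  then have "B \<in> reduced_words n" "x \<noteq> bar (hd B)"
    using assms by (auto simp: reduced_words_def reduced_list_def successively_Cons)
  then show "w \<in> (\<lambda>(B, x). x # B) ` (SIGMA B : reduced_words n. UNIV - {bar (hd B)})" using w by (intro image_eqI[of _ _ "(B, x)"]) auto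
next
  fix w assume "w \<in> (\<lambda>(B, x). x # B) ` (SIGMA B : reduced_words n. UNIV - {bar (hd B)})"
  then obtain x B where w: "w = x # B" "B \<in> reduced_words n" "x \<noteq> bar (hd B)" by auto
  then show "w \<in> reduced_words (Suc n)"
    using assms by (auto simp: reduced_words_def reduced_list_def successively_Cons)
qed

lemma reduced_words_snoc:
  assumes "n \<ge> 1"
  shows "reduced_words (Suc n) = (\<lambda>(B, x). B @ [x]) ` (SIGMA B : reduced_words n. UNIV - {bar (last B)})"
proof (intro set_eqI iffI)
  fix w assume w0: "w \<in> reduced_words (Suc n)"
  then obtain x B where w: "w = B @ [x]" "reduced_list (B @ [x])" "length B = n" by (cases w rule: rev_cases) (auto simp: reduced_words_def)
  then have "B \<in> reduced_words n" "x \<noteq> bar (last B)"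
    using assms by (auto simp: reduced_words_def reduced_list_def successively_append_iff)
  then show "w \<in> (\<lambda>(B, x). B @ [x]) ` (SIGMA B : reduced_words n. UNIV - {bar (last B)})" using w by (intro image_eqI[of _ _ "(B, x)"]) auto
next
  fix w assume "w \<in> (\<lambda>(B, x). B @ [x]) ` (SIGMA B : reduced_words n. UNIV - {bar (last B)})"
  then obtain x B where w: "w = B @ [x]" "B \<in> reduced_words n" "x \<noteq> bar (last B)" by auto
  then show "w \<in> reduced_words (Suc n)"
    using assms by (auto simp: reduced_words_def reduced_list_def successively_append_iff)
qed

lemma sum_reduced_words_Cons:
  assumes "n \<ge> 1"
  shows "(\<Sum>w\<in>reduced_words (Suc n). F w) = (\<Sum>B\<in>reduced_words n. \<Sum>x\<in>UNIV - {bar (hd B)}. F (x # B))"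
proof -
  have "inj_on (\<lambda>(B, x). x # B) (SIGMA B : reduced_words n. UNIV - {bar (hd B)})" by (auto simp: inj_on_def)
  then show ?thesis unfolding reduced_words_Cons[OF assms] by (subst sum.reindex) (simp_all add: sum.Sigma case_prod_beta o_def)
qed

lemma reduced_words_1: "reduced_words 1 = (\<lambda>x. [x]) ` UNIV"
  by (auto simp: reduced_words_def reduced_list_def length_Suc_conv)

lemma card_reduced_words: "card (reduced_words (Suc n)) = 4 * 3 ^ n"
proof (induction n)
  case 0
  have "card ((\<lambda>x :: letter. [x]) ` UNIV) = card (UNIV :: letter set)" by (rule card_image) (simp add: inj_on_def)
  then show ?case using reduced_words_1 by (simp add: UNIV_letter)
next
  case (Suc n)
  have "card (reduced_words (Suc (Suc n))) = (\<Sum>w\<in>reduced_words (Suc (Suc n)). 1)" by simp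
  also have "\<dots> = (\<Sum>B\<in>reduced_words (Suc n). 3)"
    by (subst sum_reduced_words_Cons) (simp_all add: card_UNIV_minus_letter)
  finally show ?case using Suc by simp
qed

lemma card_reduced_words_prefix:
  assumes "p \<in> reduced_words l" "l \<ge> 1"
  shows "card {B \<in> reduced_words (l + n). take l B = p} = 3 ^ n"
proof (induction n)
  case 0
  have "{B \<in> reduced_words l. take l B = p} = {p}" using assms by (auto simp: reduced_words_def)
  then show ?case by simp
next
  case (Suc n)
  let ?X = "{B \<in> reduced_words (l + n). take l B = p}"
  have "{B \<in> reduced_words (l + Suc n). take l B = p} = (\<lambda>(B, x). B @ [x]) ` (SIGMA B : ?X. UNIV - {bar (last B)})"
    using reduced_words_snoc[of "l + n"] assms(2) by (auto simp: image_iff reduced_words_def)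
  moreover have "inj_on (\<lambda>(B, x). B @ [x]) (SIGMA B : ?X. UNIV - {bar (last B)})" by (auto simp: inj_on_def)
  ultimately have "card {B \<in> reduced_words (l + Suc n). take l B = p} = card (SIGMA B : ?X. UNIV - {bar (last B)})"
    by (simp only: card_image)
  also have "\<dots> = (\<Sum>B\<in>?X. 3)" by (subst card_SigmaI) (auto simp: card_UNIV_minus_letter)
  finally show ?case using Suc by simp
qed

text \<open>The n + 1 positions contribute 3^n each. In the induction, prepending a letter triples
  the old occurrences, and those at the front are counted by
  \<open>card_reduced_words_prefix\<close>.\<close>

lemma sum_occ_reduced_words:
  assumes "p \<in> reduced_words l" "l \<ge> 1"
  shows "(n + 1) * 3 ^ n \<le> (\<Sum>B\<in>reduced_words (l + n). occ p B)"
proof (induction n)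
  case 0
  have lp: "length p = l" using assms by (simp add: reduced_words_def)
  then have "occ p p \<ge> 1" using assms(2) by (cases p) auto
  also have "occ p p \<le> (\<Sum>B\<in>reduced_words l. occ p B)" by (rule member_le_sum) (use assms in auto)
  finally show ?case by simp
next
  case (Suc n)
  have lp: "length p = l" using assms by (simp add: reduced_words_def)
  have "(\<Sum>B\<in>reduced_words (l + Suc n). occ p B) = (\<Sum>B\<in>reduced_words (l + n). \<Sum>x\<in>UNIV - {bar (hd B)}. of_bool (take l (x # B) = p) + occ p B)"
    using sum_reduced_words_Cons[of "l + n" "occ p"] assms(2) lp by simp
  also have "\<dots> = (\<Sum>B\<in>reduced_words (l + n). \<Sum>x\<in>UNIV - {bar (hd B)}. of_bool (take l (x # B) = p)) + 3 * (\<Sum>B\<in>reduced_words (l + n). occ p B)"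
    by (simp add: sum.distrib card_UNIV_minus_letter sum_distrib_left)
  also have "(\<Sum>B\<in>reduced_words (l + n). \<Sum>x\<in>UNIV - {bar (hd B)}. of_bool (take l (x # B) = p)) = (\<Sum>B\<in>reduced_words (l + Suc n). of_bool (take l B = p) :: nat)"
    using sum_reduced_words_Cons[of "l + n" "\<lambda>B. of_bool (take l B = p) :: nat"] assms(2) by simp
  also have "\<dots> = 3 ^ Suc n"
    using card_reduced_words_prefix[OF assms, of "Suc n"] by (simp add: of_bool_def sum.If_cases Int_def)
  finally show ?case using Suc by (simp add: algebra_simps)
qed

section \<open>Alternating words\<close>

fun altfrom :: "letter \<Rightarrow> nat \<Rightarrow> letter list" where
  "altfrom e 0 = []"
| "altfrom e (Suc n) = e # altfrom (mid e) n"

lemma length_altfrom [simp]: "length (altfrom e n) = n"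
  by (induction n arbitrary: e) auto

lemma take_altfrom: "take l (altfrom e n) = altfrom e (min l n)"
proof (induction n arbitrary: e l)
  case (Suc n) then show ?case by (cases l) auto
qed simp

lemma successively_mid_iff: "successively (\<lambda>e f. f = mid e) p \<longleftrightarrow> p = altfrom (hd p) (length p)"
proof (induction p)
  case (Cons x p)
  show ?case
  proof (cases p)
    case (Cons y q)
    then show ?thesis using Cons.IH by (auto simp: successively_Cons)
  qed simp
qed simp

lemma occ_altfrom:
  assumes "f = e \<or> f = mid e" "l \<ge> 1"
  shows "(n - l) div 2 \<le> occ (altfrom f l) (altfrom e n)"
  using assms(1)
proof (induction n rule: less_induct)
  case (less n)
  show ?case
  proof (cases "n < l + 2")
    case True then show ?thesis by auto
  next
    case False
    then have "n = Suc (Suc (n - 2))" by simp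
    then obtain m where m: "n = Suc (Suc m)" by blast
    have "(m - l) div 2 \<le> occ (altfrom f l) (altfrom e m)" using less m by simp
    moreover have "occ (altfrom f l) (altfrom e n) = of_bool (take l (altfrom e n) = altfrom f l)
        + (of_bool (take l (altfrom (mid e) (Suc m)) = altfrom f l) + occ (altfrom f l) (altfrom e m))"
      by (simp add: m)
    moreover have "take l (altfrom e n) = altfrom e l" "take l (altfrom (mid e) (Suc m)) = altfrom (mid e) l"
      unfolding take_altfrom using False m by (simp_all add: min_def)
    ultimately show ?thesis using less.prems False m by auto
  qed
qed

lemma reduced_altfrom: "reduced_list (altfrom e n)"
proof -
  have "successively (\<lambda>e f. f = mid e) (altfrom e n)" unfolding successively_mid_iff by (cases n) auto
  then show ?thesis unfolding reduced_list_def
    by (rule successively_mono) (metis bar.simps letter.distinct mid.simps letter.exhaust)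
qed

lemma inv_word_reduced: "p \<in> reduced_words l \<Longrightarrow> inv_word p \<in> reduced_words l"
  unfolding reduced_words_def reduced_list_def inv_word_def
  by (auto simp: successively_map elim!: successively_mono)

text \<open>An alternating word uses either the letters \<open>Pos_a\<close>, \<open>Neg_b\<close>
  or their inverses. In the second case its inverse is of the first kind; an alternating word of the
  first kind fits at every second position.\<close>

lemma occ_alternating:
  assumes "successively (\<lambda>e f. f = mid e) p" "length p = l" "l \<ge> 1"
  shows "(n - l) div 2 \<le> occ p (altfrom Pos_a n) + occ (inv_word p) (altfrom Pos_a n)"
proof (cases "hd p = Pos_a \<or> hd p = Neg_b")
  case True
  then have "hd p = Pos_a \<or> hd p = mid Pos_a" by simp
  from occ_altfrom[OF this assms(3), of n] show ?thesis using assms successively_mid_iff by (metis trans_le_add1)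
next
  case False
  have mb: "bar x = mid (bar y) \<longleftrightarrow> y = mid x" for x y by (cases x; cases y) auto
  have s: "successively (\<lambda>e f. f = mid e) (inv_word p)"
    unfolding inv_word_def successively_rev successively_map mb using assms(1) by simp
  have "hd (inv_word p) = Pos_a \<or> hd (inv_word p) = Neg_b"
  proof -
    have pne: "p \<noteq> []" using assms by auto
    have "last (altfrom e (Suc k)) \<in> {e, mid e}" for e k
    proof (induction k arbitrary: e)
      case (Suc k)
      have "last (altfrom e (Suc (Suc k))) = last (altfrom (mid e) (Suc k))" by simp
      then show ?case using Suc.IH[of "mid e"] by (simp only: mid_mid) blast
    qed simp
    then have "last p \<in> {hd p, mid (hd p)}" using assms successively_mid_iff by (metis Suc_le_D One_nat_def)
    moreover have "hd p = Neg_a \<or> hd p = Pos_b" using False by (cases "hd p") auto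
    ultimately have "last p = Neg_a \<or> last p = Pos_b" by auto
    then show ?thesis using pne by (auto simp: inv_word_def hd_rev last_map)
  qed
  then have "hd (inv_word p) = Pos_a \<or> hd (inv_word p) = mid Pos_a" by simp
  from occ_altfrom[OF this assms(3), of n] have "(n - l) div 2 \<le> occ (inv_word p) (altfrom Pos_a n)"
    using s assms(2) successively_mid_iff[of "inv_word p"] by (simp add: inv_word_def)
  then show ?thesis by simp
qed

text \<open>One connecting letter joins arbitrary blocks without cancellation. It makes a block of K
  letters occupy K + 1.\<close>

definition conn :: "letter \<Rightarrow> letter \<Rightarrow> letter" where
  "conn e f = (SOME c. c \<noteq> bar e \<and> f \<noteq> bar c)"

lemma conn: "conn e f \<noteq> bar e \<and> f \<noteq> bar (conn e f)"
proof -
  have "\<exists>c. c \<noteq> bar e \<and> f \<noteq> bar c" by (cases e; cases f) (metis bar.simps letter.distinct)+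
  then show ?thesis unfolding conn_def by (rule someI_ex)
qed

text \<open>The final connecting letter leads to \<open>Pos_a\<close>, with which the alternating
  part begins, so that the word closes up cyclically.\<close>

fun chain :: "letter \<Rightarrow> letter list list \<Rightarrow> letter list" where
  "chain e [] = [conn e Pos_a]"
| "chain e (B # bs) = conn e (hd B) # B @ chain (last B) bs"

lemma length_chain: "(\<forall>B\<in>set bs. length B = K) \<Longrightarrow> length (chain e bs) = 1 + length bs * (K + 1)"
  by (induction bs arbitrary: e) auto

lemma chain_inj:
  assumes "chain e bs = chain e bs'" "\<forall>B\<in>set bs. length B = K" "\<forall>B\<in>set bs'. length B = K" "length bs = length bs'"
  shows "bs = bs'"
  using assms(4,1,2,3)
proof (induction bs bs' arbitrary: e rule: list_induct2)
  case (Cons B bs B' bs')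
  then have "B = B'" "chain (last B) bs = chain (last B') bs'" by (auto simp: append_eq_append_conv)
  then show ?case using Cons by auto
qed simp

lemma reduced_chain:
  assumes "\<forall>B\<in>set bs. reduced_list B \<and> B \<noteq> []"
  shows "reduced_list (e # chain e bs @ [Pos_a])"
  using assms
proof (induction bs arbitrary: e)
  case Nil
  then show ?case using conn[of e Pos_a] by (simp add: reduced_list_def)
next
  case (Cons B bs)
  then have IH: "reduced_list (last B # chain (last B) bs @ [Pos_a])" and B: "reduced_list B" "B \<noteq> []" by auto
  have "chain (last B) bs @ [Pos_a] \<noteq> []" by simp
  then have "reduced_list (B @ (chain (last B) bs @ [Pos_a]))"
    using IH B unfolding reduced_list_def successively_append_iff successively_Cons by auto
  moreover have "hd (B @ chain (last B) bs @ [Pos_a]) = hd B" using B by simp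
  ultimately show ?case using conn[of e "hd B"] B unfolding reduced_list_def by (simp add: successively_Cons)
qed

lemma occ_chain: "sum_list (map (occ p) bs) \<le> occ p (chain e bs)"
proof (induction bs arbitrary: e)
  case (Cons B bs)
  have "occ p B + occ p (chain (last B) bs) \<le> occ p (B @ chain (last B) bs)" by (rule occ_append)
  then show ?case using Cons[of "last B"] by simp
qed simp

definition block_word :: "nat \<Rightarrow> letter list list \<Rightarrow> letter list" where
  "block_word n bs = altfrom Pos_a n @ chain (last (altfrom Pos_a n)) bs"

lemma cyclically_reduced_of_reduced:
  assumes "w \<noteq> []" "reduced_list (w @ [hd w])" shows "cyclically_reduced w"
proof -
  have nth: "(w @ [hd w]) ! Suc i \<noteq> bar ((w @ [hd w]) ! i)" if "i < length w" for i
  proof -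
    have "successively (\<lambda>e f. f \<noteq> bar e) (take (Suc i) (w @ [hd w]) @ drop (Suc i) (w @ [hd w]))"
      using assms(2) unfolding append_take_drop_id reduced_list_def .
    moreover have "drop (Suc i) (w @ [hd w]) \<noteq> []" "take (Suc i) (w @ [hd w]) \<noteq> []" using that assms(1) by simp_all
    ultimately have "hd (drop (Suc i) (w @ [hd w])) \<noteq> bar (last (take (Suc i) (w @ [hd w])))"
      unfolding successively_append_iff by blast
    moreover have "hd (drop (Suc i) (w @ [hd w])) = (w @ [hd w]) ! Suc i" using that by (intro hd_drop_conv_nth) simp
    moreover have "last (take (Suc i) (w @ [hd w])) = (w @ [hd w]) ! i" using that by (simp add: take_Suc_conv_app_nth nth_append)
    ultimately show ?thesis using that by simp
  qed
  have "w ! ((i + 1) mod length w) \<noteq> bar (w ! i)" if "i < length w" for i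
  proof (cases "i + 1 = length w")
    case True
    then show ?thesis using nth[OF that] assms(1) by (simp add: nth_append hd_conv_nth split: if_splits)
  next
    case False
    then show ?thesis using nth[OF that] that by (simp add: nth_append split: if_splits)
  qed
  then show ?thesis using assms by (simp add: cyclically_reduced_def)
qed

lemma block_word_cyclically_reduced:
  assumes "n \<ge> 1" "\<forall>B\<in>set bs. reduced_list B \<and> B \<noteq> []"
  shows "cyclically_reduced (block_word n bs)"
proof (rule cyclically_reduced_of_reduced)
  have ne: "altfrom Pos_a n \<noteq> []" using assms(1) by (cases n) auto
  then show "block_word n bs \<noteq> []" by (simp add: block_word_def)
  have hd: "hd (block_word n bs) = Pos_a" using assms(1) by (cases n) (auto simp: block_word_def)
  have "reduced_list (last (altfrom Pos_a n) # chain (last (altfrom Pos_a n)) bs @ [Pos_a])" by (rule reduced_chain[OF assms(2)])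
  then show "reduced_list (block_word n bs @ [hd (block_word n bs)])"
    unfolding hd using reduced_altfrom[of Pos_a n] ne unfolding block_word_def reduced_list_def
    by (simp add: successively_append_iff successively_Cons)
qed

lemma block_word_inj:
  assumes "block_word n bs = block_word n bs'" "\<forall>B\<in>set bs. length B = K" "\<forall>B\<in>set bs'. length B = K" "length bs = length bs'"
  shows "bs = bs'"
  using chain_inj[OF _ assms(2,3,4)] assms(1) by (simp add: block_word_def)

lemma length_block_word: "(\<forall>B\<in>set bs. length B = K) \<Longrightarrow> length (block_word n bs) = n + 1 + length bs * (K + 1)"
  by (simp add: block_word_def length_chain[of bs K])

lemma sum_list_permutation:
  assumes "mset bs = repeat_mset q (mset_set X)" "finite X"
  shows "sum_list (map (h :: _ \<Rightarrow> nat) bs) = q * (\<Sum>B\<in>X. h B)"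
proof -
  have "sum_list (map h bs) = sum_mset (image_mset h (mset bs))" by (metis mset_map sum_mset_sum_list)
  also have "\<dots> = sum_mset (image_mset h (repeat_mset q (mset_set X)))" using assms by simp
  also have "\<dots> = q * sum_mset (image_mset h (mset_set X))" by (induction q) (simp_all)
  finally show ?thesis by (simp add: sum_unfold_sum_mset)
qed

text \<open>The factor 2 counts both reading directions, since the blocks contain \<open>p\<close>
  and its inverse alike. The alternating part contributes in one direction only.\<close>

lemma cnt_block_word:
  assumes bs: "mset bs = repeat_mset q (mset_set (reduced_words (l + r)))" and p: "p \<in> reduced_words l" "l \<ge> 1"
  shows "2 * q * ((r + 1) * 3 ^ r) + (if successively (\<lambda>e f. f = mid e) p then (n - l) div 2 else 0) \<le> cnt (block_word n bs) p"
proof -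
  have lp: "length p = l" using p by (simp add: reduced_words_def)
  then have pne: "p \<noteq> []" using p by auto
  let ?A = "altfrom Pos_a n"
  have o: "occ p ?A + q * ((r + 1) * 3 ^ r) \<le> occ p (block_word n bs)" if "p \<in> reduced_words l" for p
  proof -
    have "occ p ?A + sum_list (map (occ p) bs) \<le> occ p ?A + occ p (chain (last ?A) bs)" using occ_chain by simp
    also have "\<dots> \<le> occ p (block_word n bs)" unfolding block_word_def by (rule occ_append)
    finally have "occ p ?A + q * (\<Sum>B\<in>reduced_words (l + r). occ p B) \<le> occ p (block_word n bs)"
      using sum_list_permutation[OF bs finite_reduced_words, of "occ p"] by simp
    moreover have "q * ((r + 1) * 3 ^ r) \<le> q * (\<Sum>B\<in>reduced_words (l + r). occ p B)"
      by (rule mult_le_mono2[OF sum_occ_reduced_words[OF that p(2)]])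
    ultimately show ?thesis by linarith
  qed
  have "occ p (block_word n bs) + occ (inv_word p) (block_word n bs) \<le> cnt (block_word n bs) p" by (rule cnt_ge_occ[OF pne])
  moreover have "(if successively (\<lambda>e f. f = mid e) p then (n - l) div 2 else 0) \<le> occ p ?A + occ (inv_word p) ?A"
    using occ_alternating[OF _ lp p(2), of n] by simp
  moreover note o[OF p(1)] o[OF inv_word_reduced[OF p(1)]]
  ultimately show ?thesis by simp
qed

section \<open>Contribution of a common segment of given length\<close>

lemma sum_letter: "(\<Sum>x\<in>UNIV. f x) = f Pos_a + f Neg_a + f Pos_b + (f Neg_b :: real)"
  by (simp add: UNIV_letter add.assoc)

lemma cyc3_sums:
  "(\<Sum>x\<in>UNIV. \<Sum>x'\<in>UNIV. of_bool (cyc3 (bar x) (bar x') d = 1)) = (3 :: real)"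
  "(\<Sum>x\<in>UNIV. \<Sum>x'\<in>UNIV. of_bool (cyc3 (bar x) (bar x') d = -1)) = (3 :: real)"
  "(\<Sum>y\<in>UNIV. \<Sum>y'\<in>UNIV. of_bool (cyc3 (bar z) y' y = 1)) = (3 :: real)"
  "(\<Sum>y\<in>UNIV. \<Sum>y'\<in>UNIV. of_bool (cyc3 (bar z) y' y = -1)) = (3 :: real)"
  "(\<Sum>x'\<in>UNIV. of_bool (cyc3 (bar (mid d)) (bar x') d = 1)) = (1 :: real)"
  "(\<Sum>x'\<in>UNIV. of_bool (cyc3 (bar (mid d)) (bar x') d = -1)) = (1 :: real)"
  "(\<Sum>x\<in>UNIV. of_bool (cyc3 (bar x) (bar (mid d)) d = 1)) = (1 :: real)"
  "(\<Sum>x\<in>UNIV. of_bool (cyc3 (bar x) (bar (mid d)) d = -1)) = (1 :: real)"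
  "(\<Sum>y'\<in>UNIV. of_bool (cyc3 (bar z) y' (mid z) = 1)) = (1 :: real)"
  "(\<Sum>y'\<in>UNIV. of_bool (cyc3 (bar z) y' (mid z) = -1)) = (1 :: real)"
  "(\<Sum>y\<in>UNIV. of_bool (cyc3 (bar z) (mid z) y = 1)) = (1 :: real)"
  "(\<Sum>y\<in>UNIV. of_bool (cyc3 (bar z) (mid z) y = -1)) = (1 :: real)"
  by (cases d; cases z; simp add: sum_letter cyc3_def)+

lemma of_bool_crossing_ends:
  "of_bool (crossing_ends x x' v y y') = (of_bool (cyc3 (bar x) (bar x') (hd v) = 1) * of_bool (cyc3 (bar (last v)) y' y = -1)
    + of_bool (cyc3 (bar x) (bar x') (hd v) = -1) * of_bool (cyc3 (bar (last v)) y' y = 1) :: real)"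
proof -
  have "cyc3 e f g = 0 \<or> cyc3 e f g = 1 \<or> cyc3 e f g = -1" for e f g by (simp add: cyc3_def)
  from this[of "bar x" "bar x'" "hd v"] this[of "bar (last v)" y' y]
  show ?thesis unfolding crossing_ends_def by auto
qed

text \<open>Two choices of opposite signs, and for each sign 3 pairs of letters at either end, give
  2 * 3 * 3 = 18. Prescribing the straight continuations of one strand leaves a single choice at
  either end.\<close>

lemma crossing_ends_sums:
  "(\<Sum>x\<in>UNIV. \<Sum>x'\<in>UNIV. \<Sum>y\<in>UNIV. \<Sum>y'\<in>UNIV. of_bool (crossing_ends x x' v y y')) = (18 :: real)"
  "(\<Sum>x'\<in>UNIV. \<Sum>y'\<in>UNIV. of_bool (crossing_ends (mid (hd v)) x' v (mid (last v)) y')) = (2 :: real)"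
  "(\<Sum>x\<in>UNIV. \<Sum>y\<in>UNIV. of_bool (crossing_ends x (mid (hd v)) v y (mid (last v)))) = (2 :: real)"
proof -
  show "(\<Sum>x\<in>UNIV. \<Sum>x'\<in>UNIV. \<Sum>y\<in>UNIV. \<Sum>y'\<in>UNIV. of_bool (crossing_ends x x' v y y')) = (18 :: real)"
    unfolding of_bool_crossing_ends
    by (simp only: sum.distrib sum_distrib_left[symmetric] sum_distrib_right[symmetric] cyc3_sums)
  show "(\<Sum>x'\<in>UNIV. \<Sum>y'\<in>UNIV. of_bool (crossing_ends (mid (hd v)) x' v (mid (last v)) y')) = (2 :: real)"
    unfolding of_bool_crossing_ends
    by (simp only: sum.distrib sum_distrib_left[symmetric] sum_distrib_right[symmetric] cyc3_sums)
  show "(\<Sum>x\<in>UNIV. \<Sum>y\<in>UNIV. of_bool (crossing_ends x (mid (hd v)) v y (mid (last v)))) = (2 :: real)"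
    unfolding of_bool_crossing_ends
    by (simp only: sum.distrib sum_distrib_left[symmetric] sum_distrib_right[symmetric] cyc3_sums)
qed

lemma sum_pick:
  "(\<Sum>x\<in>UNIV. \<Sum>x'\<in>UNIV. \<Sum>y\<in>UNIV. \<Sum>y'\<in>UNIV. F x x' y y' * (of_bool (x = c) * of_bool (y = d)))
    = (\<Sum>x'\<in>UNIV. \<Sum>y'\<in>UNIV. F (c :: letter) (x' :: letter) (d :: letter) (y' :: letter) :: real)"
proof -
  have 1: "(\<Sum>y'\<in>UNIV. F x x' y y' * (of_bool (x = c) * of_bool (y = d))) = (if x = c then if y = d then \<Sum>y'\<in>UNIV. F x x' y y' else 0 else 0)" for x x' y
    by simp
  have 2: "(\<Sum>x'\<in>UNIV. \<Sum>y\<in>UNIV. if x = c then if y = d then \<Sum>y'\<in>UNIV. F x x' y y' else 0 else 0)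
    = (if x = c then \<Sum>x'\<in>UNIV. \<Sum>y'\<in>UNIV. F x x' d y' else 0)" for x by simp
  show ?thesis unfolding 1 2 by simp
qed

lemma sum_pick':
  "(\<Sum>x\<in>UNIV. \<Sum>x'\<in>UNIV. \<Sum>y\<in>UNIV. \<Sum>y'\<in>UNIV. F x x' y y' * (of_bool (x' = c) * of_bool (y' = d)))
    = (\<Sum>x\<in>UNIV. \<Sum>y\<in>UNIV. F (x :: letter) (c :: letter) (y :: letter) (d :: letter) :: real)"
proof -
  have 1: "(\<Sum>y'\<in>UNIV. F x x' y y' * (of_bool (x' = c) * of_bool (y' = d))) = (if x' = c then F x x' y d else 0)" for x x' y
    by (simp add: of_bool_def if_distrib[of "\<lambda>t. _ * t"] cong: if_cong)
  have 2: "(\<Sum>x'\<in>UNIV. \<Sum>y\<in>UNIV. if x' = c then F x x' y d else 0) = (\<Sum>y\<in>UNIV. F x c y d)" for x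
  proof -
    have "(\<Sum>y\<in>UNIV. if x' = c then F x x' y d else 0) = (if x' = c then \<Sum>y\<in>UNIV. F x x' y d else 0)" for x' by simp
    then show ?thesis by simp
  qed
  show ?thesis unfolding 1 2 ..
qed

abbreviation alternating :: "letter list \<Rightarrow> bool" where
  "alternating p \<equiv> successively (\<lambda>e f. f = mid e) p"

lemma alternating_extend:
  "v \<noteq> [] \<Longrightarrow> alternating (x # v @ [y]) \<longleftrightarrow> alternating v \<and> x = mid (hd v) \<and> y = mid (last v)"
  by (auto simp: successively_Cons successively_append_iff)

text \<open>Expand the product of the two lower bounds. The first term is 18 ends for each of 4 *
  3^m segments; the mixed terms come from the 4 alternating segments, with 2 ends for each role of
  the alternating strand. No square of \<alpha> appears: crossing strands diverge, so they cannot
  both continue an alternating segment straight.\<close>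

lemma crossing_sum_lower:
  assumes f: "\<And>p. p \<in> reduced_words (Suc m + 2) \<Longrightarrow> \<beta> + \<alpha> * of_bool (alternating p) \<le> f p"
    and pos: "0 \<le> \<alpha>" "0 \<le> \<beta>"
  shows "72 * 3 ^ m * \<beta>\<^sup>2 + 16 * \<alpha> * \<beta> \<le> crossing_sum f (Suc m)"
proof -
  let ?n = "Suc m"
  have inner: "18 * \<beta>\<^sup>2 + 4 * \<alpha> * \<beta> * of_bool (alternating v) \<le> (\<Sum>x\<in>UNIV. \<Sum>x'\<in>UNIV. \<Sum>y\<in>UNIV. \<Sum>y'\<in>UNIV.
     (if crossing_ends x x' v y y' then f (x # v @ [y]) * f (x' # v @ [y']) else 0))" if v: "v \<in> reduced_words ?n" for v
  proof -
    have vne: "v \<noteq> []" using v by (auto simp: reduced_words_def)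
    let ?A = "of_bool (alternating v) :: real"
    let ?d = "\<lambda>x y. of_bool (x = mid (hd v)) * of_bool (y = mid (last v)) :: real"
    have alt: "of_bool (alternating (x # v @ [y])) = ?A * ?d x y" for x y
      unfolding alternating_extend[OF vne] by simp
    have le: "\<beta>\<^sup>2 * of_bool (crossing_ends x x' v y y') + \<alpha> * \<beta> * ?A * (of_bool (crossing_ends x x' v y y') * ?d x y)
        + \<alpha> * \<beta> * ?A * (of_bool (crossing_ends x x' v y y') * ?d x' y')
       \<le> (if crossing_ends x x' v y y' then f (x # v @ [y]) * f (x' # v @ [y']) else 0)" for x x' y y'
    proof (cases "crossing_ends x x' v y y'")
      case True
      then have "hd v \<noteq> bar x" "hd v \<noteq> bar x'" "y \<noteq> bar (last v)" "y' \<noteq> bar (last v)"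
        by (auto simp: crossing_ends_def cyc3_def split: if_splits)
      then have "x # v @ [y] \<in> reduced_words (?n + 2)" "x' # v @ [y'] \<in> reduced_words (?n + 2)"
        using v vne by (auto simp: reduced_words_def reduced_list_def successively_Cons successively_append_iff)
      then have f1: "\<beta> + \<alpha> * (?A * ?d x y) \<le> f (x # v @ [y])" and f2: "\<beta> + \<alpha> * (?A * ?d x' y') \<le> f (x' # v @ [y'])"
        using f alt by metis+
      have nn: "0 \<le> \<beta> + \<alpha> * (?A * ?d x y)" "0 \<le> \<beta> + \<alpha> * (?A * ?d x' y')" using pos by simp_all
      have "(\<beta> + \<alpha> * (?A * ?d x y)) * (\<beta> + \<alpha> * (?A * ?d x' y')) \<le> f (x # v @ [y]) * f (x' # v @ [y'])"
        by (rule mult_mono[OF f1 f2]) (use nn f1 in linarith)+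
      moreover have "0 \<le> (\<alpha> * (?A * ?d x y)) * (\<alpha> * (?A * ?d x' y'))" using pos by simp
      ultimately have "\<beta>\<^sup>2 + \<alpha> * \<beta> * ?A * ?d x y + \<alpha> * \<beta> * ?A * ?d x' y' \<le> f (x # v @ [y]) * f (x' # v @ [y'])"
        by (simp only: distrib_left distrib_right power2_eq_square mult_ac)
      then show ?thesis using True by simp
    qed simp
    have "18 * \<beta>\<^sup>2 + 4 * \<alpha> * \<beta> * ?A = \<beta>\<^sup>2 * 18 + \<alpha> * \<beta> * ?A * 2 + \<alpha> * \<beta> * ?A * 2" by simp
    also have "\<dots> = (\<Sum>x\<in>UNIV. \<Sum>x'\<in>UNIV. \<Sum>y\<in>UNIV. \<Sum>y'\<in>UNIV. \<beta>\<^sup>2 * of_bool (crossing_ends x x' v y y') + \<alpha> * \<beta> * ?A * (of_bool (crossing_ends x x' v y y') * ?d x y)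
        + \<alpha> * \<beta> * ?A * (of_bool (crossing_ends x x' v y y') * ?d x' y'))"
      by (simp only: sum.distrib sum_distrib_left[symmetric] sum_pick sum_pick' crossing_ends_sums)
    also have "\<dots> \<le> (\<Sum>x\<in>UNIV. \<Sum>x'\<in>UNIV. \<Sum>y\<in>UNIV. \<Sum>y'\<in>UNIV.
     (if crossing_ends x x' v y y' then f (x # v @ [y]) * f (x' # v @ [y']) else 0))"
      by (intro sum_mono le)
    finally show ?thesis .
  qed
  have "4 \<le> (\<Sum>v\<in>reduced_words ?n. of_bool (alternating v) :: real)"
  proof -
    have sub: "(\<lambda>e. altfrom e ?n) ` UNIV \<subseteq> reduced_words ?n"
      using reduced_altfrom by (auto simp: reduced_words_def simp del: altfrom.simps)
    have alt: "alternating (altfrom e ?n)" for e unfolding successively_mid_iff by simp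
    have "real (card ((\<lambda>e. altfrom e ?n) ` UNIV)) = 4"
      by (subst card_image) (auto simp: inj_on_def UNIV_letter)
    then have "4 = (\<Sum>v\<in>(\<lambda>e. altfrom e ?n) ` UNIV. of_bool (alternating v) :: real)"
      using alt by (subst sum.cong[OF refl, of _ _ "\<lambda>_. 1"]) (auto simp del: altfrom.simps)
    also have "\<dots> \<le> (\<Sum>v\<in>reduced_words ?n. of_bool (alternating v) :: real)"
      by (rule sum_mono2[OF finite_reduced_words sub]) simp
    finally show ?thesis .
  qed
  then have "4 * \<alpha> * \<beta> * 4 \<le> 4 * \<alpha> * \<beta> * (\<Sum>v\<in>reduced_words ?n. of_bool (alternating v) :: real)"
    using pos by (intro mult_left_mono) auto
  then have "72 * 3 ^ m * \<beta>\<^sup>2 + 16 * \<alpha> * \<beta> \<le> (\<Sum>v\<in>reduced_words ?n. 18 * \<beta>\<^sup>2 + 4 * \<alpha> * \<beta> * of_bool (alternating v))"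
    by (simp add: sum.distrib card_reduced_words sum_distrib_left)
  also have "\<dots> \<le> crossing_sum f ?n" unfolding crossing_sum_def by (rule sum_mono) (rule inner)
  finally show ?thesis .
qed

lemma sum_third_powers: "(\<Sum>m<N. (1 / 3 :: real) ^ Suc m) = (1 - (1 / 3) ^ N) / 2"
proof (induction N)
  case (Suc N)
  have "(\<Sum>m<Suc N. (1 / 3 :: real) ^ Suc m) = (1 - (1 / 3) ^ N) / 2 + (1 / 3) ^ Suc N"
    by (simp only: sum.lessThan_Suc Suc.IH)
  also have "\<dots> = (1 - (1 / 3) ^ Suc N) / 2" by (simp add: field_simps)
  finally show ?case .
qed simp

text \<open>In the limit of long blocks, the contributions of all lengths of common segments add up to a perfect square.\<close>

lemma crossings_complete_square:
  fixes a Y \<theta> :: real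
  assumes "0 \<le> a" "0 \<le> Y" "0 \<le> \<theta>" "\<theta> \<le> 1"
  shows "4 * (\<theta>\<^sup>2 * (1 - (1 / 3) ^ N) * (a + Y / 3)\<^sup>2)
    \<le> 4 * (a + \<theta> * Y / 6)\<^sup>2 + (\<Sum>m<N. 72 * 3 ^ m * (\<theta> * Y / (2 * 3 ^ (m + 2)))\<^sup>2 + 16 * a * (\<theta> * Y / (2 * 3 ^ (m + 2))))"
proof -
  define t where "t = 1 - (1 / 3 :: real) ^ N"
  have t: "0 \<le> t" "t \<le> 1" by (auto simp: t_def power_le_one)
  have trm: "72 * 3 ^ m * (\<theta> * Y / (2 * 3 ^ (m + 2)))\<^sup>2 + 16 * a * (\<theta> * Y / (2 * 3 ^ (m + 2)))
     = (2 / 3 * (\<theta> * Y)\<^sup>2 + 8 / 3 * a * (\<theta> * Y)) * (1 / 3) ^ Suc m" for m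
    by (simp add: power2_eq_square power_add power_divide divide_simps)
  have S: "(\<Sum>m<N. 72 * 3 ^ m * (\<theta> * Y / (2 * 3 ^ (m + 2)))\<^sup>2 + 16 * a * (\<theta> * Y / (2 * 3 ^ (m + 2))))
     = (2 / 3 * (\<theta> * Y)\<^sup>2 + 8 / 3 * a * (\<theta> * Y)) * (t / 2)"
    unfolding trm sum_distrib_left[symmetric] sum_third_powers t_def ..
  \<comment> \<open>For \<theta> = t = 1 this is an equality of polynomials, the announced square.
    In general every monomial is compared separately.\<close>
  have "4 * (\<theta>\<^sup>2 * t * (a + Y / 3)\<^sup>2) \<le> 4 * (a + \<theta> * Y / 6)\<^sup>2 + (2 / 3 * (\<theta> * Y)\<^sup>2 + 8 / 3 * a * (\<theta> * Y)) * (t / 2)"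
  proof -
    have s: "\<theta>\<^sup>2 \<le> 1" "\<theta>\<^sup>2 \<le> \<theta>" using assms by (auto simp: power2_eq_square mult_left_le_one_le mult_le_one)
    have 1: "\<theta>\<^sup>2 * t * a\<^sup>2 \<le> a\<^sup>2"
      using mult_le_one[OF s(1) t] t by (intro mult_left_le_one_le) auto
    have st: "\<theta>\<^sup>2 * t \<le> \<theta>" using mult_mono[OF s(2) t(2)] assms t by simp
    have aY: "0 \<le> a * Y" using assms by simp
    have 2: "\<theta>\<^sup>2 * t * (a * Y) \<le> \<theta> * (a * Y)" using st aY by (rule mult_right_mono)
    have 4: "\<theta>\<^sup>2 * t * (a * Y) \<le> \<theta> * t * (a * Y)" using mult_right_mono[OF mult_right_mono[OF s(2) t(1)] aY] .
    have 3: "\<theta>\<^sup>2 * t * Y\<^sup>2 \<le> \<theta>\<^sup>2 * Y\<^sup>2" using t by (simp add: mult_left_le mult_right_mono)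
    have "4 * (\<theta>\<^sup>2 * t * (a + Y / 3)\<^sup>2) = 4 * (\<theta>\<^sup>2 * t * a\<^sup>2) + 8 / 3 * (\<theta>\<^sup>2 * t * (a * Y)) + 4 / 9 * (\<theta>\<^sup>2 * t * Y\<^sup>2)"
      by (simp add: power2_eq_square field_simps)
    also have "\<dots> \<le> 4 * a\<^sup>2 + 4 / 3 * (\<theta> * (a * Y)) + 4 / 3 * (\<theta> * t * (a * Y)) + 1 / 9 * (\<theta>\<^sup>2 * Y\<^sup>2) + 1 / 3 * (\<theta>\<^sup>2 * t * Y\<^sup>2)"
      using 1 2 3 4 by linarith
    also have "\<dots> = 4 * (a + \<theta> * Y / 6)\<^sup>2 + (2 / 3 * (\<theta> * Y)\<^sup>2 + 8 / 3 * a * (\<theta> * Y)) * (t / 2)"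
      by (simp add: power2_eq_square field_simps)
    finally show ?thesis .
  qed
  then show ?thesis unfolding S unfolding t_def .
qed

section \<open>Counting words and closed geodesics\<close>

lemma fact_add_ge: "fact m * real m ^ B \<le> fact (m + B)"
proof (induction B)
  case (Suc B)
  have "fact m * real m ^ Suc B = real m * (fact m * real m ^ B)" by simp
  also have "\<dots> \<le> real (Suc (m + B)) * fact (m + B)" using Suc by (intro mult_mono) auto
  finally show ?case by simp
qed simp

text \<open>An elementary replacement for Stirling's formula: raising q by one adds B factors to the
  factorial, each at least q B. The loss q^B is polynomial for fixed B.\<close>

lemma multinomial_lower:
  assumes "q \<ge> 1" shows "(fact q) ^ B * real B ^ (B * (q - 1)) \<le> fact (q * B) * real q ^ B"
  using assms
proof (induction q rule: dec_induct)
  case (step q)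
  have "(fact (Suc q)) ^ B * real B ^ (B * (Suc q - 1)) = real (Suc q) ^ B * real B ^ B * ((fact q) ^ B * real B ^ (B * (q - 1)))"
  proof -
    have "B * (Suc q - 1) = B + B * (q - 1)" using step by (cases q) auto
    then show ?thesis by (simp add: power_add power_mult_distrib del: of_nat_Suc)
  qed
  also have "\<dots> \<le> real (Suc q) ^ B * real B ^ B * (fact (q * B) * real q ^ B)"
    by (rule mult_left_mono[OF step.IH]) simp
  also have "\<dots> = real (Suc q) ^ B * (fact (q * B) * real (q * B) ^ B)" by (simp add: power_mult_distrib)
  also have "\<dots> \<le> real (Suc q) ^ B * fact (q * B + B)" by (rule mult_left_mono[OF fact_add_ge]) simp
  finally show ?case by (simp add: add.commute mult.commute)
qed simp

lemma card_block_arrangements: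
  assumes "finite X" "q \<ge> 1"
  shows "real (card X) ^ (card X * (q - 1)) \<le> real (card (permutations_of_multiset (repeat_mset q (mset_set X)))) * real q ^ card X"
proof -
  let ?A = "repeat_mset q (mset_set X)"
  have "card (permutations_of_multiset ?A) = fact (size ?A) div (\<Prod>x\<in>set_mset ?A. fact (count ?A x))"
    and dvd: "(\<Prod>x\<in>set_mset ?A. fact (count ?A x) :: nat) dvd fact (size ?A)"
    by (rule card_permutations_of_multiset)+
  then have "card (permutations_of_multiset ?A) * (\<Prod>x\<in>set_mset ?A. fact (count ?A x)) = fact (size ?A)" by simp
  moreover have "(\<Prod>x\<in>set_mset ?A. fact (count ?A x)) = (fact q :: nat) ^ card X"
  proof -
    have c: "count ?A x = (if x \<in> X then q else 0)" for x using assms(1) by (simp add: repeat_mset.rep_eq)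
    then have "set_mset ?A = X" using assms(2) by (auto simp flip: count_greater_zero_iff split: if_splits)
    then show ?thesis using c by simp
  qed
  moreover have "size ?A = q * card X" by simp
  ultimately have "card (permutations_of_multiset ?A) * (fact q :: nat) ^ card X = fact (q * card X)" by simp
  then have E: "fact (q * card X) = real (card (permutations_of_multiset ?A)) * (fact q) ^ card X"
    by (metis of_nat_fact of_nat_mult of_nat_power)
  have "(fact q) ^ card X * real (card X) ^ (card X * (q - 1)) \<le> fact (q * card X) * real q ^ card X"
    by (rule multinomial_lower[OF assms(2)])
  also have "\<dots> = (fact q) ^ card X * (real (card (permutations_of_multiset ?A)) * real q ^ card X)"
    unfolding E by (simp only: mult_ac)
  finally show ?thesis by (rule mult_left_le_imp_le) simp
qed

text \<open>Without the turn at the junction of end and beginning, so that sums over reduced words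
  satisfy a recursion.\<close>

fun linear_nonmid :: "letter list \<Rightarrow> nat" where
  "linear_nonmid [] = 0"
| "linear_nonmid (x # w) = of_bool (w \<noteq> [] \<and> hd w \<noteq> mid x) + linear_nonmid w"

lemma linear_nonmid_card: "linear_nonmid w = card {i. Suc i < length w \<and> w ! Suc i \<noteq> mid (w ! i)}"
proof (induction w)
  case (Cons x w)
  have "{i. Suc i < length (x # w) \<and> (x # w) ! Suc i \<noteq> mid ((x # w) ! i)} =
     {i. i = 0 \<and> w \<noteq> [] \<and> hd w \<noteq> mid x} \<union> Suc ` {i. Suc i < length w \<and> w ! Suc i \<noteq> mid (w ! i)}"
  proof (rule set_eqI)
    fix j
    show "j \<in> {i. Suc i < length (x # w) \<and> (x # w) ! Suc i \<noteq> mid ((x # w) ! i)} \<longleftrightarrow>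
       j \<in> {i. i = 0 \<and> w \<noteq> [] \<and> hd w \<noteq> mid x} \<union> Suc ` {i. Suc i < length w \<and> w ! Suc i \<noteq> mid (w ! i)}"
      by (cases j) (auto simp: image_iff hd_conv_nth)
  qed
  also have "card \<dots> = card {i::nat. i = 0 \<and> w \<noteq> [] \<and> hd w \<noteq> mid x} + card (Suc ` {i. Suc i < length w \<and> w ! Suc i \<noteq> mid (w ! i)})"
  proof (rule card_Un_disjoint)
    show "finite (Suc ` {i. Suc i < length w \<and> w ! Suc i \<noteq> mid (w ! i)})"
      by (rule finite_imageI, rule finite_subset[of _ "{..<length w}"]) auto
  qed auto
  also have "\<dots> = linear_nonmid (x # w)" by (simp add: card_image Cons)
  finally show ?case by simp
qed simp

lemma linear_nonmid_le: "linear_nonmid w \<le> nonmid w"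
proof -
  have "card (Suc ` {i. Suc i < length w \<and> w ! Suc i \<noteq> mid (w ! i)}) \<le> nonmid w"
    unfolding nonmid_def
  proof (rule card_mono)
    show "Suc ` {i. Suc i < length w \<and> w ! Suc i \<noteq> mid (w ! i)} \<subseteq> {i. i < length w \<and> per w (int i) \<noteq> mid (per w (int i - 1))}"
    proof
      fix j assume "j \<in> Suc ` {i. Suc i < length w \<and> w ! Suc i \<noteq> mid (w ! i)}"
      then obtain i where i: "j = Suc i" "Suc i < length w" "w ! Suc i \<noteq> mid (w ! i)" by blast
      then show "j \<in> {i. i < length w \<and> per w (int i) \<noteq> mid (per w (int i - 1))}"
        using per_nth[OF i(2)] per_nth[of i w] by simp
    qed
  qed simp
  then show ?thesis by (simp add: linear_nonmid_card card_image)
qed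

text \<open>Of the three letters allowed before a given one, exactly one makes a turn between
  opposite sides. Hence each letter multiplies the weighted sum by 1 + 1/2 + 1/2 = 2.\<close>

lemma sum_weight_reduced_words: "(\<Sum>w\<in>reduced_words (Suc n). (1 / 2 :: real) ^ linear_nonmid w) = 4 * 2 ^ n"
proof (induction n)
  case 0
  have "(\<Sum>w\<in>reduced_words 1. (1 / 2 :: real) ^ linear_nonmid w) = (\<Sum>x\<in>UNIV. (1 / 2) ^ linear_nonmid [x])"
    unfolding reduced_words_1 by (subst sum.reindex) (auto simp: inj_on_def)
  then show ?case by (simp add: UNIV_letter)
next
  case (Suc n)
  have "(\<Sum>x\<in>UNIV - {bar e}. (1 / 2 :: real) ^ of_bool (e \<noteq> mid x)) = 2" for e
    by (cases e; simp add: UNIV_letter insert_Diff_if)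
  then have *: "(\<Sum>x\<in>UNIV - {bar (hd B)}. (1 / 2 :: real) ^ linear_nonmid (x # B)) = 2 * (1 / 2) ^ linear_nonmid B" if "B \<noteq> []" for B
    using that by (simp add: power_add sum_distrib_right[symmetric])
  have "(\<Sum>w\<in>reduced_words (Suc (Suc n)). (1 / 2 :: real) ^ linear_nonmid w) = (\<Sum>B\<in>reduced_words (Suc n). 2 * (1 / 2) ^ linear_nonmid B)"
  proof (subst sum_reduced_words_Cons)
    show "(\<Sum>B\<in>reduced_words (Suc n). \<Sum>x\<in>UNIV - {bar (hd B)}. (1 / 2 :: real) ^ linear_nonmid (x # B)) = (\<Sum>B\<in>reduced_words (Suc n). 2 * (1 / 2) ^ linear_nonmid B)"
      by (rule sum.cong[OF refl], rule *) (auto simp: reduced_words_def)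
  qed simp
  then show ?case using Suc by (simp add: sum_distrib_left[symmetric])
qed

text \<open>Markov's inequality: every word counted has weight at least 2 to the power -c.\<close>

lemma card_few_nonmid:
  "real (card {w \<in> reduced_words (Suc n). real (linear_nonmid w) \<le> c}) \<le> 4 * 2 ^ n * 2 powr c"
proof -
  let ?S = "{w \<in> reduced_words (Suc n). real (linear_nonmid w) \<le> c}"
  have "2 powr (- c) \<le> (1 / 2 :: real) ^ linear_nonmid w" if "w \<in> ?S" for w
  proof -
    have "(1 / 2 :: real) ^ linear_nonmid w = 2 powr (- real (linear_nonmid w))"
      by (simp add: powr_minus powr_realpow power_one_over inverse_eq_divide)
    then show ?thesis using that by simp
  qed
  then have "real (card ?S) * 2 powr (- c) \<le> (\<Sum>w\<in>?S. (1 / 2 :: real) ^ linear_nonmid w)"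
    by (rule sum_bounded_below)
  also have "\<dots> \<le> (\<Sum>w\<in>reduced_words (Suc n). (1 / 2 :: real) ^ linear_nonmid w)"
    by (rule sum_mono2) auto
  finally have "real (card ?S) * 2 powr (- c) \<le> 4 * 2 ^ n" unfolding sum_weight_reduced_words .
  then show ?thesis by (simp add: powr_minus field_simps)
qed

lemma reduced_of_cyclically_reduced:
  assumes "cyclically_reduced w" shows "w \<in> reduced_words (length w)"
  using reduced_list_map_upt[OF reduced_fwd[OF bireduced_per[OF assms], of 0], of "length w"]
  by (simp add: map_fwd_per reduced_words_def)

context schottky
begin

definition junk_length :: nat where
  "junk_length = length (SOME w :: letter list. False)"

lemma codes_geodesic_word: "codes a b w \<gamma> \<Longrightarrow> codes a b (geodesic_word a b \<gamma>) \<gamma>"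
  unfolding geodesic_word_def by (rule someI)

text \<open>A closed curve without code gets the fixed arbitrary word of a choice from the empty predicate,
  so it can only disturb one single combinatorial length.\<close>

lemma Gc_codes:
  assumes "\<gamma> \<in> Gc a b L" "L \<noteq> junk_length"
  shows "codes a b (geodesic_word a b \<gamma>) \<gamma>" "length (geodesic_word a b \<gamma>) = L"
proof -
  show len: "length (geodesic_word a b \<gamma>) = L" using assms(1) by (simp add: Gc_def comb_length_def)
  have "\<exists>w. codes a b w \<gamma>"
  proof (rule ccontr)
    assume "\<not> ?thesis"
    then have "(\<lambda>w. codes a b w \<gamma>) = (\<lambda>w. False)" by auto
    then have "geodesic_word a b \<gamma> = (SOME w. False)" unfolding geodesic_word_def by metis
    then show False using len assms(2) by (simp add: junk_length_def)
  qed
  then show "codes a b (geodesic_word a b \<gamma>) \<gamma>" using codes_geodesic_word by blast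
qed

lemma codes_cyclically_reduced: "codes a b w \<gamma> \<Longrightarrow> cyclically_reduced w"
  by (simp add: codes_def)

lemma codes_in_Gc:
  assumes "codes a b w \<gamma>" shows "\<gamma> \<in> Gc a b (length w)"
proof -
  obtain k where "geodesic_word a b \<gamma> = rotate k w"
    using same_curve_rotate[OF assms codes_geodesic_word[OF assms]] by blast
  then show ?thesis using codes_closed_geodesic[OF assms] by (simp add: Gc_def comb_length_def)
qed

lemma finite_coded:
  assumes "finite W"
  shows "finite {\<gamma>. \<exists>w\<in>W. codes a b w \<gamma>}" "card {\<gamma>. \<exists>w\<in>W. codes a b w \<gamma>} \<le> card W"
proof -
  have sub: "{\<gamma>. \<exists>w\<in>W. codes a b w \<gamma>} \<subseteq> (\<lambda>w. SOME \<gamma>. codes a b w \<gamma>) ` W"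
  proof
    fix \<gamma> assume "\<gamma> \<in> {\<gamma>. \<exists>w\<in>W. codes a b w \<gamma>}"
    then obtain w where w: "w \<in> W" "codes a b w \<gamma>" by blast
    then have "(SOME \<gamma>. codes a b w \<gamma>) = \<gamma>" using codes_unique by (meson someI)
    then show "\<gamma> \<in> (\<lambda>w. SOME \<gamma>. codes a b w \<gamma>) ` W" using w by blast
  qed
  show "finite {\<gamma>. \<exists>w\<in>W. codes a b w \<gamma>}" using finite_subset[OF sub] assms by simp
  have "card {\<gamma>. \<exists>w\<in>W. codes a b w \<gamma>} \<le> card ((\<lambda>w. SOME \<gamma>. codes a b w \<gamma>) ` W)" by (rule card_mono[OF _ sub]) (simp add: assms)
  also have "\<dots> \<le> card W" by (rule card_image_le[OF assms])
  finally show "card {\<gamma>. \<exists>w\<in>W. codes a b w \<gamma>} \<le> card W" .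
qed

text \<open>The words coding one closed geodesic are rotations of each other, so there are at most
  \<open>L\<close> of them.\<close>

lemma card_words_le:
  assumes W: "finite W" "\<And>w. w \<in> W \<Longrightarrow> cyclically_reduced w \<and> length w = L"
  shows "card W \<le> L * card {\<gamma>. \<exists>w\<in>W. codes a b w \<gamma>}"
proof -
  let ?h = "\<lambda>w. SOME \<gamma>. codes a b w \<gamma>"
  have h: "codes a b w (?h w)" if "w \<in> W" for w using codes_exists W(2)[OF that] by (meson someI_ex)
  show ?thesis
  proof (rule card_le_of_fibres[OF W(1) finite_coded(1)[OF W(1)], where h = ?h])
    show "?h w \<in> {\<gamma>. \<exists>w\<in>W. codes a b w \<gamma>}" if "w \<in> W" for w using h[OF that] that by blast
    fix \<gamma> assume "\<gamma> \<in> {\<gamma>. \<exists>w\<in>W. codes a b w \<gamma>}"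
    then obtain w0 where w0: "w0 \<in> W" "codes a b w0 \<gamma>" by blast
    have "{w \<in> W. ?h w = \<gamma>} \<subseteq> (\<lambda>k. rotate k w0) ` {..<L}"
    proof
      fix w assume w: "w \<in> {w \<in> W. ?h w = \<gamma>}"
      then have "codes a b w \<gamma>" using h by blast
      then obtain k where k: "w = rotate k w0" using same_curve_rotate[OF w0(2)] by blast
      have "length w0 = L" "w0 \<noteq> []" using W(2)[OF w0(1)] by (auto simp: cyclically_reduced_def)
      then have "w = rotate (k mod L) w0" "k mod L < L" using k rotate_conv_mod[of k w0] by auto
      then show "w \<in> (\<lambda>k. rotate k w0) ` {..<L}" by blast
    qed
    then have "card {w \<in> W. ?h w = \<gamma>} \<le> card ((\<lambda>k. rotate k w0) ` {..<L})" by (rule card_mono[rotated]) simp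
    also have "\<dots> \<le> L" using card_image_le[of "{..<L}" "\<lambda>k. rotate k w0"] by simp
    finally show "card {w \<in> W. ?h w = \<gamma>} \<le> L" .
  qed
qed

lemma finite_Gc: "L \<noteq> junk_length \<Longrightarrow> finite (Gc a b L)"
proof -
  assume L: "L \<noteq> junk_length"
  have "Gc a b L \<subseteq> {\<gamma>. \<exists>w\<in>reduced_words L. codes a b w \<gamma>}"
    using Gc_codes[OF _ L] codes_cyclically_reduced reduced_of_cyclically_reduced by blast
  then show ?thesis using finite_coded(1)[OF finite_reduced_words] finite_subset by blast
qed

text \<open>A connecting letter closes any reduced word of length n + 1 into a cyclically reduced
  one. The constant factor lost against all cyclically reduced words is harmless in the
  ratio.\<close>

lemma card_Gc_lower:
  assumes "Suc (Suc n) \<noteq> junk_length"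
  shows "4 * 3 ^ n \<le> Suc (Suc n) * card (Gc a b (Suc (Suc n)))"
proof -
  let ?f = "\<lambda>B. B @ [conn (last B) (hd B)]"
  let ?W = "?f ` reduced_words (Suc n)"
  have cr: "cyclically_reduced w \<and> length w = Suc (Suc n)" if w: "w \<in> ?W" for w
  proof -
    obtain B where B: "B \<in> reduced_words (Suc n)" "w = ?f B" using w by blast
    have "B \<noteq> []" "reduced_list B" "length B = Suc n" using B by (auto simp: reduced_words_def)
    moreover from this have "reduced_list (?f B @ [hd (?f B)])"
      using conn[of "last B" "hd B"] unfolding reduced_list_def by (simp add: successively_append_iff successively_Cons)
    ultimately show ?thesis using B by (auto intro!: cyclically_reduced_of_reduced)
  qed
  have "inj_on ?f (reduced_words (Suc n))" by (auto simp: inj_on_def)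
  then have "4 * 3 ^ n = card ?W" by (simp add: card_image card_reduced_words)
  also have "\<dots> \<le> Suc (Suc n) * card {\<gamma>. \<exists>w\<in>?W. codes a b w \<gamma>}" by (rule card_words_le[OF _ cr]) simp
  also have "\<dots> \<le> Suc (Suc n) * card (Gc a b (Suc (Suc n)))"
    by (rule mult_le_mono2, rule card_mono[OF finite_Gc[OF assms]]) (use codes_in_Gc cr in fastforce)
  finally show ?thesis .
qed

lemma card_Aeps_upper:
  assumes "L \<noteq> junk_length" "L \<ge> 1" "\<epsilon> > 0"
  shows "real (card (Aeps a b \<epsilon> L)) \<le> 2 * 2 ^ L * 2 powr (3 * sqrt \<epsilon> * real L)"
proof -
  obtain n where n: "L = Suc n" using assms(2) by (cases L) auto
  let ?c = "3 * sqrt \<epsilon> * real L"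
  let ?W = "{w \<in> reduced_words (Suc n). real (linear_nonmid w) \<le> ?c}"
  have "Aeps a b \<epsilon> L \<subseteq> {\<gamma>. \<exists>w\<in>?W. codes a b w \<gamma>}"
  proof
    fix \<gamma> assume g: "\<gamma> \<in> Aeps a b \<epsilon> L"
    define w where "w = geodesic_word a b \<gamma>"
    have w: "codes a b w \<gamma>" "length w = L" using Gc_codes[of \<gamma> L] g assms by (auto simp: Aeps_def w_def)
    have cr: "cyclically_reduced w" using codes_cyclically_reduced w by blast
    have "(1 / 4 - \<epsilon>) * (real L)\<^sup>2 \<le> real (word_self_int a b w)" using g by (simp add: Aeps_def self_int_def w_def)
    moreover have "8 * real (word_self_int a b w) + (real (nonmid w))\<^sup>2 \<le> 2 * (real L)\<^sup>2"
      using word_self_int_upper[OF cr] unfolding w(2) by (metis (mono_tags, lifting) of_nat_add of_nat_le_iff of_nat_mult of_nat_numeral of_nat_power)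
    ultimately have "(real (nonmid w))\<^sup>2 \<le> 8 * (\<epsilon> * (real L)\<^sup>2)" by (simp add: algebra_simps)
    \<comment> \<open>Rounding 8 up to 9 turns the bound into the square of 3 sqrt \<epsilon>
      L.\<close>
    also have "\<dots> \<le> 9 * (\<epsilon> * (real L)\<^sup>2)" using assms by (intro mult_right_mono) auto
    also have "\<dots> = ?c\<^sup>2" using assms by (simp add: power_mult_distrib)
    finally have "real (nonmid w) \<le> ?c" by (rule power2_le_imp_le) (use assms in simp)
    then have "w \<in> ?W" using linear_nonmid_le[of w] reduced_of_cyclically_reduced[OF cr] w n by simp
    then show "\<gamma> \<in> {\<gamma>. \<exists>w\<in>?W. codes a b w \<gamma>}" using w by blast
  qed
  then have "card (Aeps a b \<epsilon> L) \<le> card {\<gamma>. \<exists>w\<in>?W. codes a b w \<gamma>}" by (rule card_mono[rotated]) (rule finite_coded(1), simp)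
  also have "\<dots> \<le> card ?W" by (rule finite_coded) simp
  finally have "real (card (Aeps a b \<epsilon> L)) \<le> real (card ?W)" by simp
  also have "\<dots> \<le> 4 * 2 ^ n * 2 powr ?c" by (rule card_few_nonmid)
  finally show ?thesis by (simp add: n)
qed

text \<open>\<open>Y\<close> is the total length of the blocks with their connecting letters.
  \<open>\<theta>\<close> bounds what is lost at block boundaries: a word of at most N + 2 letters
  fits into a block of N + 3 + r letters at no fewer than r + 2 positions, while the block occupies
  N + 4 + r letters. The rotation appears because \<open>geodesic_word\<close> picks an arbitrary
  one.\<close>

lemma block_word_self_int:
  assumes bs: "mset bs = repeat_mset q (mset_set (reduced_words (N + 3 + r)))"
    and c: "cyclically_reduced (rotate k (block_word n bs))" and n: "N + 3 \<le> n"
  defines "Y \<equiv> real q * (4 * 3 ^ (N + 2 + r) * real (N + 4 + r))"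
    and "\<theta> \<equiv> real (r + 2) / real (N + 4 + r)"
  shows "\<theta>\<^sup>2 * (1 - (1 / 3) ^ N) * (real (n - (N + 3)) / 2 + Y / 3)\<^sup>2 \<le> real (word_self_int a b (rotate k (block_word n bs)))"
proof -
  let ?w = "block_word n bs" and ?a = "real (n - (N + 3)) / 2"
  have wne: "?w \<noteq> []" using c by (auto simp: cyclically_reduced_def)
  define f where "f p = real (cnt ?w p)" for p
  \<comment> \<open>The equidistributed value: the 2 Y readings in both directions are shared among
    the 4 * 3^(m+1) reduced words of length m + 2.\<close>
  have f: "\<theta> * Y / (2 * 3 ^ (m + 1)) + ?a * of_bool (alternating p) \<le> f p" if m: "m \<le> N" and p: "p \<in> reduced_words (m + 2)" for m p
  proof -
    define s where "s = N + 1 - m + r"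
    have s: "m + 2 + s = N + 3 + r" using m by (simp add: s_def)
    define C where "C = 2 * q * ((s + 1) * 3 ^ s)"
    have "C + (if alternating p then (n - (m + 2)) div 2 else 0) \<le> cnt ?w p"
      unfolding C_def
      using cnt_block_word[of bs q "m + 2" s p n, unfolded s, OF bs p] by simp
    then have "real (C + (if alternating p then (n - (m + 2)) div 2 else 0)) \<le> f p"
      unfolding f_def by (simp only: of_nat_le_iff)
    moreover have "\<theta> * Y / (2 * 3 ^ (m + 1)) \<le> real C"
    proof -
      have "\<theta> * Y = real (r + 2) * (real q * (4 * 3 ^ (N + 2 + r)))" unfolding \<theta>_def Y_def by simp
      also have "N + 2 + r = (m + 1) + s" using s by simp
      finally have "\<theta> * Y / (2 * 3 ^ (m + 1)) = real (r + 2) * (2 * real q * 3 ^ s)"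
        by (simp add: power_add)
      also have "\<dots> \<le> real (s + 1) * (2 * real q * 3 ^ s)" using m by (intro mult_right_mono) (auto simp: s_def)
      also have "\<dots> = real C" by (simp add: C_def algebra_simps)
      finally show ?thesis .
    qed
    moreover have "?a \<le> real ((n - (m + 2)) div 2)"
    proof -
      have "n - (N + 3) \<le> 2 * ((n - (m + 2)) div 2)" using m by linarith
      then have "real (n - (N + 3)) \<le> real (2 * ((n - (m + 2)) div 2))" by (simp only: of_nat_le_iff)
      then show ?thesis by simp
    qed
    ultimately show ?thesis by (cases "alternating p") auto
  qed
  have \<theta>: "0 \<le> \<theta>" "\<theta> \<le> 1" and Y: "0 \<le> Y" and a: "0 \<le> ?a" by (auto simp: \<theta>_def Y_def)
  have w2: "[Neg_b, Pos_a] \<in> reduced_words (0 + 2)" "[Pos_b, Neg_a] \<in> reduced_words (0 + 2)"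
    by (auto simp: reduced_words_def reduced_list_def)
  have f2: "?a + \<theta> * Y / 6 \<le> f [Neg_b, Pos_a]" "?a + \<theta> * Y / 6 \<le> f [Pos_b, Neg_a]"
    using f[OF le0 w2(1)] f[OF le0 w2(2)] by simp_all
  have "(?a + \<theta> * Y / 6) * (?a + \<theta> * Y / 6) \<le> f [Neg_b, Pos_a] * f [Pos_b, Neg_a]"
    by (rule mult_mono[OF f2]) (use \<theta> Y a in \<open>simp_all add: f_def\<close>)
  then have t0: "4 * (?a + \<theta> * Y / 6)\<^sup>2 \<le> 4 * (f [Neg_b, Pos_a] * f [Pos_b, Neg_a])" by (simp add: power2_eq_square)
  have t1: "72 * 3 ^ m * (\<theta> * Y / (2 * 3 ^ (m + 2)))\<^sup>2 + 16 * ?a * (\<theta> * Y / (2 * 3 ^ (m + 2))) \<le> crossing_sum f (Suc m)" if "m < N" for m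
    by (rule crossing_sum_lower) (use f[of "Suc m"] that \<theta> Y a in auto)
  have "4 * (\<theta>\<^sup>2 * (1 - (1 / 3) ^ N) * (?a + Y / 3)\<^sup>2)
    \<le> 4 * (?a + \<theta> * Y / 6)\<^sup>2 + (\<Sum>m<N. 72 * 3 ^ m * (\<theta> * Y / (2 * 3 ^ (m + 2)))\<^sup>2 + 16 * ?a * (\<theta> * Y / (2 * 3 ^ (m + 2))))"
    by (rule crossings_complete_square[OF a Y \<theta>])
  also have "\<dots> \<le> 4 * (f [Neg_b, Pos_a] * f [Pos_b, Neg_a]) + (\<Sum>m<N. crossing_sum f (Suc m))"
    by (intro add_mono t0 sum_mono t1) simp
  also have "(\<Sum>m<N. crossing_sum f (Suc m)) = (\<Sum>n=1..N. crossing_sum f n)"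
    by (simp add: sum.atLeast1_atMost_eq)
  also have "4 * (f [Neg_b, Pos_a] * f [Pos_b, Neg_a]) + \<dots> \<le> 4 * real (word_self_int a b (rotate k ?w))"
    using word_self_int_lower[OF c, of N] unfolding f_def cnt_rotate[OF wne] .
  finally show ?thesis by simp
qed

end

section \<open>Asymptotics\<close>

lemma power_times_exp_decay:
  assumes "c > 0" shows "(\<lambda>L. real L ^ k * exp (- (c * real L))) \<longlonglongrightarrow> 0"
proof -
  have f: "filterlim (\<lambda>L. c * real L) at_top sequentially" using assms by real_asymp
  have "(\<lambda>L. (c * real L) ^ k / exp (c * real L)) \<longlonglongrightarrow> 0"
    by (rule filterlim_compose[OF tendsto_power_div_exp_0 f])
  from tendsto_mult_left[OF this, of "1 / c ^ k"] have "(\<lambda>L. 1 / c ^ k * ((c * real L) ^ k / exp (c * real L))) \<longlonglongrightarrow> 0" by simp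
  moreover have "1 / c ^ k * ((c * real L) ^ k / exp (c * real L)) = real L ^ k * exp (- (c * real L))" for L
    using assms by (simp add: power_mult_distrib exp_minus divide_inverse)
  ultimately show ?thesis by simp
qed

text \<open>The parameters are chosen one after the other, each using up part of the remaining
  slack: \<open>x\<close>, then the largest segment length \<open>N\<close>, then \<open>r\<close>,
  which makes the boundary losses of the blocks small relative to \<open>N\<close>.\<close>

lemma ex_block_parameters:
  assumes "0 < \<epsilon>" "\<epsilon> < 1 / 6"
  obtains x :: real and N r :: nat where "6 * \<epsilon> < x" "x < 1"
    "1 / 4 - \<epsilon> < (real (r + 2) / real (N + 4 + r))\<^sup>2 * (1 - (1 / 3) ^ N) * (1 / 2 - x / 6)\<^sup>2"
    "6 * \<epsilon> < real (N + 3 + r) / real (N + 4 + r) * x"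
proof -
  \<comment> \<open>The first bound keeps the loss t/6 below half of the available square of
    \<epsilon>; the second keeps \<open>x\<close> below 1.\<close>
  define t where "t = min (3 * \<epsilon>\<^sup>2) ((1 - 6 * \<epsilon>) / 2)"
  have t: "0 < t" "t \<le> 3 * \<epsilon>\<^sup>2" "t \<le> (1 - 6 * \<epsilon>) / 2"
    unfolding t_def by (use assms in simp, rule min.cobounded1, rule min.cobounded2)
  define x where "x = 6 * \<epsilon> + t"
  have x: "6 * \<epsilon> < x" "x < 1" using t assms by (auto simp: x_def field_simps)
  define G where "G = (1 / 2 - x / 6)\<^sup>2"
  have "G = 1 / 4 - \<epsilon> + \<epsilon>\<^sup>2 - t / 6 + \<epsilon> * t / 3 + t\<^sup>2 / 36"
    by (simp add: G_def x_def power2_eq_square field_simps)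
  moreover have "t / 6 \<le> \<epsilon>\<^sup>2 / 2" "0 \<le> \<epsilon> * t" "0 \<le> t\<^sup>2" "0 < \<epsilon>\<^sup>2" using t assms by auto
  ultimately have G: "1 / 4 - \<epsilon> < G" by linarith
  have "(\<lambda>N. (1 - (1 / 3 :: real) ^ N) * G) \<longlonglongrightarrow> (1 - 0) * G"
    by (intro tendsto_intros LIMSEQ_power_zero) simp
  then have "\<forall>\<^sub>F N in sequentially. 1 / 4 - \<epsilon> < (1 - (1 / 3 :: real) ^ N) * G" using G by (intro order_tendstoD(1)) auto
  then obtain N where N: "1 / 4 - \<epsilon> < (1 - (1 / 3 :: real) ^ N) * G" by (auto simp: eventually_sequentially)
  have 1: "(\<lambda>r. real (r + 2) / real (N + 4 + r)) \<longlonglongrightarrow> 1" by real_asymp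
  have "(\<lambda>r. (real (r + 2) / real (N + 4 + r))\<^sup>2 * ((1 - (1 / 3 :: real) ^ N) * G)) \<longlonglongrightarrow> 1\<^sup>2 * ((1 - (1 / 3 :: real) ^ N) * G)"
    by (intro tendsto_intros 1)
  then have e1: "\<forall>\<^sub>F r in sequentially. 1 / 4 - \<epsilon> < (real (r + 2) / real (N + 4 + r))\<^sup>2 * ((1 - (1 / 3 :: real) ^ N) * G)"
    using N by (intro order_tendstoD(1)) auto
  have 2: "(\<lambda>r. real (N + 3 + r) / real (N + 4 + r)) \<longlonglongrightarrow> 1" by real_asymp
  have "(\<lambda>r. real (N + 3 + r) / real (N + 4 + r) * x) \<longlonglongrightarrow> 1 * x" by (intro tendsto_intros 2)
  then have e2: "\<forall>\<^sub>F r in sequentially. 6 * \<epsilon> < real (N + 3 + r) / real (N + 4 + r) * x"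
    using x by (intro order_tendstoD(1)) auto
  obtain r where "1 / 4 - \<epsilon> < (real (r + 2) / real (N + 4 + r))\<^sup>2 * ((1 - (1 / 3 :: real) ^ N) * G)"
      "6 * \<epsilon> < real (N + 3 + r) / real (N + 4 + r) * x"
    using eventually_happens'[OF _ eventually_conj[OF e1 e2]] by auto
  then show ?thesis using that[OF x] by (simp add: G_def mult.assoc)
qed

context schottky
begin

text \<open>Distinct arrangements give distinct words, at most \<open>L\<close> of which code the
  same geodesic; their number is bounded below by the multinomial estimate.\<close>

lemma block_words_in_Aeps:
  assumes q: "1 \<le> q" and n: "N + 3 \<le> n" and L: "L \<noteq> junk_length"
    and len: "L = n + 1 + q * (4 * 3 ^ (N + 2 + r) * (N + 4 + r))"
    and big: "(1 / 4 - \<epsilon>) * (real L)\<^sup>2 \<le> (real (r + 2) / real (N + 4 + r))\<^sup>2 * (1 - (1 / 3) ^ N) *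
        (real (n - (N + 3)) / 2 + real q * (4 * 3 ^ (N + 2 + r) * real (N + 4 + r)) / 3)\<^sup>2"
  shows "(4 * 3 ^ (N + 2 + r)) ^ (4 * 3 ^ (N + 2 + r) * (q - 1)) \<le> real L * real (card (Aeps a b \<epsilon> L)) * real q ^ (4 * 3 ^ (N + 2 + r))"
proof -
  let ?X = "reduced_words (N + 3 + r)" and ?B = "4 * 3 ^ (N + 2 + r) :: nat"
  have cX: "card ?X = ?B" using card_reduced_words[of "N + 2 + r"] by (simp add: numeral_3_eq_3)
  let ?A = "repeat_mset q (mset_set ?X)"
  let ?W = "block_word n ` permutations_of_multiset ?A"
  have bs: "mset bs = ?A \<and> length bs = q * ?B \<and> (\<forall>B\<in>set bs. reduced_list B \<and> B \<noteq> [] \<and> length B = N + 3 + r)"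
    if "bs \<in> permutations_of_multiset ?A" for bs
  proof -
    have m: "mset bs = ?A" using that by (rule permutations_of_multisetD)
    have "length bs = size ?A" using m by (metis size_mset)
    then have "length bs = q * ?B" using cX by simp
    moreover have "set bs \<subseteq> ?X"
    proof
      fix B assume "B \<in> set bs"
      then have "B \<in># ?A" using m by (metis set_mset_mset)
      then have "0 < q * count (mset_set ?X) B" by (metis count_repeat_mset count_greater_zero_iff)
      then have "B \<in># mset_set ?X" by (simp only: nat_0_less_mult_iff count_greater_zero_iff)
      then show "B \<in> ?X" using finite_reduced_words by simp
    qed
    ultimately show ?thesis using m by (auto simp: reduced_words_def)
  qed
  have W: "cyclically_reduced w \<and> length w = L" if w: "w \<in> ?W" for w
  proof -
    obtain l where l: "l \<in> permutations_of_multiset ?A" "w = block_word n l" using w by blast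
    have "cyclically_reduced w" unfolding l(2) by (rule block_word_cyclically_reduced) (use n bs[OF l(1)] in auto)
    moreover have "length w = L" unfolding l(2) using length_block_word[of l "N + 3 + r" n] bs[OF l(1)]
      by (simp add: len mult.assoc)
    ultimately show ?thesis by simp
  qed
  have sub: "{\<gamma>. \<exists>w\<in>?W. codes a b w \<gamma>} \<subseteq> Aeps a b \<epsilon> L"
  proof
    fix \<gamma> assume "\<gamma> \<in> {\<gamma>. \<exists>w\<in>?W. codes a b w \<gamma>}"
    then obtain w where w: "w \<in> ?W" "codes a b w \<gamma>" by blast
    then obtain l where l: "l \<in> permutations_of_multiset ?A" "w = block_word n l" by blast
    obtain k where k: "geodesic_word a b \<gamma> = rotate k w"
      using same_curve_rotate[OF w(2) codes_geodesic_word[OF w(2)]] by blast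
    have "cyclically_reduced (rotate k (block_word n l))" using codes_cyclically_reduced codes_rotate w(2) l(2) by blast
    from block_word_self_int[OF _ this n, of q r] bs[OF l(1)] big
    have "(1 / 4 - \<epsilon>) * (real L)\<^sup>2 \<le> real (self_int a b \<gamma>)" unfolding self_int_def k l(2) by linarith
    then show "\<gamma> \<in> Aeps a b \<epsilon> L" using codes_in_Gc[OF w(2)] W[OF w(1)] by (simp add: Aeps_def)
  qed
  have finA: "finite (Aeps a b \<epsilon> L)" by (rule finite_subset[OF _ finite_Gc[OF L]]) (auto simp: Aeps_def)
  have "inj_on (block_word n) (permutations_of_multiset ?A)"
    by (rule inj_onI, rule block_word_inj[where n = n and K = "N + 3 + r"]) (use bs in auto)
  then have "card (permutations_of_multiset ?A) = card ?W" by (simp add: card_image)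
  also have "\<dots> \<le> L * card {\<gamma>. \<exists>w\<in>?W. codes a b w \<gamma>}" by (rule card_words_le[OF _ W]) simp
  also have "\<dots> \<le> L * card (Aeps a b \<epsilon> L)" by (rule mult_le_mono2, rule card_mono[OF finA sub])
  finally have "real (card (permutations_of_multiset ?A)) \<le> real L * real (card (Aeps a b \<epsilon> L))"
    by (metis of_nat_le_iff of_nat_mult)
  then have "real (card (permutations_of_multiset ?A)) * real q ^ ?B \<le> real L * real (card (Aeps a b \<epsilon> L)) * real q ^ ?B"
    by (rule mult_right_mono) simp
  with card_block_arrangements[OF finite_reduced_words q, of "N + 3 + r"] show ?thesis
    unfolding cX by simp
qed

lemma eventually_card_Aeps_lower:
  assumes \<epsilon>: "0 < \<epsilon>" "\<epsilon> < 1 / 6"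
  shows "\<forall>\<^sub>F L in sequentially. 4 * 3 powr (6 * \<epsilon> * real L) / real L \<le> real (card (Aeps a b \<epsilon> L))"
proof -
  obtain x :: real and N r :: nat where x: "6 * \<epsilon> < x" "x < 1"
    and int: "1 / 4 - \<epsilon> < (real (r + 2) / real (N + 4 + r))\<^sup>2 * (1 - (1 / 3) ^ N) * (1 / 2 - x / 6)\<^sup>2"
    and ent: "6 * \<epsilon> < real (N + 3 + r) / real (N + 4 + r) * x"
    using ex_block_parameters[OF \<epsilon>] by blast
  define B :: nat where "B = 4 * 3 ^ (N + 2 + r)"
  define M :: nat where "M = B * (N + 4 + r)"
  define K :: nat where "K = N + 3 + r"
  define \<kappa> where "\<kappa> = (real (r + 2) / real (N + 4 + r))\<^sup>2 * (1 - (1 / 3) ^ N)"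
  \<comment> \<open>The entropy per letter of the final word in units of ln 3: a block occupies K +
    1 letters and has at least 3^K choices, and the blocks take up the fraction
    \<open>x\<close>.\<close>
  define \<rho> where "\<rho> = real K / real (K + 1) * x"
  define \<delta> where "\<delta> = \<rho> - 6 * \<epsilon>"
  have \<delta>: "\<delta> > 0" using ent by (simp add: \<delta>_def \<rho>_def K_def add_ac)
  have M1: "M \<ge> 1" by (simp add: M_def B_def)
  have \<kappa>0: "0 \<le> \<kappa>" by (simp add: \<kappa>_def power_le_one)
  have x0: "0 < x" using x \<epsilon> by linarith
  have e1: "\<forall>\<^sub>F L in sequentially. real N + 5 \<le> (1 - x) * real L" using x by real_asymp
  have e2: "\<forall>\<^sub>F L in sequentially. 2 * real M \<le> x * real L" using x0 by real_asymp
  have e3: "\<forall>\<^sub>F L in sequentially. (1 / 4 - \<epsilon>) * (real L)\<^sup>2 \<le> \<kappa> * (real L * (1 / 2 - x / 6) - (real N + 4) / 2)\<^sup>2"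
  proof -
    have "(\<lambda>L. \<kappa> * ((1 / 2 - x / 6) - (real N + 4) / 2 / real L)\<^sup>2) \<longlonglongrightarrow> \<kappa> * ((1 / 2 - x / 6) - 0)\<^sup>2"
      by (intro tendsto_intros lim_const_over_n)
    then have "\<forall>\<^sub>F L in sequentially. 1 / 4 - \<epsilon> < \<kappa> * ((1 / 2 - x / 6) - (real N + 4) / 2 / real L)\<^sup>2"
      using int by (intro order_tendstoD(1)) (auto simp: \<kappa>_def)
    with eventually_gt_at_top[of 0] show ?thesis
    proof eventually_elim
      case (elim L)
      have "(1 / 4 - \<epsilon>) * (real L)\<^sup>2 \<le> \<kappa> * ((1 / 2 - x / 6) - (real N + 4) / 2 / real L)\<^sup>2 * (real L)\<^sup>2"
        using elim by (intro mult_right_mono) auto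
      also have "\<dots> = \<kappa> * (((1 / 2 - x / 6) - (real N + 4) / 2 / real L) * real L)\<^sup>2" by (simp add: power_mult_distrib)
      also have "((1 / 2 - x / 6) - (real N + 4) / 2 / real L) * real L = real L * (1 / 2 - x / 6) - (real N + 4) / 2"
        using elim by (simp add: field_simps)
      finally show ?case .
    qed
  qed
  \<comment> \<open>\<open>B\<close> and \<open>K\<close> are fixed while \<open>L\<close> grows, so
    the surplus \<delta> in the exponent absorbs the polynomial and constant factors of the
    count.\<close>
  have e4: "\<forall>\<^sub>F L in sequentially. real L ^ B * exp (- (\<delta> * ln 3 * real L)) < 1 / (4 * 3 powr (2 * real K * real B))"
    using power_times_exp_decay[of "\<delta> * ln 3" B] \<delta> by (intro order_tendstoD(2)) auto
  have e5: "\<forall>\<^sub>F L in sequentially. L \<noteq> junk_length \<and> 1 \<le> L"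
    using eventually_gt_at_top[of "junk_length"] by eventually_elim auto
  from e1 e2 e3 e4 e5 show ?thesis
  proof eventually_elim
    case (elim L)
    \<comment> \<open>With q copies of every reduced word of length K, the blocks take q M letters,
      about x L. The alternating part fills up to exactly \<open>L\<close>.\<close>
    define q where "q = nat \<lfloor>x * real L / real M\<rfloor>"
    have Mpos: "real M > 0" using M1 by simp
    have fl: "real q = of_int \<lfloor>x * real L / real M\<rfloor>" using x0 Mpos by (simp add: q_def)
    have q1: "real q * real M \<le> x * real L" unfolding fl using Mpos by (metis of_int_floor_le pos_le_divide_eq)
    have q2: "x * real L - real M \<le> real q * real M"
    proof -
      have "x * real L / real M \<le> real q + 1" unfolding fl by linarith
      then show ?thesis using Mpos by (simp add: divide_le_eq algebra_simps)
    qed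
    have q: "1 \<le> q"
    proof (rule ccontr)
      assume "\<not> 1 \<le> q" then have "q = 0" by simp
      then show False using q2 elim(2) Mpos by simp
    qed
    define n where "n = L - 1 - q * M"
    have le: "q * M + N + 5 \<le> L"
    proof -
      have "real (q * M + N + 5) \<le> real L" using q1 elim(1) by (simp add: algebra_simps)
      then show ?thesis by (simp only: of_nat_le_iff)
    qed
    have nn: "N + 3 \<le> n" "L = n + 1 + q * M" using le by (auto simp: n_def)
    have a: "real (n - (N + 3)) / 2 + real q * real M / 3 = real L / 2 - real q * real M / 6 - (real N + 4) / 2"
    proof -
      have "n - (N + 3) + q * M + N + 4 = L" using nn by linarith
      then have "real (n - (N + 3)) = real L - real q * real M - real N - 4"
        by (metis (no_types, opaque_lifting) add.assoc add_diff_cancel_right' diff_diff_eq of_nat_add of_nat_mult of_nat_numeral)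
      then show ?thesis by (simp add: field_simps)
    qed
    have pos: "0 \<le> real L * (1 / 2 - x / 6) - (real N + 4) / 2"
    proof -
      have "0 \<le> x * real L" using x0 by simp
      then have "(real N + 4) / 2 \<le> real L * (1 / 2 - x / 6)" using elim(1) by (simp add: field_simps)
      then show ?thesis by simp
    qed
    have "(1 / 4 - \<epsilon>) * (real L)\<^sup>2 \<le> \<kappa> * (real L * (1 / 2 - x / 6) - (real N + 4) / 2)\<^sup>2" by (rule elim(3))
    also have "\<dots> \<le> \<kappa> * (real (n - (N + 3)) / 2 + real q * real M / 3)\<^sup>2"
      unfolding a by (intro mult_left_mono power_mono pos) (use q1 \<kappa>0 in \<open>auto simp: field_simps\<close>)
    finally have big: "(1 / 4 - \<epsilon>) * (real L)\<^sup>2 \<le> (real (r + 2) / real (N + 4 + r))\<^sup>2 * (1 - (1 / 3) ^ N) *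
        (real (n - (N + 3)) / 2 + real q * (4 * 3 ^ (N + 2 + r) * real (N + 4 + r)) / 3)\<^sup>2"
      by (simp add: \<kappa>_def M_def B_def)
    have "(4 * 3 ^ (N + 2 + r)) ^ (4 * 3 ^ (N + 2 + r) * (q - 1)) \<le> real L * real (card (Aeps a b \<epsilon> L)) * real q ^ (4 * 3 ^ (N + 2 + r))"
      by (rule block_words_in_Aeps[OF q nn(1) _ _ big]) (use elim(5) nn(2) in \<open>auto simp: M_def B_def\<close>)
    then have main: "real B ^ (B * (q - 1)) \<le> real L * real (card (Aeps a b \<epsilon> L)) * real q ^ B"
      by (simp add: B_def)
    have qL: "real q \<le> real L"
    proof -
      have "real q * 1 \<le> real q * real M" using M1 by (intro mult_left_mono) auto
      also have "\<dots> \<le> x * real L" by (rule q1)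
      also have "\<dots> \<le> real L" using x by (simp add: mult_left_le_one_le x0 less_imp_le)
      finally show ?thesis by simp
    qed
    have B3: "3 ^ K \<le> real B" by (simp add: B_def K_def power_add)
    \<comment> \<open>One loss of K B comes from rounding q down, the other from the exponent q - 1
      in the multinomial bound.\<close>
    have "3 powr (\<rho> * real L - 2 * real K * real B) \<le> 3 powr (real (K * (B * (q - 1))))"
    proof (rule powr_mono)
      have M: "M = B * (K + 1)" by (simp add: M_def K_def)
      then have "real K / real (K + 1) * real M = real K * real B" by (simp add: field_simps)
      then have "\<rho> * real L - real K * real B = real K / real (K + 1) * (x * real L - real M)"
        by (simp add: \<rho>_def right_diff_distrib)
      also have "\<dots> \<le> real K / real (K + 1) * (real q * real M)" by (rule mult_left_mono[OF q2]) simp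
      also have "\<dots> = real K * real B * real q" using M by (simp add: field_simps)
      finally show "\<rho> * real L - 2 * real K * real B \<le> real (K * (B * (q - 1)))"
        using q by (simp add: of_nat_diff algebra_simps)
    qed simp
    also have "\<dots> = (3 ^ K) ^ (B * (q - 1))" by (simp only: powr_realpow power_mult[symmetric])
    also have "\<dots> \<le> real B ^ (B * (q - 1))" by (rule power_mono[OF B3]) simp
    also have "\<dots> \<le> real L * real (card (Aeps a b \<epsilon> L)) * real q ^ B" by (rule main)
    also have "\<dots> \<le> real L * real (card (Aeps a b \<epsilon> L)) * real L ^ B"
      by (intro mult_left_mono power_mono qL) auto
    finally have fin: "3 powr (\<rho> * real L - 2 * real K * real B) \<le> real L * real (card (Aeps a b \<epsilon> L)) * real L ^ B" .
    have "4 * 3 powr (6 * \<epsilon> * real L) * real L ^ B \<le> 3 powr (\<rho> * real L - 2 * real K * real B)"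
    proof -
      have "exp (- (\<delta> * ln 3 * real L)) = 3 powr (- (\<delta> * real L))" by (simp add: powr_def mult_ac)
      then have "real L ^ B * 3 powr (- (\<delta> * real L)) \<le> 1 / (4 * 3 powr (2 * real K * real B))" using elim(4) by simp
      then have "real L ^ B * 3 powr (- (\<delta> * real L)) * (4 * 3 powr (\<rho> * real L)) \<le> 1 / (4 * 3 powr (2 * real K * real B)) * (4 * 3 powr (\<rho> * real L))"
        by (rule mult_right_mono) simp
      moreover have "3 powr (- (\<delta> * real L)) * 3 powr (\<rho> * real L) = 3 powr (6 * \<epsilon> * real L)"
        by (simp add: powr_add[symmetric] \<delta>_def algebra_simps)
      moreover have "1 / (4 * 3 powr (2 * real K * real B)) * (4 * 3 powr (\<rho> * real L)) = 3 powr (\<rho> * real L - 2 * real K * real B)"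
        by (simp add: powr_diff)
      ultimately show ?thesis by (simp add: mult_ac)
    qed
    with fin have "4 * 3 powr (6 * \<epsilon> * real L) * real L ^ B \<le> real L * real (card (Aeps a b \<epsilon> L)) * real L ^ B" by linarith
    then have "4 * 3 powr (6 * \<epsilon> * real L) \<le> real L * real (card (Aeps a b \<epsilon> L))"
      using elim(5) by (simp add: mult_le_cancel_right)
    then show ?case using elim(5) by (simp add: divide_le_eq mult.commute)
  qed
qed

text \<open>The square of 3/2 is 2 * (9/8). With s = 3 sqrt \<epsilon> the bracket thus contains
  2^(s L) times (9/8)^(s L), and the second factor outgrows the division by \<open>L\<close> and the
  subtracted linear term.\<close>

lemma eventually_card_Aeps_upper:
  assumes \<epsilon>: "0 < \<epsilon>"
  shows "\<forall>\<^sub>F L in sequentially. real (card (Aeps a b \<epsilon> L)) \<le>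
     2 ^ L / real L * (2\<^sup>2 * (3 / 2) powr (6 * sqrt \<epsilon> * real L) - 3 * sqrt \<epsilon> * real L)"
proof -
  define s where "s = 3 * sqrt \<epsilon>"
  have s: "s > 0" using \<epsilon> by (simp add: s_def)
  define c where "c = s * ln (9 / 8)"
  have c: "c > 0" using s by (simp add: c_def)
  have e1: "\<forall>\<^sub>F L in sequentially. real L ^ 1 * exp (- (c * real L)) < 4 / (2 + s)"
    using power_times_exp_decay[OF c, of 1] s by (intro order_tendstoD(2)) auto
  have e2: "\<forall>\<^sub>F L in sequentially. L \<noteq> junk_length \<and> 1 \<le> L"
    using eventually_gt_at_top[of "junk_length"] by eventually_elim auto
  from e1 e2 show ?thesis
  proof eventually_elim
    case (elim L)
    have L: "real L > 0" using elim by simp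
    define P where "P = 2 powr (s * real L)"
    have P: "P \<ge> 1" using s L by (simp add: P_def ge_one_powr_ge_zero)
    have "(2 + s) * real L \<le> 4 * exp (c * real L)"
      using elim(1) s by (simp add: exp_minus field_simps)
    also have "exp (c * real L) = (9 / 8) powr (s * real L)" by (simp add: powr_def c_def mult_ac)
    finally have k: "(2 + s) * real L \<le> 4 * (9 / 8) powr (s * real L)" .
    have "(3 / 2 :: real) powr (6 * sqrt \<epsilon> * real L) = ((3 / 2) powr 2) powr (s * real L)"
      unfolding powr_powr by (simp add: s_def mult.assoc)
    also have "(3 / 2 :: real) powr 2 = 2 * (9 / 8)" by (simp add: powr_numeral power2_eq_square)
    also have "(2 * (9 / 8 :: real)) powr (s * real L) = P * (9 / 8) powr (s * real L)" by (simp only: powr_mult P_def)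
    finally have e: "(3 / 2 :: real) powr (6 * sqrt \<epsilon> * real L) = P * (9 / 8) powr (s * real L)" .
    have "2 * P * real L + s * real L \<le> 2 * P * real L + P * (s * real L)"
      using mult_right_mono[OF P, of "s * real L"] s L by simp
    also have "\<dots> = P * ((2 + s) * real L)" by (simp add: algebra_simps)
    also have "\<dots> \<le> P * (4 * (9 / 8) powr (s * real L))" using k P by (intro mult_left_mono) auto
    finally have "2 * P * real L \<le> 2\<^sup>2 * (3 / 2) powr (6 * sqrt \<epsilon> * real L) - 3 * sqrt \<epsilon> * real L"
      unfolding e by (simp add: s_def mult_ac)
    then have "2 ^ L / real L * (2 * P * real L) \<le> 2 ^ L / real L * (2\<^sup>2 * (3 / 2) powr (6 * sqrt \<epsilon> * real L) - 3 * sqrt \<epsilon> * real L)"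
      by (rule mult_left_mono) simp
    moreover have "real (card (Aeps a b \<epsilon> L)) \<le> 2 * 2 ^ L * P"
      unfolding P_def s_def by (rule card_Aeps_upper) (use elim \<epsilon> in auto)
    ultimately show ?case using L by (simp add: mult_ac)
  qed
qed

text \<open>For \<epsilon> < 1/36 the exponent s = 3 sqrt \<epsilon> is below 1/2, and 2^(1 + s) <
  2^(3/2) < 3 because 8 < 9. So the upper bound grows more slowly than 3^L / L.\<close>

lemma Aeps_Gc_ratio:
  assumes \<epsilon>: "0 < \<epsilon>" "\<epsilon> < 1 / 36"
  shows "(\<lambda>L. real (card (Aeps a b \<epsilon> L)) / real (card (Gc a b L))) \<longlonglongrightarrow> 0"
proof -
  define s where "s = 3 * sqrt \<epsilon>"
  have "sqrt \<epsilon> < sqrt ((1 / 6)\<^sup>2)" using \<epsilon> by (intro real_sqrt_less_mono) (simp add: power2_eq_square)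
  then have s: "s < 1 / 2" by (simp add: s_def)
  define c where "c = ln 3 - (1 + s) * ln (2 :: real)"
  have c: "c > 0"
  proof -
    have "ln ((2 :: real) ^ 3) < ln (3 ^ 2)" by (subst ln_less_cancel_iff) simp_all
    then have "3 * ln (2 :: real) < 2 * ln 3" by (simp only: ln_realpow)
    moreover have "(1 + s) * ln 2 \<le> 3 / 2 * ln (2 :: real)" using s by (intro mult_right_mono) auto
    ultimately show ?thesis unfolding c_def by linarith
  qed
  have lim: "(\<lambda>L. 9 / 2 * (real L ^ 1 * exp (- (c * real L)))) \<longlonglongrightarrow> 0"
    using tendsto_mult_left[OF power_times_exp_decay[OF c, of 1], of "9 / 2"] by simp
  have "\<forall>\<^sub>F L in sequentially. real (card (Aeps a b \<epsilon> L)) / real (card (Gc a b L)) \<le> 9 / 2 * (real L ^ 1 * exp (- (c * real L)))"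
    using eventually_gt_at_top[of "junk_length + 2"]
  proof eventually_elim
    case (elim L)
    then have "L = Suc (Suc (L - 2))" by simp
    then obtain n where n: "L = Suc (Suc n)" by blast
    have A: "real (card (Aeps a b \<epsilon> L)) \<le> 2 * 2 ^ L * 2 powr (s * real L)"
      unfolding s_def by (rule card_Aeps_upper) (use elim \<epsilon> in auto)
    have "4 * 3 ^ n \<le> L * card (Gc a b L)" using card_Gc_lower[of n] elim unfolding n by simp
    then have "real (4 * 3 ^ n) \<le> real (L * card (Gc a b L))" by (simp only: of_nat_le_iff)
    then have G: "4 * 3 ^ n \<le> real L * real (card (Gc a b L))" by simp
    have L: "real L > 0" using elim by simp
    have Gpos: "real (card (Gc a b L)) > 0"
    proof (rule ccontr)
      assume "\<not> ?thesis" then have "real (card (Gc a b L)) = 0" by simp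
      then have "(4 * 3 ^ n :: real) \<le> 0" using G by simp
      moreover have "(0 :: real) < 4 * 3 ^ n" by simp
      ultimately show False by linarith
    qed
    have e: "exp (- (c * real L)) * 3 ^ L = 2 ^ L * 2 powr (s * real L)"
    proof -
      have "(3 :: real) ^ L = exp (ln 3 * real L)" "(2 :: real) ^ L = exp (ln 2 * real L)"
        by (simp_all add: powr_realpow[symmetric] powr_def mult.commute)
      moreover have "2 powr (s * real L) = exp (s * real L * ln 2)" by (simp add: powr_def)
      ultimately show ?thesis by (simp add: mult_exp_exp c_def algebra_simps)
    qed
    have "real (card (Aeps a b \<epsilon> L)) * (4 * 3 ^ n) \<le> (2 * 2 ^ L * 2 powr (s * real L)) * (real L * real (card (Gc a b L)))"
      by (rule mult_mono[OF A G]) auto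
    also have "\<dots> = 2 * (exp (- (c * real L)) * 3 ^ L) * (real L * real (card (Gc a b L)))" unfolding e by simp
    also have "\<dots> = (9 / 2 * (real L * exp (- (c * real L))) * real (card (Gc a b L))) * (4 * 3 ^ n)"
      by (simp add: n mult_ac)
    finally have "real (card (Aeps a b \<epsilon> L)) \<le> 9 / 2 * (real L * exp (- (c * real L))) * real (card (Gc a b L))"
      by (rule mult_right_le_imp_le) simp
    then show ?case using Gpos by (simp add: divide_le_eq)
  qed
  then show ?thesis by (intro tendsto_sandwich[OF _ _ tendsto_const lim]) auto
qed

end

text \<open>The lower bound is guarded by \<epsilon> < 1/6 because there are only about 3^L / L
  closed geodesics of length L: from \<epsilon> = 1/6 on, 4 * 3^(6 \<epsilon> L) / L exceeds the
  number of all of them for large L.\<close>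

theorem theorem1p3:
  fixes a b :: "complex \<Rightarrow> complex" and D :: "letter \<Rightarrow> complex set" and \<epsilon> :: real
  assumes "schottky_pants a b D"
    and "\<epsilon> > 0"
  shows "(\<forall>\<^sub>F L in sequentially.
            (\<epsilon> < 1 / 6 \<longrightarrow>
               4 * 3 powr (6 * \<epsilon> * real L) / real L \<le> real (card (Aeps a b \<epsilon> L))) \<and>
            real (card (Aeps a b \<epsilon> L)) \<le>
              2 ^ L / real L *
                (2\<^sup>2 * (3 / 2) powr (6 * sqrt \<epsilon> * real L) - 3 * sqrt \<epsilon> * real L)) \<and>
         (\<epsilon> < 1 / 36 \<longrightarrow>
            (\<lambda>L. real (card (Aeps a b \<epsilon> L)) / real (card (Gc a b L))) \<longlonglongrightarrow> 0)"
proof -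
  interpret schottky a b D by unfold_locales (rule assms(1))
  have "\<forall>\<^sub>F L in sequentially. \<epsilon> < 1 / 6 \<longrightarrow> 4 * 3 powr (6 * \<epsilon> * real L) / real L \<le> real (card (Aeps a b \<epsilon> L))"
    using eventually_card_Aeps_lower[OF assms(2)] by (cases "\<epsilon> < 1 / 6") auto
  then show ?thesis
    using eventually_card_Aeps_upper[OF assms(2)] Aeps_Gc_ratio[OF assms(2)] by (auto intro: eventually_conj)
qed

end
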